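(* Let $r_1>r_2>0$ and let $L^{(2)}:(\pi^0_l,\mathcal H^+)\otimes(\pi^0_r,\mathcal H^+)\to(\pi^0_l,\mathcal H^+)\otimes(\pi^0_r,\mathcal H^+)$ be the operator associated with the two-loop ladder diagram, defined in the context. Then for all $\phi_1,\phi_2\in\mathcal H^+$, $$L^{(2)}(\phi_1\otimes\phi_2)(W_1,W_2)=L^{(2)}(\phi_2\otimes\phi_1)(W_2,W_1).$$
   Context: Basic notation. $\mathbb H_{\mathbb C}=\mathbb H\otimes_{\mathbb R}\mathbb C$ is identified with the algebra of complex $2\times2$ matrices $Z=\begin{pmatrix} z_{11} & z_{12} \\ z_{21} & z_{22} \end{pmatrix}=\begin{pmatrix} z^0-iz^3 & -iz^1-z^2 \\ -iz^1+z^2 & z^0+iz^3 \end{pmatrix}$, $z^k\in\mathbb C$; $\mathbb H$ is the subset where all $z^k$ are real. $N(Z)=\det Z=\sum_k (z^k)^2$. $dV=dz^0\wedge dz^1\wedge dz^2\wedge dz^3$. For $R>0$: $U(2)_R=\{RZ: Z\in\mathbb H_{\mathbb C},\ Z^*=Z^{-1}\}$, oriented so that $\int_{U(2)_R}dV/N(Z)^2=-2\pi^3 i$; $S^3_R=\{X\in\mathbb H: N(X)=R^2\}$ with Euclidean volume element $dS$; $\mathbb D^+_R=\{Z\in\mathbb H_{\mathbb C}: ZZ^*<R^2\}$ (i.e. $R^2-ZZ^*$ positive definite). $\widetilde{\deg}f=f+\sum_{i,j}z_{ij}\,\partial f/\partial z_{ij}$. $\mathcal H^+$ is the space of polynomials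 $\phi\in\mathbb C[z_{11},z_{12},z_{21},z_{22}]$ with $\square\phi=0$, $\square=4(\partial_{11}\partial_{22}-\partial_{12}\partial_{21})$, $\partial_{ij}=\partial/\partial z_{ij}$. Elements of $\mathcal H^+\otimes\mathcal H^+$ are regarded as polynomials in two variables in $\mathbb H_{\mathbb C}$. Actions. For $h=\begin{pmatrix} a' & b' \\ c' & d' \end{pmatrix}\in GL(2,\mathbb H_{\mathbb C})\simeq GL(4,\mathbb C)$ with $h^{-1}=\begin{pmatrix} a & b \\ c & d \end{pmatrix}$ put $\tilde Z=(aZ+b)(cZ+d)^{-1}$; $(\pi^0_l(h)\phi)(Z)=N(cZ+d)^{-1}\phi(\tilde Z)$, $(\pi^0_r(h)\phi)(Z)=N(a'-Zc')^{-1}\phi(\tilde Z)$; the same letters denote the differentiated actions of $\mathfrak{gl}(2,\mathbb H_{\mathbb C})$ on $\mathcal H^+$. Operator. The two-loop ladder integral is $l^{(2)}(Z_1,Z_2;W_1,W_2)=N(Z_1-W_1)\cdot\tilde l^{(2)}(Z_1,Z_2;W_1,W_2)$, where $$-4\pi^6\,\tilde l^{(2)}=\iint_{T_1\in U(2)_{r_1},\,T_2\in U(2)_{r_2}}\frac{N(T_1-T_2)^{-1}\,dV_{T_1}\,dV_{T_2}}{N(Z_1-T_1)N(Z_2-T_1)N(W_1-T_1)N(Z_1-T_2)N(W_1-T_2)N(W_2-T_2)}.$$ For $\phi_1,\phi_2\in\mathcal H^+$, $W_1,W_2\in\mathbb D^+_{r_2}$ and $R_1,R_2>r_1$, $$L^{(2)}(\phi_1\otimes\phi_2)(W_1,W_2)=\frac{i}{4\pi^5}\iint_{Z_1\in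 U(2)_{R_1},\,Z_2\in S^3_{R_2}}l^{(2)}(Z_1,Z_2;W_1,W_2)\,(\widetilde{\deg}\phi_1)(Z_1)\,(\widetilde{\deg}\phi_2)(Z_2)\,\frac{dV_1}{N(Z_1)}\frac{dS_2}{R_2}.$$ It is known that this function is the restriction of an element of $\mathcal H^+\otimes\mathcal H^+$, with which it is identified, and that $L^{(2)}$ is a $\mathfrak{gl}(2,\mathbb H_{\mathbb C})$-equivariant map as displayed in the claim. *)

theory Defs
  imports "HOL-Analysis.Analysis"
begin

section \<open>Complexified quaternions as complex matrices\<close>

text \<open>
  Coordinates are indexed by the type \<open>4\<close>, written \<open>0, 1, 2, 3\<close> as is customary for
  quaternions; in that type \<open>0 = 4\<close>, so this enumerates all indices.
\<close>

type_synonym hc = "complex^2^2"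

definition quat :: "complex^4 \<Rightarrow> hc" where
  "quat z = vector [vector [z$0 - \<i> * z$3, - \<i> * z$1 - z$2],
                    vector [- \<i> * z$1 + z$2, z$0 + \<i> * z$3]]"

definition cvec :: "real^4 \<Rightarrow> complex^4" where
  "cvec x = (\<chi> k. complex_of_real (x $ k))"

abbreviation N :: "hc \<Rightarrow> complex" where
  "N Z \<equiv> det Z"

definition adj :: "hc \<Rightarrow> hc" where
  "adj Z = (\<chi> i j. cnj (Z $ j $ i))"

definition pos_def :: "hc \<Rightarrow> bool" where
  "pos_def A \<longleftrightarrow> adj A = A \<and>
     (\<forall>v::complex^2. v \<noteq> 0 \<longrightarrow> Re (\<Sum>i\<in>UNIV. cnj (v $ i) * (A *v v) $ i) > 0)"

definition D_plus :: "real \<Rightarrow> hc set" where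
  "D_plus R = {Z. pos_def (mat (complex_of_real (R\<^sup>2)) - Z ** adj Z)}"

definition U2 :: "real \<Rightarrow> hc set" where
  "U2 R = {R *\<^sub>R Z | Z. Z ** adj Z = mat 1 \<and> adj Z ** Z = mat 1}"

definition S3 :: "real \<Rightarrow> hc set" where
  "S3 R = {quat (cvec x) | x. N (quat (cvec x)) = complex_of_real (R\<^sup>2)}"

section \<open>Integration over \<open>U2 R\<close> and \<open>S3 R\<close>\<close>

text \<open>
  Both integrals are taken in a chart that is injective on the interior of a box and maps the
  box onto the manifold: the 4-form \<open>dV\<close> is pulled back to its Jacobian determinant, and the
  Euclidean volume element to the square root of the Gram determinant. That the charts cover
  \<open>U2 R\<close> and \<open>S3 R\<close> is shown in \<open>U2_chart_image\<close>, \<open>U2_chart_inj\<close>, \<open>S3_chart_image\<close>,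
  \<open>S3_chart_inj\<close>.
\<close>

definition sph :: "real \<Rightarrow> real \<Rightarrow> real \<Rightarrow> real^4" where
  "sph a b c = (\<chi> k. if k = 0 then cos a
                     else if k = 1 then sin a * cos b
                     else if k = 2 then sin a * sin b * cos c
                     else sin a * sin b * sin c)"

text \<open>
  The phase is \<open>- t\<close> rather than \<open>t\<close> because this induces the orientation
  for which the integral of \<open>dV / N(Z)\<^sup>2\<close> is \<open>- 2 \<pi>\<^sup>3 i\<close>; see \<open>U2_integral_normalization\<close> below.
\<close>

definition U2_chart :: "real \<Rightarrow> real \<Rightarrow> real \<Rightarrow> real \<Rightarrow> real \<Rightarrow> complex^4" where
  "U2_chart R t a b c = (complex_of_real R * cis (- t)) *s cvec (sph a b c)"

definition dV_jac :: "(real \<Rightarrow> real \<Rightarrow> real \<Rightarrow> real \<Rightarrow> complex^4) \<Rightarrow> real \<Rightarrow> real \<Rightarrow> real \<Rightarrow> real \<Rightarrow> complex" where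
  "dV_jac g t a b c = det (\<chi> k j. (
      if j = 0 then vector_derivative (\<lambda>s. g s a b c) (at t)
      else if j = 1 then vector_derivative (\<lambda>s. g t s b c) (at a)
      else if j = 2 then vector_derivative (\<lambda>s. g t a s c) (at b)
      else vector_derivative (\<lambda>s. g t a b s) (at c)) $ k)"

definition U2_integral :: "real \<Rightarrow> (hc \<Rightarrow> complex) \<Rightarrow> complex" where
  "U2_integral R f = set_lebesgue_integral lborel ({0..pi} \<times> {0..pi} \<times> {0..pi} \<times> {0..2*pi})
     (\<lambda>(t, a, b, c). f (quat (U2_chart R t a b c)) * dV_jac (U2_chart R) t a b c)"

definition S3_chart :: "real \<Rightarrow> real \<Rightarrow> real \<Rightarrow> real \<Rightarrow> real^4" where
  "S3_chart R a b c = R *\<^sub>R sph a b c"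

definition dS_jac :: "(real \<Rightarrow> real \<Rightarrow> real \<Rightarrow> real^4) \<Rightarrow> real \<Rightarrow> real \<Rightarrow> real \<Rightarrow> real" where
  "dS_jac g a b c =
     (let d = (\<lambda>i::3. if i = 1 then vector_derivative (\<lambda>s. g s b c) (at a)
                      else if i = 2 then vector_derivative (\<lambda>s. g a s c) (at b)
                      else vector_derivative (\<lambda>s. g a b s) (at c))
      in sqrt (det (\<chi> i j. d i \<bullet> d j)))"

definition S3_integral :: "real \<Rightarrow> (hc \<Rightarrow> complex) \<Rightarrow> complex" where
  "S3_integral R f = set_lebesgue_integral lborel ({0..pi} \<times> {0..pi} \<times> {0..2*pi})
     (\<lambda>(a, b, c). f (quat (cvec (S3_chart R a b c))) * complex_of_real (dS_jac (S3_chart R) a b c))"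

section \<open>Harmonic polynomials\<close>

text \<open>Polynomials over the infinite field \<open>\<complex>\<close> are represented by their polynomial functions.\<close>

definition poly_fun :: "(hc \<Rightarrow> complex) \<Rightarrow> bool" where
  "poly_fun f \<longleftrightarrow> (\<exists>(n::nat) (C :: nat \<Rightarrow> nat \<Rightarrow> nat \<Rightarrow> nat \<Rightarrow> complex). \<forall>Z.
     f Z = (\<Sum>p\<le>n. \<Sum>q\<le>n. \<Sum>r\<le>n. \<Sum>s\<le>n.
              C p q r s * (Z$1$1)^p * (Z$1$2)^q * (Z$2$1)^r * (Z$2$2)^s))"

definition pd :: "2 \<Rightarrow> 2 \<Rightarrow> (hc \<Rightarrow> complex) \<Rightarrow> hc \<Rightarrow> complex" where
  "pd i j f Z = deriv (\<lambda>t. f (\<chi> k l. if k = i \<and> l = j then t else Z $ k $ l)) (Z $ i $ j)"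

definition box_op :: "(hc \<Rightarrow> complex) \<Rightarrow> hc \<Rightarrow> complex" where
  "box_op f Z = 4 * (pd 1 1 (pd 2 2 f) Z - pd 1 2 (pd 2 1 f) Z)"

definition deg_tilde :: "(hc \<Rightarrow> complex) \<Rightarrow> hc \<Rightarrow> complex" where
  "deg_tilde f Z = f Z + (\<Sum>i\<in>UNIV. \<Sum>j\<in>UNIV. Z $ i $ j * pd i j f Z)"

definition H_plus :: "(hc \<Rightarrow> complex) set" where
  "H_plus = {f. poly_fun f \<and> (\<forall>Z. box_op f Z = 0)}"

definition H_plus_tensor :: "(hc \<Rightarrow> hc \<Rightarrow> complex) set" where
  "H_plus_tensor = {P. \<exists>(n::nat) f g. (\<forall>k<n. f k \<in> H_plus \<and> g k \<in> H_plus) \<and>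
     P = (\<lambda>W1 W2. \<Sum>k<n. f k W1 * g k W2)}"

section \<open>The two-loop ladder operator\<close>

definition l2_tilde :: "real \<Rightarrow> real \<Rightarrow> hc \<Rightarrow> hc \<Rightarrow> hc \<Rightarrow> hc \<Rightarrow> complex" where
  "l2_tilde r1 r2 Z1 Z2 W1 W2 = - 1 / (4 * complex_of_real pi ^ 6) *
     U2_integral r1 (\<lambda>T1. U2_integral r2 (\<lambda>T2.
       inverse (N (T1 - T2)) /
       (N (Z1 - T1) * N (Z2 - T1) * N (W1 - T1) * N (Z1 - T2) * N (W1 - T2) * N (W2 - T2))))"

definition l2 :: "real \<Rightarrow> real \<Rightarrow> hc \<Rightarrow> hc \<Rightarrow> hc \<Rightarrow> hc \<Rightarrow> complex" where
  "l2 r1 r2 Z1 Z2 W1 W2 = N (Z1 - W1) * l2_tilde r1 r2 Z1 Z2 W1 W2"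

definition L2 :: "real \<Rightarrow> real \<Rightarrow> real \<Rightarrow> real \<Rightarrow>
    (hc \<Rightarrow> complex) \<Rightarrow> (hc \<Rightarrow> complex) \<Rightarrow> hc \<Rightarrow> hc \<Rightarrow> complex" where
  "L2 r1 r2 R1 R2 f1 f2 W1 W2 = \<i> / (4 * complex_of_real pi ^ 5) *
     U2_integral R1 (\<lambda>Z1. S3_integral R2 (\<lambda>Z2.
       l2 r1 r2 Z1 Z2 W1 W2 * deg_tilde f1 Z1 * deg_tilde f2 Z2
         / N Z1 / complex_of_real R2))"

text \<open>
  The integral \<open>L2\<close> is meaningful only for arguments in \<open>D_plus r2\<close>; the operator sends
  \<open>f1 \<otimes> f2\<close> to the element of the tensor square that restricts to it there.
\<close>

definition L2_represents :: "real \<Rightarrow> real \<Rightarrow> real \<Rightarrow> real \<Rightarrow>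
    (hc \<Rightarrow> complex) \<Rightarrow> (hc \<Rightarrow> complex) \<Rightarrow> (hc \<Rightarrow> hc \<Rightarrow> complex) \<Rightarrow> bool" where
  "L2_represents r1 r2 R1 R2 f1 f2 P \<longleftrightarrow> P \<in> H_plus_tensor \<and>
     (\<forall>W1\<in>D_plus r2. \<forall>W2\<in>D_plus r2. P W1 W2 = L2 r1 r2 R1 R2 f1 f2 W1 W2)"

section \<open>The charts in explicit form\<close>

lemma sph_nth: "sph a b c $ 0 = cos a" "sph a b c $ 1 = sin a * cos b"
  "sph a b c $ 2 = sin a * sin b * cos c" "sph a b c $ 3 = sin a * sin b * sin c"
  by (simp_all add: sph_def)

lemma UNIV_4': "(UNIV::4 set) = {0, 1, 2, 3}"
proof -
  have z: "(0::4) = 4" by simp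
  show ?thesis unfolding UNIV_4 z by blast
qed

lemma sum_4': "sum f (UNIV::4 set) = f 0 + f 1 + f 2 + f 3"
  unfolding UNIV_4' by (simp add: ac_simps)

lemma forall_4': "(\<forall>k::4. P k) \<longleftrightarrow> P 0 \<and> P 1 \<and> P 2 \<and> P 3"
  by (metis UNIV_4' UNIV_I insertE singletonD)

lemma vec4_eq_iff: "(x::'a^4) = y \<longleftrightarrow> x$0 = y$0 \<and> x$1 = y$1 \<and> x$2 = y$2 \<and> x$3 = y$3"
  by (simp add: vec_eq_iff forall_4')

lemma N_quat: "N (quat z) = (z$0)\<^sup>2 + (z$1)\<^sup>2 + (z$2)\<^sup>2 + (z$3)\<^sup>2"
  by (simp add: det_2 quat_def power2_eq_square algebra_simps)

lemma quat_inj: "quat z = quat w \<longleftrightarrow> z = w"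
proof
  assume "quat z = quat w"
  then have e: "quat z $ i $ j = quat w $ i $ j" for i j by simp
  have a: "z$0 - \<i> * z$3 = w$0 - \<i> * w$3" and b: "- \<i> * z$1 - z$2 = - \<i> * w$1 - w$2"
    and c: "- \<i> * z$1 + z$2 = - \<i> * w$1 + w$2" and d: "z$0 + \<i> * z$3 = w$0 + \<i> * w$3"
    using e[of 1 1] e[of 1 2] e[of 2 1] e[of 2 2] by (simp_all add: quat_def)
  have "2 * z$0 = 2 * w$0" using arg_cong2[OF a d, of "(+)"] by simp
  moreover have "2 * z$2 = 2 * w$2" using arg_cong2[OF c b, of "(-)"] by simp
  ultimately show "z = w" using a c by (simp add: vec4_eq_iff)
qed simp

lemma quat_surj: "\<exists>z. quat z = Z"
proof -
  define z :: "complex^4" where "z = (\<chi> k. if k = 0 then (Z$1$1 + Z$2$2) / 2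
    else if k = 1 then \<i> * (Z$1$2 + Z$2$1) / 2
    else if k = 2 then (Z$2$1 - Z$1$2) / 2 else \<i> * (Z$1$1 - Z$2$2) / 2)"
  have "quat z = Z"
    by (simp add: quat_def z_def vec_eq_iff forall_2 field_simps)
  then show ?thesis ..
qed

lemma det_4:
  fixes A :: "'a::comm_ring_1^4^4"
  shows "det A =
      A$0$0 * A$1$1 * A$2$2 * A$3$3 - A$0$0 * A$1$1 * A$2$3 * A$3$2
      - A$0$0 * A$1$2 * A$2$1 * A$3$3 + A$0$0 * A$1$2 * A$2$3 * A$3$1
      + A$0$0 * A$1$3 * A$2$1 * A$3$2 - A$0$0 * A$1$3 * A$2$2 * A$3$1
      - A$0$1 * A$1$0 * A$2$2 * A$3$3 + A$0$1 * A$1$0 * A$2$3 * A$3$2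
      + A$0$1 * A$1$2 * A$2$0 * A$3$3 - A$0$1 * A$1$2 * A$2$3 * A$3$0
      - A$0$1 * A$1$3 * A$2$0 * A$3$2 + A$0$1 * A$1$3 * A$2$2 * A$3$0
      + A$0$2 * A$1$0 * A$2$1 * A$3$3 - A$0$2 * A$1$0 * A$2$3 * A$3$1
      - A$0$2 * A$1$1 * A$2$0 * A$3$3 + A$0$2 * A$1$1 * A$2$3 * A$3$0
      + A$0$2 * A$1$3 * A$2$0 * A$3$1 - A$0$2 * A$1$3 * A$2$1 * A$3$0
      - A$0$3 * A$1$0 * A$2$1 * A$3$2 + A$0$3 * A$1$0 * A$2$2 * A$3$1
      + A$0$3 * A$1$1 * A$2$0 * A$3$2 - A$0$3 * A$1$1 * A$2$2 * A$3$0
      - A$0$3 * A$1$2 * A$2$0 * A$3$1 + A$0$3 * A$1$2 * A$2$1 * A$3$0"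
proof -
  have f: "finite {1,2,3::4}" "0 \<notin> {1,2,3::4}" by auto
  have f2: "finite {2,3::4}" "1 \<notin> {2,3::4}" by auto
  have f3: "finite {3::4}" "2 \<notin> {3::4}" by auto
  have s: "permutation (Transposition.transpose x y \<circ> p)"
      "sign (Transposition.transpose x y \<circ> p) = (if x = y then 1 else - 1) * sign p"
    if "permutation p" for p :: "4 \<Rightarrow> 4" and x y
    using that by (simp_all add: sign_compose permutation_compose permutation_swap_id sign_swap_id)
  have n: "0 \<noteq> (1::4)" "0 \<noteq> (2::4)" "0 \<noteq> (3::4)" "1 \<noteq> (2::4)" "1 \<noteq> (3::4)" "2 \<noteq> (3::4)"
    by auto
  note n = n n[symmetric]
  have S: "sum g {0,1,2,3} = g 0 + (g 1 + (g 2 + g 3))" "sum g {1,2,3} = g 1 + (g 2 + g 3)"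
      "sum g {2,3} = g 2 + g 3" "sum g {3} = g 3"
      "prod g {0,1,2,3} = g 0 * g 1 * g 2 * g 3" for g :: "4 \<Rightarrow> 'a"
    by (simp_all add: n ac_simps)
  have S1: "sum g {p} = g p" for g :: "(4 \<Rightarrow> 4) \<Rightarrow> 'a" and p
    by simp
  show ?thesis
    unfolding det_def UNIV_4'
    unfolding sum_over_permutations_insert[OF f] sum_over_permutations_insert[OF f2]
      sum_over_permutations_insert[OF f3] permutes_sing
    by (simp only: S s permutation_id sign_id n o_apply id_apply transpose_apply_first transpose_apply_second
        transpose_apply_other Transposition.transpose_def refl if_True if_False simp_thms singleton_conv S1
        mult_1_left mult_minus_left of_int_1 of_int_minus minus_minus)
       (simp only: diff_conv_add_uminus ac_simps)
qed

lemma has_vector_derivative_vecI: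
  fixes g :: "real \<Rightarrow> ('a::euclidean_space)^4"
  assumes "\<And>k. ((\<lambda>s. g s $ k) has_vector_derivative D $ k) (at x)"
  shows "(g has_vector_derivative D) (at x)"
proof -
  have bl: "bounded_linear (axis k :: 'a \<Rightarrow> 'a^4)" for k :: 4
    unfolding linear_conv_bounded_linear[symmetric]
    by (rule linearI) (simp_all add: axis_def vec_eq_iff)
  have ex: "v = (\<Sum>k\<in>UNIV. axis k (v $ k))" for v :: "'a^4"
    by (simp add: vec_eq_iff axis_def if_distrib cong: if_cong)
  have "((\<lambda>s. \<Sum>k\<in>UNIV. axis k (g s $ k)) has_vector_derivative (\<Sum>k\<in>UNIV. axis k (D $ k))) (at x)"
    by (intro has_vector_derivative_sum bounded_linear.has_vector_derivative[OF bl] assms)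
  then show ?thesis by (simp only: ex[symmetric])
qed

definition sph_d :: "nat \<Rightarrow> real \<Rightarrow> real \<Rightarrow> real \<Rightarrow> real^4" where
  "sph_d i a b c = (\<chi> k.
     if i = 0 then (if k = 0 then - sin a else if k = 1 then cos a * cos b
       else if k = 2 then cos a * sin b * cos c else cos a * sin b * sin c)
     else if i = 1 then (if k = 0 then 0 else if k = 1 then - sin a * sin b
       else if k = 2 then sin a * cos b * cos c else sin a * cos b * sin c)
     else (if k = 0 then 0 else if k = 1 then 0
       else if k = 2 then - sin a * sin b * sin c else sin a * sin b * cos c))"

lemma sph_has_vector_derivative:
  "((\<lambda>s. sph s b c) has_vector_derivative sph_d 0 a b c) (at a)"
  "((\<lambda>s. sph a s c) has_vector_derivative sph_d 1 a b c) (at b)"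
  "((\<lambda>s. sph a b s) has_vector_derivative sph_d 2 a b c) (at c)"
  by (rule has_vector_derivative_vecI;
      auto simp: sph_def sph_d_def has_real_derivative_iff_has_vector_derivative[symmetric]
           intro!: derivative_eq_intros)+

lemma sph_norm: "(sph a b c $ 0)\<^sup>2 + (sph a b c $ 1)\<^sup>2 + (sph a b c $ 2)\<^sup>2 + (sph a b c $ 3)\<^sup>2 = 1"
proof -
  have "(sph a b c $ 0)\<^sup>2 + (sph a b c $ 1)\<^sup>2 + (sph a b c $ 2)\<^sup>2 + (sph a b c $ 3)\<^sup>2
      = (cos a)\<^sup>2 + (sin a)\<^sup>2 * ((cos b)\<^sup>2 + (sin b)\<^sup>2 * ((cos c)\<^sup>2 + (sin c)\<^sup>2))"
    unfolding sph_nth by algebra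
  also have "\<dots> = 1"
    by (simp only: sin_cos_squared_add2 mult_1_right)
  finally show ?thesis .
qed

lemma N_U2_chart: "N (quat (U2_chart R t a b c)) = (complex_of_real R * cis (- t))\<^sup>2"
proof -
  have "N (quat (U2_chart R t a b c)) = (complex_of_real R * cis (- t))\<^sup>2 * complex_of_real
      ((sph a b c $ 0)\<^sup>2 + (sph a b c $ 1)\<^sup>2 + (sph a b c $ 2)\<^sup>2 + (sph a b c $ 3)\<^sup>2)"
    by (simp add: N_quat U2_chart_def cvec_def power_mult_distrib algebra_simps)
  then show ?thesis by (simp only: sph_norm of_real_1 mult_1_right)
qed

lemma dS_jac_S3:
  assumes "0 \<le> R" "a \<in> {0..pi}" "b \<in> {0..pi}"
  shows "dS_jac (S3_chart R) a b c = R ^ 3 * (sin a)\<^sup>2 * sin b"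
proof -
  have d: "vector_derivative (\<lambda>s. S3_chart R s b c) (at a) = R *\<^sub>R sph_d 0 a b c"
    "vector_derivative (\<lambda>s. S3_chart R a s c) (at b) = R *\<^sub>R sph_d 1 a b c"
    "vector_derivative (\<lambda>s. S3_chart R a b s) (at c) = R *\<^sub>R sph_d 2 a b c"
    unfolding S3_chart_def
    by (intro vector_derivative_at bounded_linear.has_vector_derivative[OF bounded_linear_scaleR_right]
          sph_has_vector_derivative)+
  have cs: "(cos x)\<^sup>2 = 1 - (sin x)\<^sup>2" for x :: real by (simp add: cos_squared_eq)
  define sa ca sb cb sc cc where trig: "sa = sin a" "ca = cos a" "sb = sin b" "cb = cos b" "sc = sin c" "cc = cos c"
  have t: "ca\<^sup>2 = 1 - sa\<^sup>2" "cb\<^sup>2 = 1 - sb\<^sup>2" "cc\<^sup>2 = 1 - sc\<^sup>2" by (simp_all add: trig cs)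
  have g: "sph_d 0 a b c \<bullet> sph_d 0 a b c = 1" "sph_d 1 a b c \<bullet> sph_d 1 a b c = sa\<^sup>2"
    "sph_d 2 a b c \<bullet> sph_d 2 a b c = (sa * sb)\<^sup>2"
    "sph_d 0 a b c \<bullet> sph_d 1 a b c = 0" "sph_d 0 a b c \<bullet> sph_d 2 a b c = 0"
    "sph_d 1 a b c \<bullet> sph_d 2 a b c = 0"
    using t by (simp_all add: inner_vec_def sum_4' sph_d_def trig[symmetric]; algebra)+
  have "dS_jac (S3_chart R) a b c = sqrt ((R ^ 3 * sa\<^sup>2 * sb)\<^sup>2)"
    unfolding dS_jac_def d Let_def real_sqrt_eq_iff
    by (simp del: One_nat_def add: det_3 g inner_commute[of "sph_d 1 a b c" "sph_d 0 a b c"]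
        inner_commute[of "sph_d 2 a b c" "sph_d 0 a b c"] inner_commute[of "sph_d 2 a b c" "sph_d 1 a b c"])
       (simp add: power2_eq_square power3_eq_cube algebra_simps)
  also have "\<dots> = R ^ 3 * sa\<^sup>2 * sb"
    using assms by (simp add: trig sin_ge_zero)
  finally show ?thesis by (simp add: trig)
qed

lemma dV_jac_U2:
  "dV_jac (U2_chart R) t a b c = - \<i> * (N (quat (U2_chart R t a b c)))\<^sup>2 * complex_of_real ((sin a)\<^sup>2 * sin b)"
proof -
  let ?e = "complex_of_real R * cis (- t)"
  have bl: "bounded_linear (\<lambda>x. e *s cvec x)" for e :: complex
    unfolding linear_conv_bounded_linear[symmetric]
    by (rule linearI) (simp_all add: vec_eq_iff cvec_def algebra_simps scaleR_conv_of_real[where 'a=complex])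
  have dt: "vector_derivative (\<lambda>s. U2_chart R s a b c) (at t) = (- \<i> * ?e) *s cvec (sph a b c)"
  proof (rule vector_derivative_at, rule has_vector_derivative_vecI)
    fix k
    have "((\<lambda>s. cis (- s)) has_vector_derivative (- \<i> * cis (- t))) (at t)"
    proof -
      have "((\<lambda>z. exp (- (\<i> * z))) has_field_derivative (- \<i> * exp (- (\<i> * complex_of_real t)))) (at (complex_of_real t))"
        by (auto intro!: derivative_eq_intros)
      from has_vector_derivative_real_field[OF this] show ?thesis
        by (simp add: cis_conv_exp)
    qed
    from has_vector_derivative_mult_left[OF has_vector_derivative_mult_right[OF this, of "complex_of_real R"],
        of "complex_of_real (sph a b c $ k)"]
    show "((\<lambda>s. U2_chart R s a b c $ k) has_vector_derivative ((- \<i> * ?e) *s cvec (sph a b c)) $ k) (at t)"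
      by (simp add: U2_chart_def cvec_def algebra_simps)
  qed
  have d: "vector_derivative (\<lambda>s. U2_chart R t s b c) (at a) = ?e *s cvec (sph_d 0 a b c)"
    "vector_derivative (\<lambda>s. U2_chart R t a s c) (at b) = ?e *s cvec (sph_d 1 a b c)"
    "vector_derivative (\<lambda>s. U2_chart R t a b s) (at c) = ?e *s cvec (sph_d 2 a b c)"
    unfolding U2_chart_def
    by (intro vector_derivative_at bounded_linear.has_vector_derivative[OF bl] sph_has_vector_derivative)+
  define sa ca sb cb sc cc where trig: "sa = complex_of_real (sin a)" "ca = complex_of_real (cos a)"
    "sb = complex_of_real (sin b)" "cb = complex_of_real (cos b)"
    "sc = complex_of_real (sin c)" "cc = complex_of_real (cos c)"
  have cs: "(complex_of_real (cos x))\<^sup>2 + (complex_of_real (sin x))\<^sup>2 = 1" for x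
    by (metis of_real_1 of_real_add of_real_power sin_cos_squared_add2)
  have t: "ca\<^sup>2 + sa\<^sup>2 = 1" "cb\<^sup>2 + sb\<^sup>2 = 1" "cc\<^sup>2 + sc\<^sup>2 = 1" using cs by (simp_all add: trig)
  obtain e where e: "e = ?e" by blast
  have "dV_jac (U2_chart R) t a b c = - \<i> * e ^ 4 * (sa\<^sup>2 * sb)
      * ((ca\<^sup>2 + sa\<^sup>2) * (cb\<^sup>2 + sb\<^sup>2) * (cc\<^sup>2 + sc\<^sup>2))"
    unfolding dV_jac_def dt d e[symmetric] det_4
    by (simp add: sph_def sph_d_def cvec_def trig[symmetric])
       (simp add: power2_eq_square power4_eq_xxxx algebra_simps)
  then have "dV_jac (U2_chart R) t a b c = - \<i> * e ^ 4 * (sa\<^sup>2 * sb)"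
    by (simp only: t mult_1_right)
  then show ?thesis
    by (simp add: N_U2_chart e trig power_mult_distrib flip: power_mult)
qed

lemma sph_cover:
  assumes "(x$0)\<^sup>2 + (x$1)\<^sup>2 + (x$2)\<^sup>2 + (x$3)\<^sup>2 = (1::real)"
  obtains a b c where "a \<in> {0..pi}" "b \<in> {0..pi}" "c \<in> {0..2*pi}" "x = sph a b c"
proof -
  define p where "p = sqrt ((x$1)\<^sup>2 + (x$2)\<^sup>2 + (x$3)\<^sup>2)"
  define q where "q = sqrt ((x$2)\<^sup>2 + (x$3)\<^sup>2)"
  have p2: "p\<^sup>2 = (x$1)\<^sup>2 + (x$2)\<^sup>2 + (x$3)\<^sup>2" and q2: "q\<^sup>2 = (x$2)\<^sup>2 + (x$3)\<^sup>2"
    and pq: "0 \<le> p" "0 \<le> q" by (simp_all add: p_def q_def)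
  obtain a where a: "0 \<le> a" "a \<le> pi" "x$0 = cos a" "p = sin a"
    using sincos_total_pi[of p "x$0"] assms p2 pq by auto
  obtain b where b: "0 \<le> b" "b \<le> pi" "x$1 = p * cos b" "q = p * sin b"
  proof (cases "p = 0")
    case True
    then have "x$1 = 0" "q\<^sup>2 = 0" using p2 q2 by (auto simp: add_nonneg_eq_0_iff)
    with True that[of 0] show ?thesis by simp
  next
    case False
    have "(x$1)\<^sup>2 + q\<^sup>2 = p\<^sup>2" using p2 q2 by simp
    with False have "(x$1 / p)\<^sup>2 + (q / p)\<^sup>2 = 1"
      by (simp only: power_divide add_divide_distrib[symmetric]) simp
    with sincos_total_pi[of "q / p" "x$1 / p"] pq False that show ?thesis
      by (auto simp: field_simps)
  qed
  obtain c where c: "0 \<le> c" "c \<le> 2 * pi" "x$2 = q * cos c" "x$3 = q * sin c"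
  proof (cases "q = 0")
    case True
    then have "x$2 = 0" "x$3 = 0" using q2 by (auto simp: add_nonneg_eq_0_iff)
    with True that[of 0] show ?thesis by simp
  next
    case False
    have "(x$2 / q)\<^sup>2 + (x$3 / q)\<^sup>2 = 1"
      using False by (simp add: power_divide flip: add_divide_distrib q2)
    with sincos_total_2pi_le[of "x$2 / q" "x$3 / q"] False that show ?thesis
      by (auto simp: field_simps)
  qed
  have "x = sph a b c"
    using a b c by (simp add: vec4_eq_iff sph_nth)
  with a b c that show ?thesis by auto
qed

lemma sph_inj:
  assumes "sph a b c = sph a' b' c'"
    and "a \<in> {0<..<pi}" "b \<in> {0<..<pi}" "c \<in> {0<..<2*pi}"
    and "a' \<in> {0<..<pi}" "b' \<in> {0<..<pi}" "c' \<in> {0<..<2*pi}"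
  shows "a = a' \<and> b = b' \<and> c = c'"
proof -
  have e: "sph a b c $ k = sph a' b' c' $ k" for k using assms(1) by simp
  have a: "a = a'" by (rule cos_inj_pi) (use e[of 0] assms(2-) in \<open>auto simp: sph_nth\<close>)
  have s: "sin a \<noteq> 0" "sin b \<noteq> 0" using assms sin_gt_zero by fastforce+
  have b: "b = b'" by (rule cos_inj_pi) (use e[of 1] s a assms(2-) in \<open>auto simp: sph_nth\<close>)
  have "cos c = cos c'" "sin c = sin c'" using e[of 2] e[of 3] s a b by (simp_all add: sph_nth)
  then obtain n :: int where n: "c = c' + 2 * pi * n"
    using sin_cos_eq_iff[of c c'] by auto
  have "\<bar>2 * pi * n\<bar> < 2 * pi" using n assms by auto
  then have "\<bar>real_of_int n\<bar> < 1" by (simp add: abs_mult)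
  then have "n = 0" by linarith
  with n a b show ?thesis by simp
qed

lemma quat_scale: "quat (e *s z) = (\<chi> i j. e * quat z $ i $ j)"
  by (simp add: quat_def vec_eq_iff forall_2 algebra_simps)

lemma U2_chart_inj:
  assumes "R \<noteq> 0"
  shows "inj_on (\<lambda>(t, a, b, c). quat (U2_chart R t a b c))
    ({0<..<pi} \<times> {0<..<pi} \<times> {0<..<pi} \<times> {0<..<2*pi})"
proof (rule inj_onI)
  fix u v
  assume u: "u \<in> {0<..<pi} \<times> {0<..<pi} \<times> {0<..<pi} \<times> {0<..<2*pi}"
    and v: "v \<in> {0<..<pi} \<times> {0<..<pi} \<times> {0<..<pi} \<times> {0<..<2*pi}"
    and uv: "(\<lambda>(t, a, b, c). quat (U2_chart R t a b c)) u = (\<lambda>(t, a, b, c). quat (U2_chart R t a b c)) v"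
  obtain t a b c where u_eq: "u = (t, a, b, c)" by (cases u) auto
  obtain t' a' b' c' where v_eq: "v = (t', a', b', c')" by (cases v) auto
  note uv_eq = u_eq v_eq
  have i: "t \<in> {0<..<pi}" "a \<in> {0<..<pi}" "b \<in> {0<..<pi}" "c \<in> {0<..<2*pi}"
    "t' \<in> {0<..<pi}" "a' \<in> {0<..<pi}" "b' \<in> {0<..<pi}" "c' \<in> {0<..<2*pi}"
    and e: "quat (U2_chart R t a b c) = quat (U2_chart R t' a' b' c')"
    using u v uv unfolding uv_eq by auto
  have "N (quat (U2_chart R t a b c)) = N (quat (U2_chart R t' a' b' c'))" using e by simp
  then have "(cis (- t))\<^sup>2 = (cis (- t'))\<^sup>2"
    using assms by (simp add: N_U2_chart power_mult_distrib)
  then have d: "cis (- t) = cis (- t') \<or> cis (- t) = - cis (- t')"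
    by (simp add: power2_eq_iff)
  have "cis (- t) \<noteq> - cis (- t')"
    using i sin_gt_zero[of t] sin_gt_zero[of t'] by (auto simp: complex_eq_iff)
  with d have ct: "cis (- t) = cis (- t')" by simp
  then have "cos t = cos t'" by (simp add: complex_eq_iff)
  then have "t = t'"
    by (intro cos_inj_pi[of t t']) (use i in \<open>simp_all only: greaterThanLessThan_iff order.strict_implies_order\<close>)
  moreover have "U2_chart R t a b c = U2_chart R t' a' b' c'" using e by (simp only: quat_inj)
  then have "cvec (sph a b c) = cvec (sph a' b' c')"
    using ct assms by (simp add: U2_chart_def vec_eq_iff)
  then have "sph a b c = sph a' b' c'" by (simp add: cvec_def vec_eq_iff)
  ultimately show "u = v" using sph_inj[of a b c a' b' c'] i unfolding uv_eq by simp
qed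

lemma U2_chart_image:
  "(\<lambda>(t, a, b, c). quat (U2_chart R t a b c)) ` ({0..pi} \<times> {0..pi} \<times> {0..pi} \<times> {0..2*pi}) = U2 R"
proof (intro equalityI subsetI)
  fix Z assume "Z \<in> (\<lambda>(t, a, b, c). quat (U2_chart R t a b c)) ` ({0..pi} \<times> {0..pi} \<times> {0..pi} \<times> {0..2*pi})"
  then obtain t a b c where Z: "Z = quat (U2_chart R t a b c)" by auto
  let ?Y = "quat (cis (- t) *s cvec (sph a b c))"
  define p q where "p = complex_of_real (cos a) - \<i> * complex_of_real (sin a * sin b * sin c)"
    and "q = - \<i> * complex_of_real (sin a * cos b) - complex_of_real (sin a * sin b * cos c)"
  have Y: "?Y = (\<chi> i j. cis (- t) * (if i = 1 then if j = 1 then p else q else if j = 1 then - cnj q else cnj p))"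
    by (simp add: quat_scale vec_eq_iff forall_2)
       (simp add: quat_def cvec_def sph_nth p_def q_def)
  have "p * cnj p + q * cnj q = complex_of_real
      ((sph a b c $ 0)\<^sup>2 + (sph a b c $ 1)\<^sup>2 + (sph a b c $ 2)\<^sup>2 + (sph a b c $ 3)\<^sup>2)"
    by (simp add: complex_eq_iff p_def q_def sph_nth power2_eq_square)
  then have pq: "p * cnj p + q * cnj q = 1" by (simp only: sph_norm of_real_1)
  have c1: "cis t * cis (- t) = 1" by (simp add: cis_mult)
  have c1': "cis (- t) * cis t = 1" by (simp add: cis_mult)
  have pq': "cnj p * p + q * cnj q = 1" and pq'': "cnj p * p + cnj q * q = 1"
    and pq''': "cnj q * q + p * cnj p = 1"
    using pq by (simp_all add: ac_simps)
  have k: "e * x * (f * y) + e * x' * (f * y') = (e * f) * (x * y + x' * y')" for e f x y x' y' :: complex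
    by (simp add: algebra_simps)
  have "(?Y ** adj ?Y) $ i $ j = mat 1 $ i $ j \<and> (adj ?Y ** ?Y) $ i $ j = mat 1 $ i $ j" for i j
    using exhaust_2[of i] exhaust_2[of j] unfolding Y
    by (elim disjE)
       (simp_all add: matrix_matrix_mult_def adj_def sum_2 mat_def cis_cnj k c1 c1' pq pq' pq'' pq''')
  then have "?Y ** adj ?Y = mat 1" "adj ?Y ** ?Y = mat 1"
    by (simp_all add: vec_eq_iff)
  moreover have "Z = R *\<^sub>R ?Y"
    by (simp add: Z U2_chart_def quat_scale vec_eq_iff scaleR_conv_of_real[where 'a=complex])
  ultimately show "Z \<in> U2 R" unfolding U2_def by blast
next
  fix Z assume "Z \<in> U2 R"
  then obtain Y where Y: "Z = R *\<^sub>R Y" "Y ** adj Y = mat 1" unfolding U2_def by blast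
  have da: "det (adj Y) = cnj (det Y)" by (simp add: det_2 adj_def)
  have "det Y * cnj (det Y) = 1" using arg_cong[OF Y(2), of det] by (simp add: det_mul da)
  then have "norm (det Y * cnj (det Y)) = 1" by simp
  then have "(norm (det Y))\<^sup>2 = 1" by (simp add: norm_mult power2_eq_square)
  then have "norm (det Y) = 1" by (simp add: power2_eq_1_iff) (smt (verit) norm_ge_zero)
  then obtain s where s: "0 \<le> s" "s < 2 * pi" "det Y = Complex (cos s) (sin s)"
    using complex_unimodular_polar by blast
  define t where "t = pi - s / 2"
  have t: "t \<in> {0..pi}" using s by (auto simp: t_def)
  have c1: "cis t * cis (- t) = 1" by (simp add: cis_mult)
  have "(cis (- t))\<^sup>2 = cis (s - 2 * pi)"
    by (simp add: power2_eq_square cis_mult t_def)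
  also have "\<dots> = cis s" by (simp flip: cis_divide)
  finally have dY: "det Y = (cis (- t))\<^sup>2" by (simp add: s(3) complex_eq_iff)
  have k: "e * x * (f * y) + e * x' * (f * y') = (e * f) * (x * y + x' * y')" for e f x y x' y' :: complex
    by (simp add: algebra_simps)
  define y where "y i j = cis t * Y $ i $ j" for i j
  have Yij: "Y $ i $ j = cis (- t) * y i j" for i j
    using c1 by (simp add: y_def mult.assoc[symmetric]) (simp add: mult.commute)
  have ent: "(Y ** adj Y) $ i $ j = (mat 1 :: hc) $ i $ j" for i j using Y(2) by simp
  have u: "y 1 1 * cnj (y 1 1) + y 1 2 * cnj (y 1 2) = 1" "y 2 1 * cnj (y 1 1) + y 2 2 * cnj (y 1 2) = 0"
    "y 2 1 * cnj (y 2 1) + y 2 2 * cnj (y 2 2) = 1" "y 1 1 * cnj (y 2 1) + y 1 2 * cnj (y 2 2) = 0"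
    using ent[of 1 1] ent[of 2 1] ent[of 2 2] ent[of 1 2]
    by (simp_all add: matrix_matrix_mult_def adj_def sum_2 mat_def y_def cis_cnj k c1)
  have d: "y 1 1 * y 2 2 - y 1 2 * y 2 1 = 1"
    using dY c1 unfolding det_2 y_def by algebra
  have y22: "cnj (y 1 1) = y 2 2" and y12: "cnj (y 2 1) = - y 1 2"
    using u d by algebra+
  define x :: "real^4" where "x = (\<chi> k. if k = 0 then Re (y 1 1) else if k = 1 then - Im (y 2 1)
    else if k = 2 then Re (y 2 1) else - Im (y 1 1))"
  have yx: "quat (cvec x) = (\<chi> i j. y i j)"
    using y22 y12 by (simp add: quat_def cvec_def x_def vec_eq_iff forall_2 complex_eq_iff)
  have "complex_of_real ((x$0)\<^sup>2 + (x$1)\<^sup>2 + (x$2)\<^sup>2 + (x$3)\<^sup>2) = 1"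
    using N_quat[of "cvec x"] d unfolding yx by (simp add: det_2 cvec_def)
  then have "(x$0)\<^sup>2 + (x$1)\<^sup>2 + (x$2)\<^sup>2 + (x$3)\<^sup>2 = 1" by (simp only: of_real_eq_1_iff)
  then obtain a b c where abc: "a \<in> {0..pi}" "b \<in> {0..pi}" "c \<in> {0..2*pi}" "x = sph a b c"
    using sph_cover by blast
  have "Z = quat (U2_chart R t a b c)"
    unfolding U2_chart_def abc(4)[symmetric] quat_scale yx
    by (simp add: Y(1) vec_eq_iff Yij scaleR_conv_of_real[where 'a=complex])
  with t abc show "Z \<in> (\<lambda>(t, a, b, c). quat (U2_chart R t a b c)) ` ({0..pi} \<times> {0..pi} \<times> {0..pi} \<times> {0..2*pi})"
    by (intro image_eqI[of _ _ "(t, a, b, c)"]) auto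
qed

lemma S3_chart_inj:
  assumes "R \<noteq> 0"
  shows "inj_on (\<lambda>(a, b, c). quat (cvec (S3_chart R a b c))) ({0<..<pi} \<times> {0<..<pi} \<times> {0<..<2*pi})"
proof (rule inj_onI)
  fix u v
  assume u: "u \<in> {0<..<pi} \<times> {0<..<pi} \<times> {0<..<2*pi}"
    and v: "v \<in> {0<..<pi} \<times> {0<..<pi} \<times> {0<..<2*pi}"
    and uv: "(\<lambda>(a, b, c). quat (cvec (S3_chart R a b c))) u = (\<lambda>(a, b, c). quat (cvec (S3_chart R a b c))) v"
  obtain a b c where u_eq: "u = (a, b, c)" by (cases u) auto
  obtain a' b' c' where v_eq: "v = (a', b', c')" by (cases v) auto
  note uv_eq = u_eq v_eq
  have i: "a \<in> {0<..<pi}" "b \<in> {0<..<pi}" "c \<in> {0<..<2*pi}"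
    "a' \<in> {0<..<pi}" "b' \<in> {0<..<pi}" "c' \<in> {0<..<2*pi}"
    and e: "quat (cvec (S3_chart R a b c)) = quat (cvec (S3_chart R a' b' c'))"
    using u v uv unfolding uv_eq by auto
  have "cvec (S3_chart R a b c) = cvec (S3_chart R a' b' c')" using e by (simp only: quat_inj)
  then have "sph a b c = sph a' b' c'"
    using assms by (simp add: cvec_def S3_chart_def vec_eq_iff)
  then show "u = v" using sph_inj[of a b c a' b' c'] i unfolding uv_eq by simp
qed

lemma S3_chart_image:
  assumes "R > 0"
  shows "(\<lambda>(a, b, c). quat (cvec (S3_chart R a b c))) ` ({0..pi} \<times> {0..pi} \<times> {0..2*pi}) = S3 R"
proof (intro equalityI subsetI)
  fix Z assume "Z \<in> (\<lambda>(a, b, c). quat (cvec (S3_chart R a b c))) ` ({0..pi} \<times> {0..pi} \<times> {0..2*pi})"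
  then obtain a b c where Z: "Z = quat (cvec (S3_chart R a b c))" by auto
  have "N Z = complex_of_real (R\<^sup>2 * ((sph a b c $ 0)\<^sup>2 + (sph a b c $ 1)\<^sup>2 + (sph a b c $ 2)\<^sup>2 + (sph a b c $ 3)\<^sup>2))"
    by (simp add: Z N_quat S3_chart_def cvec_def power_mult_distrib algebra_simps)
  then show "Z \<in> S3 R" using Z by (auto simp: sph_norm S3_def)
next
  fix Z assume "Z \<in> S3 R"
  then obtain x where x: "Z = quat (cvec x)" "N (quat (cvec x)) = complex_of_real (R\<^sup>2)"
    unfolding S3_def by blast
  have "complex_of_real ((x$0)\<^sup>2 + (x$1)\<^sup>2 + (x$2)\<^sup>2 + (x$3)\<^sup>2) = complex_of_real (R\<^sup>2)"
    using x(2) by (simp add: N_quat cvec_def)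
  then have n: "(x$0)\<^sup>2 + (x$1)\<^sup>2 + (x$2)\<^sup>2 + (x$3)\<^sup>2 = R\<^sup>2" by (simp only: of_real_eq_iff)
  define y where "y = (1 / R) *\<^sub>R x"
  have "(y$0)\<^sup>2 + (y$1)\<^sup>2 + (y$2)\<^sup>2 + (y$3)\<^sup>2 = 1"
    using n assms by (simp add: y_def power_divide flip: add_divide_distrib)
  then obtain a b c where abc: "a \<in> {0..pi}" "b \<in> {0..pi}" "c \<in> {0..2*pi}" "y = sph a b c"
    using sph_cover by blast
  have "x = S3_chart R a b c" using assms by (simp add: S3_chart_def y_def flip: abc(4))
  then show "Z \<in> (\<lambda>(a, b, c). quat (cvec (S3_chart R a b c))) ` ({0..pi} \<times> {0..pi} \<times> {0..2*pi})"
    using abc x(1) by (intro image_eqI[of _ _ "(a, b, c)"]) auto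
qed

lemma integral_sin_0_pi: "integral {0..pi} sin = 2"
  using fundamental_theorem_of_calculus[of 0 pi "\<lambda>x. - cos x" sin]
  by (auto intro!: integral_unique derivative_eq_intros
      simp: has_real_derivative_iff_has_vector_derivative[symmetric])

lemma integral_sin_squared_0_pi: "integral {0..pi} (\<lambda>x. (sin x)\<^sup>2) = pi / 2"
proof -
  have "((\<lambda>x. (sin x)\<^sup>2) has_integral ((pi - sin pi * cos pi) / 2 - (0 - sin 0 * cos 0) / 2)) {0..pi}"
    by (intro fundamental_theorem_of_calculus)
       (auto intro!: derivative_eq_intros
          simp: has_real_derivative_iff_has_vector_derivative[symmetric] power2_eq_square[symmetric] cos_squared_eq)
  then show ?thesis by (simp add: integral_unique)
qed

lemma sphere_box_integral:
  "integral ({0..pi} \<times> {0..pi} \<times> {0..2*pi}) (\<lambda>(a, b, c). (sin a)\<^sup>2 * sin b) = 2 * pi\<^sup>2"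
proof -
  have "integral (cbox (0, 0, 0) (pi, pi, 2*pi)) (\<lambda>(a, b, c::real). (sin a)\<^sup>2 * sin b)
      = integral (cbox 0 pi) (\<lambda>a. integral (cbox (0, 0) (pi, 2*pi)) (\<lambda>(b, c::real). (sin a)\<^sup>2 * sin b))"
    by (subst integral_prod_continuous) (auto intro!: continuous_intros simp: case_prod_unfold)
  also have "\<dots> = integral (cbox 0 pi) (\<lambda>a. integral (cbox 0 pi) (\<lambda>b. integral (cbox 0 (2*pi)) (\<lambda>c::real. (sin a)\<^sup>2 * sin b)))"
    by (subst integral_prod_continuous) (auto intro!: continuous_intros simp: case_prod_unfold)
  also have "\<dots> = 2 * pi\<^sup>2"
    by (simp add: integral_sin_0_pi integral_sin_squared_0_pi) (simp add: power2_eq_square)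
  finally show ?thesis by (simp add: cbox_Pair_eq)
qed

lemma S3_integral_area:
  assumes "R \<ge> 0"
  shows "S3_integral R (\<lambda>Z. 1) = complex_of_real (2 * pi\<^sup>2 * R ^ 3)"
proof -
  let ?B = "{0..pi} \<times> {0..pi} \<times> {0..2*pi}"
  have B: "?B = cbox (0, 0, 0) (pi, pi, 2*pi)" by (simp add: cbox_Pair_eq)
  have "S3_integral R (\<lambda>Z. 1) = set_lebesgue_integral lborel ?B
      (\<lambda>x. complex_of_real (R ^ 3) * complex_of_real ((\<lambda>(a, b, c::real). (sin a)\<^sup>2 * sin b) x))"
    unfolding S3_integral_def
    by (rule set_lebesgue_integral_cong) (use assms in \<open>auto simp: dS_jac_S3 B\<close>)
  also have "\<dots> = complex_of_real (R ^ 3) * complex_of_real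
      (set_lebesgue_integral lborel ?B (\<lambda>(a, b, c). (sin a)\<^sup>2 * sin b))"
    by (simp add: set_integral_complex_of_real)
  also have "set_lebesgue_integral lborel ?B (\<lambda>(a, b, c). (sin a)\<^sup>2 * sin b)
      = integral ?B (\<lambda>(a, b, c). (sin a)\<^sup>2 * sin b)"
    unfolding B
    by (intro set_borel_integral_eq_integral, unfold set_integrable_def, intro borel_integrable_compact)
       (auto intro!: continuous_intros simp: case_prod_unfold)
  finally show ?thesis unfolding sphere_box_integral by (simp add: mult.commute)
qed

lemma U2_integral_normalization:
  assumes "R \<noteq> 0"
  shows "U2_integral R (\<lambda>Z. 1 / (N Z)\<^sup>2) = - 2 * complex_of_real pi ^ 3 * \<i>"
proof -
  let ?B = "{0..pi} \<times> {0..pi} \<times> {0..pi} \<times> {0..2*pi}"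
  let ?f = "\<lambda>(t::real, a, b, c::real). (sin a)\<^sup>2 * sin b"
  have B: "?B = cbox (0, 0, 0, 0) (pi, pi, pi, 2*pi)" by (simp add: cbox_Pair_eq)
  have "U2_integral R (\<lambda>Z. 1 / (N Z)\<^sup>2) = set_lebesgue_integral lborel ?B
      (\<lambda>x. - \<i> * complex_of_real (?f x))"
    unfolding U2_integral_def
    by (rule set_lebesgue_integral_cong) (use assms in \<open>auto simp: dV_jac_U2 B N_U2_chart\<close>)
  also have "\<dots> = - \<i> * complex_of_real (set_lebesgue_integral lborel ?B ?f)"
    by (simp only: set_integral_mult_right set_integral_complex_of_real)
  also have "set_lebesgue_integral lborel ?B ?f = integral ?B ?f"
    unfolding B
    by (intro set_borel_integral_eq_integral, unfold set_integrable_def, intro borel_integrable_compact)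
       (auto intro!: continuous_intros simp: case_prod_unfold)
  also have "\<dots> = integral (cbox 0 pi) (\<lambda>t::real. integral ({0..pi} \<times> {0..pi} \<times> {0..2*pi}) (\<lambda>(a, b, c). (sin a)\<^sup>2 * sin b))"
    unfolding B
    by (subst integral_prod_continuous)
       (auto intro!: continuous_intros simp: case_prod_unfold cbox_Pair_eq)
  also have "\<dots> = 2 * pi ^ 3"
    unfolding sphere_box_integral by (simp add: power2_eq_square power3_eq_cube)
  finally show ?thesis by simp
qed

end

theory Submission
  imports Defs
begin

text \<open>
  Plane waves \<open>\<sigma>\<^sup>p\<close> with \<open>\<sigma> Z = u\<^sup>T Z v\<close> span \<open>H\<^sup>+\<close>, and the operator is bilinear, so it is
  enough to compute it on pairs \<open>\<sigma>\<^sup>p, \<sigma>'\<^sup>q\<close>. All integrals are exchanged so that those over \<open>Z\<^sub>1\<close>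
  and \<open>Z\<^sub>2\<close> are done first: the \<open>Z\<^sub>2\<close> integral reproduces \<open>\<sigma>'\<^sup>q\<close> at \<open>T\<^sub>1\<close>, and the \<open>Z\<^sub>1\<close> integral gives
  a divided difference of \<open>\<sigma>\<^sup>p\<close> at \<open>T\<^sub>1, T\<^sub>2\<close>. The remaining integrals over \<open>T\<^sub>1\<close> and \<open>T\<^sub>2\<close> have two poles
  \<open>N(T - W)\<^sup>-\<^sup>1 N(T - W')\<^sup>-\<^sup>1\<close>; each evaluates a polynomial \<open>g\<close> to the average of \<open>g(W + (W' - W) P)\<close>
  over the projections \<open>P\<close> of rank one, a matrix form of Feynman's parameter integral.

  The result is a double binomial transform of \<open>d(i, j) R\<^sub>i\<^sub>j\<close>, where \<open>R\<^sub>i\<^sub>j\<close> is symmetric under the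
  exchange up to the sign \<open>(-1)\<^sup>i\<^sup>+\<^sup>j\<close>, and the numbers \<open>d\<close> satisfy \<open>d(i + 1, j) + d(i, j + 1) = d(i, j)\<close>.
  By this recursion the alternating binomial transform maps \<open>d(j, i)\<close> to \<open>d(i, j)\<close>, which is
  the asserted symmetry.
\<close>

section \<open>Weighted means over a chart\<close>

text \<open>The obstacle is that means over \<open>U2 R\<close> are handled through invariance, so
  no integral is expanded in a series. Each evaluation embeds the integrand in a family with a
  complex parameter, shows by an infinitesimal invariance (rotation, Euler field, translation of Z
  or of its inverse) that the mean is constant or obeys a simple differential equation, and reads it
  off where the integrand is trivial. Hence a kernel must have no zeros along the whole deformation,
  which is what \<open>inside\<close> records. Plane waves fit because u v^T has rank one:
  \<sigma>^p is harmonic, and the vector field Z v u^T Z raises p by one. The Z2 integral runs over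
  a three-sphere only; it is compared with the unitary mean by showing that all phases contribute
  equally. The numbers d(i, j) are a segment of the harmonic series, left by the divided difference,
  times the Beta value i! j! / (i + j + 1)!, which comes from the second average over projections.
  That average also replaces T2 - W1 by a matrix of rank one, and this collapses the sums left by
  the first.\<close>

locale mean =
  fixes lo hi :: "'p::euclidean_space" and ch :: "'p \<Rightarrow> 'x::metric_space" and wt :: "'p \<Rightarrow> complex"
  assumes continuous_chart: "continuous_on (cbox lo hi) ch"
    and continuous_weight: "continuous_on (cbox lo hi) wt"
begin

text \<open>The integral is the Henstock-Kurzweil integral over the chart box. For continuous
  integrands, exchange of integrals and differentiation under the integral are then library
  theorems, so continuity on \<open>carr\<close> is the main analytic condition to check.\<close>

definition avg :: "('x \<Rightarrow> complex) \<Rightarrow> complex" where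
  "avg F = integral (cbox lo hi) (\<lambda>p. wt p * F (ch p))"

definition carr :: "'x set" where
  "carr = ch ` cbox lo hi"

lemma continuous_integrand:
  "continuous_on carr F \<Longrightarrow> continuous_on (cbox lo hi) (\<lambda>p. wt p * F (ch p))"
  by (rule continuous_on_mult[OF continuous_weight continuous_on_compose2[OF _ continuous_chart]])
     (auto simp: carr_def)

lemma continuous_integrand2:
  assumes "continuous_on (S \<times> carr) (\<lambda>(s, x). F s x)"
  shows "continuous_on (S \<times> cbox lo hi) (\<lambda>(s, p). wt p * F s (ch p))"
proof -
  have 1: "continuous_on (S \<times> cbox lo hi) (\<lambda>q. wt (snd q))"
    by (rule continuous_on_compose2[OF continuous_weight continuous_on_snd[OF continuous_on_id]]) auto
  have "continuous_on (S \<times> cbox lo hi) (\<lambda>q. ch (snd q))"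
    by (rule continuous_on_compose2[OF continuous_chart continuous_on_snd[OF continuous_on_id]]) auto
  then have "continuous_on (S \<times> cbox lo hi) (\<lambda>q. (fst q, ch (snd q)))"
    by (intro continuous_intros) auto
  from continuous_on_compose2[OF assms this]
  have 2: "continuous_on (S \<times> cbox lo hi) (\<lambda>q. F (fst q) (ch (snd q)))"
    by (force simp: carr_def split_beta)
  show ?thesis
    using continuous_on_mult[OF 1 2] by (simp add: split_beta)
qed

lemma integrable_integrand:
  "continuous_on carr F \<Longrightarrow> (\<lambda>p. wt p * F (ch p)) integrable_on cbox lo hi"
  by (intro integrable_continuous continuous_integrand)

lemma avg_cong: "(\<And>x. x \<in> carr \<Longrightarrow> F x = G x) \<Longrightarrow> avg F = avg G"
  unfolding avg_def by (intro Henstock_Kurzweil_Integration.integral_cong) (auto simp: carr_def)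

lemma avg_cmult: "avg (\<lambda>x. c * F x) = c * avg F"
proof -
  have "(\<lambda>p. wt p * (c * F (ch p))) = (\<lambda>p. c * (wt p * F (ch p)))" by (simp add: ac_simps)
  then show ?thesis unfolding avg_def by (simp only: Henstock_Kurzweil_Integration.integral_mult_right)
qed

lemma avg_zero: "avg (\<lambda>x. 0) = 0"
  by (simp add: avg_def)

lemma avg_add:
  "continuous_on carr F \<Longrightarrow> continuous_on carr G \<Longrightarrow> avg (\<lambda>x. F x + G x) = avg F + avg G"
  unfolding avg_def distrib_left
  by (intro Henstock_Kurzweil_Integration.integral_add integrable_integrand)

lemma avg_diff:
  "continuous_on carr F \<Longrightarrow> continuous_on carr G \<Longrightarrow> avg (\<lambda>x. F x - G x) = avg F - avg G"
  unfolding avg_def right_diff_distrib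
  by (intro Henstock_Kurzweil_Integration.integral_diff integrable_integrand)

lemma avg_sum:
  "finite I \<Longrightarrow> (\<And>i. i \<in> I \<Longrightarrow> continuous_on carr (F i)) \<Longrightarrow>
    avg (\<lambda>x. \<Sum>i\<in>I. F i x) = (\<Sum>i\<in>I. avg (F i))"
  by (induction rule: finite_induct) (auto simp: avg_zero avg_add continuous_on_sum)

lemma avg_continuous:
  assumes "continuous_on (S \<times> carr) (\<lambda>(s, x). F s x)"
  shows "continuous_on S (\<lambda>s. avg (F s))"
  unfolding avg_def
  by (rule integral_continuous_on_param[OF continuous_integrand2[OF assms]])

lemma slice_continuous:
  assumes "continuous_on (S \<times> T) (\<lambda>(s, x). F s x)" "s \<in> S"
  shows "continuous_on T (F s)"
proof -
  have "continuous_on T (\<lambda>x. (s, x))" by (intro continuous_intros)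
  from continuous_on_compose2[OF assms(1) this] assms(2) show ?thesis by auto
qed

text \<open>Used with a disc or ball S of complex parameters: a mean whose parameter derivative
  averages to zero is constant on S.\<close>

lemma avg_field_derivative:
  fixes F :: "complex \<Rightarrow> 'x \<Rightarrow> complex"
  assumes d: "\<And>s x. s \<in> S \<Longrightarrow> x \<in> carr \<Longrightarrow> ((\<lambda>s. F s x) has_field_derivative F' s x) (at s within S)"
    and c: "\<And>s. s \<in> S \<Longrightarrow> continuous_on carr (F s)"
    and c': "continuous_on (S \<times> carr) (\<lambda>(s, x). F' s x)"
    and S: "s \<in> S" "convex S"
  shows "((\<lambda>s. avg (F s)) has_field_derivative avg (F' s)) (at s within S)"
  unfolding avg_def
  by (rule leibniz_rule_field_derivative[OF _ _ continuous_integrand2[OF c'] S])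
     (auto intro!: DERIV_cmult d integrable_integrand c simp: carr_def)

lemma avg_vector_derivative:
  fixes F :: "real \<Rightarrow> 'x \<Rightarrow> complex"
  assumes d: "\<And>s x. s \<in> S \<Longrightarrow> x \<in> carr \<Longrightarrow> ((\<lambda>s. F s x) has_vector_derivative F' s x) (at s within S)"
    and c: "\<And>s. s \<in> S \<Longrightarrow> continuous_on carr (F s)"
    and c': "continuous_on (S \<times> carr) (\<lambda>(s, x). F' s x)"
    and S: "s \<in> S" "convex S"
  shows "((\<lambda>s. avg (F s)) has_vector_derivative avg (F' s)) (at s within S)"
  unfolding avg_def
  by (rule leibniz_rule_vector_derivative[OF _ _ continuous_integrand2[OF c'] S])
     (auto intro!: has_vector_derivative_mult_right d integrable_integrand c simp: carr_def)

end

lemma avg_swap: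
  assumes "mean a b f v" "mean c d g w"
    and "continuous_on (mean.carr a b f \<times> mean.carr c d g) (\<lambda>(x, y). F x y)"
  shows "mean.avg a b f v (\<lambda>x. mean.avg c d g w (\<lambda>y. F x y)) =
    mean.avg c d g w (\<lambda>y. mean.avg a b f v (\<lambda>x. F x y))"
proof -
  interpret A: mean a b f v by fact
  interpret B: mean c d g w by fact
  have 1: "continuous_on (cbox a b \<times> cbox c d) (\<lambda>q. v (fst q))"
    by (rule continuous_on_compose2[OF A.continuous_weight continuous_on_fst[OF continuous_on_id]]) auto
  have 2: "continuous_on (cbox a b \<times> cbox c d) (\<lambda>q. w (snd q))"
    by (rule continuous_on_compose2[OF B.continuous_weight continuous_on_snd[OF continuous_on_id]]) auto
  have "continuous_on (cbox a b \<times> cbox c d) (\<lambda>q. f (fst q))"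
    "continuous_on (cbox a b \<times> cbox c d) (\<lambda>q. g (snd q))"
    by (rule continuous_on_compose2[OF A.continuous_chart continuous_on_fst[OF continuous_on_id]], auto)
       (rule continuous_on_compose2[OF B.continuous_chart continuous_on_snd[OF continuous_on_id]], auto)
  then have "continuous_on (cbox a b \<times> cbox c d) (\<lambda>q. (f (fst q), g (snd q)))"
    by (intro continuous_intros)
  from continuous_on_compose2[OF assms(3) this]
  have 3: "continuous_on (cbox a b \<times> cbox c d) (\<lambda>q. F (f (fst q)) (g (snd q)))"
    by (force simp: A.carr_def B.carr_def split_beta)
  have "continuous_on (cbox (a, c) (b, d)) (\<lambda>(x, y). v x * (w y * F (f x) (g y)))"
    using continuous_on_mult[OF 1 continuous_on_mult[OF 2 3]]
    by (simp add: split_beta cbox_Pair_eq)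
  from integral_swap_continuous[OF this] show ?thesis
    unfolding A.avg_def B.avg_def
    by (simp only: Henstock_Kurzweil_Integration.integral_mult_right[symmetric] mult.left_commute[of "w _" "v _"])
qed

section \<open>Rotations of the three-sphere\<close>

text \<open>In the angles of \<open>sph\<close> the area density is sin^2 a sin b, and 2 pi^2 is the
  area of the unit three-sphere, so the mean of the constant 1 is 1.\<close>

abbreviation sph_weight :: "real \<times> real \<times> real \<Rightarrow> complex" where
  "sph_weight \<equiv> \<lambda>(a, b, c). complex_of_real ((sin a)\<^sup>2 * sin b / (2 * pi\<^sup>2))"

lemma continuous_on_sph [continuous_intros]:
  fixes S :: "'s::metric_space set"
  assumes "continuous_on S f" "continuous_on S g" "continuous_on S h"
  shows "continuous_on S (\<lambda>x. sph (f x) (g x) (h x))"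
  unfolding sph_def
proof (rule continuous_on_vec_lambda)
  fix k :: 4
  show "continuous_on S (\<lambda>x. if k = 0 then cos (f x) else if k = 1 then sin (f x) * cos (g x)
      else if k = 2 then sin (f x) * sin (g x) * cos (h x) else sin (f x) * sin (g x) * sin (h x))"
    using assms by (cases "k = 0"; cases "k = 1"; cases "k = 2") (auto intro!: continuous_intros)
qed

global_interpretation sphere: mean "(0, 0, 0)" "(pi, pi, 2 * pi)" "\<lambda>(a, b, c). sph a b c" sph_weight
  defines sphere_avg = "sphere.avg" and sphere_set = "sphere.carr"
proof
  show "continuous_on (cbox (0, 0, 0) (pi, pi, 2 * pi)) (\<lambda>(a, b, c). sph a b c)"
    unfolding split_beta by (intro continuous_intros)
  show "continuous_on (cbox (0, 0, 0) (pi, pi, 2 * pi)) sph_weight"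
    unfolding split_beta by (intro continuous_intros) simp
qed

lemma sphere_carr: "sphere.carr = {x. (x$0)\<^sup>2 + (x$1)\<^sup>2 + (x$2)\<^sup>2 + (x$3)\<^sup>2 = 1}"
proof -
  have "x \<in> sphere.carr" if n: "(x$0)\<^sup>2 + (x$1)\<^sup>2 + (x$2)\<^sup>2 + (x$3)\<^sup>2 = 1" for x
  proof -
    obtain a b c where "a \<in> {0..pi}" "b \<in> {0..pi}" "c \<in> {0..2*pi}" "x = sph a b c"
      by (rule sph_cover[OF n])
    then show ?thesis
      unfolding sphere.carr_def cbox_Pair_eq by (intro image_eqI[of _ _ "(a, b, c)"]) auto
  qed
  then show ?thesis
    using sph_norm by (auto simp: sphere.carr_def)
qed

section \<open>The divergence theorem in the spherical chart\<close>

lemma box_divergence: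
  fixes p q r p' q' r' :: "real \<Rightarrow> real \<Rightarrow> real \<Rightarrow> complex"
  assumes "0 \<le> A" "0 \<le> B" "0 \<le> C"
    and p: "\<And>a b c. ((\<lambda>a. p a b c) has_vector_derivative p' a b c) (at a)"
    and q: "\<And>a b c. ((\<lambda>b. q a b c) has_vector_derivative q' a b c) (at b)"
    and r: "\<And>a b c. ((\<lambda>c. r a b c) has_vector_derivative r' a b c) (at c)"
    and cp: "continuous_on UNIV (\<lambda>(a, b, c). p' a b c)"
    and cq: "continuous_on UNIV (\<lambda>(a, b, c). q' a b c)"
    and cr: "continuous_on UNIV (\<lambda>(a, b, c). r' a b c)"
    and bp: "\<And>b c. p A b c = p 0 b c" and bq: "\<And>a c. q a B c = q a 0 c"
    and br: "\<And>a b. r a b C = r a b 0"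
  shows "integral (cbox (0, 0, 0) (A, B, C)) (\<lambda>(a, b, c). p' a b c + q' a b c + r' a b c) = 0"
proof -
  have ftc: "integral {0..L} h' = h L - h 0"
    if "0 \<le> L" "\<And>x. (h has_vector_derivative h' x) (at x)" for h h' :: "real \<Rightarrow> complex" and L :: real
    using that by (intro integral_unique fundamental_theorem_of_calculus)
      (auto intro: has_vector_derivative_at_within)
  have ctr: "continuous_on UNIV (\<lambda>y::real \<times> real. (a, fst y, snd y))" for a :: real
    by (intro continuous_intros)
  have cq2: "continuous_on UNIV (\<lambda>(b, c). q' a b c)" for a
    using continuous_on_compose2[OF cq ctr subset_UNIV, of a] by (simp add: split_beta)
  have cr2: "continuous_on UNIV (\<lambda>(b, c). r' a b c)" for a
    using continuous_on_compose2[OF cr ctr subset_UNIV, of a] by (simp add: split_beta)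
  have cp3: "continuous_on UNIV (\<lambda>(a, y). (\<lambda>(b, c). p' a b c) y)"
    using cp by (simp add: split_beta)
  have P: "integral (cbox (0, 0, 0) (A, B, C)) (\<lambda>(a, b, c). p' a b c) = 0"
  proof -
    have "integral (cbox (0, 0, 0) (A, B, C)) (\<lambda>(a, b, c). p' a b c)
        = integral (cbox 0 A) (\<lambda>a. integral (cbox (0, 0) (B, C)) (\<lambda>y. (\<lambda>(b, c). p' a b c) y))"
      using integral_prod_continuous[OF continuous_on_subset[OF cp subset_UNIV]] by (simp add: split_def)
    \<comment> \<open>Each partial derivative is integrated in its own variable first, where it
      gives a difference of values on opposite faces.\<close>
    also have "\<dots> = integral (cbox (0, 0) (B, C)) (\<lambda>y. integral (cbox 0 A) (\<lambda>a. (\<lambda>(b, c). p' a b c) y))"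
      by (rule integral_swap_continuous) (rule continuous_on_subset[OF cp3 subset_UNIV])
    also have "\<dots> = 0"
      using ftc[OF assms(1) p] bp by (simp add: split_beta)
    finally show ?thesis .
  qed
  have Q: "integral (cbox (0, 0, 0) (A, B, C)) (\<lambda>(a, b, c). q' a b c) = 0"
  proof -
    have "integral (cbox (0, 0, 0) (A, B, C)) (\<lambda>(a, b, c). q' a b c)
        = integral (cbox 0 A) (\<lambda>a. integral (cbox (0, 0) (B, C)) (\<lambda>(b, c). q' a b c))"
      using integral_prod_continuous[OF continuous_on_subset[OF cq subset_UNIV]] by (simp add: split_def)
    also have "\<dots> = integral (cbox 0 A) (\<lambda>a. integral (cbox 0 B) (\<lambda>b. integral (cbox 0 C) (q' a b)))"
      using integral_prod_continuous[OF continuous_on_subset[OF cq2 subset_UNIV]] by (simp add: split_def)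
    also have "\<dots> = integral (cbox 0 A) (\<lambda>a. integral (cbox 0 C) (\<lambda>c. integral (cbox 0 B) (\<lambda>b. q' a b c)))"
      by (intro Henstock_Kurzweil_Integration.integral_cong integral_swap_continuous
          continuous_on_subset[OF cq2 subset_UNIV])
    also have "\<dots> = 0"
      using ftc[OF assms(2) q] bq by simp
    finally show ?thesis .
  qed
  have R: "integral (cbox (0, 0, 0) (A, B, C)) (\<lambda>(a, b, c). r' a b c) = 0"
  proof -
    have "integral (cbox (0, 0, 0) (A, B, C)) (\<lambda>(a, b, c). r' a b c)
        = integral (cbox 0 A) (\<lambda>a. integral (cbox (0, 0) (B, C)) (\<lambda>(b, c). r' a b c))"
      using integral_prod_continuous[OF continuous_on_subset[OF cr subset_UNIV]] by (simp add: split_def)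
    also have "\<dots> = integral (cbox 0 A) (\<lambda>a. integral (cbox 0 B) (\<lambda>b. integral (cbox 0 C) (r' a b)))"
      using integral_prod_continuous[OF continuous_on_subset[OF cr2 subset_UNIV]] by (simp add: split_def)
    also have "\<dots> = 0"
      using ftc[OF assms(3) r] br by simp
    finally show ?thesis .
  qed
  have i: "f integrable_on cbox (0, 0, 0) (A, B, C)" if "continuous_on UNIV f"
    for f :: "real \<times> real \<times> real \<Rightarrow> complex"
    by (rule integrable_continuous) (rule continuous_on_subset[OF that], simp)
  show ?thesis
    using P Q R i[OF cp] i[OF cq] i[OF cr]
    by (simp add: split_def Henstock_Kurzweil_Integration.integral_add integrable_add)
qed

text \<open>Left multiplication by the three imaginary quaternion units.\<close>

definition rot :: "nat \<Rightarrow> 'a::comm_ring_1^4 \<Rightarrow> 'a^4" where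
  "rot j x = (if j = 1 then (\<chi> k. if k = 0 then - x$1 else if k = 1 then x$0 else if k = 2 then - x$3 else x$2)
    else if j = 2 then (\<chi> k. if k = 0 then - x$2 else if k = 1 then x$3 else if k = 2 then x$0 else - x$1)
    else (\<chi> k. if k = 0 then - x$3 else if k = 1 then - x$2 else if k = 2 then x$1 else x$0))"

lemma rot_nth:
  "rot 1 x $ 0 = - x$1" "rot 1 x $ 1 = x$0" "rot 1 x $ 2 = - x$3" "rot 1 x $ 3 = x$2"
  "rot 2 x $ 0 = - x$2" "rot 2 x $ 1 = x$3" "rot 2 x $ 2 = x$0" "rot 2 x $ 3 = - x$1"
  "rot 3 x $ 0 = - x$3" "rot 3 x $ 1 = - x$2" "rot 3 x $ 2 = x$1" "rot 3 x $ 3 = x$0"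
  by (simp_all add: rot_def)

text \<open>
  In the chart, the rotation field times the density of the sphere is a divergence-free
  field that is tangential to the boundary, or periodic.
\<close>

lemma sphere_field_integral:
  fixes H :: "real^4 \<Rightarrow> complex" and g :: "real^4 \<Rightarrow> complex^4"
    and A B C A' B' C' :: "real \<Rightarrow> real \<Rightarrow> real \<Rightarrow> real"
  assumes H: "\<And>x. x \<in> sphere.carr \<Longrightarrow>
      (H has_derivative (\<lambda>v. \<Sum>k\<in>UNIV. g x $ k * complex_of_real (v $ k))) (at x)"
    and g: "continuous_on sphere.carr g"
    and dA: "\<And>a b c. ((\<lambda>a. A a b c) has_real_derivative A' a b c) (at a)"
    and dB: "\<And>a b c. ((\<lambda>b. B a b c) has_real_derivative B' a b c) (at b)"
    and dC: "\<And>a b c. ((\<lambda>c. C a b c) has_real_derivative C' a b c) (at c)"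
    and cont: "continuous_on UNIV (\<lambda>(a, b, c). A a b c)" "continuous_on UNIV (\<lambda>(a, b, c). B a b c)"
      "continuous_on UNIV (\<lambda>(a, b, c). C a b c)" "continuous_on UNIV (\<lambda>(a, b, c). A' a b c)"
      "continuous_on UNIV (\<lambda>(a, b, c). B' a b c)" "continuous_on UNIV (\<lambda>(a, b, c). C' a b c)"
    and div: "\<And>a b c. A' a b c + B' a b c + C' a b c = 0"
    and bdry: "\<And>b c. A 0 b c = 0" "\<And>b c. A pi b c = 0" "\<And>a c. B a 0 c = 0" "\<And>a c. B a pi c = 0"
      "\<And>a b. C a b (2 * pi) = C a b 0"
    and field: "\<And>a b c. A a b c *\<^sub>R sph_d 0 a b c + B a b c *\<^sub>R sph_d 1 a b c + C a b c *\<^sub>R sph_d 2 a b c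
        = ((sin a)\<^sup>2 * sin b) *\<^sub>R v (sph a b c)"
  shows "sphere.avg (\<lambda>x. \<Sum>k\<in>UNIV. g x $ k * complex_of_real (v x $ k)) = 0"
proof -
  define h where "h a b c = H (sph a b c)" for a b c
  define D where "D y a b c = (\<Sum>k\<in>UNIV. g (sph a b c) $ k * complex_of_real (y $ k))" for y :: "real^4" and a b c
  have carr: "sph a b c \<in> sphere.carr" for a b c
    using sph_norm by (simp add: sphere_carr)
  have chain: "((\<lambda>s. H (\<gamma> s)) has_vector_derivative (\<Sum>k\<in>UNIV. g (\<gamma> s) $ k * complex_of_real (y $ k))) (at s)"
    if "(\<gamma> has_vector_derivative y) (at s)" "\<gamma> s \<in> sphere.carr" for \<gamma> y s
  proof -
    have "((\<lambda>s. H (\<gamma> s)) has_derivative (\<lambda>t. \<Sum>k\<in>UNIV. g (\<gamma> s) $ k * complex_of_real ((t *\<^sub>R y) $ k))) (at s)"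
      using has_derivative_compose[OF that(1)[unfolded has_vector_derivative_def] H[OF that(2)]] .
    then show ?thesis
      unfolding has_vector_derivative_def
      by (simp add: scaleR_conv_of_real[where 'a=complex] sum_distrib_left mult.left_commute)
  qed
  note dh = chain[OF sph_has_vector_derivative(1) carr] chain[OF sph_has_vector_derivative(2) carr]
    chain[OF sph_has_vector_derivative(3) carr]
  have cg: "continuous_on UNIV (\<lambda>q. g (sph (fst q) (fst (snd q)) (snd (snd q))))"
    by (rule continuous_on_compose2[OF g]) (auto intro!: continuous_intros carr)
  have ch: "continuous_on UNIV (\<lambda>q. H (sph (fst q) (fst (snd q)) (snd (snd q))))"
  proof (rule continuous_on_compose2[of sphere.carr H])
    show "continuous_on sphere.carr H"
      by (rule has_derivative_continuous_on) (rule has_derivative_at_withinI[OF H])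
  qed (auto intro!: continuous_intros carr)
  have csd: "continuous_on UNIV (\<lambda>q. sph_d i (fst q) (fst (snd q)) (snd (snd q)) $ k)" for i k
    unfolding sph_d_def
    by (cases "i = 0"; cases "i = 1"; cases "k = 0"; cases "k = 1"; cases "k = 2")
       (auto intro!: continuous_intros)
  have cD: "continuous_on UNIV (\<lambda>q. D (sph_d i (fst q) (fst (snd q)) (snd (snd q))) (fst q) (fst (snd q)) (snd (snd q)))" for i
    unfolding D_def by (intro continuous_intros cg csd)
  note cc = cont[unfolded split_beta]
  have "integral (cbox (0, 0, 0) (pi, pi, 2 * pi)) (\<lambda>(a, b, c).
      (complex_of_real (A' a b c) * h a b c + complex_of_real (A a b c) * D (sph_d 0 a b c) a b c)
    + (complex_of_real (B' a b c) * h a b c + complex_of_real (B a b c) * D (sph_d 1 a b c) a b c)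
    + (complex_of_real (C' a b c) * h a b c + complex_of_real (C a b c) * D (sph_d 2 a b c) a b c)) = 0"
  proof (rule box_divergence)
    fix a b c
    show "((\<lambda>a. complex_of_real (A a b c) * h a b c) has_vector_derivative
        complex_of_real (A' a b c) * h a b c + complex_of_real (A a b c) * D (sph_d 0 a b c) a b c) (at a)"
      unfolding h_def D_def
      using has_vector_derivative_mult[OF has_vector_derivative_of_real[OF dA] dh(1)]
      by (simp add: add.commute)
    show "((\<lambda>b. complex_of_real (B a b c) * h a b c) has_vector_derivative
        complex_of_real (B' a b c) * h a b c + complex_of_real (B a b c) * D (sph_d 1 a b c) a b c) (at b)"
      unfolding h_def D_def
      using has_vector_derivative_mult[OF has_vector_derivative_of_real[OF dB] dh(2)]
      by (simp add: add.commute)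
    show "((\<lambda>c. complex_of_real (C a b c) * h a b c) has_vector_derivative
        complex_of_real (C' a b c) * h a b c + complex_of_real (C a b c) * D (sph_d 2 a b c) a b c) (at c)"
      unfolding h_def D_def
      using has_vector_derivative_mult[OF has_vector_derivative_of_real[OF dC] dh(3)]
      by (simp add: add.commute)
    show "complex_of_real (C a b (2 * pi)) * h a b (2 * pi) = complex_of_real (C a b 0) * h a b 0"
    proof -
      have "sph a b (2 * pi) = sph a b 0"
        unfolding vec4_eq_iff sph_nth by simp
      then show ?thesis using bdry(5) by (simp add: h_def)
    qed
  qed (use bdry in \<open>auto simp: split_beta h_def intro!: continuous_intros ch cD cc\<close>)
  \<comment> \<open>By \<open>div\<close> the undifferentiated terms cancel, and by
    \<open>field\<close> the three directional derivatives add up to the one along v, weighted by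
    the density.\<close>
  moreover have "(complex_of_real (A' a b c) * h a b c + complex_of_real (A a b c) * D (sph_d 0 a b c) a b c)
    + (complex_of_real (B' a b c) * h a b c + complex_of_real (B a b c) * D (sph_d 1 a b c) a b c)
    + (complex_of_real (C' a b c) * h a b c + complex_of_real (C a b c) * D (sph_d 2 a b c) a b c)
    = complex_of_real ((sin a)\<^sup>2 * sin b) * D (v (sph a b c)) a b c" (is "?l = ?r") for a b c
  proof -
    have lin: "complex_of_real s * D y a b c = D (s *\<^sub>R y) a b c"
      "D y a b c + D y' a b c = D (y + y') a b c" for s y y'
      by (simp_all add: D_def sum_distrib_left algebra_simps sum.distrib)
    have "?l = complex_of_real (A' a b c + B' a b c + C' a b c) * h a b c
        + (complex_of_real (A a b c) * D (sph_d 0 a b c) a b c + complex_of_real (B a b c) * D (sph_d 1 a b c) a b c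
        + complex_of_real (C a b c) * D (sph_d 2 a b c) a b c)"
      by (simp add: algebra_simps)
    also have "\<dots> = ?r"
      unfolding lin div field by simp
    finally show ?thesis .
  qed
  ultimately have z: "integral (cbox (0, 0, 0) (pi, pi, 2 * pi))
      (\<lambda>(a, b, c). complex_of_real ((sin a)\<^sup>2 * sin b) * D (v (sph a b c)) a b c) = 0"
    by simp
  have "sphere.avg (\<lambda>x. \<Sum>k\<in>UNIV. g x $ k * complex_of_real (v x $ k))
    = integral (cbox (0, 0, 0) (pi, pi, 2 * pi)) (\<lambda>q. complex_of_real (1 / (2 * pi\<^sup>2)) *
        (\<lambda>(a, b, c). complex_of_real ((sin a)\<^sup>2 * sin b) * D (v (sph a b c)) a b c) q)"
    unfolding sphere.avg_def D_def
    by (intro Henstock_Kurzweil_Integration.integral_cong) (auto simp: split_beta)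
  then show ?thesis
    by (simp only: Henstock_Kurzweil_Integration.integral_mult_right z mult_zero_right)
qed

lemma sph_d_nth:
  "sph_d 0 a b c $ 0 = - sin a" "sph_d 0 a b c $ 1 = cos a * cos b"
  "sph_d 0 a b c $ 2 = cos a * sin b * cos c" "sph_d 0 a b c $ 3 = cos a * sin b * sin c"
  "sph_d 1 a b c $ 0 = 0" "sph_d 1 a b c $ 1 = - sin a * sin b"
  "sph_d 1 a b c $ 2 = sin a * cos b * cos c" "sph_d 1 a b c $ 3 = sin a * cos b * sin c"
  "sph_d 2 a b c $ 0 = 0" "sph_d 2 a b c $ 1 = 0"
  "sph_d 2 a b c $ 2 = - sin a * sin b * sin c" "sph_d 2 a b c $ 3 = sin a * sin b * cos c"
  by (simp_all add: sph_d_def)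

text \<open>The flow of \<open>rot j\<close> consists of rotations, which preserve the mean. The
  functions \<open>?A\<close>, \<open>?B\<close>, \<open>?C\<close> are the components of the field
  in the frame \<open>sph_d 0\<close>, \<open>sph_d 1\<close>, \<open>sph_d 2\<close>, multiplied by
  the density sin^2 a sin b; this factor clears the poles of the spherical coordinates.\<close>

lemma sphere_rot_integral:
  fixes H :: "real^4 \<Rightarrow> complex" and g :: "real^4 \<Rightarrow> complex^4"
  assumes H: "\<And>x. x \<in> sphere.carr \<Longrightarrow>
      (H has_derivative (\<lambda>v. \<Sum>k\<in>UNIV. g x $ k * complex_of_real (v $ k))) (at x)"
    and g: "continuous_on sphere.carr g" and j: "j \<in> {1, 2, 3}"
  shows "sphere.avg (\<lambda>x. \<Sum>k\<in>UNIV. g x $ k * complex_of_real (rot j x $ k)) = 0"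
proof -
  consider "j = 1" | "j = 2" | "j = 3" using j by auto
  then show ?thesis
  proof cases
    case 1
    let ?A = "\<lambda>a b c :: real. (sin a)\<^sup>2 * sin b * cos b"
    let ?A' = "\<lambda>a b c :: real. 2 * sin a * cos a * sin b * cos b"
    let ?B = "\<lambda>a b c :: real. - (sin a * cos a * (sin b)\<^sup>2)"
    let ?B' = "\<lambda>a b c :: real. - (2 * sin a * cos a * sin b * cos b)"
    let ?C = "\<lambda>a b c :: real. (sin a)\<^sup>2 * sin b"
    let ?C' = "\<lambda>a b c :: real. 0"
    show ?thesis unfolding 1
    proof (rule sphere_field_integral[OF H g, where A = ?A and A' = ?A' and B = ?B and B' = ?B' and C = ?C and C' = ?C'])
      fix a b c :: real
      define sa ca sb cb sc cc where trig: "sa = sin a" "ca = cos a" "sb = sin b" "cb = cos b" "sc = sin c" "cc = cos c"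
      have u: "sa\<^sup>2 + ca\<^sup>2 = 1" "sb\<^sup>2 + cb\<^sup>2 = 1" "sc\<^sup>2 + cc\<^sup>2 = 1" by (simp_all add: trig)
      show "((\<lambda>a. ?A a b c) has_real_derivative ?A' a b c) (at a)"
        "((\<lambda>b. ?B a b c) has_real_derivative ?B' a b c) (at b)"
        "((\<lambda>c. ?C a b c) has_real_derivative ?C' a b c) (at c)"
        by (auto intro!: derivative_eq_intros simp: power2_eq_square algebra_simps)
      show "?A' a b c + ?B' a b c + ?C' a b c = 0"
        unfolding trig[symmetric] by (simp add: power2_eq_square algebra_simps; fail | use u in algebra)
      show "?A a b c *\<^sub>R sph_d 0 a b c + ?B a b c *\<^sub>R sph_d 1 a b c + ?C a b c *\<^sub>R sph_d 2 a b c
          = ((sin a)\<^sup>2 * sin b) *\<^sub>R rot 1 (sph a b c)"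
        unfolding vec4_eq_iff vector_add_component vector_scaleR_component real_scaleR_def
          rot_nth sph_nth sph_d_nth trig[symmetric]
        by (intro conjI; (simp add: power2_eq_square algebra_simps; fail | use u in algebra))
    qed (auto intro!: continuous_intros simp: split_def)
  next
    case 2
    let ?A = "\<lambda>a b c :: real. (sin a)\<^sup>2 * (sin b)\<^sup>2 * cos c"
    let ?A' = "\<lambda>a b c :: real. 2 * sin a * cos a * (sin b)\<^sup>2 * cos c"
    let ?B = "\<lambda>a b c :: real. sin a * cos a * sin b * cos b * cos c - (sin a)\<^sup>2 * sin b * sin c"
    let ?B' = "\<lambda>a b c :: real. sin a * cos a * (cos b * cos b - sin b * sin b) * cos c - (sin a)\<^sup>2 * cos b * sin c"
    let ?C = "\<lambda>a b c :: real. - (sin a * cos a * sin c) - (sin a)\<^sup>2 * cos b * cos c"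
    let ?C' = "\<lambda>a b c :: real. - (sin a * cos a * cos c) + (sin a)\<^sup>2 * cos b * sin c"
    show ?thesis unfolding 2
    proof (rule sphere_field_integral[OF H g, where A = ?A and A' = ?A' and B = ?B and B' = ?B' and C = ?C and C' = ?C'])
      fix a b c :: real
      define sa ca sb cb sc cc where trig: "sa = sin a" "ca = cos a" "sb = sin b" "cb = cos b" "sc = sin c" "cc = cos c"
      have u: "sa\<^sup>2 + ca\<^sup>2 = 1" "sb\<^sup>2 + cb\<^sup>2 = 1" "sc\<^sup>2 + cc\<^sup>2 = 1" by (simp_all add: trig)
      show "((\<lambda>a. ?A a b c) has_real_derivative ?A' a b c) (at a)"
        "((\<lambda>b. ?B a b c) has_real_derivative ?B' a b c) (at b)"
        "((\<lambda>c. ?C a b c) has_real_derivative ?C' a b c) (at c)"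
        by (auto intro!: derivative_eq_intros simp: power2_eq_square algebra_simps)
      show "?A' a b c + ?B' a b c + ?C' a b c = 0"
        unfolding trig[symmetric] by (simp add: power2_eq_square algebra_simps; fail | use u in algebra)
      show "?A a b c *\<^sub>R sph_d 0 a b c + ?B a b c *\<^sub>R sph_d 1 a b c + ?C a b c *\<^sub>R sph_d 2 a b c
          = ((sin a)\<^sup>2 * sin b) *\<^sub>R rot 2 (sph a b c)"
        unfolding vec4_eq_iff vector_add_component vector_scaleR_component real_scaleR_def
          rot_nth sph_nth sph_d_nth trig[symmetric]
        by (intro conjI; (simp add: power2_eq_square algebra_simps; fail | use u in algebra))
    qed (auto intro!: continuous_intros simp: split_def)
  next
    case 3
    let ?A = "\<lambda>a b c :: real. (sin a)\<^sup>2 * (sin b)\<^sup>2 * sin c"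
    let ?A' = "\<lambda>a b c :: real. 2 * sin a * cos a * (sin b)\<^sup>2 * sin c"
    let ?B = "\<lambda>a b c :: real. sin a * cos a * sin b * cos b * sin c + (sin a)\<^sup>2 * sin b * cos c"
    let ?B' = "\<lambda>a b c :: real. sin a * cos a * (cos b * cos b - sin b * sin b) * sin c + (sin a)\<^sup>2 * cos b * cos c"
    let ?C = "\<lambda>a b c :: real. sin a * cos a * cos c - (sin a)\<^sup>2 * cos b * sin c"
    let ?C' = "\<lambda>a b c :: real. - (sin a * cos a * sin c) - (sin a)\<^sup>2 * cos b * cos c"
    show ?thesis unfolding 3
    proof (rule sphere_field_integral[OF H g, where A = ?A and A' = ?A' and B = ?B and B' = ?B' and C = ?C and C' = ?C'])
      fix a b c :: real
      define sa ca sb cb sc cc where trig: "sa = sin a" "ca = cos a" "sb = sin b" "cb = cos b" "sc = sin c" "cc = cos c"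
      have u: "sa\<^sup>2 + ca\<^sup>2 = 1" "sb\<^sup>2 + cb\<^sup>2 = 1" "sc\<^sup>2 + cc\<^sup>2 = 1" by (simp_all add: trig)
      show "((\<lambda>a. ?A a b c) has_real_derivative ?A' a b c) (at a)"
        "((\<lambda>b. ?B a b c) has_real_derivative ?B' a b c) (at b)"
        "((\<lambda>c. ?C a b c) has_real_derivative ?C' a b c) (at c)"
        by (auto intro!: derivative_eq_intros simp: power2_eq_square algebra_simps)
      show "?A' a b c + ?B' a b c + ?C' a b c = 0"
        unfolding trig[symmetric] by (simp add: power2_eq_square algebra_simps; fail | use u in algebra)
      show "?A a b c *\<^sub>R sph_d 0 a b c + ?B a b c *\<^sub>R sph_d 1 a b c + ?C a b c *\<^sub>R sph_d 2 a b c
          = ((sin a)\<^sup>2 * sin b) *\<^sub>R rot 3 (sph a b c)"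
        unfolding vec4_eq_iff vector_add_component vector_scaleR_component real_scaleR_def
          rot_nth sph_nth sph_d_nth trig[symmetric]
        by (intro conjI; (simp add: power2_eq_square algebra_simps; fail | use u in algebra))
    qed (auto intro!: continuous_intros simp: split_def)
  qed
qed

text \<open>Left multiplication by cos s + i sin s joins the identity to x -> -x within the
  rotations, and the mean is constant along this path. The antipode matters because the chart of the
  unitary group lets the phase run over a half circle only.\<close>

lemma sphere_antipode:
  fixes H :: "real^4 \<Rightarrow> complex" and g :: "real^4 \<Rightarrow> complex^4"
  assumes H: "\<And>x. x \<in> sphere.carr \<Longrightarrow>
      (H has_derivative (\<lambda>v. \<Sum>k\<in>UNIV. g x $ k * complex_of_real (v $ k))) (at x)"
    and g: "continuous_on sphere.carr g"
  shows "sphere.avg (\<lambda>x. H (- x)) = sphere.avg H"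
proof -
  define \<rho> :: "real \<Rightarrow> real^4 \<Rightarrow> real^4" where "\<rho> s x = cos s *\<^sub>R x + sin s *\<^sub>R rot 1 x" for s x
  have rho_nth: "\<rho> s x $ k = cos s * x $ k + sin s * rot 1 x $ k" for s x k
    by (simp add: \<rho>_def)
  have rho_carr: "\<rho> s x \<in> sphere.carr" if "x \<in> sphere.carr" for s x
  proof -
    have "(\<rho> s x$0)\<^sup>2 + (\<rho> s x$1)\<^sup>2 + (\<rho> s x$2)\<^sup>2 + (\<rho> s x$3)\<^sup>2
        = ((cos s)\<^sup>2 + (sin s)\<^sup>2) * ((x$0)\<^sup>2 + (x$1)\<^sup>2 + (x$2)\<^sup>2 + (x$3)\<^sup>2)"
      unfolding rho_nth rot_nth by algebra
    then show ?thesis using that by (simp add: sphere_carr)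
  qed
  have blr: "bounded_linear (rot 1 :: real^4 \<Rightarrow> real^4)"
    unfolding linear_conv_bounded_linear[symmetric]
    by (rule linearI) (simp_all add: vec4_eq_iff rot_nth del: One_nat_def)
  have blrho: "bounded_linear (\<rho> s)" for s
    unfolding \<rho>_def by (intro bounded_linear_add bounded_linear_scaleR_right bounded_linear_ident
        bounded_linear_const_scaleR blr)
  have crho: "continuous_on (UNIV \<times> sphere.carr) (\<lambda>(s, x). \<rho> s x)"
    unfolding \<rho>_def split_def
    by (intro continuous_intros bounded_linear.continuous_on[OF blr])
  have cH: "continuous_on sphere.carr H"
    by (rule has_derivative_continuous_on) (rule has_derivative_at_withinI[OF H])
  define D where "D s x = (\<Sum>k\<in>UNIV. g (\<rho> s x) $ k * complex_of_real (rot 1 (\<rho> s x) $ k))" for s x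
  have rr: "rot 1 (rot 1 x) = - x" for x :: "real^4"
    by (simp add: vec4_eq_iff rot_nth del: One_nat_def)
  have drho: "((\<lambda>s. \<rho> s x) has_vector_derivative rot 1 (\<rho> s x)) (at s)" for s x
  proof -
    have "((\<lambda>s. \<rho> s x) has_vector_derivative - sin s *\<^sub>R x + cos s *\<^sub>R rot 1 x) (at s)"
      unfolding \<rho>_def by (auto intro!: derivative_eq_intros)
    also have "- sin s *\<^sub>R x + cos s *\<^sub>R rot 1 x = rot 1 (\<rho> s x)"
      by (simp add: vec4_eq_iff rho_nth rot_nth del: One_nat_def)
    finally show ?thesis .
  qed
  have chain: "((\<lambda>s. H (\<rho> s x)) has_vector_derivative D s x) (at s)" if "x \<in> sphere.carr" for s x
  proof -
    have "((\<lambda>s. H (\<rho> s x)) has_derivative (\<lambda>t. \<Sum>k\<in>UNIV. g (\<rho> s x) $ k * complex_of_real ((t *\<^sub>R rot 1 (\<rho> s x)) $ k))) (at s)"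
      using has_derivative_compose[OF drho[unfolded has_vector_derivative_def] H[OF rho_carr[OF that]]] .
    then show ?thesis
      unfolding has_vector_derivative_def D_def
      by (simp add: scaleR_conv_of_real[where 'a=complex] sum_distrib_left mult.left_commute)
  qed
  have cg: "continuous_on (UNIV \<times> sphere.carr) (\<lambda>(s, x). g (\<rho> s x))"
    using rho_carr unfolding split_def
    by (auto intro!: continuous_on_compose2[OF g crho[unfolded split_def]])
  have cD: "continuous_on (UNIV \<times> sphere.carr) (\<lambda>(s, x). D s x)"
  proof -
    have "continuous_on (UNIV \<times> sphere.carr) (\<lambda>q. g (\<rho> (fst q) (snd q)))"
      "continuous_on (UNIV \<times> sphere.carr) (\<lambda>q. rot 1 (\<rho> (fst q) (snd q)))"
      using cg bounded_linear.continuous_on[OF blr crho] by (simp_all add: split_def)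
    then show ?thesis
      unfolding D_def split_def by (intro continuous_intros)
  qed
  have z: "sphere.avg (D s) = 0" for s
  proof -
    \<comment> \<open>Gradient of H after the linear map \<rho> s. As \<rho> s commutes with
      \<open>rot 1\<close>, \<open>sphere_rot_integral\<close> applies at every s.\<close>
    define g' where "g' x = (\<chi> k. \<Sum>l\<in>UNIV. g (\<rho> s x) $ l * complex_of_real (\<rho> s (axis k 1) $ l))" for x
    have ex: "(\<Sum>l\<in>UNIV. g (\<rho> s x) $ l * complex_of_real (\<rho> s v $ l)) = (\<Sum>k\<in>UNIV. g' x $ k * complex_of_real (v $ k))" for x v
      by (simp add: g'_def sum_4' rho_nth rot_nth axis_def algebra_simps del: One_nat_def)
    have cg': "continuous_on sphere.carr g'"
    proof -
      have "continuous_on sphere.carr (\<lambda>x. g (\<rho> s x))"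
        using sphere.slice_continuous[OF cg] by simp
      then show ?thesis unfolding g'_def by (intro continuous_on_vec_lambda continuous_intros)
    qed
    have "sphere.avg (\<lambda>x. \<Sum>k\<in>UNIV. g' x $ k * complex_of_real (rot 1 x $ k)) = 0"
    proof (rule sphere_rot_integral[OF _ cg'])
      fix x assume x: "x \<in> sphere.carr"
      show "((\<lambda>x. H (\<rho> s x)) has_derivative (\<lambda>v. \<Sum>k\<in>UNIV. g' x $ k * complex_of_real (v $ k))) (at x)"
        using has_derivative_compose[OF bounded_linear_imp_has_derivative[OF blrho] H[OF rho_carr[OF x, of s]]]
        by (simp add: ex)
    qed simp
    moreover have "\<rho> s (rot 1 x) = rot 1 (\<rho> s x)" for x
      by (simp add: vec4_eq_iff rho_nth rot_nth del: One_nat_def)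
    ultimately show ?thesis
      unfolding D_def by (simp flip: ex del: One_nat_def)
  qed
  have "((\<lambda>s. sphere.avg (\<lambda>x. H (\<rho> s x))) has_vector_derivative sphere.avg (D s)) (at s within UNIV)" for s
  proof (rule sphere.avg_vector_derivative[OF _ _ cD])
    fix s
    have "continuous_on sphere.carr (\<rho> s)"
      using sphere.slice_continuous[OF crho] by simp
    then show "continuous_on sphere.carr (\<lambda>x. H (\<rho> s x))"
      using continuous_on_compose2[OF cH] rho_carr by auto
  qed (auto intro: chain)
  then have "((\<lambda>s. sphere.avg (\<lambda>x. H (\<rho> s x))) has_vector_derivative 0) (at s within UNIV)" for s
    using z by simp
  from has_vector_derivative_zero_constant[OF convex_UNIV this]
  have "sphere.avg (\<lambda>x. H (\<rho> pi x)) = sphere.avg (\<lambda>x. H (\<rho> 0 x))" by fastforce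
  then show ?thesis by (simp add: \<rho>_def)
qed

section \<open>Holomorphic functions near the unitary group\<close>

text \<open>\<open>*\<^sub>R\<close> scales by reals only, and \<open>*s\<close> on
  \<open>hc\<close> expects a row as its scalar; hence a separate complex scaling.\<close>

definition csc :: "complex \<Rightarrow> hc \<Rightarrow> hc" where
  "csc c Z = (\<chi> i j. c * Z $ i $ j)"

lemma csc_nth [simp]: "csc c Z $ i $ j = c * Z $ i $ j"
  by (simp add: csc_def)

text \<open>Complex bilinear, without conjugation: the trace of the transpose of A times X. It
  identifies holomorphic differentials with matrices.\<close>

definition pair :: "hc \<Rightarrow> hc \<Rightarrow> complex" where
  "pair A X = A$1$1 * X$1$1 + A$1$2 * X$1$2 + A$2$1 * X$2$1 + A$2$2 * X$2$2"

lemma hc_eq_iff: "(A::hc) = B \<longleftrightarrow> A$1$1 = B$1$1 \<and> A$1$2 = B$1$2 \<and> A$2$1 = B$2$1 \<and> A$2$2 = B$2$2"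
  by (auto simp: vec_eq_iff forall_2)

lemma pair_simps [simp]:
  "pair (csc c A) X = c * pair A X" "pair A (csc c X) = c * pair A X"
  "pair (A + B) X = pair A X + pair B X" "pair A (X + Y) = pair A X + pair A Y"
  "pair (A - B) X = pair A X - pair B X" "pair A (X - Y) = pair A X - pair A Y"
  "pair (- A) X = - pair A X" "pair A (- X) = - pair A X"
  "pair 0 X = 0" "pair A 0 = 0"
  by (simp_all add: pair_def algebra_simps)

lemma continuous_on_hc:
  fixes f :: "'a::topological_space \<Rightarrow> hc"
  assumes "\<And>i j. continuous_on S (\<lambda>x. f x $ i $ j)"
  shows "continuous_on S f"
proof -
  have "continuous_on S (\<lambda>x. \<chi> i j. f x $ i $ j)"
    by (intro continuous_on_vec_lambda assms)
  then show ?thesis by simp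
qed

lemma continuous_on_csc [continuous_intros]:
  "continuous_on S f \<Longrightarrow> continuous_on S g \<Longrightarrow> continuous_on S (\<lambda>x. csc (f x) (g x))"
  by (rule continuous_on_hc) (auto intro!: continuous_intros)

lemma continuous_on_pair [continuous_intros]:
  "continuous_on S f \<Longrightarrow> continuous_on S g \<Longrightarrow> continuous_on S (\<lambda>x. pair (f x) (g x))"
  unfolding pair_def by (intro continuous_intros)

lemma continuous_on_hc_mult [continuous_intros]:
  fixes f g :: "'a::topological_space \<Rightarrow> hc"
  shows "continuous_on S f \<Longrightarrow> continuous_on S g \<Longrightarrow> continuous_on S (\<lambda>x. f x ** g x)"
  by (rule continuous_on_hc) (auto simp: matrix_matrix_mult_def sum_2 intro!: continuous_intros)

lemma continuous_on_N [continuous_intros]: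
  "continuous_on S f \<Longrightarrow> continuous_on S (\<lambda>x. N (f x))"
  unfolding det_2 by (intro continuous_intros)

lemma bounded_linear_quat: "bounded_linear quat"
  unfolding linear_conv_bounded_linear[symmetric]
  by (rule linearI) (simp_all add: quat_def hc_eq_iff algebra_simps scaleR_conv_of_real[where 'a=complex])

lemma bounded_linear_cvec: "bounded_linear cvec"
  unfolding linear_conv_bounded_linear[symmetric]
  by (rule linearI) (simp_all add: cvec_def vec_eq_iff scaleR_conv_of_real[where 'a=complex])

lemma quat_smult: "quat (c *s z) = csc c (quat z)"
  by (simp add: quat_scale csc_def)

lemma bounded_linear_pair: "bounded_linear (pair A)"
  unfolding linear_conv_bounded_linear[symmetric]
  by (rule linearI) (simp_all add: pair_def algebra_simps scaleR_conv_of_real[where 'a=complex])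

text \<open>F is complex differentiable at every point of S with gradient G. The derivative is taken
  in all directions of the ambient space, although S is mostly \<open>U2 R\<close>, a real
  submanifold of half the dimension; this is what lets invariance be used with complex
  directions.\<close>

definition hol :: "hc set \<Rightarrow> (hc \<Rightarrow> complex) \<Rightarrow> (hc \<Rightarrow> hc) \<Rightarrow> bool" where
  "hol S F G \<longleftrightarrow> (\<forall>Z\<in>S. (F has_derivative pair (G Z)) (at Z)) \<and> continuous_on S G"

lemma holD:
  assumes "hol S F G"
  shows "Z \<in> S \<Longrightarrow> (F has_derivative pair (G Z)) (at Z)" "continuous_on S G" "continuous_on S F"
proof -
  show d: "(F has_derivative pair (G Z)) (at Z)" if "Z \<in> S" for Z using assms that by (auto simp: hol_def)
  show "continuous_on S G" using assms by (auto simp: hol_def)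
  show "continuous_on S F"
    by (rule has_derivative_continuous_on) (rule has_derivative_at_withinI[OF d])
qed

lemma hol_const [intro]: "hol S (\<lambda>Z. c) (\<lambda>Z. 0)"
  by (auto simp: hol_def pair_def[abs_def])

lemma hol_add [intro]:
  "hol S F F' \<Longrightarrow> hol S G G' \<Longrightarrow> hol S (\<lambda>Z. F Z + G Z) (\<lambda>Z. F' Z + G' Z)"
  by (auto simp: hol_def intro!: derivative_eq_intros continuous_intros)

lemma hol_diff [intro]:
  "hol S F F' \<Longrightarrow> hol S G G' \<Longrightarrow> hol S (\<lambda>Z. F Z - G Z) (\<lambda>Z. F' Z - G' Z)"
  by (auto simp: hol_def intro!: derivative_eq_intros continuous_intros)

lemma hol_mult [intro]:
  assumes "hol S F F'" "hol S G G'"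
  shows "hol S (\<lambda>Z. F Z * G Z) (\<lambda>Z. csc (F Z) (G' Z) + csc (G Z) (F' Z))"
  using assms holD(3)[OF assms(1)] holD(3)[OF assms(2)]
  by (auto simp: hol_def algebra_simps intro!: derivative_eq_intros continuous_intros)

lemma hol_inverse [intro]:
  assumes "hol S F F'" "\<And>Z. Z \<in> S \<Longrightarrow> F Z \<noteq> 0"
  shows "hol S (\<lambda>Z. inverse (F Z)) (\<lambda>Z. csc (- inverse ((F Z)\<^sup>2)) (F' Z))"
  using assms holD(3)[OF assms(1)]
  by (auto simp: hol_def power2_eq_square intro!: derivative_eq_intros continuous_intros)

lemma hol_power [intro]:
  assumes "hol S F F'"
  shows "hol S (\<lambda>Z. F Z ^ n) (\<lambda>Z. csc (of_nat n * F Z ^ (n - 1)) (F' Z))"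
  using assms holD(3)[OF assms(1)]
  by (auto simp: hol_def algebra_simps intro!: derivative_eq_intros continuous_intros)

lemma hol_cong:
  "hol S F G \<Longrightarrow> (\<And>Z. F Z = F' Z) \<Longrightarrow> (\<And>Z. Z \<in> S \<Longrightarrow> G Z = G' Z) \<Longrightarrow> hol S F' G'"
  unfolding hol_def using continuous_on_cong[of S S G G'] by (metis ext)

lemma hol_subset: "hol S F G \<Longrightarrow> T \<subseteq> S \<Longrightarrow> hol T F G"
  by (auto simp: hol_def intro: continuous_on_subset)

lemma hol_pair [intro]: "hol S (\<lambda>Z. pair A (Z - B)) (\<lambda>Z. A)"
proof -
  have "((\<lambda>Z. pair A Z - pair A B) has_derivative (\<lambda>X. pair A X - 0)) (at Z)" for Z
    by (intro has_derivative_diff bounded_linear_imp_has_derivative bounded_linear_pair has_derivative_const)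
  then show ?thesis by (auto simp: hol_def)
qed

section \<open>The invariant mean on the unitary group\<close>

lemma continuous_on_svec [continuous_intros]:
  fixes g :: "'a::topological_space \<Rightarrow> complex^4"
  shows "continuous_on S f \<Longrightarrow> continuous_on S g \<Longrightarrow> continuous_on S (\<lambda>x. f x *s g x)"
  unfolding vector_scalar_mult_def by (intro continuous_on_vec_lambda continuous_intros)

lemmas continuous_on_quat [continuous_intros] = bounded_linear.continuous_on[OF bounded_linear_quat]
lemmas continuous_on_cvec [continuous_intros] = bounded_linear.continuous_on[OF bounded_linear_cvec]

text \<open>The invariant probability measure of U(2), scaled to radius R. With density sin^2 a sin
  b on the sphere and uniform phase on [0, pi], the total mass before normalization is 2
  pi^3.\<close>

global_interpretation U: mean "(0, 0, 0, 0)" "(pi, pi, pi, 2 * pi)" "\<lambda>(t, a, b, c). quat (U2_chart R t a b c)"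
    "\<lambda>(t, a, b, c). complex_of_real ((sin a)\<^sup>2 * sin b / (2 * pi ^ 3))" for R :: real
  defines E = U.avg and U_set = U.carr
proof
  show "continuous_on (cbox (0, 0, 0, 0) (pi, pi, pi, 2 * pi)) (\<lambda>(t, a, b, c). quat (U2_chart R t a b c))" for R
    unfolding split_def U2_chart_def by (intro continuous_intros)
  show "continuous_on (cbox (0, 0, 0, 0) (pi, pi, pi, 2 * pi))
      (\<lambda>(t, a, b, c). complex_of_real ((sin a)\<^sup>2 * sin b / (2 * pi ^ 3)))"
    unfolding split_def by (intro continuous_intros) simp
qed

lemma U_set_eq: "U_set R = U2 R"
  using U2_chart_image[of R] by (simp add: U.carr_def cbox_Pair_eq)

lemmas E_cong = U.avg_cong[unfolded U_set_eq]
  and E_cmult = U.avg_cmult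
  and E_add = U.avg_add[unfolded U_set_eq]
  and E_diff = U.avg_diff[unfolded U_set_eq]
  and E_sum = U.avg_sum[unfolded U_set_eq]
  and E_zero = U.avg_zero
  and E_continuous = U.avg_continuous[unfolded U_set_eq]
  and E_field_derivative = U.avg_field_derivative[unfolded U_set_eq]

lemma sphere_U2:
  assumes "x \<in> sphere.carr"
  shows "quat ((complex_of_real R * cis t) *s cvec x) \<in> U2 R"
proof -
  have "(complex_of_real R * cis t) *s cvec x = R *\<^sub>R (cis t *s cvec x)"
    by (simp add: vec_eq_iff scaleR_conv_of_real[where 'a=complex])
  then have 1: "quat ((complex_of_real R * cis t) *s cvec x) = R *\<^sub>R quat (cis t *s cvec x)"
    by (simp add: linear_cmul[OF bounded_linear.linear[OF bounded_linear_quat]])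
  define p q where "p = complex_of_real (x$0) - \<i> * complex_of_real (x$3)"
    and "q = - \<i> * complex_of_real (x$1) - complex_of_real (x$2)"
  have n: "p * cnj p + q * cnj q = 1"
  proof -
    have "p * cnj p + q * cnj q = complex_of_real ((x$0)\<^sup>2 + (x$1)\<^sup>2 + (x$2)\<^sup>2 + (x$3)\<^sup>2)"
      by (simp add: complex_eq_iff p_def q_def power2_eq_square)
    also have "(x$0)\<^sup>2 + (x$1)\<^sup>2 + (x$2)\<^sup>2 + (x$3)\<^sup>2 = 1"
      using assms by (simp add: sphere_carr)
    finally show ?thesis by simp
  qed
  have c: "cis t * cis (- t) = 1" "cis (- t) * cis t = 1" by (simp_all add: cis_mult)
  have Y: "quat (cis t *s cvec x) $ 1 $ 1 = cis t * p" "quat (cis t *s cvec x) $ 1 $ 2 = cis t * q"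
    "quat (cis t *s cvec x) $ 2 $ 1 = - (cis t * cnj q)" "quat (cis t *s cvec x) $ 2 $ 2 = cis t * cnj p"
    by (simp_all add: quat_def cvec_def p_def q_def algebra_simps)
  have e: "cis t * p * (cis (- t) * cnj p) + cis t * q * (cis (- t) * cnj q) = 1"
    "cis t * cnj q * (cis (- t) * q) + cis t * cnj p * (cis (- t) * p) = 1"
    using n c by algebra+
  have "quat (cis t *s cvec x) ** adj (quat (cis t *s cvec x)) = mat 1"
    "adj (quat (cis t *s cvec x)) ** quat (cis t *s cvec x) = mat 1"
    using e by (simp_all add: hc_eq_iff matrix_matrix_mult_def adj_def sum_2 mat_def Y cis_cnj ac_simps)
  then show ?thesis unfolding 1 U2_def by blast
qed

text \<open>A unitary matrix is a phase times a unit quaternion, unique up to a common sign, so a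
  half circle of phases suffices.\<close>

lemma E_iterated:
  assumes F: "continuous_on (U2 R) F"
  shows "E R F = integral {0..pi} (\<lambda>t. sphere.avg (\<lambda>x. F (quat ((complex_of_real R * cis (- t)) *s cvec x)))) / pi"
proof -
  have "E R F = integral (cbox 0 pi) (\<lambda>t. integral (cbox (0, 0, 0) (pi, pi, 2 * pi))
      (\<lambda>y. (\<lambda>(t, a, b, c). complex_of_real ((sin a)\<^sup>2 * sin b / (2 * pi ^ 3)) * F (quat (U2_chart R t a b c))) (t, y)))"
    unfolding U.avg_def using integral_prod_continuous[OF U.continuous_integrand[of R F]] F
    by (simp add: U_set_eq split_def)
  also have "\<dots> = integral (cbox 0 pi) (\<lambda>t. (1 / pi) * sphere.avg (\<lambda>x. F (quat ((complex_of_real R * cis (- t)) *s cvec x))))"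
    unfolding sphere.avg_def
    by (subst Henstock_Kurzweil_Integration.integral_mult_right[symmetric])
       (simp add: split_def U2_chart_def power2_eq_square power3_eq_cube mult.assoc)
  also have "\<dots> = (1 / pi) * integral (cbox 0 pi) (\<lambda>t. sphere.avg (\<lambda>x. F (quat ((complex_of_real R * cis (- t)) *s cvec x))))"
    by (rule Henstock_Kurzweil_Integration.integral_mult_right)
  finally show ?thesis by simp
qed

text \<open>Makes the real lemmas on the sphere applicable to a holomorphic F on one phase slice:
  \<open>g t\<close> is the gradient of F composed with the real linear map
  \<open>L t\<close>.\<close>

lemma sphere_hol_pullback:
  assumes F: "hol (U2 R) F G"
  defines "L \<equiv> \<lambda>t x. quat ((complex_of_real R * cis t) *s cvec x)"
  defines "g \<equiv> \<lambda>t x. \<chi> k. pair (G (L t x)) (quat ((complex_of_real R * cis t) *s axis k 1))"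
  shows "x \<in> sphere.carr \<Longrightarrow>
      ((\<lambda>x. F (L t x)) has_derivative (\<lambda>v. \<Sum>k\<in>UNIV. g t x $ k * complex_of_real (v $ k))) (at x)"
    and "continuous_on sphere.carr (g t)"
    and "(\<Sum>k\<in>UNIV. g t x $ k * complex_of_real (v $ k)) = pair (G (L t x)) (L t v)"
proof -
  have bl: "bounded_linear (\<lambda>x. e *s cvec x)" for e :: complex
    unfolding linear_conv_bounded_linear[symmetric]
    by (rule linearI) (simp_all add: vec_eq_iff cvec_def algebra_simps scaleR_conv_of_real[where 'a=complex])
  have blL: "bounded_linear (L t)" for t
    unfolding L_def by (rule bounded_linear_compose[OF bounded_linear_quat bl])
  show ex: "(\<Sum>k\<in>UNIV. g t x $ k * complex_of_real (v $ k)) = pair (G (L t x)) (L t v)" for x v t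
    by (simp add: g_def L_def quat_smult sum_4') (simp add: quat_def pair_def axis_def cvec_def algebra_simps)
  show "((\<lambda>x. F (L t x)) has_derivative (\<lambda>v. \<Sum>k\<in>UNIV. g t x $ k * complex_of_real (v $ k))) (at x)"
    if "x \<in> sphere.carr"
    unfolding ex
    using has_derivative_compose[OF bounded_linear_imp_has_derivative[OF blL] holD(1)[OF F]] sphere_U2[OF that]
    by (simp add: L_def)
  have "continuous_on sphere.carr (\<lambda>x. G (L t x))"
    by (rule continuous_on_compose2[OF holD(2)[OF F] bounded_linear.continuous_on[OF blL continuous_on_id]])
       (auto simp: L_def sphere_U2)
  then show "continuous_on sphere.carr (g t)"
    unfolding g_def by (intro continuous_on_vec_lambda continuous_intros)
qed

text \<open>The infinitesimal form of the invariance of the mean under left multiplication.\<close>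

lemma E_invariant:
  assumes F: "hol (U2 R) F G"
  shows "E R (\<lambda>Z. pair (G Z) (X ** Z)) = 0"
proof -
  note cG = holD(2)[OF F] and cF = holD(3)[OF F]
  define L where "L t x = quat ((complex_of_real R * cis t) *s cvec x)" for t x
  note pb = sphere_hol_pullback[OF F, folded L_def]
  \<comment> \<open>Imaginary units: left multiplication commutes with the phase and acts on each
    slice as \<open>rot j\<close>.\<close>
  have rot: "E R (\<lambda>Z. pair (G Z) (quat (axis (of_nat j) 1) ** Z)) = 0" if j: "j \<in> {1, 2, 3}" for j
  proof -
    have m: "quat (axis (of_nat j) 1) ** L t x = L t (rot j x)" for t x
      using j unfolding L_def quat_smult
      by (elim insertE) (simp_all add: hc_eq_iff matrix_matrix_mult_def sum_2 quat_def axis_def cvec_def rot_def algebra_simps)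
    have "sphere.avg (\<lambda>x. pair (G (L t x)) (quat (axis (of_nat j) 1) ** L t x)) = 0" for t
      using sphere_rot_integral[OF pb(1) pb(2) j, of t] unfolding pb(3) m .
    then show ?thesis
      by (subst E_iterated) (auto intro!: continuous_intros cG simp: L_def)
  qed
  \<comment> \<open>The Euler field is, up to the factor \<i>, the derivative in the phase; the
    boundary terms at 0 and pi agree by \<open>sphere_antipode\<close>.\<close>
  have phase: "E R (\<lambda>Z. pair (G Z) Z) = 0"
  proof -
    define \<psi> where "\<psi> t = sphere.avg (\<lambda>x. F (L (- t) x))" for t
    have cL: "continuous_on (UNIV \<times> sphere.carr) (\<lambda>(t, x). L (- t) x)"
      unfolding L_def split_def by (intro continuous_intros)
    have LU: "L t x \<in> U2 R" if "x \<in> sphere.carr" for t x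
      using sphere_U2[OF that] by (simp add: L_def)
    have blc: "bounded_linear (\<lambda>c. csc c A)" for A
      unfolding linear_conv_bounded_linear[symmetric]
      by (rule linearI) (simp_all add: hc_eq_iff algebra_simps scaleR_conv_of_real[where 'a=complex])
    have d: "(\<psi> has_vector_derivative - \<i> * sphere.avg (\<lambda>x. pair (G (L (- t) x)) (L (- t) x))) (at t)" for t
    proof -
      have "((\<lambda>t. sphere.avg (\<lambda>x. F (L (- t) x))) has_vector_derivative
          sphere.avg (\<lambda>x. - \<i> * pair (G (L (- t) x)) (L (- t) x))) (at t within UNIV)"
      proof (rule sphere.avg_vector_derivative)
        fix t x assume x: "x \<in> sphere.carr"
        have "((\<lambda>t. cis (- t)) has_vector_derivative (- \<i> * cis (- t))) (at t)"
        proof -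
          have "((\<lambda>z. exp (- (\<i> * z))) has_field_derivative (- \<i> * exp (- (\<i> * complex_of_real t)))) (at (complex_of_real t))"
            by (auto intro!: derivative_eq_intros)
          from has_vector_derivative_real_field[OF this] show ?thesis
            by (simp add: cis_conv_exp)
        qed
        from bounded_linear.has_vector_derivative[OF blc[of "quat (cvec x)"]
            has_vector_derivative_mult_right[OF this, of "complex_of_real R"]]
        have "((\<lambda>t. L (- t) x) has_vector_derivative csc (- \<i>) (L (- t) x)) (at t)"
          by (simp add: L_def quat_smult csc_def mult.left_commute mult.assoc)
        from has_derivative_compose[OF this[unfolded has_vector_derivative_def] holD(1)[OF F LU[OF x]]]
        show "((\<lambda>t. F (L (- t) x)) has_vector_derivative - \<i> * pair (G (L (- t) x)) (L (- t) x)) (at t within UNIV)"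
          by (simp add: has_vector_derivative_def linear_cmul[OF bounded_linear.linear[OF bounded_linear_pair]])
      next
        show "continuous_on (UNIV \<times> sphere.carr) (\<lambda>(t, x). - \<i> * pair (G (L (- t) x)) (L (- t) x))"
          using cL[unfolded split_def] LU unfolding split_def
          by (auto intro!: continuous_intros continuous_on_compose2[OF cG cL[unfolded split_def]])
      next
        fix t show "continuous_on sphere.carr (\<lambda>x. F (L (- t) x))"
          using sphere.slice_continuous[OF cL, of t]
          by (auto intro!: continuous_on_compose2[OF cF] LU)
      qed auto
      then show ?thesis unfolding \<psi>_def sphere.avg_cmult by simp
    qed
    have "((\<lambda>t. - \<i> * sphere.avg (\<lambda>x. pair (G (L (- t) x)) (L (- t) x))) has_integral (\<psi> pi - \<psi> 0)) {0..pi}"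
      by (rule fundamental_theorem_of_calculus[OF _ has_vector_derivative_at_within[OF d]]) simp
    moreover have "\<psi> pi = \<psi> 0"
    proof -
      have cis_minus_pi: "cis (- pi) = - 1" by (simp add: complex_eq_iff)
      have "L (- pi) x = L 0 (- x)" for x
        unfolding L_def quat_smult by (simp add: hc_eq_iff quat_def cvec_def algebra_simps cis_minus_pi)
      then show ?thesis
        unfolding \<psi>_def using sphere_antipode[OF pb(1) pb(2), of 0] by simp
    qed
    ultimately have "((\<lambda>t. - \<i> * sphere.avg (\<lambda>x. pair (G (L (- t) x)) (L (- t) x))) has_integral 0) {0..pi}"
      by simp
    from has_integral_mult_right[OF this, of \<i>]
    have "integral {0..pi} (\<lambda>t. sphere.avg (\<lambda>x. pair (G (L (- t) x)) (L (- t) x))) = 0"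
      by (intro integral_unique) (simp flip: mult.assoc)
    then show ?thesis
      by (subst E_iterated) (auto intro!: continuous_intros cG simp: L_def)
  qed
  \<comment> \<open>Every X is a complex combination of 1 and the three units, and the pairing is
    complex linear.\<close>
  obtain z where z: "X = quat z" using quat_surj by metis
  have XZ: "pair A (X ** Z) = z$0 * pair A Z + (z$1 * pair A (quat (axis 1 1) ** Z)
      + (z$2 * pair A (quat (axis 2 1) ** Z) + z$3 * pair A (quat (axis 3 1) ** Z)))" for A Z
    unfolding z by (simp add: quat_def pair_def matrix_matrix_mult_def sum_2 axis_def algebra_simps)
  show ?thesis
    unfolding XZ
    by (subst E_add; (intro continuous_intros cG)?)+ (use rot[of 1] rot[of 2] rot[of 3] in \<open>simp add: E_cmult phase\<close>)
qed

section \<open>From the integrals in the definitions to the invariant mean\<close>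

lemma U2_N_norm:
  assumes "Z \<in> U2 R" shows "norm (N Z) = R\<^sup>2"
proof -
  obtain t a b c where "Z = quat (U2_chart R t a b c)"
    using assms unfolding U2_chart_image[symmetric] by auto
  then show ?thesis by (simp add: N_U2_chart norm_mult norm_power)
qed

lemma U2_N_nonzero: "Z \<in> U2 R \<Longrightarrow> R \<noteq> 0 \<Longrightarrow> N Z \<noteq> 0"
  using U2_N_norm[of Z R] by auto

text \<open>By \<open>dV_jac_U2\<close>, dV = - \<i> N^2 sin^2 a sin b dt da db dc, while the mean
  has the weight sin^2 a sin b / (2 pi^3); the quotient is - 2 pi^3 \<i> N^2.\<close>

lemma U2_integral_eq_E:
  assumes f: "continuous_on (U2 R) f"
  shows "U2_integral R f = - 2 * complex_of_real pi ^ 3 * \<i> * E R (\<lambda>Z. f Z * (N Z)\<^sup>2)"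
proof -
  let ?B = "{0..pi} \<times> {0..pi} \<times> {0..pi} \<times> {0..2*pi}"
  let ?h = "\<lambda>(t, a, b, c). complex_of_real ((sin a)\<^sup>2 * sin b / (2 * pi ^ 3)) *
      (f (quat (U2_chart R t a b c)) * (N (quat (U2_chart R t a b c)))\<^sup>2)"
  have B: "?B = cbox (0, 0, 0, 0) (pi, pi, pi, 2*pi)" by (simp add: cbox_Pair_eq)
  have c: "continuous_on ?B ?h"
    unfolding B using U.continuous_integrand[of R "\<lambda>Z. f Z * (N Z)\<^sup>2"]
    by (simp add: U_set_eq split_def continuous_intros f)
  have "U2_integral R f = set_lebesgue_integral lborel ?B (\<lambda>x. (- 2 * complex_of_real pi ^ 3 * \<i>) * ?h x)"
    unfolding U2_integral_def
  proof (rule set_lebesgue_integral_cong)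
    show "?B \<in> sets lborel" by (simp add: B)
  qed (auto simp: dV_jac_U2 field_simps)
  also have "\<dots> = (- 2 * complex_of_real pi ^ 3 * \<i>) * set_lebesgue_integral lborel ?B ?h"
    by (rule set_integral_mult_right)
  also have "set_lebesgue_integral lborel ?B ?h = integral ?B ?h"
    by (intro set_borel_integral_eq_integral, unfold set_integrable_def, intro borel_integrable_compact c)
       (simp add: B)
  also have "integral ?B ?h = E R (\<lambda>Z. f Z * (N Z)\<^sup>2)"
    unfolding B U.avg_def by (simp add: split_def)
  finally show ?thesis .
qed

lemma U2_integral_cong: "(\<And>Z. Z \<in> U2 R \<Longrightarrow> f Z = g Z) \<Longrightarrow> U2_integral R f = U2_integral R g"
  unfolding U2_integral_def
proof (rule set_lebesgue_integral_cong)
  assume *: "\<And>Z. Z \<in> U2 R \<Longrightarrow> f Z = g Z"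
  have "{0..pi} \<times> {0..pi} \<times> {0..pi} \<times> {0..2*pi} = cbox (0, 0, 0, 0) (pi, pi, pi, 2*pi)"
    by (simp add: cbox_Pair_eq)
  then show "{0..pi} \<times> {0..pi} \<times> {0..pi} \<times> {0..2*pi} \<in> sets lborel" by simp
  show "\<forall>x. x \<in> {0..pi} \<times> {0..pi} \<times> {0..pi} \<times> {0..2*pi} \<longrightarrow>
      (case x of (t, a, b, c) \<Rightarrow> f (quat (U2_chart R t a b c)) * dV_jac (U2_chart R) t a b c) =
      (case x of (t, a, b, c) \<Rightarrow> g (quat (U2_chart R t a b c)) * dV_jac (U2_chart R) t a b c)"
  proof (intro allI impI)
    fix x assume "x \<in> {0..pi} \<times> {0..pi} \<times> {0..pi} \<times> {0..2*pi}"
    then have "(\<lambda>(t, a, b, c). quat (U2_chart R t a b c)) x \<in> U2 R"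
      unfolding U2_chart_image[symmetric] by (rule imageI)
    from *[OF this] show "(case x of (t, a, b, c) \<Rightarrow> f (quat (U2_chart R t a b c)) * dV_jac (U2_chart R) t a b c) =
      (case x of (t, a, b, c) \<Rightarrow> g (quat (U2_chart R t a b c)) * dV_jac (U2_chart R) t a b c)"
      by (simp add: split_def)
  qed
qed

lemma E_const:
  assumes "R \<noteq> 0" shows "E R (\<lambda>Z. c) = c"
proof -
  have "continuous_on (U2 R) (\<lambda>Z. 1 / (N Z)\<^sup>2)"
    using U2_N_nonzero assms by (auto intro!: continuous_intros)
  then have "E R (\<lambda>Z. 1 / (N Z)\<^sup>2 * (N Z)\<^sup>2) = 1"
    using U2_integral_eq_E[of R "\<lambda>Z. 1 / (N Z)\<^sup>2"] U2_integral_normalization[OF assms] by simp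
  moreover have "E R (\<lambda>Z. 1 / (N Z)\<^sup>2 * (N Z)\<^sup>2) = E R (\<lambda>Z. 1)"
    by (rule E_cong) (use U2_N_nonzero assms in auto)
  ultimately show ?thesis using E_cmult[of R c "\<lambda>Z. 1"] by simp
qed

section \<open>Gradients of polynomials, and Stokes' theorem on the unitary group\<close>

definition unit_mat :: "2 \<Rightarrow> 2 \<Rightarrow> hc" where
  "unit_mat i j = (\<chi> k l. if k = i \<and> l = j then 1 else 0)"

lemma pair_unit_mat: "pair (unit_mat i j) X = X $ i $ j"
  using exhaust_2[of i] exhaust_2[of j] by (auto simp: pair_def unit_mat_def)

lemma pair_minus_zero: "pair A (X - 0) = pair A X" by simp

lemmas hol_pair0 [intro] = hol_pair[where B = 0, unfolded pair_minus_zero]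
lemmas hol_nth [intro] = hol_pair0[of S "unit_mat i j" for S i j, unfolded pair_unit_mat]

text \<open>The gradient of N with respect to \<open>pair\<close>, that is, the cofactor matrix; the
  adjugate is its transpose.\<close>

definition cof :: "hc \<Rightarrow> hc" where
  "cof A = (\<chi> i j. if i = 1 then (if j = 1 then A$2$2 else - A$2$1) else (if j = 1 then - A$1$2 else A$1$1))"

lemma cof_nth: "cof A $ 1 $ 1 = A$2$2" "cof A $ 1 $ 2 = - A$2$1" "cof A $ 2 $ 1 = - A$1$2" "cof A $ 2 $ 2 = A$1$1"
  by (simp_all add: cof_def)

lemma hol_N [intro]: "hol S (\<lambda>Z. N (Z - B)) (\<lambda>Z. cof (Z - B))"
proof -
  have e: "pair (unit_mat i j) (Z - B) = Z $ i $ j - B $ i $ j" for i j Z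
    by (simp add: pair_unit_mat)
  note h = hol_pair[where B = B, of S "unit_mat i j" for i j, unfolded e]
  have "hol S (\<lambda>Z. (Z$1$1 - B$1$1) * (Z$2$2 - B$2$2) - (Z$1$2 - B$1$2) * (Z$2$1 - B$2$1))
     (\<lambda>Z. (csc (Z$1$1 - B$1$1) (unit_mat 2 2) + csc (Z$2$2 - B$2$2) (unit_mat 1 1))
       - (csc (Z$1$2 - B$1$2) (unit_mat 2 1) + csc (Z$2$1 - B$2$1) (unit_mat 1 2)))"
    by (intro hol_diff hol_mult h)
  then show ?thesis
    by (rule hol_cong) (simp_all add: det_2 hc_eq_iff cof_nth unit_mat_def)
qed

lemma hol_N0 [intro]: "hol S N cof"
  using hol_N[of S 0] by simp

lemma matrix_mult_nth_2: "(A ** B) $ i $ j = A $ i $ 1 * B $ 1 $ j + A $ i $ 2 * (B :: hc) $ 2 $ j"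
  by (simp add: matrix_matrix_mult_def sum_2)

lemma E_sum4:
  assumes "continuous_on (U2 R) F1" "continuous_on (U2 R) F2" "continuous_on (U2 R) F3" "continuous_on (U2 R) F4"
    and "E R F1 = 0" "E R F2 = 0" "E R F3 = 0" "E R F4 = 0"
  shows "E R (\<lambda>Z. F1 Z + F2 Z + F3 Z + F4 Z) = 0"
  using assms by (simp add: E_add continuous_intros)

text \<open>Stokes' theorem for the form \<open>F dV\<close>, whose density with respect to the mean is \<open>N\<^sup>2\<close>.\<close>

lemma E_stokes:
  assumes F: "hol (U2 R) F G"
  shows "E R (\<lambda>Z. (N Z)\<^sup>2 * pair (G Z) W) = 0"
proof -
  \<comment> \<open>\<open>pair (m a c) Z\<close> is the entry (a, c) of W adj(Z), adj being the
    adjugate. Thus N^2 W = X Z with X = N W adj(Z), and \<open>E_invariant\<close> is applied to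
    each entry of X; the terms in which F is not differentiated cancel in the sum.\<close>
  define m where "m a c = (if c = 1 then csc (W$a$1) (unit_mat 2 2) - csc (W$a$2) (unit_mat 2 1)
      else csc (W$a$2) (unit_mat 1 1) - csc (W$a$1) (unit_mat 1 2))" for a c :: 2
  have h: "hol (U2 R) (\<lambda>Z. N Z * pair (m a c) Z * F Z)
      (\<lambda>Z. csc (N Z * pair (m a c) Z) (G Z) + csc (F Z) (csc (N Z) (m a c) + csc (pair (m a c) Z) (cof Z)))" for a c
    by (intro hol_mult hol_N0 hol_pair0 F)
  define D where "D a c Z = pair (csc (N Z * pair (m a c) Z) (G Z) + csc (F Z) (csc (N Z) (m a c) + csc (pair (m a c) Z) (cof Z)))
      (unit_mat a c ** Z)" for a c Z
  have z: "E R (D a c) = 0" for a c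
    unfolding D_def by (rule E_invariant[OF h])
  have cont: "continuous_on (U2 R) (D a c)" for a c
    unfolding D_def by (intro continuous_intros holD(2)[OF h] continuous_on_id)
  have "E R (\<lambda>Z. (N Z)\<^sup>2 * pair (G Z) W) = E R (\<lambda>Z. D 1 1 Z + D 1 2 Z + D 2 1 Z + D 2 2 Z)"
  proof (rule E_cong)
    fix Z :: hc
    have p: "pair (m a c) Z = (if c = 1 then W$a$1 * Z$2$2 - W$a$2 * Z$2$1 else W$a$2 * Z$1$1 - W$a$1 * Z$1$2)" for a c
      by (simp add: m_def pair_unit_mat)
    have q: "unit_mat a c ** Z = (\<chi> i j. if i = a then Z $ c $ j else 0)" for a c
      using exhaust_2[of a] exhaust_2[of c]
      unfolding hc_eq_iff matrix_mult_nth_2 by (auto simp: unit_mat_def)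
    have d: "D a c Z = N Z * pair (m a c) Z * pair (G Z) (unit_mat a c ** Z)
        + F Z * (N Z * pair (m a c) (unit_mat a c ** Z) + pair (m a c) Z * pair (cof Z) (unit_mat a c ** Z))" for a c
      by (simp add: D_def algebra_simps)
    show "(N Z)\<^sup>2 * pair (G Z) W = D 1 1 Z + D 1 2 Z + D 2 1 Z + D 2 2 Z"
      unfolding d p q by (simp add: m_def pair_def cof_nth unit_mat_def det_2) algebra
  qed
  also have "\<dots> = 0" by (intro E_sum4 cont z)
  finally show ?thesis .
qed

definition tens :: "complex^2 \<Rightarrow> complex^2 \<Rightarrow> hc" where
  "tens u v = (\<chi> i j. u $ i * v $ j)"

lemma tens_nth [simp]: "tens u v $ i $ j = u $ i * v $ j"
  by (simp add: tens_def)

text \<open>The flow of the vector field \<open>Z v u\<^sup>T Z\<close> is the translation of \<open>Z\<^sup>-\<^sup>1\<close> along \<open>- v u\<^sup>T\<close>.\<close>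

lemma E_inverse_stokes:
  assumes F: "hol (U2 R) F G"
  shows "E R (\<lambda>Z. pair (G Z) (Z ** tens v u ** Z) + 2 * (pair (tens u v) Z * F Z)) = 0"
proof -
  \<comment> \<open>\<open>pair (m a c) Z\<close> is the entry (a, c) of Z v u^T. Differentiating
    these entries along the field gives u^T Z v once for each row a, whence the factor 2.\<close>
  define m where "m a c = csc (u $ c) (csc (v$1) (unit_mat a 1) + csc (v$2) (unit_mat a 2))" for a c :: 2
  have h: "hol (U2 R) (\<lambda>Z. pair (m a c) Z * F Z) (\<lambda>Z. csc (pair (m a c) Z) (G Z) + csc (F Z) (m a c))" for a c
    by (intro hol_mult hol_pair0 F)
  define D where "D a c Z = pair (csc (pair (m a c) Z) (G Z) + csc (F Z) (m a c)) (unit_mat a c ** Z)" for a c Z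
  have z: "E R (D a c) = 0" for a c
    unfolding D_def by (rule E_invariant[OF h])
  have cont: "continuous_on (U2 R) (D a c)" for a c
    unfolding D_def by (intro continuous_intros holD(2)[OF h] continuous_on_id)
  have "E R (\<lambda>Z. pair (G Z) (Z ** tens v u ** Z) + 2 * (pair (tens u v) Z * F Z))
      = E R (\<lambda>Z. D 1 1 Z + D 1 2 Z + D 2 1 Z + D 2 2 Z)"
  proof (rule E_cong)
    fix Z :: hc
    have q: "unit_mat a c ** Z = (\<chi> i j. if i = a then Z $ c $ j else 0)" for a c
      using exhaust_2[of a] exhaust_2[of c]
      unfolding hc_eq_iff matrix_mult_nth_2 by (auto simp: unit_mat_def)
    show "pair (G Z) (Z ** tens v u ** Z) + 2 * (pair (tens u v) Z * F Z) = D 1 1 Z + D 1 2 Z + D 2 1 Z + D 2 2 Z"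
      unfolding D_def q by (simp add: m_def pair_def unit_mat_def matrix_mult_nth_2) algebra
  qed
  also have "\<dots> = 0" by (intro E_sum4 cont z)
  finally show ?thesis .
qed

lemma E_euler:
  assumes "hol (U2 R) F G"
  shows "E R (\<lambda>Z. pair (G Z) Z) = 0"
  using E_invariant[OF assms, of "mat 1"] by simp

section \<open>Polynomials and the reproducing kernel\<close>

text \<open>The polynomial functions again, now as sums of monomials: induction reduces additive
  claims to single monomials, which are homogeneous.\<close>

inductive_set PF :: "(hc \<Rightarrow> complex) set" where
  mono: "(\<lambda>Z. c * Z$1$1 ^ p * Z$1$2 ^ q * Z$2$1 ^ r * Z$2$2 ^ s) \<in> PF"
| add: "f \<in> PF \<Longrightarrow> g \<in> PF \<Longrightarrow> (\<lambda>Z. f Z + g Z) \<in> PF"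

lemma PF_const [intro]: "(\<lambda>Z. c) \<in> PF"
  using PF.mono[of c 0 0 0 0] by simp

lemma PF_nth [intro]: "(\<lambda>Z. Z $ i $ j) \<in> PF"
  using exhaust_2[of i] exhaust_2[of j] PF.mono[of 1 1 0 0 0] PF.mono[of 1 0 1 0 0]
    PF.mono[of 1 0 0 1 0] PF.mono[of 1 0 0 0 1] by auto

lemma PF_mult [intro]:
  assumes "f \<in> PF" "g \<in> PF" shows "(\<lambda>Z. f Z * g Z) \<in> PF"
  using assms(1)
proof induction
  case (mono c p q r s)
  show ?case using assms(2)
  proof induction
    case (mono c' p' q' r' s')
    then show ?case
      using PF.mono[of "c * c'" "p + p'" "q + q'" "r + r'" "s + s'"] by (simp add: power_add ac_simps)
  next
    case (add f g)
    then show ?case using PF.add by (fastforce simp: distrib_left)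
  qed
next
  case (add f h)
  then show ?case using PF.add by (fastforce simp: distrib_right)
qed

lemmas PF_add [intro] = PF.add

lemma PF_diff [intro]: "f \<in> PF \<Longrightarrow> g \<in> PF \<Longrightarrow> (\<lambda>Z. f Z - g Z) \<in> PF"
  using PF_add[OF _ PF_mult[OF PF_const[of "- 1"]], of f g] by simp

lemma PF_power [intro]: "f \<in> PF \<Longrightarrow> (\<lambda>Z. f Z ^ n) \<in> PF"
  by (induction n) auto

lemma PF_sum [intro]: "(\<And>i. i \<in> I \<Longrightarrow> f i \<in> PF) \<Longrightarrow> (\<lambda>Z. \<Sum>i\<in>I. f i Z) \<in> PF"
  by (induction I rule: infinite_finite_induct) auto

lemma PF_pair [intro]: "(\<And>i j. (\<lambda>Z. A Z $ i $ j) \<in> PF) \<Longrightarrow> (\<lambda>Z. pair B (A Z)) \<in> PF"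
  unfolding pair_def by (intro PF_add PF_mult PF_const)

lemma PF_compose:
  assumes "f \<in> PF" "\<And>i j. (\<lambda>Z. A Z $ i $ j) \<in> PF"
  shows "(\<lambda>Z. f (A Z)) \<in> PF"
  using assms(1) by induction (intro PF_mult PF_power PF_const assms(2) PF_add; assumption?)+

lemma poly_fun_PF: "poly_fun f \<Longrightarrow> f \<in> PF"
proof -
  assume "poly_fun f"
  then obtain n C where "\<And>Z. f Z = (\<Sum>p\<le>n. \<Sum>q\<le>n. \<Sum>r\<le>n. \<Sum>s\<le>n.
              C p q r s * (Z$1$1)^p * (Z$1$2)^q * (Z$2$1)^r * (Z$2$2)^s)"
    unfolding poly_fun_def by blast
  then have "f = (\<lambda>Z. \<Sum>p\<le>(n::nat). \<Sum>q\<le>n. \<Sum>r\<le>n. \<Sum>s\<le>n.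
              C p q r s * (Z$1$1)^p * (Z$1$2)^q * (Z$2$1)^r * (Z$2$2)^s)" by blast
  also have "\<dots> \<in> PF" by (intro PF_sum PF.mono)
  finally show ?thesis .
qed

text \<open>Homogeneity is stated as Euler's identity for the gradient, the form in which
  \<open>E_euler\<close> can use it.\<close>

definition homog :: "nat \<Rightarrow> (hc \<Rightarrow> complex) \<Rightarrow> bool" where
  "homog d f \<longleftrightarrow> (\<exists>G. hol UNIV f G \<and> (\<forall>Z. pair (G Z) Z = of_nat d * f Z))"

lemma homog_const: "homog 0 (\<lambda>Z. c)"
  unfolding homog_def using hol_const by force

lemma homog_nth: "homog 1 (\<lambda>Z. Z $ i $ j)"
  unfolding homog_def using hol_nth[of UNIV i j] by (fastforce simp: pair_unit_mat)

lemma homog_mult: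
  assumes "homog d f" "homog e g" shows "homog (d + e) (\<lambda>Z. f Z * g Z)"
proof -
  obtain F G where h: "hol UNIV f F" "hol UNIV g G" "\<And>Z. pair (F Z) Z = of_nat d * f Z"
      "\<And>Z. pair (G Z) Z = of_nat e * g Z"
    using assms unfolding homog_def by blast
  then show ?thesis
    unfolding homog_def using hol_mult[OF h(1,2)]
    by (intro exI[of _ "\<lambda>Z. csc (f Z) (G Z) + csc (g Z) (F Z)"]) (auto simp: algebra_simps)
qed

lemma homog_power: "homog d f \<Longrightarrow> homog (n * d) (\<lambda>Z. f Z ^ n)"
  by (induction n) (auto simp: homog_const homog_mult)

lemma homog_mono: "homog (p + q + r + s) (\<lambda>Z. c * Z$1$1 ^ p * Z$1$2 ^ q * Z$2$1 ^ r * Z$2$2 ^ s)"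
  using homog_mult[OF homog_mult[OF homog_mult[OF homog_mult[OF homog_const[of c]
      homog_power[OF homog_nth, of p 1 1]] homog_power[OF homog_nth, of q 1 2]]
      homog_power[OF homog_nth, of r 2 1]] homog_power[OF homog_nth, of s 2 2]]
  by simp

lemma PF_hol:
  assumes "f \<in> PF" obtains G where "hol UNIV f G"
proof -
  have "\<exists>G. hol UNIV f G"
    using assms by induction (use homog_mono homog_def hol_add in blast)+
  then show ?thesis using that by blast
qed

lemma PF_continuous: "f \<in> PF \<Longrightarrow> continuous_on S g \<Longrightarrow> continuous_on S (\<lambda>x. f (g x))"
  by (metis PF_hol holD(3) continuous_on_compose2 subset_UNIV)

lemma PF_continuous_on: "f \<in> PF \<Longrightarrow> continuous_on S f"
  using PF_continuous[OF _ continuous_on_id] by simp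

lemma continuous_on_cof [continuous_intros]:
  assumes "continuous_on S f" shows "continuous_on S (\<lambda>x. cof (f x))"
proof (rule continuous_on_hc)
  fix i j show "continuous_on S (\<lambda>x. cof (f x) $ i $ j)"
    using exhaust_2[of i] exhaust_2[of j] assms by (elim disjE) (simp_all add: cof_nth continuous_intros)
qed

text \<open>By Euler's identity the degree times the mean of a monomial is 0, so only the constant
  term survives.\<close>

lemma E_polynomial:
  assumes "f \<in> PF" "R \<noteq> 0" shows "E R f = f 0"
  using assms(1)
proof induction
  case (mono c p q r s)
  let ?m = "\<lambda>Z::hc. c * Z$1$1 ^ p * Z$1$2 ^ q * Z$2$1 ^ r * Z$2$2 ^ s"
  show ?case
  proof (cases "p + q + r + s = 0")
    case True
    then show ?thesis using E_const[OF assms(2)] by simp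
  next
    case False
    obtain G where G: "hol UNIV ?m G" "\<And>Z. pair (G Z) Z = of_nat (p + q + r + s) * ?m Z"
      using homog_mono[of p q r s c] unfolding homog_def by blast
    have "E R (\<lambda>Z. of_nat (p + q + r + s) * ?m Z) = 0"
      using E_euler[OF hol_subset[OF G(1) subset_UNIV], of R] unfolding G(2) .
    then have "E R ?m = 0"
      unfolding E_cmult using False by (simp only: mult_eq_0_iff of_nat_eq_0_iff simp_thms)
    moreover have "?m 0 = 0" using False by auto
    ultimately show ?thesis by simp
  qed
next
  case (add f g)
  then show ?case
    using E_add[OF PF_continuous_on PF_continuous_on, of f g R] by simp
qed

lemma hol_shift: "hol UNIV F G \<Longrightarrow> hol S (\<lambda>Z. F (Z + B)) (\<lambda>Z. G (Z + B))"
  unfolding hol_def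
  by (auto intro!: continuous_on_compose2[of UNIV G] continuous_intros
      has_derivative_compose[of "\<lambda>Z. Z + B" "\<lambda>X. X" _ _ F, simplified] derivative_eq_intros)

lemma has_derivative_line:
  assumes "(F has_derivative pair A) (at (Z + csc s W))"
  shows "((\<lambda>s. F (Z + csc s W)) has_field_derivative pair A W) (at s within S)"
proof -
  have bl: "bounded_linear (\<lambda>c. csc c W)"
    unfolding linear_conv_bounded_linear[symmetric]
    by (rule linearI) (simp_all add: hc_eq_iff algebra_simps scaleR_conv_of_real[where 'a=complex])
  have "((\<lambda>s. Z + csc s W) has_derivative (\<lambda>c. 0 + csc c W)) (at s within S)"
    by (intro has_derivative_add has_derivative_const bounded_linear_imp_has_derivative bl)
  from has_derivative_compose[OF this assms] show ?thesis
    by (simp add: has_field_derivative_def mult.commute[of _ "pair A W"] fun_eq_iff mult_commute_abs)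
qed

text \<open>The whole disc of multiples \<zeta> W is required, so that poles can be contracted to
  the origin without meeting \<open>U2 R\<close>.\<close>

definition inside :: "real \<Rightarrow> hc set" where
  "inside R = {W. \<forall>Z\<in>U2 R. \<forall>\<zeta>. norm \<zeta> \<le> 1 \<longrightarrow> N (Z - csc \<zeta> W) \<noteq> 0}"

lemma insideD: "W \<in> inside R \<Longrightarrow> Z \<in> U2 R \<Longrightarrow> norm \<zeta> \<le> 1 \<Longrightarrow> N (Z - csc \<zeta> W) \<noteq> 0"
  by (auto simp: inside_def)

lemma csc_one [simp]: "csc 1 W = W" and csc_zero [simp]: "csc 0 W = 0"
  by (simp_all add: hc_eq_iff)

lemma insideD1: "W \<in> inside R \<Longrightarrow> Z \<in> U2 R \<Longrightarrow> N (Z - W) \<noteq> 0"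
  using insideD[of W R Z 1] by simp

text \<open>Translating \<open>Z\<close> by \<open>s W\<close> does not change the integral, and at \<open>s = 0\<close> it is a mean value.\<close>

lemma szego:
  assumes g: "g \<in> PF" and W: "W \<in> inside R" and R: "R \<noteq> 0"
  shows "E R (\<lambda>Z. (N Z)\<^sup>2 * (g Z * inverse ((N (Z - W))\<^sup>2))) = g W"
proof -
  obtain G where G: "hol UNIV g G" using PF_hol[OF g] .
  \<comment> \<open>\<open>F s Z\<close> is \<open>F 1\<close> evaluated at Z + (1 - s) W. Its
    derivative in s is therefore minus the derivative in the direction W, which
    \<open>E_stokes\<close> averages to 0.\<close>
  define F where "F s Z = g (Z + csc (1 - s) W) * inverse ((N (Z - csc s W))\<^sup>2)" for s Z
  define D where "D s Z = csc (g (Z + csc (1 - s) W)) (csc (- inverse (((N (Z - csc s W))\<^sup>2)\<^sup>2))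
      (csc (of_nat 2 * N (Z - csc s W) ^ (2 - 1)) (cof (Z - csc s W))))
      + csc (inverse ((N (Z - csc s W))\<^sup>2)) (G (Z + csc (1 - s) W))" for s Z
  have nz: "N (Z - csc s W) \<noteq> 0" if "s \<in> cball 0 1" "Z \<in> U2 R" for s Z
    using insideD[OF W that(2)] that(1) by simp
  have hF: "hol (U2 R) (F s) (D s)" if "s \<in> cball 0 1" for s
    unfolding F_def D_def using nz[OF that]
    by (intro hol_mult hol_shift[OF G] hol_inverse hol_power hol_N) auto
  have dF: "((\<lambda>s. F s Z) has_field_derivative - pair (D s Z) W) (at s within cball 0 1)"
    if "s \<in> cball 0 1" "Z \<in> U2 R" for s Z
  proof -
    have 1: "((\<lambda>s. N (Z + csc (- s) W)) has_field_derivative pair (cof (Z + csc (- s) W)) W * (- 1)) (at s within cball 0 1)"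
      by (rule DERIV_chain2[of "\<lambda>c. N (Z + csc c W)"], rule has_derivative_line[where S = UNIV])
         (auto intro!: derivative_eq_intros holD(1)[OF hol_N0])
    have 2: "((\<lambda>s. g (Z + csc (1 - s) W)) has_field_derivative pair (G (Z + csc (1 - s) W)) W * (- 1)) (at s within cball 0 1)"
      by (rule DERIV_chain2[of "\<lambda>c. g (Z + csc c W)"], rule has_derivative_line[where S = UNIV])
         (auto intro!: derivative_eq_intros holD(1)[OF G])
    have e: "Z + csc (- s) W = Z - csc s W" for s by (simp add: hc_eq_iff)
    show ?thesis
      unfolding F_def D_def
      using nz[OF that]
      by (auto intro!: derivative_eq_intros 1[unfolded e] 2 simp: field_simps power2_eq_square)
  qed
  have cG: "continuous_on S (\<lambda>x. G (f x))" if "continuous_on S f" for S :: "(complex \<times> hc) set" and f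
    using continuous_on_compose2[OF holD(2)[OF G] that] by simp
  have cD: "continuous_on (cball 0 1 \<times> U2 R) (\<lambda>(s, Z). (N Z)\<^sup>2 * - pair (D s Z) W)"
  proof -
    have "N (snd x - csc (fst x) W) \<noteq> 0" if "x \<in> cball 0 1 \<times> U2 R" for x
      using nz that by auto
    then show ?thesis
      unfolding split_def D_def
      by (intro continuous_intros cG PF_continuous[OF g] continuous_on_cof) auto
  qed
  have "((\<lambda>s. E R (\<lambda>Z. (N Z)\<^sup>2 * F s Z)) has_field_derivative E R (\<lambda>Z. (N Z)\<^sup>2 * - pair (D s Z) W)) (at s within cball 0 1)"
    if s': "s \<in> cball 0 1" for s
  proof (rule E_field_derivative[OF DERIV_cmult[OF dF] _ cD s' convex_cball])
    fix s :: complex assume s: "s \<in> cball 0 1"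
    show "continuous_on (U2 R) (\<lambda>Z. (N Z)\<^sup>2 * F s Z)"
      by (intro continuous_intros holD(3)[OF hF[OF s]])
  qed
  moreover have "E R (\<lambda>Z. (N Z)\<^sup>2 * - pair (D s Z) W) = 0" if "s \<in> cball 0 1" for s
    using E_stokes[OF hF[OF that], of W] E_cmult[of R "- 1" "\<lambda>Z. (N Z)\<^sup>2 * pair (D s Z) W"] by simp
  ultimately obtain c where c: "\<And>s. s \<in> cball 0 1 \<Longrightarrow> E R (\<lambda>Z. (N Z)\<^sup>2 * F s Z) = c"
    using has_field_derivative_zero_constant[OF convex_cball, of "0::complex" 1 "\<lambda>s. E R (\<lambda>Z. (N Z)\<^sup>2 * F s Z)"] by auto
  have "E R (\<lambda>Z. (N Z)\<^sup>2 * F 1 Z) = E R (\<lambda>Z. (N Z)\<^sup>2 * F 0 Z)"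
    using c[of 0] c[of 1] by simp
  also have "\<dots> = E R (\<lambda>Z. g (Z + W))"
    by (rule E_cong) (use U2_N_nonzero R in \<open>simp add: F_def\<close>)
  also have "\<dots> = g W"
    using E_polynomial[OF PF_compose[OF g, of "\<lambda>Z. Z + W"] R] by (simp add: PF_add PF_nth PF_const)
  finally show ?thesis by (simp add: F_def)
qed

section \<open>Feynman parameters\<close>

text \<open>
  The mean of \<open>F\<close> over the orthogonal projections of rank one, for polynomial \<open>F\<close>; the
  non-orthogonal projections used here make the integrals over \<open>s\<close> rational.
\<close>

definition proj :: "real \<times> real \<Rightarrow> hc" where
  "proj q = (\<chi> i j. if i = 1 then (if j = 1 then complex_of_real (fst q) else complex_of_real (fst q) * cis (snd q))
     else (if j = 1 then complex_of_real (1 - fst q) * cis (- snd q) else complex_of_real (1 - fst q)))"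

lemma proj_nth:
  "proj q $ 1 $ 1 = complex_of_real (fst q)" "proj q $ 1 $ 2 = complex_of_real (fst q) * cis (snd q)"
  "proj q $ 2 $ 1 = complex_of_real (1 - fst q) * cis (- snd q)" "proj q $ 2 $ 2 = complex_of_real (1 - fst q)"
  by (simp_all add: proj_def)

lemma continuous_on_proj [continuous_intros]:
  assumes "continuous_on S f" shows "continuous_on S (\<lambda>x. proj (f x))"
proof (rule continuous_on_hc)
  fix i j show "continuous_on S (\<lambda>x. proj (f x) $ i $ j)"
    using exhaust_2[of i] exhaust_2[of j]
    by (elim disjE) (auto simp only: proj_nth intro!: continuous_intros assms)
qed

global_interpretation Pr: mean "(0, 0)" "(1, 2 * pi)" proj "\<lambda>_. 1 / (2 * complex_of_real pi)"
  defines PA = Pr.avg and P_set = Pr.carr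
  by unfold_locales (intro continuous_intros)+

lemma P_set_rank_one:
  assumes "P \<in> P_set"
  shows "P$2$2 = 1 - P$1$1" "P$1$2 * P$2$1 = P$1$1 * P$2$2"
  using assms by (auto simp: Pr.carr_def proj_nth cis_mult)

lemma PA_iterated:
  assumes "continuous_on P_set F"
  shows "PA F = integral {0..2*pi} (\<lambda>\<theta>. integral {0..1} (\<lambda>s. F (proj (s, \<theta>)))) / (2 * pi)"
proof -
  have c: "continuous_on (cbox (0, 0) (1, 2 * pi)) (\<lambda>q. F (proj q))"
    by (rule continuous_on_compose2[OF assms Pr.continuous_chart]) (simp add: Pr.carr_def)
  have "PA F = (1 / (2 * complex_of_real pi)) * integral (cbox (0, 0) (1, 2 * pi)) (\<lambda>q. F (proj q))"
    unfolding Pr.avg_def by (rule Henstock_Kurzweil_Integration.integral_mult_right)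
  also have "integral (cbox (0, 0) (1, 2 * pi)) (\<lambda>q. F (proj q))
      = integral (cbox 0 1) (\<lambda>s. integral (cbox 0 (2 * pi)) (\<lambda>\<theta>. F (proj (s, \<theta>))))"
    by (rule integral_prod_continuous[OF c])
  also have "\<dots> = integral (cbox 0 (2 * pi)) (\<lambda>\<theta>. integral (cbox 0 1) (\<lambda>s. F (proj (s, \<theta>))))"
    by (rule integral_swap_continuous) (use c in \<open>simp add: split_def\<close>)
  finally show ?thesis by simp
qed

section \<open>One-dimensional integrals behind Feynman's formula\<close>

lemma cis_vector_derivative:
  "((\<lambda>\<theta>. cis (k * \<theta>)) has_vector_derivative (\<i> * complex_of_real k * cis (k * \<theta>))) (at \<theta> within S)"
proof -
  have "((\<lambda>z. exp (\<i> * (complex_of_real k * z))) has_field_derivative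
      (\<i> * complex_of_real k * exp (\<i> * (complex_of_real k * complex_of_real \<theta>)))) (at (complex_of_real \<theta>))"
    by (auto intro!: derivative_eq_intros)
  from has_vector_derivative_real_field[OF this, of S] show ?thesis
    by (simp add: cis_conv_exp)
qed

text \<open>Mean value property of 1 / (1 + \<rho> z) on the unit circle: replacing \<rho> by \<tau>
  \<rho> does not change the integral, because the derivative in \<tau> is a total derivative in
  \<theta>.\<close>

lemma circle_mean:
  assumes \<rho>: "norm \<rho> < 1" and k: "k = 1 \<or> k = - 1"
  shows "((\<lambda>\<theta>. 1 / (1 + \<rho> * cis (k * \<theta>))) has_integral 2 * pi) {0..2*pi}"
proof -
  have nz: "1 + \<tau> * \<rho> * cis x \<noteq> 0" if "\<tau> \<in> cball 0 1" for \<tau> x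
  proof
    assume "1 + \<tau> * \<rho> * cis x = 0"
    then have "norm (\<tau> * \<rho> * cis x) = 1" by (metis add_eq_0_iff norm_minus_cancel norm_one)
    then have "norm \<tau> * norm \<rho> = 1" by (simp add: norm_mult)
    moreover have "norm \<tau> * norm \<rho> \<le> 1 * norm \<rho>"
      using that by (intro mult_right_mono) auto
    ultimately show False using \<rho> by simp
  qed
  define D where "D \<tau> \<theta> = - (\<rho> * cis (k * \<theta>)) / (1 + \<tau> * \<rho> * cis (k * \<theta>))\<^sup>2" for \<tau> \<theta>
  have c2: "continuous_on (cball 0 1 \<times> cbox 0 (2*pi)) (\<lambda>(\<tau>, \<theta>). D \<tau> \<theta>)"
    unfolding D_def split_def using nz by (intro continuous_intros) auto
  have c1: "continuous_on {0..2*pi} (\<lambda>\<theta>. 1 / (1 + \<tau> * \<rho> * cis (k * \<theta>)))" if "\<tau> \<in> cball 0 1" for \<tau>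
    using nz[OF that] by (intro continuous_intros) auto
  have "((\<lambda>\<tau>. integral (cbox 0 (2*pi)) (\<lambda>\<theta>. 1 / (1 + \<tau> * \<rho> * cis (k * \<theta>)))) has_field_derivative
      integral (cbox 0 (2*pi)) (D \<tau>)) (at \<tau> within cball 0 1)" if t': "\<tau> \<in> cball 0 1" for \<tau>
  proof (rule leibniz_rule_field_derivative[OF _ _ c2 t' convex_cball])
    fix \<tau> :: complex and \<theta> assume t: "\<tau> \<in> cball 0 1"
    show "((\<lambda>\<tau>. 1 / (1 + \<tau> * \<rho> * cis (k * \<theta>))) has_field_derivative D \<tau> \<theta>) (at \<tau> within cball 0 1)"
      unfolding D_def using nz[OF t] by (auto intro!: derivative_eq_intros simp: power2_eq_square)
    show "(\<lambda>\<theta>. 1 / (1 + \<tau> * \<rho> * cis (k * \<theta>))) integrable_on cbox 0 (2 * pi)"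
      using c1[OF t] by (intro integrable_continuous) simp
  qed
  moreover have "integral (cbox 0 (2*pi)) (D \<tau>) = 0" if "\<tau> \<in> cball 0 1" for \<tau>
  proof -
    \<comment> \<open>A primitive of \<open>D \<tau>\<close>: differentiation brings out a factor
      k^2 = 1, so both orientations of the circle are covered.\<close>
    define A where "A \<theta> = \<i> * complex_of_real k * \<rho> * cis (k * \<theta>) / (1 + \<tau> * \<rho> * cis (k * \<theta>))" for \<theta>
    have kk: "complex_of_real k * complex_of_real k = 1" using k by auto
    have dA: "(A has_vector_derivative D \<tau> \<theta>) (at \<theta> within {0..2*pi})" for \<theta>
    proof -
      have "((\<lambda>z. \<i> * complex_of_real k * \<rho> * z / (1 + \<tau> * \<rho> * z)) has_field_derivative
          \<i> * complex_of_real k * \<rho> / (1 + \<tau> * \<rho> * cis (k * \<theta>))\<^sup>2) (at (cis (k * \<theta>)))"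
        using nz[OF that] by (auto intro!: derivative_eq_intros simp: power2_eq_square field_simps)
      from field_vector_diff_chain_within[OF cis_vector_derivative has_field_derivative_at_within[OF this], of "{0..2*pi}"]
      have "(A has_vector_derivative \<i> * complex_of_real k * cis (k * \<theta>) *
          (\<i> * complex_of_real k * \<rho> / (1 + \<tau> * \<rho> * cis (k * \<theta>))\<^sup>2)) (at \<theta> within {0..2*pi})"
        by (simp add: A_def[abs_def] o_def)
      also have "\<i> * complex_of_real k * cis (k * \<theta>) * (\<i> * complex_of_real k * \<rho> / (1 + \<tau> * \<rho> * cis (k * \<theta>))\<^sup>2)
          = (\<i> * \<i>) * (complex_of_real k * complex_of_real k) * (\<rho> * cis (k * \<theta>)) / (1 + \<tau> * \<rho> * cis (k * \<theta>))\<^sup>2"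
        by (simp add: ac_simps)
      finally show ?thesis by (simp add: D_def kk)
    qed
    have "(D \<tau> has_integral A (2*pi) - A 0) {0..2*pi}"
      by (rule fundamental_theorem_of_calculus[OF _ dA]) simp
    moreover have "cis (k * (2 * pi)) = 1" using k by (auto simp: complex_eq_iff)
    ultimately show ?thesis by (simp add: A_def integral_unique)
  qed
  ultimately have "\<exists>c. \<forall>\<tau>\<in>cball 0 1. integral (cbox 0 (2*pi)) (\<lambda>\<theta>. 1 / (1 + \<tau> * \<rho> * cis (k * \<theta>))) = c"
    by (intro has_field_derivative_zero_constant[OF convex_cball]) auto
  then obtain c where c: "\<And>\<tau>. \<tau> \<in> cball 0 1 \<Longrightarrow> integral (cbox 0 (2*pi)) (\<lambda>\<theta>. 1 / (1 + \<tau> * \<rho> * cis (k * \<theta>))) = c"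
    by blast
  have "integral {0..2*pi} (\<lambda>\<theta>. 1 / (1 + \<rho> * cis (k * \<theta>))) = 2 * pi"
    using c[of 0] c[of 1] by (simp add: scaleR_conv_of_real)
  moreover have "(\<lambda>\<theta>. 1 / (1 + \<rho> * cis (k * \<theta>))) integrable_on {0..2*pi}"
    using c1[of 1] by (intro integrable_continuous_interval) simp
  ultimately show ?thesis by (simp add: has_integral_iff)
qed

text \<open>Feynman's identity. The primitive s / (b (b + s (a - b))) is chosen because it stays
  valid for a = b.\<close>

lemma integral_inverse_square_segment:
  assumes nz: "\<And>s. s \<in> {0..1} \<Longrightarrow> b + complex_of_real s * (a - b) \<noteq> 0"
  shows "integral {0..1} (\<lambda>s. 1 / (b + complex_of_real s * (a - b))\<^sup>2) = 1 / (a * b)"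
proof -
  have b: "b \<noteq> 0" using nz[of 0] by simp
  have "((\<lambda>s. 1 / (b + complex_of_real s * (a - b))\<^sup>2) has_integral
      complex_of_real 1 / (b * (b + complex_of_real 1 * (a - b))) - complex_of_real 0 / (b * (b + complex_of_real 0 * (a - b)))) {0..1}"
  proof (rule fundamental_theorem_of_calculus)
    fix s :: real assume s: "s \<in> {0..1}"
    let ?q = "b + complex_of_real s * (a - b)"
    have "((\<lambda>z. z / (b * (b + z * (a - b)))) has_field_derivative
        (b * ?q - complex_of_real s * (b * (a - b))) / (b * ?q * (b * ?q))) (at (complex_of_real s))"
      using nz[OF s] b by (auto intro!: derivative_eq_intros)
    moreover have "b * ?q - complex_of_real s * (b * (a - b)) = b * b"
      by (simp add: algebra_simps)
    ultimately have "((\<lambda>z. z / (b * (b + z * (a - b)))) has_field_derivative 1 / ?q\<^sup>2) (at (complex_of_real s))"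
      using b by (simp add: power2_eq_square)
    from has_vector_derivative_real_field[OF this]
    show "((\<lambda>s. complex_of_real s / (b * (b + complex_of_real s * (a - b)))) has_vector_derivative
        1 / (b + complex_of_real s * (a - b))\<^sup>2) (at s within {0..1})" .
  qed simp
  then show ?thesis by (simp add: integral_unique mult.commute)
qed

text \<open>The trace of the product M P, whereas \<open>pair\<close> would transpose M.\<close>

definition trp :: "hc \<Rightarrow> hc \<Rightarrow> complex" where
  "trp M P = M$1$1 * P$1$1 + M$1$2 * P$2$1 + M$2$1 * P$1$2 + M$2$2 * P$2$2"

text \<open>With the bound 1/4 per entry, the perturbation of tr(M P) = \<nu> + ... stays within
  half of the modulus of \<nu> for the projections \<open>proj (s, \<theta>)\<close> with s in
  [0, 1], which excludes zeros.\<close>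

definition near_scalar :: "complex \<Rightarrow> hc \<Rightarrow> bool" where
  "near_scalar \<nu> M \<longleftrightarrow> (\<forall>i j. norm ((M - mat \<nu>) $ i $ j) < norm \<nu> / 4)"

lemma near_scalar_entries:
  assumes "near_scalar \<nu> M"
  shows "norm (M$1$1 - \<nu>) < norm \<nu> / 4" "norm (M$1$2) < norm \<nu> / 4"
    "norm (M$2$1) < norm \<nu> / 4" "norm (M$2$2 - \<nu>) < norm \<nu> / 4"
proof -
  have e: "norm ((M - mat \<nu>) $ i $ j) < norm \<nu> / 4" for i j
    using assms unfolding near_scalar_def by blast
  show "norm (M$1$1 - \<nu>) < norm \<nu> / 4" "norm (M$1$2) < norm \<nu> / 4"
    "norm (M$2$1) < norm \<nu> / 4" "norm (M$2$2 - \<nu>) < norm \<nu> / 4"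
    using e[of 1 1] e[of 1 2] e[of 2 1] e[of 2 2] by (simp_all add: mat_def)
qed

lemma near_scalar_trp:
  assumes "near_scalar \<nu> M" "0 \<le> s" "s \<le> 1"
  shows "trp M (proj (s, \<theta>)) \<noteq> 0"
proof
  note e = near_scalar_entries[OF assms(1)]
  define x y where "x = (M$1$1 - \<nu>) + M$2$1 * cis \<theta>" and "y = (M$2$2 - \<nu>) + M$1$2 * cis (- \<theta>)"
  assume "trp M (proj (s, \<theta>)) = 0"
  then have "- \<nu> = complex_of_real s * x + complex_of_real (1 - s) * y"
    by (simp add: trp_def proj_nth x_def y_def algebra_simps add_eq_0_iff)
  then have "norm \<nu> = norm (complex_of_real s * x + complex_of_real (1 - s) * y)"
    by (metis norm_minus_cancel)
  also have "\<dots> \<le> norm (complex_of_real s * x) + norm (complex_of_real (1 - s) * y)"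
    by (rule norm_triangle_ineq)
  also have "\<dots> = s * norm x + (1 - s) * norm y"
    using assms by (simp only: norm_mult norm_of_real)
  also have "\<dots> \<le> s * (norm \<nu> / 2) + (1 - s) * (norm \<nu> / 2)"
  proof -
    have xy: "norm x \<le> norm \<nu> / 2" "norm y \<le> norm \<nu> / 2"
      unfolding x_def y_def using e norm_triangle_ineq[of "M$1$1 - \<nu>" "M$2$1 * cis \<theta>"]
        norm_triangle_ineq[of "M$2$2 - \<nu>" "M$1$2 * cis (- \<theta>)"] by (simp_all add: norm_mult)
    show ?thesis by (intro add_mono mult_left_mono) (use assms xy in auto)
  qed
  also have "\<dots> = (s + (1 - s)) * (norm \<nu> / 2)" by (rule distrib_right[symmetric])
  also have "\<dots> = norm \<nu> / 2" by simp
  finally show False using e(2) norm_ge_zero[of "M$1$2"] by linarith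
qed

text \<open>A matrix form of Feynman's identity. The integral over s is the scalar identity for the
  two ends of the segment; partial fractions then split the function of \<theta>, up to the factor 1
  / det M, into two terms of circle mean 1, minus 1.\<close>

lemma PA_inverse_square:
  assumes M: "near_scalar \<nu> M"
  shows "PA (\<lambda>P. 1 / (trp M P)\<^sup>2) = 1 / N M"
proof -
  note e = near_scalar_entries[OF M]
  define a b c d where abcd: "a = M$1$1" "b = M$1$2" "c = M$2$1" "d = M$2$2"
  have n: "norm \<nu> \<le> norm (\<nu> - w) + norm w" for w using norm_triangle_ineq[of "\<nu> - w" w] by simp
  have lt: "norm c < norm a" "norm b < norm d"
    using e n[of a] n[of d] norm_ge_zero[of b] unfolding abcd norm_minus_commute[of _ \<nu>] by linarith+
  then have nz: "a \<noteq> 0" "d \<noteq> 0" by auto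
  have "norm (b * c) < norm (a * d)"
    using mult_strict_mono'[OF lt(2) lt(1)] by (simp add: norm_mult mult.commute)
  then have \<Delta>: "a * d - b * c \<noteq> 0" by auto
  have cont: "continuous_on P_set (\<lambda>P. 1 / (trp M P)\<^sup>2)"
  proof -
    have "trp M P \<noteq> 0" if "P \<in> P_set" for P
      using that near_scalar_trp[OF M] by (auto simp: Pr.carr_def cbox_Pair_eq)
    then show ?thesis unfolding trp_def by (intro continuous_intros) auto
  qed
  have r: "norm (c / a) < 1" "norm (b / d) < 1" using lt nz by (simp_all add: norm_divide)
  have nz2: "a + c * cis \<theta> \<noteq> 0" "d + b * cis (- \<theta>) \<noteq> 0" for \<theta>
    using near_scalar_trp[OF M, of 1 \<theta>] near_scalar_trp[OF M, of 0 \<theta>]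
    by (simp_all add: trp_def proj_nth abcd add.commute)
  have "integral {0..1} (\<lambda>s. 1 / (trp M (proj (s, \<theta>)))\<^sup>2) = 1 / ((a + c * cis \<theta>) * (d + b * cis (- \<theta>)))" for \<theta>
  proof -
    have t: "trp M (proj (s, \<theta>)) = (d + b * cis (- \<theta>)) + complex_of_real s * ((a + c * cis \<theta>) - (d + b * cis (- \<theta>)))" for s
      by (simp add: trp_def proj_nth abcd algebra_simps)
    show ?thesis unfolding t
      by (rule integral_inverse_square_segment) (use near_scalar_trp[OF M, of _ \<theta>] in \<open>simp flip: t\<close>)
  qed
  then have "PA (\<lambda>P. 1 / (trp M P)\<^sup>2) = integral {0..2*pi} (\<lambda>\<theta>. 1 / ((a + c * cis \<theta>) * (d + b * cis (- \<theta>)))) / (2 * pi)"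
    by (simp add: PA_iterated[OF cont])
  also have "(\<lambda>\<theta>. 1 / ((a + c * cis \<theta>) * (d + b * cis (- \<theta>)))) =
      (\<lambda>\<theta>. (1 / (a * d - b * c)) * (1 / (1 + c / a * cis (1 * \<theta>)) + 1 / (1 + b / d * cis (- 1 * \<theta>)) - 1))"
  proof
    fix \<theta>
    define z where "z = cis \<theta>"
    have z: "cis (- \<theta>) = inverse z" "z \<noteq> 0" by (simp_all add: z_def)
    have 1: "1 / (1 + c / a * z) = a / (a + c * z)" "1 / (1 + b / d * inverse z) = d / (d + b * inverse z)"
      using nz z(2) by (simp_all add: field_simps)
    have nn: "a + c * z \<noteq> 0" "d + b * inverse z \<noteq> 0" using nz2[of \<theta>] unfolding z(1) z_def[symmetric] by auto
    have 2: "a / (a + c * z) + d / (d + b * inverse z) - 1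
        = (a * (d + b * inverse z) + d * (a + c * z) - (a + c * z) * (d + b * inverse z)) / ((a + c * z) * (d + b * inverse z))"
      using nn by (simp add: add_divide_distrib diff_divide_distrib)
    have 3: "a * (d + b * inverse z) + d * (a + c * z) - (a + c * z) * (d + b * inverse z) = a * d - b * c"
      using z(2) by (simp add: algebra_simps)
    show "1 / ((a + c * cis \<theta>) * (d + b * cis (- \<theta>))) =
       (1 / (a * d - b * c)) * (1 / (1 + c / a * cis (1 * \<theta>)) + 1 / (1 + b / d * cis (- 1 * \<theta>)) - 1)"
      using \<Delta> unfolding mult_1 mult_minus1 z(1) z_def[symmetric] 1 2 3 by simp
  qed
  also have "integral {0..2*pi} \<dots> = (1 / (a * d - b * c)) * (2 * pi)"
  proof (rule integral_unique, rule has_integral_mult_right)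
    have "((\<lambda>\<theta>. 1 / (1 + c / a * cis (1 * \<theta>)) + 1 / (1 + b / d * cis (- 1 * \<theta>)) - 1) has_integral
        (complex_of_real (2 * pi) + complex_of_real (2 * pi) - complex_of_real (2 * pi))) {0..2*pi}"
      using has_integral_const_real[of "1::complex" 0 "2*pi"]
      by (intro has_integral_diff has_integral_add circle_mean r) (auto simp: scaleR_conv_of_real)
    then show "((\<lambda>\<theta>. 1 / (1 + c / a * cis (1 * \<theta>)) + 1 / (1 + b / d * cis (- 1 * \<theta>)) - 1) has_integral
        complex_of_real (2 * pi)) {0..2*pi}" by simp
  qed
  finally show ?thesis by (simp add: abcd det_2)
qed

lemmas E_PA_swap = avg_swap[OF U.mean_axioms Pr.mean_axioms, folded E_def PA_def U_set_def P_set_def, unfolded U_set_eq]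
lemmas E_E_swap = avg_swap[OF U.mean_axioms U.mean_axioms, folded E_def U_set_def, unfolded U_set_eq]
lemmas E_sphere_swap = avg_swap[OF U.mean_axioms sphere.mean_axioms,
    folded E_def sphere_avg_def U_set_def sphere_set_def, unfolded U_set_eq]

section \<open>The two-pole formula for poles near the origin\<close>

lemma compact_U2: "compact (U2 R)"
  unfolding U_set_eq[symmetric] U.carr_def
  by (intro compact_continuous_image U.continuous_chart) simp

lemma uniformly_small:
  fixes f :: "complex \<times> 'a::metric_space \<Rightarrow> 'b::real_normed_vector"
  assumes "compact K" "continuous_on (cball 0 1 \<times> K) f" "\<And>k. k \<in> K \<Longrightarrow> f (0, k) = 0" "\<epsilon> > 0"
  obtains \<delta> where "0 < \<delta>" "\<delta> \<le> 1" "\<And>s k. norm s \<le> \<delta> \<Longrightarrow> k \<in> K \<Longrightarrow> norm (f (s, k)) < \<epsilon>"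
proof -
  have "uniformly_continuous_on (cball 0 1 \<times> K) f"
    by (intro compact_uniformly_continuous assms compact_Times compact_cball)
  then obtain d where d: "d > 0" "\<And>x y. x \<in> cball 0 1 \<times> K \<Longrightarrow> y \<in> cball 0 1 \<times> K \<Longrightarrow> dist y x < d \<Longrightarrow> dist (f y) (f x) < \<epsilon>"
    using assms(4) unfolding uniformly_continuous_on_def by metis
  show ?thesis
  proof (rule that[of "min 1 (d / 2)"])
    fix s :: complex and k assume s: "norm s \<le> min 1 (d / 2)" and k: "k \<in> K"
    have "dist (s, k) (0, k) < d" using s d(1) by (simp add: dist_Pair_Pair)
    then have "dist (f (s, k)) (f (0, k)) < \<epsilon>"
      using s k by (intro d(2)) auto
    then show "norm (f (s, k)) < \<epsilon>" using assms(3)[OF k] by simp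
  qed (use d(1) in auto)
qed

lemma uniformly_nonzero:
  fixes f :: "complex \<times> 'a::metric_space \<Rightarrow> complex"
  assumes "compact K" "continuous_on (cball 0 1 \<times> K) f" "\<And>k. k \<in> K \<Longrightarrow> f (0, k) \<noteq> 0"
  obtains \<delta> where "0 < \<delta>" "\<delta> \<le> 1" "\<And>s k. norm s \<le> \<delta> \<Longrightarrow> k \<in> K \<Longrightarrow> f (s, k) \<noteq> 0"
proof (cases "K = {}")
  case True then show ?thesis using that[of 1] by simp
next
  case False
  have c0: "continuous_on (cball 0 1 \<times> K) (\<lambda>x. f (0, snd x))"
    by (rule continuous_on_compose2[OF assms(2)]) (auto intro!: continuous_intros)
  have "continuous_on K (\<lambda>k. norm (f (0, k)))"
    by (intro continuous_on_norm continuous_on_compose2[OF assms(2)]) (auto intro!: continuous_intros)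
  then obtain k0 where k0: "k0 \<in> K" "\<And>k. k \<in> K \<Longrightarrow> norm (f (0, k0)) \<le> norm (f (0, k))"
    using continuous_attains_inf[OF assms(1) False] by blast
  have "continuous_on (cball 0 1 \<times> K) (\<lambda>x. f x - f (0, snd x))"
    by (intro continuous_intros assms(2) c0)
  then obtain \<delta> where \<delta>: "0 < \<delta>" "\<delta> \<le> 1"
    "\<And>s k. norm s \<le> \<delta> \<Longrightarrow> k \<in> K \<Longrightarrow> norm (f (s, k) - f (0, snd (s, k))) < norm (f (0, k0))"
    using assms(3)[OF k0(1)] by (elim uniformly_small[OF assms(1), where \<epsilon> = "norm (f (0, k0))"]) auto
  have "f (s, k) \<noteq> 0" if "norm s \<le> \<delta>" "k \<in> K" for s k
    using \<delta>(3)[OF that] k0(2)[OF that(2)] by auto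
  then show ?thesis using that \<delta> by blast
qed

text \<open>P and 1 - P have rank one on \<open>P_set\<close>, so in det(A (1 - P) + B P) only the
  mixed term survives, and that is linear in P. The matrix \<open>transpose (cof A)\<close> is the
  adjugate of A.\<close>

lemma N_segment:
  assumes "P \<in> P_set"
  shows "N (A + (B - A) ** P) = trp (transpose (cof A) ** B) P"
proof -
  have "P$1$2 * P$2$1 = P$1$1 * (1 - P$1$1)" using P_set_rank_one[OF assms] by simp
  then show ?thesis
    unfolding det_2 trp_def matrix_mult_nth_2 vector_add_component transpose_def
      vec_lambda_beta cof_nth P_set_rank_one(1)[OF assms] vector_minus_component
    by algebra
qed

lemma N_transpose_cof: "N (transpose (cof A)) = N A"
  by (simp add: det_2 cof_nth transpose_def algebra_simps)

text \<open>N^2 is the density of dV; it also makes the factor next to g homogeneous of degree 0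
  jointly in Z, W1 and W2.\<close>

definition two_poles :: "(hc \<Rightarrow> complex) \<Rightarrow> hc \<Rightarrow> hc \<Rightarrow> hc \<Rightarrow> complex" where
  "two_poles g W1 W2 Z = (N Z)\<^sup>2 * (g Z * (inverse (N (Z - W1)) * inverse (N (Z - W2))))"

text \<open>For small poles, adj(Z - \<delta> W1) (Z - \<delta> W2), with adj the adjugate, is close
  to the scalar N Z, and its determinant is the product of the two denominators. So
  \<open>PA_inverse_square\<close> writes the inverse of that product as a mean of double poles, and
  \<open>szego\<close> evaluates each of these after the means are exchanged.\<close>

lemma E_two_poles_small:
  assumes g: "g \<in> PF" and R: "R \<noteq> 0"
  obtains \<delta> :: real where "0 < \<delta>" "\<delta> \<le> 1"
    "E R (two_poles g (csc \<delta> W1) (csc \<delta> W2)) = PA (\<lambda>P. g (csc \<delta> (W1 + (W2 - W1) ** P)))"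
proof -
  define M where "M s Z = transpose (cof (Z - csc s W1)) ** (Z - csc s W2)" for s Z
  have cM: "continuous_on S (\<lambda>x. M (fst x) (snd x) - mat (N (snd x)))" for S
  proof (rule continuous_on_hc)
    fix i j
    show "continuous_on S (\<lambda>x. (M (fst x) (snd x) - mat (N (snd x))) $ i $ j)"
      unfolding M_def vector_minus_component matrix_mult_nth_2 mat_def vec_lambda_beta transpose_def
      by (cases "i = j"; simp; intro continuous_intros)
  qed
  have cof_mult: "transpose (cof Z) ** Z = mat (N Z)" for Z
    by (simp add: hc_eq_iff matrix_mult_nth_2 transpose_def cof_nth mat_def det_2 algebra_simps)
  obtain \<delta> where \<delta>: "0 < \<delta>" "\<delta> \<le> 1"
    "\<And>s Z. norm s \<le> \<delta> \<Longrightarrow> Z \<in> U2 R \<Longrightarrow> norm (M s Z - mat (N Z)) < R\<^sup>2 / 4"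
    using uniformly_small[OF compact_U2[of R] cM, of "R\<^sup>2 / 4"] R
    by (auto simp: M_def cof_mult)
  have near: "near_scalar (N Z) (M s Z)" if "norm s \<le> \<delta>" "Z \<in> U2 R" for s Z
    unfolding near_scalar_def
  proof (intro allI)
    fix i j
    have "norm ((M s Z - mat (N Z)) $ i $ j) \<le> norm (M s Z - mat (N Z))"
      using Finite_Cartesian_Product.norm_nth_le[of "(M s Z - mat (N Z)) $ i" j]
        Finite_Cartesian_Product.norm_nth_le[of "M s Z - mat (N Z)" i] by linarith
    then show "norm ((M s Z - mat (N Z)) $ i $ j) < norm (N Z) / 4"
      using \<delta>(3)[OF that] U2_N_norm[OF that(2)] by simp
  qed
  have seg: "N (Z - csc s (W1 + (W2 - W1) ** P)) = trp (M s Z) P" if "P \<in> P_set" for s Z P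
  proof -
    have e: "Z - csc s (W1 + (W2 - W1) ** P) = (Z - csc s W1) + ((Z - csc s W2) - (Z - csc s W1)) ** P"
      by (simp add: hc_eq_iff matrix_mult_nth_2 algebra_simps)
    show ?thesis unfolding e N_segment[OF that] M_def ..
  qed
  have nz: "N (Z - csc s (W1 + (W2 - W1) ** P)) \<noteq> 0" if "norm s \<le> \<delta>" "Z \<in> U2 R" "P \<in> P_set" for s Z P
    using near_scalar_trp[OF near[OF that(1,2)]] that(3) unfolding seg[OF that(3)]
    by (auto simp: Pr.carr_def cbox_Pair_eq)
  have ins: "csc \<delta> (W1 + (W2 - W1) ** P) \<in> inside R" if "P \<in> P_set" for P
    unfolding inside_def
  proof (intro CollectI ballI allI impI)
    fix Z \<zeta> assume *: "Z \<in> U2 R" "norm (\<zeta>::complex) \<le> 1"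
    have "csc \<zeta> (csc (complex_of_real \<delta>) V) = csc (\<zeta> * \<delta>) V" for V by (simp add: hc_eq_iff)
    moreover have "norm (\<zeta> * complex_of_real \<delta>) \<le> \<delta>"
      using * \<delta>(1) by (simp add: norm_mult mult_left_le_one_le)
    ultimately show "N (Z - csc \<zeta> (csc \<delta> (W1 + (W2 - W1) ** P))) \<noteq> 0"
      using nz[OF _ *(1) that] by simp
  qed
  have n\<delta>: "norm (complex_of_real \<delta>) \<le> \<delta>" using \<delta>(1) by simp
  have "E R (two_poles g (csc \<delta> W1) (csc \<delta> W2))
      = E R (\<lambda>Z. PA (\<lambda>P. (N Z)\<^sup>2 * (g Z * inverse ((N (Z - csc \<delta> (W1 + (W2 - W1) ** P)))\<^sup>2))))"
  proof (rule E_cong)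
    fix Z assume Z: "Z \<in> U2 R"
    have "PA (\<lambda>P. (N Z)\<^sup>2 * (g Z * inverse ((N (Z - csc \<delta> (W1 + (W2 - W1) ** P)))\<^sup>2)))
        = PA (\<lambda>P. ((N Z)\<^sup>2 * g Z) * (1 / (trp (M \<delta> Z) P)\<^sup>2))"
      by (rule Pr.avg_cong) (simp add: seg divide_inverse)
    also have "\<dots> = ((N Z)\<^sup>2 * g Z) * (1 / N (M \<delta> Z))"
      unfolding Pr.avg_cmult PA_inverse_square[OF near[OF n\<delta> Z]] ..
    also have "N (M \<delta> Z) = N (Z - csc \<delta> W1) * N (Z - csc \<delta> W2)"
      by (simp only: M_def det_mul N_transpose_cof)
    finally show "two_poles g (csc \<delta> W1) (csc \<delta> W2) Z
        = PA (\<lambda>P. (N Z)\<^sup>2 * (g Z * inverse ((N (Z - csc \<delta> (W1 + (W2 - W1) ** P)))\<^sup>2)))"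
      by (simp add: two_poles_def divide_inverse)
  qed
  also have "\<dots> = PA (\<lambda>P. E R (\<lambda>Z. (N Z)\<^sup>2 * (g Z * inverse ((N (Z - csc \<delta> (W1 + (W2 - W1) ** P)))\<^sup>2))))"
  proof (rule E_PA_swap)
    have "N (fst x - csc \<delta> (W1 + (W2 - W1) ** snd x)) \<noteq> 0" if "x \<in> U2 R \<times> P_set" for x
      using nz[OF n\<delta>] that by auto
    then show "continuous_on (U2 R \<times> P_set)
        (\<lambda>(Z, P). (N Z)\<^sup>2 * (g Z * inverse ((N (Z - csc \<delta> (W1 + (W2 - W1) ** P)))\<^sup>2)))"
      unfolding split_def by (intro continuous_intros PF_continuous[OF g]) auto
  qed
  also have "\<dots> = PA (\<lambda>P. g (csc \<delta> (W1 + (W2 - W1) ** P)))"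
    by (rule Pr.avg_cong) (rule szego[OF g ins R])
  finally show ?thesis using that \<delta> by blast
qed

section \<open>Scaling the poles from small to arbitrary position\<close>

lemma hol_two_poles:
  assumes G: "hol S g G" and "\<And>Z. Z \<in> S \<Longrightarrow> N (Z - W1) \<noteq> 0" "\<And>Z. Z \<in> S \<Longrightarrow> N (Z - W2) \<noteq> 0"
  shows "hol S (two_poles g W1 W2) (\<lambda>Z. csc ((N Z)\<^sup>2)
      (csc (g Z) (csc (inverse (N (Z - W1))) (csc (- inverse ((N (Z - W2))\<^sup>2)) (cof (Z - W2)))
        + csc (inverse (N (Z - W2))) (csc (- inverse ((N (Z - W1))\<^sup>2)) (cof (Z - W1))))
      + csc (inverse (N (Z - W1)) * inverse (N (Z - W2))) (G Z))
    + csc (g Z * (inverse (N (Z - W1)) * inverse (N (Z - W2)))) (csc (of_nat 2 * N Z ^ (2 - 1)) (cof Z)))"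
  unfolding two_poles_def[abs_def]
  by (intro hol_mult hol_power hol_N0 G hol_inverse hol_N assms(2,3))

text \<open>The integrand is homogeneous of degree d jointly in Z and the poles. Since the Euler
  field in Z averages to 0, the mean L(s) with poles s W1 and s W2 satisfies s L' = d L.\<close>

lemma E_two_poles_scaling:
  assumes g: "hol UNIV g G" "\<And>Z. pair (G Z) Z = of_nat d * g Z"
    and W: "W1 \<in> inside R" "W2 \<in> inside R" and R: "R \<noteq> 0" and \<delta>: "0 < \<delta>" "\<delta> \<le> (1::real)"
  shows "E R (two_poles g (csc \<delta> W1) (csc \<delta> W2)) = complex_of_real \<delta> ^ d * E R (two_poles g W1 W2)"
proof -
  define F where "F s = two_poles g (csc s W1) (csc s W2)" for s
  define D where "D s Z = (N Z)\<^sup>2 * (g Z *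
     (pair (cof (Z - csc s W1)) W1 * inverse ((N (Z - csc s W1))\<^sup>2) * inverse (N (Z - csc s W2))
     + pair (cof (Z - csc s W2)) W2 * inverse ((N (Z - csc s W2))\<^sup>2) * inverse (N (Z - csc s W1))))" for s Z
  define L where "L s = E R (F s)" for s
  have nz: "N (Z - csc s W1) \<noteq> 0" "N (Z - csc s W2) \<noteq> 0" if "s \<in> cball 0 1" "Z \<in> U2 R" for s Z
    using insideD[OF W(1) that(2)] insideD[OF W(2) that(2)] that(1) by simp_all
  define GF where "GF s Z = csc ((N Z)\<^sup>2)
      (csc (g Z) (csc (inverse (N (Z - csc s W1))) (csc (- inverse ((N (Z - csc s W2))\<^sup>2)) (cof (Z - csc s W2)))
        + csc (inverse (N (Z - csc s W2))) (csc (- inverse ((N (Z - csc s W1))\<^sup>2)) (cof (Z - csc s W1))))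
      + csc (inverse (N (Z - csc s W1)) * inverse (N (Z - csc s W2))) (G Z))
    + csc (g Z * (inverse (N (Z - csc s W1)) * inverse (N (Z - csc s W2)))) (csc (of_nat 2 * N Z ^ (2 - 1)) (cof Z))" for s Z
  have hF: "hol (U2 R) (F s) (GF s)" if "s \<in> cball 0 1" for s
    unfolding F_def GF_def
    by (rule hol_two_poles[OF hol_subset[OF g(1) subset_UNIV]]) (use nz[OF that] in auto)
  have dF: "((\<lambda>s. F s Z) has_field_derivative D s Z) (at s within cball 0 1)"
    if "s \<in> cball 0 1" "Z \<in> U2 R" for s Z
  proof -
    have e: "Z + csc (- s) W = Z - csc s W" for s W by (simp add: hc_eq_iff)
    have 1: "((\<lambda>s. N (Z - csc s W)) has_field_derivative pair (cof (Z - csc s W)) W * (- 1)) (at s within cball 0 1)" for W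
      unfolding e[symmetric]
      by (rule DERIV_chain2[of "\<lambda>c. N (Z + csc c W)"], rule has_derivative_line[where S = UNIV])
         (auto intro!: derivative_eq_intros holD(1)[OF hol_N0])
    show ?thesis
      unfolding F_def D_def two_poles_def
      using nz[OF that]
      by (auto intro!: derivative_eq_intros 1 simp: field_simps power2_eq_square)
  qed
  have cD: "continuous_on (cball 0 1 \<times> U2 R) (\<lambda>(s, Z). D s Z)"
  proof -
    have "N (snd x - csc (fst x) W1) \<noteq> 0" "N (snd x - csc (fst x) W2) \<noteq> 0" if "x \<in> cball 0 1 \<times> U2 R" for x
      using nz that by auto
    moreover have "continuous_on (cball 0 1 \<times> U2 R) (\<lambda>x. g (snd x))"
      by (rule continuous_on_compose2[OF holD(3)[OF g(1)]]) (auto intro!: continuous_intros)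
    ultimately show ?thesis
      unfolding split_def D_def by (intro continuous_intros) auto
  qed
  have dL: "(L has_field_derivative E R (D s)) (at s within cball 0 1)" if "s \<in> cball 0 1" for s
    unfolding L_def[abs_def]
    by (rule E_field_derivative[OF dF holD(3)[OF hF] cD that convex_cball]) auto
  have euler: "s * E R (D s) = of_nat d * L s" if s: "s \<in> cball 0 1" for s
  proof -
    define H where "H Z = of_nat d * F s Z - s * D s Z" for Z
    have "E R H = 0"
    proof -
      have "E R H = E R (\<lambda>Z. pair (GF s Z) Z)"
      proof (rule E_cong)
        fix Z assume Z: "Z \<in> U2 R"
        define x y where "x = N (Z - csc s W1)" and "y = N (Z - csc s W2)"
        define p q where "p = pair (cof (Z - csc s W1)) W1" and "q = pair (cof (Z - csc s W2)) W2"
        have xy: "x \<noteq> 0" "y \<noteq> 0" using nz[OF s Z] by (simp_all add: x_def y_def)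
        have "pair (cof (Z - csc s W)) Z = 2 * N (Z - csc s W) + s * pair (cof (Z - csc s W)) W" for W
          by (simp add: pair_def cof_nth det_2 algebra_simps)
        then have 1: "pair (cof (Z - csc s W1)) Z = 2 * x + s * p" "pair (cof (Z - csc s W2)) Z = 2 * y + s * q"
          by (simp_all add: x_def y_def p_def q_def)
        have 2: "pair (cof Z) Z = 2 * N Z" by (simp add: pair_def cof_nth det_2 algebra_simps)
        show "H Z = pair (GF s Z) Z"
          unfolding H_def F_def GF_def D_def two_poles_def pair_simps 1 2 g(2)
            x_def[symmetric] y_def[symmetric] p_def[symmetric] q_def[symmetric]
          using xy by (simp add: field_simps power2_eq_square)
      qed
      also have "\<dots> = 0" by (rule E_euler[OF hF[OF s]])
      finally show ?thesis .
    qed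
    moreover have "E R H = of_nat d * L s - s * E R (D s)"
      unfolding H_def L_def
      using U.slice_continuous[OF cD s] holD(3)[OF hF[OF s]]
      by (subst E_diff) (auto simp: E_cmult intro!: continuous_intros)
    ultimately show ?thesis by simp
  qed
  \<comment> \<open>The segment from \<delta> to 1 stays in the disc but avoids 0, so L(s) / s^d can
    be differentiated along it.\<close>
  define S where "S = closed_segment (complex_of_real \<delta>) 1"
  have S: "S \<subseteq> cball 0 1" "0 \<notin> S"
  proof -
    show "S \<subseteq> cball 0 1"
      unfolding S_def using \<delta> by (intro closed_segment_subset) auto
    have "Re x > 0" if "x \<in> S" for x
    proof -
      have "S \<subseteq> {x. Re x > 0}"
        unfolding S_def using \<delta> by (intro closed_segment_subset convex_halfspace_Re_gt) auto
      then show ?thesis using that by auto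
    qed
    then show "0 \<notin> S" by force
  qed
  have "((\<lambda>s. L s / s ^ d) has_field_derivative 0) (at s within S)" if s: "s \<in> S" for s
  proof -
    have s1: "s \<in> cball 0 1" "s \<noteq> 0" using s S by auto
    have "((\<lambda>s. L s / s ^ d) has_field_derivative
        (E R (D s) * s ^ d - L s * (of_nat d * s ^ (d - 1))) / (s ^ d * s ^ d)) (at s within S)"
      using s1 by (auto intro!: derivative_eq_intros has_field_derivative_subset[OF dL S(1)])
    moreover have "E R (D s) * s ^ d - L s * (of_nat d * s ^ (d - 1)) = 0"
    proof (cases d)
      case 0
      then show ?thesis using euler[OF s1(1)] s1(2) by simp
    next
      case (Suc m)
      have "E R (D s) * s ^ d - L s * (of_nat d * s ^ (d - 1)) = s ^ m * (s * E R (D s) - of_nat d * L s)"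
        by (simp add: Suc algebra_simps)
      then show ?thesis using euler[OF s1(1)] by simp
    qed
    ultimately show ?thesis by simp
  qed
  then obtain c where c: "\<And>s. s \<in> S \<Longrightarrow> L s / s ^ d = c"
    using has_field_derivative_zero_constant[of S "\<lambda>s. L s / s ^ d"] unfolding S_def by (metis convex_closed_segment)
  have "L (complex_of_real \<delta>) / complex_of_real \<delta> ^ d = L 1 / 1 ^ d"
    using c[of "complex_of_real \<delta>"] c[of 1] by (simp add: S_def)
  then have "L (complex_of_real \<delta>) = complex_of_real \<delta> ^ d * L 1"
    using \<delta> by (simp add: field_simps)
  then show ?thesis by (simp add: L_def F_def)
qed

lemma two_poles_continuous:
  assumes "g \<in> PF" "W1 \<in> inside R" "W2 \<in> inside R"
  shows "continuous_on (U2 R) (two_poles g W1 W2)"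
  unfolding two_poles_def[abs_def]
  using insideD1[OF assms(2)] insideD1[OF assms(3)]
  by (intro continuous_intros PF_continuous_on[OF assms(1)]) auto

text \<open>For a monomial of degree d both sides are multiplied by \<delta>^d when the poles are
  multiplied by \<delta>, and for some small \<delta> they agree.\<close>

theorem E_two_poles:
  assumes g: "g \<in> PF" and W: "W1 \<in> inside R" "W2 \<in> inside R" and R: "R \<noteq> 0"
  shows "E R (two_poles g W1 W2) = PA (\<lambda>P. g (W1 + (W2 - W1) ** P))"
  using g
proof induction
  case (mono c p q r s)
  let ?m = "\<lambda>Z::hc. c * Z$1$1 ^ p * Z$1$2 ^ q * Z$2$1 ^ r * Z$2$2 ^ s" and ?d = "p + q + r + s"
  obtain G where G0: "hol UNIV ?m G \<and> (\<forall>Z. pair (G Z) Z = of_nat ?d * ?m Z)"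
    using homog_mono[of p q r s c, unfolded homog_def] by (rule exE)
  then have G: "hol UNIV ?m G" "pair (G Z) Z = of_nat ?d * ?m Z" for Z by simp_all
  have m: "?m \<in> PF" by (rule PF.mono)
  obtain \<delta> :: real where \<delta>: "0 < \<delta>" "\<delta> \<le> 1"
    "E R (two_poles ?m (csc \<delta> W1) (csc \<delta> W2)) = PA (\<lambda>P. ?m (csc \<delta> (W1 + (W2 - W1) ** P)))"
    by (rule E_two_poles_small[OF m R])
  have "?m (csc x Z) = x ^ ?d * ?m Z" for x Z
    by (simp add: power_mult_distrib power_add ac_simps)
  then have "complex_of_real \<delta> ^ ?d * E R (two_poles ?m W1 W2)
      = complex_of_real \<delta> ^ ?d * PA (\<lambda>P. ?m (W1 + (W2 - W1) ** P))"
    using \<delta>(3) unfolding E_two_poles_scaling[OF G W R \<delta>(1,2)] by (simp only: Pr.avg_cmult)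
  then show ?case using \<delta>(1) by (simp only: mult_cancel_left) simp
next
  case (add f g)
  have c: "continuous_on P_set (\<lambda>P. h (W1 + (W2 - W1) ** P))" if "h \<in> PF" for h
    by (intro PF_continuous[OF that] continuous_intros)
  have "E R (two_poles (\<lambda>Z. f Z + g Z) W1 W2) = E R (\<lambda>Z. two_poles f W1 W2 Z + two_poles g W1 W2 Z)"
    by (rule E_cong) (simp add: two_poles_def algebra_simps)
  then show ?case
    using add by (simp add: E_add two_poles_continuous W Pr.avg_add c)
qed

section \<open>Moments of the Feynman projections\<close>

lemma circle_integral_cis:
  "((\<lambda>\<theta>. cis (of_int k * \<theta>)) has_integral (if k = 0 then 2 * pi else 0)) {0..2*pi}"
proof (cases "k = 0")
  case True
  then show ?thesis
    using has_integral_const_real[of "1::complex" 0 "2*pi"] by (auto simp: scaleR_conv_of_real)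
next
  case False
  have "((\<lambda>\<theta>. cis (of_int k * \<theta>)) has_integral
      cis (of_int k * (2 * pi)) / (\<i> * of_int k) - cis (of_int k * 0) / (\<i> * of_int k)) {0..2*pi}"
  proof (rule fundamental_theorem_of_calculus)
    fix \<theta> :: real
    show "((\<lambda>\<theta>. cis (of_int k * \<theta>) / (\<i> * of_int k)) has_vector_derivative cis (of_int k * \<theta>)) (at \<theta> within {0..2*pi})"
      using has_vector_derivative_divide[OF cis_vector_derivative[of "of_int k" \<theta>], of "\<i> * of_int k" "{0..2*pi}"] False
      by simp
  qed simp
  moreover have "cis (of_int k * (2 * pi)) = 1"
    using cis_multiple_2pi[of "of_int k"] by (simp add: mult.commute)
  ultimately show ?thesis using False by simp
qed

lemma circle_coeff:
  fixes Q :: "complex poly"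
  shows "((\<lambda>\<theta>. cis (- \<theta>) ^ k * poly Q (cis \<theta>)) has_integral 2 * pi * coeff Q k) {0..2*pi}"
proof -
  have e: "cis (- \<theta>) ^ k * poly Q (cis \<theta>) = (\<Sum>m\<le>degree Q + k. coeff Q m * cis (of_int (int m - int k) * \<theta>))" for \<theta>
  proof -
    have "poly Q (cis \<theta>) = (\<Sum>m\<le>degree Q + k. coeff Q m * cis \<theta> ^ m)"
      unfolding poly_altdef by (rule sum.mono_neutral_left) (auto simp: coeff_eq_0)
    moreover have "cis (- \<theta>) ^ k * cis \<theta> ^ m = cis (of_int (int m - int k) * \<theta>)" for m
      by (simp only: Complex.DeMoivre cis_mult) (simp add: algebra_simps)
    ultimately show ?thesis by (simp add: sum_distrib_left mult.left_commute)
  qed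
  have "((\<lambda>\<theta>. \<Sum>m\<le>degree Q + k. coeff Q m * cis (of_int (int m - int k) * \<theta>)) has_integral
      (\<Sum>m\<le>degree Q + k. coeff Q m * (if int m - int k = 0 then 2 * pi else 0))) {0..2*pi}"
    by (intro has_integral_sum has_integral_mult_right finite_atMost circle_integral_cis[THEN has_integral_eq_rhs]) auto
  moreover have "(\<Sum>m\<le>degree Q + k. coeff Q m * (if int m - int k = 0 then 2 * pi else 0)) = 2 * pi * coeff Q k"
    by (simp add: if_distrib[of complex_of_real] if_distrib[of "(*) _"] cong: if_cong)
  ultimately show ?thesis unfolding e by simp
qed

text \<open>The divided difference (x^n - y^n) / (x - y) as a polynomial, so that x = y is
  included.\<close>

definition divdiff :: "nat \<Rightarrow> complex \<Rightarrow> complex \<Rightarrow> complex" where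
  "divdiff n x y = (\<Sum>i<n. x ^ i * y ^ (n - Suc i))"

lemma divdiff_eq: "x ^ n - y ^ n = (x - y) * divdiff n x y"
  unfolding divdiff_def by (rule power_diff_sumr2[of x n y, unfolded mult.commute[of "y ^ _"]])

lemma divdiff_0 [simp]: "divdiff 0 x y = 0"
  by (simp add: divdiff_def)

lemma divdiff_Suc: "divdiff (Suc n) x y = x * divdiff n x y + y ^ n"
proof -
  have "divdiff (Suc n) x y = y ^ n + (\<Sum>i<n. x ^ Suc i * y ^ (n - Suc i))"
    unfolding divdiff_def by (subst sum.lessThan_Suc_shift) simp
  then show ?thesis by (simp add: divdiff_def sum_distrib_left ac_simps)
qed

lemma divdiff_same: "divdiff (Suc n) x x = of_nat (Suc n) * x ^ n"
  by (induction n) (simp_all add: divdiff_Suc algebra_simps)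

lemma integral_power_segment:
  "integral {0..1} (\<lambda>s. (y + complex_of_real s * (x - y)) ^ n) = divdiff (Suc n) x y / of_nat (Suc n)"
proof (cases "x = y")
  case True
  then show ?thesis by (simp add: divdiff_same del: of_nat_Suc)
next
  case False
  let ?F = "\<lambda>z. (y + z * (x - y)) ^ Suc n / (of_nat (Suc n) * (x - y))"
  have "((\<lambda>s. (y + complex_of_real s * (x - y)) ^ n) has_integral ?F (complex_of_real 1) - ?F (complex_of_real 0)) {0..1}"
  proof (rule fundamental_theorem_of_calculus)
    fix s :: real
    have "(?F has_field_derivative (y + complex_of_real s * (x - y)) ^ n) (at (complex_of_real s))"
      by (rule derivative_eq_intros refl | use False in \<open>simp del: of_nat_Suc power_Suc\<close>)+
    from has_vector_derivative_real_field[OF this]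
    show "((\<lambda>s. ?F (complex_of_real s)) has_vector_derivative (y + complex_of_real s * (x - y)) ^ n) (at s within {0..1})" .
  qed simp
  moreover have "?F (complex_of_real 1) - ?F (complex_of_real 0) = (x ^ Suc n - y ^ Suc n) / (of_nat (Suc n) * (x - y))"
    by (simp add: diff_divide_distrib del: power_Suc of_nat_Suc)
  ultimately show ?thesis
    unfolding divdiff_eq using False by (simp add: integral_unique del: power_Suc of_nat_Suc)
qed

definition dot :: "complex^2 \<Rightarrow> complex^2 \<Rightarrow> complex" where
  "dot c v = c$1 * v$1 + c$2 * v$2"

lemma homogenization:
  fixes a b x y :: complex
  assumes "degree Q \<le> n"
  shows "(\<Sum>k\<le>Suc n. coeff ([:a, b:] * Q) k * x ^ k * y ^ (Suc n - k))
    = (y * a + x * b) * (\<Sum>k\<le>n. coeff Q k * x ^ k * y ^ (n - k))"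
proof -
  have c: "coeff ([:a, b:] * Q) k = a * coeff Q k + b * (if k = 0 then 0 else coeff Q (k - 1))" for k
    by (cases k) (simp_all add: mult_pCons_left)
  have top: "coeff Q (Suc n) = 0" using assms by (simp add: coeff_eq_0)
  have "(\<Sum>k\<le>Suc n. coeff ([:a, b:] * Q) k * x ^ k * y ^ (Suc n - k))
    = (\<Sum>k\<le>Suc n. a * coeff Q k * x ^ k * y ^ (Suc n - k))
    + (\<Sum>k\<le>Suc n. b * (if k = 0 then 0 else coeff Q (k - 1)) * x ^ k * y ^ (Suc n - k))"
    unfolding c by (simp add: algebra_simps sum.distrib)
  also have "(\<Sum>k\<le>Suc n. a * coeff Q k * x ^ k * y ^ (Suc n - k)) = y * a * (\<Sum>k\<le>n. coeff Q k * x ^ k * y ^ (n - k))"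
    using top by (simp add: sum_distrib_left Suc_diff_le ac_simps)
  also have "(\<Sum>k\<le>Suc n. b * (if k = 0 then 0 else coeff Q (k - 1)) * x ^ k * y ^ (Suc n - k))
      = x * b * (\<Sum>k\<le>n. coeff Q k * x ^ k * y ^ (n - k))"
    by (subst sum.atMost_Suc_shift) (simp add: sum_distrib_left ac_simps)
  finally show ?thesis by (simp add: algebra_simps)
qed

text \<open>The coefficients of a product of i + j linear polynomials are those of a binary form,
  and that form factors in the same way at (c$1, c$2). The degree bound is carried along for the
  induction.\<close>

lemma homogenization_powers:
  fixes c v v' :: "complex^2"
  shows "degree ([:v$1, v$2:] ^ i * [:v'$1, v'$2:] ^ j) \<le> i + j \<and>
    (\<Sum>k\<le>i + j. coeff ([:v$1, v$2:] ^ i * [:v'$1, v'$2:] ^ j) k * c$2 ^ k * c$1 ^ (i + j - k)) = dot c v ^ i * dot c v' ^ j"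
proof (induction i)
  case 0
  show ?case
  proof (induction j)
    case (Suc j)
    have d: "degree ([:v'$1, v'$2:] ^ j) \<le> j" using Suc by simp
    have "degree ([:v'$1, v'$2:] * [:v'$1, v'$2:] ^ j) \<le> Suc j"
      using degree_mult_le[of "[:v'$1, v'$2:]" "[:v'$1, v'$2:] ^ j"] d by (simp split: if_splits)
    then show ?case
      using homogenization[OF d, of "v'$1" "v'$2" "c$2" "c$1"] Suc by (simp add: dot_def del: sum.atMost_Suc)
  qed simp
next
  case (Suc i)
  let ?Q = "[:v$1, v$2:] ^ i * [:v'$1, v'$2:] ^ j"
  have d: "degree ?Q \<le> i + j" using Suc by simp
  have "degree ([:v$1, v$2:] * ?Q) \<le> Suc (i + j)"
    using degree_mult_le[of "[:v$1, v$2:]" ?Q] d by (simp split: if_splits)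
  then show ?case
    using homogenization[OF d, of "v$1" "v$2" "c$2" "c$1"] Suc
    by (simp add: dot_def mult.assoc del: sum.atMost_Suc mult_pCons_left)
qed

text \<open>The integral over s yields powers of cis (- \<theta>) and the factor 1 / (i + j + 1);
  the circle integral picks the matching coefficients, which reassemble to a product of linear forms
  at c.\<close>

lemma PA_moment_same:
  "PA (\<lambda>P. pair (tens c v) P ^ i * pair (tens c v') P ^ j) = dot c v ^ i * dot c v' ^ j / of_nat (Suc (i + j))"
proof -
  let ?n = "i + j" and ?Q = "[:v$1, v$2:] ^ i * [:v'$1, v'$2:] ^ j"
  \<comment> \<open>\<open>proj (s, \<theta>)\<close> is the column (s, (1 - s) cis (- \<theta>))
    times the row (1, cis \<theta>), so the pairing splits into a factor linear in s and a
    polynomial in cis \<theta>.\<close>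
  have e: "pair (tens c v) (proj (s, \<theta>)) = (c$2 * cis (- \<theta>) + complex_of_real s * (c$1 - c$2 * cis (- \<theta>))) * (v$1 + v$2 * cis \<theta>)" for v s \<theta>
  proof -
    have "cis (- \<theta>) * cis \<theta> = 1" by (simp add: cis_mult)
    then show ?thesis
      unfolding pair_def tens_nth proj_nth fst_conv snd_conv of_real_diff of_real_1 by algebra
  qed
  have Q: "(v$1 + v$2 * z) ^ i * (v'$1 + v'$2 * z) ^ j = poly ?Q z" for z
    by (simp add: mult.commute)
  have "PA (\<lambda>P. pair (tens c v) P ^ i * pair (tens c v') P ^ j)
      = integral {0..2*pi} (\<lambda>\<theta>. integral {0..1} (\<lambda>s. pair (tens c v) (proj (s, \<theta>)) ^ i * pair (tens c v') (proj (s, \<theta>)) ^ j)) / (2 * pi)"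
    by (rule PA_iterated) (intro continuous_intros)
  also have "(\<lambda>\<theta>. integral {0..1} (\<lambda>s. pair (tens c v) (proj (s, \<theta>)) ^ i * pair (tens c v') (proj (s, \<theta>)) ^ j))
      = (\<lambda>\<theta>. \<Sum>k\<le>?n. (c$1 ^ (?n - k) * c$2 ^ k / of_nat (Suc ?n)) * (cis (- \<theta>) ^ k * poly ?Q (cis \<theta>)))"
  proof
    fix \<theta>
    define y where "y = c$2 * cis (- \<theta>)"
    have "(\<lambda>s. pair (tens c v) (proj (s, \<theta>)) ^ i * pair (tens c v') (proj (s, \<theta>)) ^ j)
        = (\<lambda>s. poly ?Q (cis \<theta>) * (y + complex_of_real s * (c$1 - y)) ^ ?n)"
      unfolding e Q[symmetric] y_def by (simp add: power_mult_distrib power_add ac_simps)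
    then have "integral {0..1} (\<lambda>s. pair (tens c v) (proj (s, \<theta>)) ^ i * pair (tens c v') (proj (s, \<theta>)) ^ j)
        = poly ?Q (cis \<theta>) * (divdiff (Suc ?n) (c$1) y / of_nat (Suc ?n))"
      by (simp only: Henstock_Kurzweil_Integration.integral_mult_right integral_power_segment)
    also have "divdiff (Suc ?n) (c$1) y = (\<Sum>k\<le>?n. c$1 ^ (?n - k) * y ^ k)"
      unfolding divdiff_def lessThan_Suc_atMost
      by (subst sum.nat_diff_reindex[symmetric, of _ "Suc ?n", unfolded lessThan_Suc_atMost]) simp
    finally show "integral {0..1} (\<lambda>s. pair (tens c v) (proj (s, \<theta>)) ^ i * pair (tens c v') (proj (s, \<theta>)) ^ j)
        = (\<Sum>k\<le>?n. (c$1 ^ (?n - k) * c$2 ^ k / of_nat (Suc ?n)) * (cis (- \<theta>) ^ k * poly ?Q (cis \<theta>)))"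
      by (simp add: y_def power_mult_distrib sum_distrib_left sum_divide_distrib sum_distrib_right ac_simps
          del: of_nat_Suc)
  qed
  also have "integral {0..2*pi} \<dots> = (\<Sum>k\<le>?n. (c$1 ^ (?n - k) * c$2 ^ k / of_nat (Suc ?n)) * (2 * pi * coeff ?Q k))"
    by (intro integral_unique has_integral_sum has_integral_mult_right circle_coeff) simp
  also have "\<dots> / (2 * pi) = (\<Sum>k\<le>?n. coeff ?Q k * c$2 ^ k * c$1 ^ (?n - k)) / of_nat (Suc ?n)"
    by (simp add: sum_divide_distrib sum_distrib_left ac_simps del: of_nat_Suc)
  also have "\<dots> = dot c v ^ i * dot c v' ^ j / of_nat (Suc ?n)"
    using homogenization_powers[of v i v' j c] by simp
  finally show ?thesis .
qed

text \<open>The coefficient of \<mu>^q in (X + \<mu> m')^p (m + \<mu> Y)^q, where M = m m'. For k >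
  q the binomial vanishes, so the truncated exponent \<open>q - k\<close> does no harm.\<close>

definition Rsum :: "nat \<Rightarrow> nat \<Rightarrow> complex \<Rightarrow> complex \<Rightarrow> complex \<Rightarrow> complex" where
  "Rsum p q X Y M = (\<Sum>k\<le>p. of_nat (p choose k) * of_nat (q choose k) * X ^ (p - k) * Y ^ (q - k) * M ^ k)"

lemma coeff_compare:
  fixes f g :: "nat \<Rightarrow> nat \<Rightarrow> complex"
  assumes "\<And>\<mu>. (\<Sum>k\<le>p. \<Sum>l\<le>q. f k l * \<mu> ^ (k + l)) = (\<Sum>k\<le>p. \<Sum>l\<le>q. g k l * \<mu> ^ (k + l))"
  shows "(\<Sum>k\<le>p. if k \<le> q then f k (q - k) else 0) = (\<Sum>k\<le>p. if k \<le> q then g k (q - k) else 0)"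
proof -
  define S where "S h = (\<Sum>k\<le>p. \<Sum>l\<le>q. monom (h k l) (k + l))" for h :: "nat \<Rightarrow> nat \<Rightarrow> complex"
  have c: "coeff (S h) q = (\<Sum>k\<le>p. if k \<le> q then h k (q - k) else 0)" for h
  proof -
    have "(\<Sum>l\<le>q. if k + l = q then h k l else 0) = (if k \<le> q then h k (q - k) else 0)" for k
    proof (cases "k \<le> q")
      case True
      then have e: "(\<lambda>l. if k + l = q then h k l else 0) = (\<lambda>l. if l = q - k then h k (q - k) else 0)"
        by (intro ext) auto
      show ?thesis unfolding e using True by simp
    qed (auto intro: sum.neutral)
    then show ?thesis by (simp add: S_def coeff_sum)
  qed
  have "poly (S f) = poly (S g)"
    using assms by (simp add: S_def poly_sum poly_monom fun_eq_iff)
  then have "S f = S g" by (simp add: poly_eq_poly_eq_iff)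
  then show ?thesis using c by metis
qed

text \<open>Polarization: \<open>PA_moment_same\<close> with c replaced by c + \<mu> c', compared at
  \<mu>^q. As P has rank one, all means on the left are equal, and Vandermonde's identity adds up
  their multiplicities to binom(p + q, p).\<close>

lemma PA_moment:
  "PA (\<lambda>P. pair (tens c v) P ^ p * pair (tens c' v') P ^ q)
    = Rsum p q (dot c v) (dot c' v') (dot c v' * dot c' v) / (of_nat (Suc (p + q)) * of_nat (p + q choose p))"
proof -
  define \<alpha> \<alpha>' \<beta> \<beta>' where "\<alpha> P = pair (tens c v) P" and "\<alpha>' P = pair (tens c' v) P"
    and "\<beta> P = pair (tens c v') P" and "\<beta>' P = pair (tens c' v') P" for P
  have cont: "continuous_on S \<alpha>" "continuous_on S \<alpha>'" "continuous_on S \<beta>" "continuous_on S \<beta>'" for S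
    unfolding \<alpha>_def[abs_def] \<alpha>'_def[abs_def] \<beta>_def[abs_def] \<beta>'_def[abs_def] by (intro continuous_intros)+
  define X Y m m' where "X = dot c v" and "Y = dot c' v'" and "m = dot c v'" and "m' = dot c' v"
  define n where "n = p + q"
  have expand: "(a + \<mu> * a') ^ p * (b + \<mu> * b') ^ q
      = (\<Sum>k\<le>p. \<Sum>l\<le>q. (of_nat (p choose k) * of_nat (q choose l) * (a ^ (p - k) * a' ^ k * b ^ (q - l) * b' ^ l)) * \<mu> ^ (k + l))"
    for a a' b b' \<mu> :: complex
    unfolding add.commute[of a] add.commute[of b] binomial_ring sum_product
    by (simp add: power_mult_distrib power_add ac_simps)
  have "(\<Sum>k\<le>p. if k \<le> q then of_nat (p choose k) * of_nat (q choose (q - k)) * PA (\<lambda>P. \<alpha> P ^ (p - k) * \<alpha>' P ^ k * \<beta> P ^ (q - (q - k)) * \<beta>' P ^ (q - k)) else 0)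
    = (\<Sum>k\<le>p. if k \<le> q then of_nat (p choose k) * of_nat (q choose (q - k)) * (X ^ (p - k) * m' ^ k * m ^ (q - (q - k)) * Y ^ (q - k)) / of_nat (Suc n) else 0)"
  proof (rule coeff_compare)
    fix \<mu> :: complex
    define D where "D = (\<chi> i. c $ i + \<mu> * c' $ i)"
    have D: "pair (tens D v) P = \<alpha> P + \<mu> * \<alpha>' P" "pair (tens D v') P = \<beta> P + \<mu> * \<beta>' P" for P
      by (simp_all add: pair_def D_def \<alpha>_def \<alpha>'_def \<beta>_def \<beta>'_def algebra_simps)
    have d: "dot D v = X + \<mu> * m'" "dot D v' = m + \<mu> * Y"
      by (simp_all add: dot_def D_def X_def Y_def m_def m'_def algebra_simps)
    have "(\<Sum>k\<le>p. \<Sum>l\<le>q. (of_nat (p choose k) * of_nat (q choose l) * PA (\<lambda>P. \<alpha> P ^ (p - k) * \<alpha>' P ^ k * \<beta> P ^ (q - l) * \<beta>' P ^ l)) * \<mu> ^ (k + l))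
       = PA (\<lambda>P. \<Sum>k\<le>p. \<Sum>l\<le>q. (of_nat (p choose k) * of_nat (q choose l) * \<mu> ^ (k + l)) * (\<alpha> P ^ (p - k) * \<alpha>' P ^ k * \<beta> P ^ (q - l) * \<beta>' P ^ l))"
    proof -
      define T where "T k l P = \<alpha> P ^ (p - k) * \<alpha>' P ^ k * \<beta> P ^ (q - l) * \<beta>' P ^ l" for k l P
      have cT: "continuous_on P_set (T k l)" for k l
        unfolding T_def by (intro continuous_intros cont)
      have e: "PA (\<lambda>P. \<Sum>k\<le>p. \<Sum>l\<le>q. u k l * T k l P) = (\<Sum>k\<le>p. \<Sum>l\<le>q. u k l * PA (T k l))" for u
        by (simp add: Pr.avg_sum Pr.avg_cmult continuous_on_sum continuous_on_mult_left cT)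
      show ?thesis unfolding T_def[symmetric] e by (simp add: ac_simps)
    qed
    also have "\<dots> = PA (\<lambda>P. pair (tens D v) P ^ p * pair (tens D v') P ^ q)"
      unfolding D expand by (simp add: ac_simps)
    also have "\<dots> = (X + \<mu> * m') ^ p * (m + \<mu> * Y) ^ q / of_nat (Suc n)"
      unfolding PA_moment_same d n_def ..
    finally show "(\<Sum>k\<le>p. \<Sum>l\<le>q. (of_nat (p choose k) * of_nat (q choose l) * PA (\<lambda>P. \<alpha> P ^ (p - k) * \<alpha>' P ^ k * \<beta> P ^ (q - l) * \<beta>' P ^ l)) * \<mu> ^ (k + l))
      = (\<Sum>k\<le>p. \<Sum>l\<le>q. (of_nat (p choose k) * of_nat (q choose l) * (X ^ (p - k) * m' ^ k * m ^ (q - l) * Y ^ l) / of_nat (Suc n)) * \<mu> ^ (k + l))"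
      unfolding expand by (simp add: sum_divide_distrib)
  qed
  moreover have "PA (\<lambda>P. \<alpha> P ^ (p - k) * \<alpha>' P ^ k * \<beta> P ^ (q - (q - k)) * \<beta>' P ^ (q - k)) = PA (\<lambda>P. \<alpha> P ^ p * \<beta>' P ^ q)"
    if "k \<le> p" "k \<le> q" for k
  proof (rule Pr.avg_cong)
    fix P assume P: "P \<in> P_set"
    have r: "\<alpha>' P * \<beta> P = \<alpha> P * \<beta>' P"
      using P_set_rank_one[OF P] unfolding \<alpha>_def \<alpha>'_def \<beta>_def \<beta>'_def pair_def tens_nth by algebra
    have "\<alpha> P ^ (p - k) * \<alpha>' P ^ k * \<beta> P ^ (q - (q - k)) * \<beta>' P ^ (q - k)
        = \<alpha> P ^ (p - k) * (\<alpha>' P * \<beta> P) ^ k * \<beta>' P ^ (q - k)"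
      using that by (simp add: power_mult_distrib)
    also have "\<dots> = (\<alpha> P ^ (p - k) * \<alpha> P ^ k) * (\<beta>' P ^ k * \<beta>' P ^ (q - k))"
      unfolding r by (simp add: power_mult_distrib ac_simps)
    also have "\<dots> = \<alpha> P ^ p * \<beta>' P ^ q"
      using that by (simp flip: power_add)
    finally show "\<alpha> P ^ (p - k) * \<alpha>' P ^ k * \<beta> P ^ (q - (q - k)) * \<beta>' P ^ (q - k) = \<alpha> P ^ p * \<beta>' P ^ q" .
  qed
  ultimately have "(\<Sum>k\<le>p. of_nat ((p choose k) * (q choose k)) * PA (\<lambda>P. \<alpha> P ^ p * \<beta>' P ^ q))
    = (\<Sum>k\<le>p. of_nat (p choose k) * of_nat (q choose k) * X ^ (p - k) * Y ^ (q - k) * (m * m') ^ k / of_nat (Suc n))"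
  proof -
    assume A: "(\<Sum>k\<le>p. if k \<le> q then of_nat (p choose k) * of_nat (q choose (q - k)) * PA (\<lambda>P. \<alpha> P ^ (p - k) * \<alpha>' P ^ k * \<beta> P ^ (q - (q - k)) * \<beta>' P ^ (q - k)) else 0)
    = (\<Sum>k\<le>p. if k \<le> q then of_nat (p choose k) * of_nat (q choose (q - k)) * (X ^ (p - k) * m' ^ k * m ^ (q - (q - k)) * Y ^ (q - k)) / of_nat (Suc n) else 0)"
     and B: "\<And>k. k \<le> p \<Longrightarrow> k \<le> q \<Longrightarrow> PA (\<lambda>P. \<alpha> P ^ (p - k) * \<alpha>' P ^ k * \<beta> P ^ (q - (q - k)) * \<beta>' P ^ (q - k)) = PA (\<lambda>P. \<alpha> P ^ p * \<beta>' P ^ q)"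
    have "(\<Sum>k\<le>p. of_nat ((p choose k) * (q choose k)) * PA (\<lambda>P. \<alpha> P ^ p * \<beta>' P ^ q))
      = (\<Sum>k\<le>p. if k \<le> q then of_nat (p choose k) * of_nat (q choose (q - k)) * PA (\<lambda>P. \<alpha> P ^ (p - k) * \<alpha>' P ^ k * \<beta> P ^ (q - (q - k)) * \<beta>' P ^ (q - k)) else 0)"
      by (rule sum.cong) (use B in \<open>auto simp: binomial_symmetric[symmetric] binomial_eq_0\<close>)
    also have "\<dots> = (\<Sum>k\<le>p. of_nat (p choose k) * of_nat (q choose k) * X ^ (p - k) * Y ^ (q - k) * (m * m') ^ k / of_nat (Suc n))"
      unfolding A by (rule sum.cong) (auto simp: binomial_symmetric[symmetric] binomial_eq_0 power_mult_distrib simp del: of_nat_Suc)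
    finally show ?thesis .
  qed
  moreover have "(\<Sum>k\<le>p. of_nat ((p choose k) * (q choose k)) * PA (\<lambda>P. \<alpha> P ^ p * \<beta>' P ^ q))
      = of_nat (n choose p) * PA (\<lambda>P. \<alpha> P ^ p * \<beta>' P ^ q)"
  proof -
    have "(\<Sum>k\<le>p. (p choose k) * (q choose k)) = (\<Sum>k\<le>p. (q choose k) * (p choose (p - k)))"
      by (rule sum.cong) (auto simp: binomial_symmetric[symmetric])
    also have "\<dots> = n choose p"
      using vandermonde[of q p p] by (simp add: n_def add.commute)
    finally show ?thesis by (simp only: of_nat_sum[symmetric] sum_distrib_right[symmetric])
  qed
  ultimately have "of_nat (n choose p) * PA (\<lambda>P. \<alpha> P ^ p * \<beta>' P ^ q) = Rsum p q X Y (m * m') / of_nat (Suc n)"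
    by (simp add: Rsum_def sum_divide_distrib)
  moreover have "(of_nat (n choose p) :: complex) \<noteq> 0" by (simp add: n_def)
  ultimately have "PA (\<lambda>P. \<alpha> P ^ p * \<beta>' P ^ q) = Rsum p q X Y (m * m') / (of_nat (Suc n) * of_nat (n choose p))"
    by (simp add: field_simps del: of_nat_Suc)
  then show ?thesis by (simp add: \<alpha>_def \<beta>'_def X_def Y_def m_def m'_def n_def)
qed

section \<open>The integral over the first external point\<close>

text \<open>
  \<open>zker T u v \<zeta> z Z\<close> is \<open>N(Z) N(1 - (\<zeta> Z\<^sup>-\<^sup>1 + z v u\<^sup>T) T)\<close>, written without inverses.
\<close>

definition zker :: "hc \<Rightarrow> complex^2 \<Rightarrow> complex^2 \<Rightarrow> complex \<Rightarrow> complex \<Rightarrow> hc \<Rightarrow> complex" where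
  "zker T u v \<zeta> z Z = N (Z - csc \<zeta> T) - z * (N Z * pair (tens u v) T - \<zeta> * N T * pair (tens u v) Z)"

definition zker_grad :: "hc \<Rightarrow> complex^2 \<Rightarrow> complex^2 \<Rightarrow> complex \<Rightarrow> complex \<Rightarrow> hc \<Rightarrow> hc" where
  "zker_grad T u v \<zeta> z Z = cof (Z - csc \<zeta> T)
     - csc z (csc (pair (tens u v) T) (cof Z) - csc (\<zeta> * N T) (tens u v))"

lemma hol_zker: "hol S (zker T u v \<zeta> z) (zker_grad T u v \<zeta> z)"
proof -
  have "hol S (\<lambda>Z. N (Z - csc \<zeta> T) - z * (N Z * pair (tens u v) T - \<zeta> * N T * pair (tens u v) Z))
    (\<lambda>Z. cof (Z - csc \<zeta> T) - (csc z ((csc (N Z) 0 + csc (pair (tens u v) T) (cof Z))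
      - (csc (\<zeta> * N T) (tens u v) + csc (pair (tens u v) Z) 0))
      + csc (N Z * pair (tens u v) T - \<zeta> * N T * pair (tens u v) Z) 0))"
    by (intro hol_diff hol_mult hol_const hol_N hol_N0 hol_pair0)
  then show ?thesis
    by (rule hol_cong) (simp_all add: zker_def zker_grad_def hc_eq_iff)
qed

lemma continuous_on_zker [continuous_intros]:
  assumes "continuous_on S f" "continuous_on S g" "continuous_on S h"
  shows "continuous_on S (\<lambda>x. zker T u v (f x) (g x) (h x))"
  unfolding zker_def by (intro continuous_intros assms)

lemma zker_euler:
  "pair (zker_grad T u v \<zeta> z Z) Z = 2 * zker T u v \<zeta> z Z
    + \<zeta> * (pair (cof (Z - csc \<zeta> T)) T - z * (N T * pair (tens u v) Z))"
  by (simp add: zker_def zker_grad_def pair_def cof_nth det_2 algebra_simps)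

text \<open>The last summand is minus the derivative of \<open>zker\<close> in z: the flow moves z,
  apart from its effect on the factor N(Z).\<close>

lemma zker_flow:
  "pair (zker_grad T u v 1 z Z) (Z ** tens v u ** Z) = pair (tens u v) Z * zker T u v 1 z Z
    + (N Z * pair (tens u v) T - N T * pair (tens u v) Z)"
  unfolding zker_def zker_grad_def pair_def cof_nth det_2 matrix_mult_nth_2 tens_nth csc_nth
    vector_minus_component mult_1
  by algebra

text \<open>At \<zeta> = 1, z = 0 this is the rational kernel of the Z1 integral. The parameter
  \<zeta> contracts W, T1, T2 to the origin, and z generates the powers of u^T Z v.\<close>

definition zprod :: "hc \<Rightarrow> hc \<Rightarrow> hc \<Rightarrow> complex^2 \<Rightarrow> complex^2 \<Rightarrow> complex \<Rightarrow> complex \<Rightarrow> hc \<Rightarrow> complex" where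
  "zprod W T1 T2 u v \<zeta> z Z = N Z * (zker W u v \<zeta> z Z * (inverse (zker T1 u v \<zeta> z Z) * inverse (zker T2 u v \<zeta> z Z)))"

definition zprod_grad :: "hc \<Rightarrow> hc \<Rightarrow> hc \<Rightarrow> complex^2 \<Rightarrow> complex^2 \<Rightarrow> complex \<Rightarrow> complex \<Rightarrow> hc \<Rightarrow> hc" where
  "zprod_grad W T1 T2 u v \<zeta> z Z =
    csc (N Z) (csc (zker W u v \<zeta> z Z)
        (csc (inverse (zker T1 u v \<zeta> z Z)) (csc (- inverse ((zker T2 u v \<zeta> z Z)\<^sup>2)) (zker_grad T2 u v \<zeta> z Z))
       + csc (inverse (zker T2 u v \<zeta> z Z)) (csc (- inverse ((zker T1 u v \<zeta> z Z)\<^sup>2)) (zker_grad T1 u v \<zeta> z Z)))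
      + csc (inverse (zker T1 u v \<zeta> z Z) * inverse (zker T2 u v \<zeta> z Z)) (zker_grad W u v \<zeta> z Z))
    + csc (zker W u v \<zeta> z Z * (inverse (zker T1 u v \<zeta> z Z) * inverse (zker T2 u v \<zeta> z Z))) (cof Z)"

lemma hol_zprod:
  assumes "\<And>Z. Z \<in> S \<Longrightarrow> zker T1 u v \<zeta> z Z \<noteq> 0" "\<And>Z. Z \<in> S \<Longrightarrow> zker T2 u v \<zeta> z Z \<noteq> 0"
  shows "hol S (zprod W T1 T2 u v \<zeta> z) (zprod_grad W T1 T2 u v \<zeta> z)"
  unfolding zprod_def[abs_def] zprod_grad_def[abs_def]
  by (intro hol_mult hol_N0 hol_zker hol_inverse assms)

text \<open>Shared by the derivatives in \<zeta> and in z; n stands for N Z, which depends on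
  neither.\<close>

definition zprod_deriv :: "complex \<Rightarrow> complex \<Rightarrow> complex \<Rightarrow> complex \<Rightarrow> complex \<Rightarrow> complex \<Rightarrow> complex \<Rightarrow> complex" where
  "zprod_deriv n w x y w' x' y' = n * (w' * (inverse x * inverse y)
    - w * (x' * inverse (x\<^sup>2) * inverse y + y' * inverse (y\<^sup>2) * inverse x))"

lemma zprod_has_derivative:
  assumes "(w has_field_derivative w') (at s within S)" "(x has_field_derivative x') (at s within S)"
    "(y has_field_derivative y') (at s within S)" "x s \<noteq> 0" "y s \<noteq> 0"
  shows "((\<lambda>s. n * (w s * (inverse (x s) * inverse (y s)))) has_field_derivative
    zprod_deriv n (w s) (x s) (y s) w' x' y') (at s within S)"
  unfolding zprod_deriv_def using assms
  by (auto intro!: derivative_eq_intros simp: field_simps power2_eq_square)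

lemma zker_deriv_\<zeta>:
  "((\<lambda>\<zeta>. zker T u v \<zeta> z Z) has_field_derivative
    - (pair (cof (Z - csc \<zeta> T)) T - z * (N T * pair (tens u v) Z))) (at \<zeta> within S)"
proof -
  have e: "Z + csc (- s) T = Z - csc s T" for s by (simp add: hc_eq_iff)
  have 1: "((\<lambda>s. N (Z - csc s T)) has_field_derivative pair (cof (Z - csc \<zeta> T)) T * (- 1)) (at \<zeta> within S)"
    unfolding e[symmetric]
    by (rule DERIV_chain2[of "\<lambda>c. N (Z + csc c T)"], rule has_derivative_line[where S = UNIV])
       (auto intro!: derivative_eq_intros holD(1)[OF hol_N0])
  show ?thesis
    unfolding zker_def by (auto intro!: derivative_eq_intros 1)
qed

lemma zker_deriv_z:
  "((\<lambda>z. zker T u v \<zeta> z Z) has_field_derivative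
    - (N Z * pair (tens u v) T - \<zeta> * N T * pair (tens u v) Z)) (at z within S)"
  unfolding zker_def by (auto intro!: derivative_eq_intros)

text \<open>The kernel is homogeneous of degree 0 jointly in Z and \<zeta>, so its mean does not
  depend on \<zeta>; at \<zeta> = 0 it is constant in Z.\<close>

lemma zprod_mean:
  assumes R: "R \<noteq> 0"
    and nz: "\<And>\<zeta> Z T. \<zeta> \<in> cball 0 1 \<Longrightarrow> Z \<in> U2 R \<Longrightarrow> T \<in> {T1, T2} \<Longrightarrow> zker T u v \<zeta> z Z \<noteq> 0"
  shows "E R (zprod W T1 T2 u v 1 z) = (1 - z * pair (tens u v) W)
      * (inverse (1 - z * pair (tens u v) T1) * inverse (1 - z * pair (tens u v) T2))"
proof -
  define e where "e T \<zeta> Z = - (pair (cof (Z - csc \<zeta> T)) T - z * (N T * pair (tens u v) Z))" for T \<zeta> Z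
  define D where "D \<zeta> Z = zprod_deriv (N Z) (zker W u v \<zeta> z Z) (zker T1 u v \<zeta> z Z) (zker T2 u v \<zeta> z Z)
    (e W \<zeta> Z) (e T1 \<zeta> Z) (e T2 \<zeta> Z)" for \<zeta> Z
  define L where "L \<zeta> = E R (zprod W T1 T2 u v \<zeta> z)" for \<zeta>
  have h: "hol (U2 R) (zprod W T1 T2 u v \<zeta> z) (zprod_grad W T1 T2 u v \<zeta> z)" if "\<zeta> \<in> cball 0 1" for \<zeta>
    by (rule hol_zprod) (use nz[OF that] in auto)
  have cD: "continuous_on (cball 0 1 \<times> U2 R) (\<lambda>(\<zeta>, Z). D \<zeta> Z)"
  proof -
    have "zker T1 u v (fst x) z (snd x) \<noteq> 0" "zker T2 u v (fst x) z (snd x) \<noteq> 0"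
      if "x \<in> cball 0 1 \<times> U2 R" for x using nz that by auto
    then show ?thesis
      unfolding split_def D_def zprod_deriv_def e_def by (intro continuous_intros) auto
  qed
  have dL: "(L has_field_derivative E R (D \<zeta>)) (at \<zeta> within cball 0 1)" if "\<zeta> \<in> cball 0 1" for \<zeta>
    unfolding L_def[abs_def]
  proof (rule E_field_derivative[OF _ holD(3)[OF h] cD that convex_cball])
    fix \<zeta> Z assume *: "\<zeta> \<in> cball (0::complex) 1" "Z \<in> U2 R"
    show "((\<lambda>\<zeta>. zprod W T1 T2 u v \<zeta> z Z) has_field_derivative D \<zeta> Z) (at \<zeta> within cball 0 1)"
      unfolding zprod_def D_def e_def
      by (intro zprod_has_derivative zker_deriv_\<zeta>) (use nz[OF *] in auto)
  qed
  have euler: "\<zeta> * E R (D \<zeta>) = 0" if \<zeta>: "\<zeta> \<in> cball 0 1" for \<zeta>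
  proof -
    have "- \<zeta> * E R (D \<zeta>) = E R (\<lambda>Z. - \<zeta> * D \<zeta> Z)" by (rule E_cmult[symmetric])
    also have "\<dots> = E R (\<lambda>Z. pair (zprod_grad W T1 T2 u v \<zeta> z Z) Z)"
    proof (rule E_cong)
      fix Z assume Z: "Z \<in> U2 R"
      have c: "pair (cof Z) Z = 2 * N Z" by (simp add: pair_def cof_nth det_2 algebra_simps)
      have k: "pair (zker_grad T u v \<zeta> z Z) Z = 2 * zker T u v \<zeta> z Z - \<zeta> * e T \<zeta> Z" for T
        by (simp add: zker_euler e_def algebra_simps)
      have "zker T1 u v \<zeta> z Z \<noteq> 0" "zker T2 u v \<zeta> z Z \<noteq> 0" using nz[OF \<zeta> Z] by auto
      then show "- \<zeta> * D \<zeta> Z = pair (zprod_grad W T1 T2 u v \<zeta> z Z) Z"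
        unfolding D_def zprod_deriv_def zprod_grad_def pair_simps k c
        by (simp add: field_simps power2_eq_square)
    qed
    also have "\<dots> = 0" by (rule E_euler[OF h[OF \<zeta>]])
    finally show ?thesis by simp
  qed
  have "L 1 = L 0"
  proof (rule has_derivative_zero_unique_strong_convex[of "cball (0::complex) 1" "{0}" L 0 "L 0" 1])
    show "continuous_on (cball 0 1) L"
      using dL by (intro DERIV_continuous_on) auto
    fix \<zeta> :: complex assume \<zeta>: "\<zeta> \<in> cball 0 1 - {0}"
    then have "E R (D \<zeta>) = 0" using euler[of \<zeta>] by simp
    moreover have "(*) (0 :: complex) = (\<lambda>h. 0)" by (intro ext) simp
    ultimately show "(L has_derivative (\<lambda>h. 0)) (at \<zeta> within cball 0 1)"
      using dL[of \<zeta>] \<zeta> unfolding has_field_derivative_def by auto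
  qed auto
  also have "L 0 = E R (\<lambda>Z. (1 - z * pair (tens u v) W)
      * (inverse (1 - z * pair (tens u v) T1) * inverse (1 - z * pair (tens u v) T2)))"
    unfolding L_def
  proof (rule E_cong)
    fix Z assume Z: "Z \<in> U2 R"
    have k: "zker T u v 0 z Z = N Z * (1 - z * pair (tens u v) T)" for T
      by (simp add: zker_def algebra_simps)
    show "zprod W T1 T2 u v 0 z Z = (1 - z * pair (tens u v) W)
      * (inverse (1 - z * pair (tens u v) T1) * inverse (1 - z * pair (tens u v) T2))"
    proof -
      have "n * (n * w * (inverse (n * x) * inverse (n * y))) = w * (inverse x * inverse y)"
        if "n \<noteq> 0" for n w x y :: complex
        using that by (simp add: field_simps)
      then show ?thesis unfolding zprod_def k using U2_N_nonzero[OF Z R] by blast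
    qed
  qed
  finally show ?thesis using R by (simp add: L_def E_const)
qed

text \<open>The product of two Taylor coefficients at z: that of order i of 1 / (1 - a z) and that
  of order j of 1 / (1 - b z).\<close>

definition cterm :: "complex \<Rightarrow> complex \<Rightarrow> nat \<Rightarrow> nat \<Rightarrow> complex \<Rightarrow> complex" where
  "cterm a b i j z = (a ^ i * inverse (1 - a * z) ^ Suc i) * (b ^ j * inverse (1 - b * z) ^ Suc j)"

lemma cterm_deriv:
  assumes "1 - a * z \<noteq> 0" "1 - b * z \<noteq> 0"
  shows "(cterm a b i j has_field_derivative
    of_nat (Suc i) * cterm a b (Suc i) j z + of_nat (Suc j) * cterm a b i (Suc j) z) (at z)"
proof -
  have d: "((\<lambda>z. a ^ i * inverse (1 - a * z) ^ Suc i) has_field_derivative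
      of_nat (Suc i) * (a ^ Suc i * inverse (1 - a * z) ^ Suc (Suc i))) (at z)" if "1 - a * z \<noteq> 0" for a i
  proof -
    have "((\<lambda>z. inverse (1 - a * z)) has_field_derivative a * (inverse (1 - a * z))\<^sup>2) (at z)"
      using that by (auto intro!: derivative_eq_intros simp: power2_eq_square)
    from DERIV_cmult[OF DERIV_power_Suc[OF this, of i], of "a ^ i"] show ?thesis
      by (rule DERIV_cong) (simp add: power2_eq_square algebra_simps)
  qed
  show ?thesis
    unfolding cterm_def[abs_def]
    by (rule DERIV_cong[OF DERIV_mult[OF d[OF assms(1)] d[OF assms(2)]]]) (simp add: algebra_simps)
qed

text \<open>For m > 0 this is the Taylor coefficient at z of order m - 1 of 1 / ((1 - a z) (1 - b
  z)); at z = 0 it becomes \<open>divdiff m a b\<close>.\<close>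

definition csum :: "complex \<Rightarrow> complex \<Rightarrow> nat \<Rightarrow> complex \<Rightarrow> complex" where
  "csum a b m z = (\<Sum>i<m. cterm a b i (m - Suc i) z)"

lemma csum_deriv:
  assumes "1 - a * z \<noteq> 0" "1 - b * z \<noteq> 0"
  shows "(csum a b m has_field_derivative of_nat m * csum a b (Suc m) z) (at z)"
proof -
  have "(csum a b m has_field_derivative (\<Sum>i<m. of_nat (Suc i) * cterm a b (Suc i) (m - Suc i) z
      + of_nat (Suc (m - Suc i)) * cterm a b i (Suc (m - Suc i)) z)) (at z)"
    unfolding csum_def[abs_def] by (intro DERIV_sum cterm_deriv assms)
  also have "(\<Sum>i<m. of_nat (Suc i) * cterm a b (Suc i) (m - Suc i) z
      + of_nat (Suc (m - Suc i)) * cterm a b i (Suc (m - Suc i)) z) = of_nat m * csum a b (Suc m) z"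
  proof -
    have "(\<Sum>i<m. of_nat (Suc i) * cterm a b (Suc i) (m - Suc i) z) = (\<Sum>i<Suc m. of_nat i * cterm a b i (m - i) z)"
      by (subst sum.lessThan_Suc_shift) simp
    moreover have "(\<Sum>i<m. of_nat (Suc (m - Suc i)) * cterm a b i (Suc (m - Suc i)) z)
        = (\<Sum>i<Suc m. of_nat (m - i) * cterm a b i (m - i) z)"
      by (simp add: Suc_diff_Suc del: of_nat_Suc)
    moreover have "(\<Sum>i<Suc m. of_nat i * cterm a b i (m - i) z) + (\<Sum>i<Suc m. of_nat (m - i) * cterm a b i (m - i) z)
        = (\<Sum>i<Suc m. of_nat m * cterm a b i (m - i) z)"
      unfolding sum.distrib[symmetric]
      by (rule sum.cong) (auto simp: distrib_right[symmetric] of_nat_add[symmetric] simp del: of_nat_add)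
    ultimately show ?thesis
      by (simp add: sum.distrib csum_def sum_distrib_left del: sum.lessThan_Suc)
  qed
  finally show ?thesis .
qed

text \<open>Let A_m(z) be m + 1 times the mean of \<sigma>^m times the kernel.
  \<open>E_inverse_stokes\<close> gives A_m' = (m + 1) A_(m+1). The Taylor coefficients \<beta>_m of
  (1 - w z) / ((1 - a z) (1 - b z)) obey the same rule, and A_0 = \<beta>_0 is
  \<open>zprod_mean\<close>. The claim is A_p = \<beta>_p at z = 0.\<close>

theorem E_plane_wave:
  assumes T: "T1 \<in> inside R" "T2 \<in> inside R" and R: "R \<noteq> 0"
  shows "of_nat (Suc p) * E R (\<lambda>Z. pair (tens u v) Z ^ p * (N Z * (N (Z - W) * (inverse (N (Z - T1)) * inverse (N (Z - T2))))))
    = divdiff (Suc p) (pair (tens u v) T1) (pair (tens u v) T2)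
      - pair (tens u v) W * divdiff p (pair (tens u v) T1) (pair (tens u v) T2)"
proof -
  define \<sigma> where "\<sigma> = pair (tens u v)"
  define a b w where "a = \<sigma> T1" and "b = \<sigma> T2" and "w = \<sigma> W"
  \<comment> \<open>At z = 0 the kernel is N(Z - \<zeta> T), nonzero by \<open>inside\<close>;
    compactness keeps it nonzero for small z, uniformly in \<zeta> and Z.\<close>
  have small: "\<exists>\<delta>>0. \<forall>z \<zeta> Z. norm z \<le> \<delta> \<longrightarrow> \<zeta> \<in> cball 0 1 \<longrightarrow> Z \<in> U2 R \<longrightarrow> zker T u v \<zeta> z Z \<noteq> 0"
    if T': "T \<in> inside R" for T
  proof -
    have "continuous_on (cball 0 1 \<times> (cball 0 1 \<times> U2 R)) (\<lambda>x. zker T u v (fst (snd x)) (fst x) (snd (snd x)))"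
      by (intro continuous_intros)
    then obtain \<delta> where "0 < \<delta>" "\<And>s k. norm s \<le> \<delta> \<Longrightarrow> k \<in> cball 0 1 \<times> U2 R \<Longrightarrow>
        zker T u v (fst (snd (s, k))) (fst (s, k)) (snd (snd (s, k))) \<noteq> 0"
      by (rule uniformly_nonzero[OF compact_Times[OF compact_cball compact_U2[of R]]])
         (use insideD[OF T'] in \<open>auto simp: zker_def\<close>)
    then show ?thesis by (intro exI[of _ \<delta>]) auto
  qed
  obtain \<delta>1 where \<delta>1: "\<delta>1 > 0" "\<And>z \<zeta> Z. norm z \<le> \<delta>1 \<Longrightarrow> \<zeta> \<in> cball 0 1 \<Longrightarrow> Z \<in> U2 R \<Longrightarrow> zker T1 u v \<zeta> z Z \<noteq> 0"
    using small[OF T(1)] by blast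
  obtain \<delta>2 where \<delta>2: "\<delta>2 > 0" "\<And>z \<zeta> Z. norm z \<le> \<delta>2 \<Longrightarrow> \<zeta> \<in> cball 0 1 \<Longrightarrow> Z \<in> U2 R \<Longrightarrow> zker T2 u v \<zeta> z Z \<noteq> 0"
    using small[OF T(2)] by blast
  define B where "B = ball (0::complex) (min \<delta>1 \<delta>2)"
  have B: "convex B" "open B" "0 \<in> B" using \<delta>1(1) \<delta>2(1) by (simp_all add: B_def)
  have nz: "zker T u v \<zeta> z Z \<noteq> 0" if "z \<in> B" "\<zeta> \<in> cball 0 1" "Z \<in> U2 R" "T \<in> {T1, T2}" for T \<zeta> z Z
    using that \<delta>1(2)[of z \<zeta> Z] \<delta>2(2)[of z \<zeta> Z] by (auto simp: B_def)
  have ab: "1 - a * z \<noteq> 0" "1 - b * z \<noteq> 0" if z: "z \<in> B" for z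
  proof -
    obtain Z where Z: "Z \<in> U2 R" using U2_chart_image[of R] by (force simp: image_iff)
    have "zker T u v 0 z Z = N Z * (1 - z * \<sigma> T)" for T
      by (simp add: zker_def \<sigma>_def algebra_simps)
    then show "1 - a * z \<noteq> 0" "1 - b * z \<noteq> 0"
      using nz[OF z _ Z, of 0 T1] nz[OF z _ Z, of 0 T2] by (auto simp: a_def b_def mult.commute)
  qed
  define A where "A m z = of_nat (Suc m) * E R (\<lambda>Z. \<sigma> Z ^ m * zprod W T1 T2 u v 1 z Z)" for m z
  define \<beta> where "\<beta> m z = (1 - w * z) * csum a b (Suc m) z - w * csum a b m z" for m z
  have h: "hol (U2 R) (\<lambda>Z. \<sigma> Z ^ m * zprod W T1 T2 u v 1 z Z)
      (\<lambda>Z. csc (\<sigma> Z ^ m) (zprod_grad W T1 T2 u v 1 z Z) + csc (zprod W T1 T2 u v 1 z Z) (csc (of_nat m * \<sigma> Z ^ (m - 1)) (tens u v)))"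
    if "z \<in> B" for z m
    unfolding \<sigma>_def by (intro hol_mult hol_power hol_pair0 hol_zprod nz that) auto
  define e where "e T Z = - (N Z * \<sigma> T - 1 * N T * \<sigma> Z)" for T Z
  define D where "D z Z = zprod_deriv (N Z) (zker W u v 1 z Z) (zker T1 u v 1 z Z) (zker T2 u v 1 z Z) (e W Z) (e T1 Z) (e T2 Z)" for z Z
  have cD: "continuous_on (B \<times> U2 R) (\<lambda>(z, Z). D z Z)"
  proof -
    have "zker T1 u v 1 (fst x) (snd x) \<noteq> 0" "zker T2 u v 1 (fst x) (snd x) \<noteq> 0"
      if "x \<in> B \<times> U2 R" for x using nz that by auto
    then show ?thesis
      unfolding split_def D_def zprod_deriv_def e_def \<sigma>_def by (intro continuous_intros) auto
  qed
  have dA: "(A m has_field_derivative of_nat (Suc m) * A (Suc m) z) (at z)" if z: "z \<in> B" for m z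
  proof -
    have "((\<lambda>z. E R (\<lambda>Z. \<sigma> Z ^ m * zprod W T1 T2 u v 1 z Z)) has_field_derivative E R (\<lambda>Z. \<sigma> Z ^ m * D z Z)) (at z within B)"
    proof (rule E_field_derivative[OF _ holD(3)[OF h] _ z B(1)])
      fix z Z assume *: "z \<in> B" "Z \<in> U2 R"
      show "((\<lambda>z. \<sigma> Z ^ m * zprod W T1 T2 u v 1 z Z) has_field_derivative \<sigma> Z ^ m * D z Z) (at z within B)"
        unfolding zprod_def D_def e_def \<sigma>_def
        by (intro DERIV_cmult zprod_has_derivative zker_deriv_z) (use nz[OF *(1) _ *(2)] in auto)
    next
      show "continuous_on (B \<times> U2 R) (\<lambda>(z, Z). \<sigma> Z ^ m * D z Z)"
        using cD unfolding split_def \<sigma>_def by (intro continuous_intros) auto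
    qed
    then have 1: "(A m has_field_derivative of_nat (Suc m) * E R (\<lambda>Z. \<sigma> Z ^ m * D z Z)) (at z)"
      unfolding A_def[abs_def] by (intro DERIV_cmult) (simp add: at_within_open[OF z B(2)])
    have c\<sigma>: "continuous_on S \<sigma>" for S
      unfolding \<sigma>_def by (intro continuous_intros)
    let ?G = "\<lambda>Z. \<sigma> Z ^ m * zprod W T1 T2 u v 1 z Z"
    have c: "continuous_on (U2 R) (\<lambda>Z. \<sigma> Z * ?G Z)" "continuous_on (U2 R) (\<lambda>Z. \<sigma> Z ^ m * D z Z)"
      by (rule continuous_on_mult[OF c\<sigma> holD(3)[OF h[OF z]]],
          rule continuous_on_mult[OF continuous_on_power[OF c\<sigma>] U.slice_continuous[OF cD z]])
    \<comment> \<open>The factor m + 2 below: the field sends \<sigma>^m to m \<sigma>^(m+1), and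
      its divergence contributes 2 \<sigma>.\<close>
    have "0 = E R (\<lambda>Z. pair (csc (\<sigma> Z ^ m) (zprod_grad W T1 T2 u v 1 z Z) + csc (zprod W T1 T2 u v 1 z Z) (csc (of_nat m * \<sigma> Z ^ (m - 1)) (tens u v))) (Z ** tens v u ** Z)
        + 2 * (\<sigma> Z * ?G Z))"
      using E_inverse_stokes[OF h[OF z], where u = u and v = v] by (simp add: \<sigma>_def)
    also have "\<dots> = E R (\<lambda>Z. of_nat (m + 2) * (\<sigma> Z * ?G Z) - \<sigma> Z ^ m * D z Z)"
    proof (rule E_cong)
      fix Z assume Z: "Z \<in> U2 R"
      have s: "pair (tens u v) (Z ** tens v u ** Z) = \<sigma> Z * \<sigma> Z"
        unfolding \<sigma>_def pair_def matrix_mult_nth_2 tens_nth by algebra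
      have n: "pair (cof Z) (Z ** tens v u ** Z) = \<sigma> Z * N Z"
        unfolding \<sigma>_def pair_def matrix_mult_nth_2 tens_nth cof_nth det_2 by algebra
      have k: "pair (zker_grad T u v 1 z Z) (Z ** tens v u ** Z) = \<sigma> Z * zker T u v 1 z Z - e T Z" for T
        by (simp add: zker_flow e_def \<sigma>_def)
      have g: "pair (zprod_grad W T1 T2 u v 1 z Z) (Z ** tens v u ** Z) = - D z Z"
        unfolding D_def zprod_deriv_def zprod_grad_def pair_simps k n
        using nz[OF z _ Z, of 1 T1] nz[OF z _ Z, of 1 T2]
        by (simp add: field_simps power2_eq_square)
      show "pair (csc (\<sigma> Z ^ m) (zprod_grad W T1 T2 u v 1 z Z) + csc (zprod W T1 T2 u v 1 z Z) (csc (of_nat m * \<sigma> Z ^ (m - 1)) (tens u v))) (Z ** tens v u ** Z)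
        + 2 * (\<sigma> Z * ?G Z) = of_nat (m + 2) * (\<sigma> Z * ?G Z) - \<sigma> Z ^ m * D z Z"
        unfolding pair_simps g s by (cases m) (simp_all add: algebra_simps)
    qed
    also have "\<dots> = of_nat (m + 2) * E R (\<lambda>Z. \<sigma> Z * ?G Z) - E R (\<lambda>Z. \<sigma> Z ^ m * D z Z)"
      by (subst E_diff) (auto simp: E_cmult intro!: c continuous_on_mult_left)
    finally have "E R (\<lambda>Z. \<sigma> Z ^ m * D z Z) = A (Suc m) z"
      by (simp add: A_def mult.assoc)
    with 1 show ?thesis by simp
  qed
  have d\<beta>: "(\<beta> m has_field_derivative of_nat (Suc m) * \<beta> (Suc m) z) (at z)" if "z \<in> B" for m z
    unfolding \<beta>_def[abs_def]
    by (rule derivative_eq_intros csum_deriv[OF ab[OF that]] refl)+ (simp add: algebra_simps)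
  have "A m z = \<beta> m z" if "z \<in> B" for m z
    using that
  proof (induction m arbitrary: z)
    case 0
    have "A 0 z = (1 - z * w) * (inverse (1 - z * a) * inverse (1 - z * b))"
      using zprod_mean[OF R nz[OF 0]] by (simp add: A_def w_def a_def b_def \<sigma>_def)
    then show ?case by (simp add: \<beta>_def csum_def cterm_def mult.commute)
  next
    case (Suc m)
    have "(\<beta> m has_field_derivative of_nat (Suc m) * A (Suc m) z) (at z)"
      by (rule has_field_derivative_transform_within_open[OF dA[OF Suc.prems] B(2) Suc.prems Suc.IH])
    from DERIV_unique[OF this d\<beta>[OF Suc.prems]] show ?case by (simp del: of_nat_Suc)
  qed
  from this[OF B(3), of p] have "A p 0 = \<beta> p 0" .
  moreover have "A p 0 = of_nat (Suc p) * E R (\<lambda>Z. \<sigma> Z ^ p * (N Z * (N (Z - W) * (inverse (N (Z - T1)) * inverse (N (Z - T2))))))"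
    by (simp add: A_def zprod_def zker_def)
  moreover have "\<beta> p 0 = divdiff (Suc p) a b - w * divdiff p a b"
    by (simp add: \<beta>_def csum_def cterm_def divdiff_def)
  ultimately show ?thesis by (simp add: \<sigma>_def a_def b_def w_def)
qed

section \<open>The integral over the second external point\<close>

definition lmul :: "complex^2 \<Rightarrow> hc \<Rightarrow> complex^2" where
  "lmul u A = (\<chi> j. u$1 * A$1$j + u$2 * A$2$j)"

lemma pair_tens_mult: "pair (tens u v) (A ** P) = pair (tens (lmul u A) v) P"
  by (simp add: pair_def matrix_mult_nth_2 lmul_def algebra_simps)

lemma dot_lmul: "dot (lmul u A) v = pair (tens u v) A"
  by (simp add: pair_def dot_def lmul_def algebra_simps)

lemma zero_inside: "R \<noteq> 0 \<Longrightarrow> 0 \<in> inside R"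
  using U2_N_nonzero by (auto simp: inside_def csc_def[abs_def] zero_vec_def[symmetric])

lemma PF_plane_wave [intro]: "pair A \<in> PF"
  using PF_pair[of "\<lambda>Z. Z" A] by (simp add: PF_nth)

text \<open>The case of two poles with the first at the origin: it reduces N^2 to N, and the average
  of \<sigma>(T P)^q is \<sigma>(T)^q / (q + 1).\<close>

lemma E_one_pole:
  assumes T: "T \<in> inside R" and R: "R \<noteq> 0"
  shows "of_nat (Suc q) * E R (\<lambda>Z. pair (tens u v) Z ^ q * (N Z * inverse (N (Z - T)))) = pair (tens u v) T ^ q"
proof -
  have "E R (\<lambda>Z. pair (tens u v) Z ^ q * (N Z * inverse (N (Z - T)))) = E R (two_poles (\<lambda>Z. pair (tens u v) Z ^ q) 0 T)"
    by (rule E_cong) (use U2_N_nonzero R in \<open>simp add: two_poles_def power2_eq_square field_simps\<close>)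
  also have "\<dots> = PA (\<lambda>P. pair (tens (lmul u T) v) P ^ q * pair (tens (lmul u T) v) P ^ 0)"
    by (subst E_two_poles[OF _ zero_inside[OF R] T R]) (auto simp: pair_tens_mult)
  also have "\<dots> = pair (tens u v) T ^ q / of_nat (Suc q)"
    by (subst PA_moment_same) (simp add: dot_lmul)
  finally show ?thesis by (simp del: of_nat_Suc)
qed

section \<open>Green's formula for a null linear form on the three-sphere\<close>

definition cdot :: "complex^4 \<Rightarrow> real^4 \<Rightarrow> complex" where
  "cdot s x = (\<Sum>k\<in>UNIV. s $ k * complex_of_real (x $ k))"

lemma cdot_axis: "cdot s (axis k 1) = s $ k"
  by (simp add: cdot_def axis_def if_distrib cong: if_cong)

lemma bounded_linear_cdot: "bounded_linear (cdot s)"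
  unfolding linear_conv_bounded_linear[symmetric] cdot_def
  by (rule linearI) (simp_all add: sum_4' algebra_simps scaleR_conv_of_real[where 'a=complex])

lemma bounded_linear_rot: "bounded_linear (rot j :: real^4 \<Rightarrow> real^4)"
  unfolding linear_conv_bounded_linear[symmetric]
  by (rule linearI) (simp_all add: vec4_eq_iff rot_def)

lemmas continuous_on_cdot [continuous_intros] = bounded_linear.continuous_on[OF bounded_linear_cdot]
lemmas continuous_on_rot [continuous_intros] = bounded_linear.continuous_on[OF bounded_linear_rot]

lemma cdot_rot_rot: "j \<in> {1, 2, 3} \<Longrightarrow> cdot s (rot j (rot j x)) = - cdot s x"
  by (elim insertE) (simp_all add: cdot_def sum_4' rot_def)

text \<open>x and its three rotations form an orthonormal basis, so the squared components of s
  along it add up to its quadratic form.\<close>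

lemma cdot_rot_squares:
  assumes "x \<in> sphere.carr"
  shows "(cdot s (rot 1 x))\<^sup>2 + (cdot s (rot 2 x))\<^sup>2 + (cdot s (rot 3 x))\<^sup>2
    = (s$0)\<^sup>2 + (s$1)\<^sup>2 + (s$2)\<^sup>2 + (s$3)\<^sup>2 - (cdot s x)\<^sup>2"
proof -
  have "(x$0)\<^sup>2 + (x$1)\<^sup>2 + (x$2)\<^sup>2 + (x$3)\<^sup>2 = 1" using assms by (simp add: sphere_carr)
  then have "complex_of_real ((x$0)\<^sup>2 + (x$1)\<^sup>2 + (x$2)\<^sup>2 + (x$3)\<^sup>2) = 1" by simp
  then have "(complex_of_real (x$0))\<^sup>2 + (complex_of_real (x$1))\<^sup>2 + (complex_of_real (x$2))\<^sup>2 + (complex_of_real (x$3))\<^sup>2 = 1"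
    by simp
  then show ?thesis
    unfolding cdot_def sum_4' rot_nth of_real_minus by algebra
qed

text \<open>
  Green's formula on the sphere for \<open>f = (s \<cdot> x)\<^sup>q\<close>, an eigenfunction of the Laplacian, and
  \<open>g = 1 / D\<close>, applied to the fields \<open>f L g - g L f\<close> where \<open>L\<close> runs over the three rotations.
\<close>

lemma sphere_green:
  fixes s t :: "complex^4" and \<zeta> :: complex and q :: nat
  defines "\<nu> \<equiv> (t$0)\<^sup>2 + (t$1)\<^sup>2 + (t$2)\<^sup>2 + (t$3)\<^sup>2"
  defines "D \<equiv> \<lambda>x. 1 - 2 * \<zeta> * cdot t x + \<zeta>\<^sup>2 * \<nu>"
  assumes null: "(s$0)\<^sup>2 + (s$1)\<^sup>2 + (s$2)\<^sup>2 + (s$3)\<^sup>2 = 0"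
    and nz: "\<And>x. x \<in> sphere.carr \<Longrightarrow> D x \<noteq> 0"
  shows "sphere.avg (\<lambda>x. cdot s x ^ q * (of_nat q * (of_nat q + 2) * inverse (D x)
    - 6 * \<zeta> * cdot t x * inverse (D x) ^ 2 + 8 * \<zeta>\<^sup>2 * (\<nu> - (cdot t x)\<^sup>2) * inverse (D x) ^ 3)) = 0"
proof -
  define f1 f2 where "f1 x = of_nat q * cdot s x ^ (q - 1)" and "f2 x = of_nat (q * (q - 1)) * cdot s x ^ (q - 2)" for x
  \<comment> \<open>The derivative at x in the direction v of f L g - g L f, where L differentiates
    along \<open>rot j\<close>.\<close>
  define dH where "dH j x v =
      f1 x * cdot s v * (2 * \<zeta> * cdot t (rot j x)) * inverse (D x) ^ 2
    + cdot s x ^ q * (2 * \<zeta> * cdot t (rot j v)) * inverse (D x) ^ 2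
    + cdot s x ^ q * (2 * \<zeta> * cdot t (rot j x)) * (4 * \<zeta> * cdot t v * inverse (D x) ^ 3)
    - f2 x * cdot s v * cdot s (rot j x) * inverse (D x) - f1 x * cdot s (rot j v) * inverse (D x)
    - f1 x * cdot s (rot j x) * (2 * \<zeta> * cdot t v * inverse (D x) ^ 2)" for j :: nat and x v :: "real^4"
  have df: "((\<lambda>x. cdot s x ^ q) has_derivative (\<lambda>v. f1 x * cdot s v)) (at x)" for x
    unfolding f1_def
    by (rule has_derivative_eq_rhs[OF has_derivative_power[OF bounded_linear_imp_has_derivative[OF bounded_linear_cdot]]])
       (simp add: ac_simps)
  have df1: "(f1 has_derivative (\<lambda>v. f2 x * cdot s v)) (at x)" for x
    unfolding f1_def[abs_def] f2_def
    by (rule has_derivative_eq_rhs[OF has_derivative_mult_right[OF has_derivative_power[OF bounded_linear_imp_has_derivative[OF bounded_linear_cdot]]]])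
       (simp add: ac_simps numeral_2_eq_2)
  have dD: "(D has_derivative (\<lambda>v. - (2 * \<zeta> * cdot t v))) (at x)" for x
    unfolding D_def
    by (rule has_derivative_eq_rhs, rule has_derivative_add[OF has_derivative_diff[OF has_derivative_const
          has_derivative_mult_right[OF bounded_linear_imp_has_derivative[OF bounded_linear_cdot]]] has_derivative_const]) simp
  have di: "((\<lambda>x. inverse (D x)) has_derivative (\<lambda>v. 2 * \<zeta> * cdot t v * inverse (D x) ^ 2)) (at x)"
    if "x \<in> sphere.carr" for x
    by (rule has_derivative_eq_rhs[OF Deriv.has_derivative_inverse[OF nz[OF that] dD]])
       (simp add: power2_eq_square fun_eq_iff)
  have dr: "((\<lambda>x. cdot s (rot j x)) has_derivative (\<lambda>v. cdot s (rot j v))) (at x)" for s j x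
    by (rule bounded_linear_imp_has_derivative[OF bounded_linear_compose[OF bounded_linear_cdot bounded_linear_rot]])
  have cD: "continuous_on S D" for S
    unfolding D_def by (intro continuous_intros)
  have cH: "continuous_on sphere.carr (\<lambda>x. dH j x v)" for j v
    unfolding dH_def f1_def f2_def by (intro continuous_intros cD) (use nz in auto)
  have z: "sphere.avg (\<lambda>x. dH j x (rot j x)) = 0" if j: "j \<in> {1, 2, 3}" for j
  proof -
    let ?H = "\<lambda>x. cdot s x ^ q * (2 * \<zeta> * cdot t (rot j x)) * inverse (D x) ^ 2 - f1 x * cdot s (rot j x) * inverse (D x)"
    define g where "g x = (\<chi> k. dH j x (axis k 1))" for x
    have ex: "dH j x v = (\<Sum>k\<in>UNIV. g x $ k * complex_of_real (v $ k))" for x v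
    proof -
      have "cdot s (rot j v) = (\<Sum>k\<in>UNIV. cdot s (rot j (axis k 1)) * complex_of_real (v $ k))" for s
        by (simp add: cdot_def sum_4' rot_def axis_def algebra_simps)
      moreover have "cdot s v = (\<Sum>k\<in>UNIV. cdot s (axis k 1) * complex_of_real (v $ k))" for s
        unfolding cdot_axis by (simp add: cdot_def)
      ultimately show ?thesis
        unfolding g_def vec_lambda_beta sum_4' dH_def by (simp add: algebra_simps)
    qed
    have "sphere.avg (\<lambda>x. \<Sum>k\<in>UNIV. g x $ k * complex_of_real (rot j x $ k)) = 0"
    proof (rule sphere_rot_integral[OF _ _ j])
      show "continuous_on sphere.carr g"
        unfolding g_def by (intro continuous_on_vec_lambda cH)
      fix x assume x: "x \<in> sphere.carr"
      show "(?H has_derivative (\<lambda>v. \<Sum>k\<in>UNIV. g x $ k * complex_of_real (v $ k))) (at x)"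
        unfolding ex[symmetric]
        by (rule has_derivative_eq_rhs[OF has_derivative_diff[OF
              has_derivative_mult[OF has_derivative_mult[OF df has_derivative_mult_right[OF dr]] has_derivative_power[OF di[OF x]]]
              has_derivative_mult[OF has_derivative_mult[OF df1 dr] di[OF x]]]])
           (simp add: dH_def algebra_simps power2_eq_square power3_eq_cube fun_eq_iff)
    qed
    then show ?thesis unfolding ex .
  qed
  have "sphere.avg (\<lambda>x. cdot s x ^ q * (of_nat q * (of_nat q + 2) * inverse (D x)
    - 6 * \<zeta> * cdot t x * inverse (D x) ^ 2 + 8 * \<zeta>\<^sup>2 * (\<nu> - (cdot t x)\<^sup>2) * inverse (D x) ^ 3))
    = sphere.avg (\<lambda>x. dH 1 x (rot 1 x) + (dH 2 x (rot 2 x) + dH 3 x (rot 3 x)))"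
  proof (rule sphere.avg_cong)
    fix x assume x: "x \<in> sphere.carr"
    \<comment> \<open>For v = \<open>rot j x\<close> the mixed products of first derivatives of f
      and g cancel, and \<open>rot j\<close> applied twice is -1.\<close>
    have e: "dH j x (rot j x) = - (cdot s x ^ q * (2 * \<zeta> * cdot t x) * inverse (D x) ^ 2)
        + 8 * \<zeta>\<^sup>2 * cdot s x ^ q * (cdot t (rot j x))\<^sup>2 * inverse (D x) ^ 3
        - f2 x * (cdot s (rot j x))\<^sup>2 * inverse (D x) + f1 x * cdot s x * inverse (D x)" if "j \<in> {1, 2, 3}" for j
      unfolding dH_def cdot_rot_rot[OF that] by (simp add: power2_eq_square algebra_simps)
    define a b c where "a = (cdot t (rot 1 x))\<^sup>2" and "b = (cdot t (rot 2 x))\<^sup>2" and "c = (cdot t (rot 3 x))\<^sup>2"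
    define a' b' c' where "a' = (cdot s (rot 1 x))\<^sup>2" and "b' = (cdot s (rot 2 x))\<^sup>2" and "c' = (cdot s (rot 3 x))\<^sup>2"
    have abc: "c = \<nu> - (cdot t x)\<^sup>2 - a - b"
      using cdot_rot_squares[OF x, of t] unfolding a_def b_def c_def \<nu>_def by (simp add: algebra_simps)
    \<comment> \<open>As s is null, summing over the rotations turns the second derivatives of f
      into q (q - 1) f; with the first-order terms 3 q f this gives the eigenvalue factor q (q +
      2).\<close>
    have abc': "c' = - (cdot s x)\<^sup>2 - a' - b'"
      using cdot_rot_squares[OF x, of s] null unfolding a'_def b'_def c'_def by algebra
    have f1: "f1 x * cdot s x = of_nat q * cdot s x ^ q"
      by (cases q) (simp_all add: f1_def)
    have f2: "f2 x * (cdot s x)\<^sup>2 = of_nat q * (of_nat q - 1) * cdot s x ^ q"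
    proof -
      consider "q = 0" | "q = 1" | m where "q = Suc (Suc m)" by (metis One_nat_def not0_implies_Suc)
      then show ?thesis by cases (simp_all add: f2_def power2_eq_square algebra_simps)
    qed
    have "dH 1 x (rot 1 x) + (dH 2 x (rot 2 x) + dH 3 x (rot 3 x))
        = - (6 * \<zeta> * cdot t x * cdot s x ^ q * inverse (D x) ^ 2)
        + 8 * \<zeta>\<^sup>2 * cdot s x ^ q * (\<nu> - (cdot t x)\<^sup>2) * inverse (D x) ^ 3
        + (f2 x * (cdot s x)\<^sup>2) * inverse (D x) + 3 * (f1 x * cdot s x) * inverse (D x)"
      by (simp add: e flip: a_def b_def c_def a'_def b'_def c'_def del: One_nat_def)
         (simp add: abc abc' algebra_simps)
    then show "cdot s x ^ q * (of_nat q * (of_nat q + 2) * inverse (D x)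
      - 6 * \<zeta> * cdot t x * inverse (D x) ^ 2 + 8 * \<zeta>\<^sup>2 * (\<nu> - (cdot t x)\<^sup>2) * inverse (D x) ^ 3)
      = dH 1 x (rot 1 x) + (dH 2 x (rot 2 x) + dH 3 x (rot 3 x))"
      unfolding f1 f2 by (simp add: algebra_simps)
  qed
  also have "\<dots> = 0"
  proof -
    have c: "continuous_on sphere.carr (\<lambda>x. dH j x (rot j x))" for j
      unfolding dH_def f1_def f2_def by (intro continuous_intros cD) (use nz in auto)
    show ?thesis
      using z[of 1] z[of 2] z[of 3] c by (simp add: sphere.avg_add continuous_on_add del: One_nat_def)
  qed
  finally show ?thesis .
qed

lemma N_csc: "N (csc c A) = c\<^sup>2 * N A"
  by (simp add: det_2 power2_eq_square algebra_simps)

text \<open>On the unit sphere D is the quadratic form of x - \<zeta> t. Green's formula gives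
  \<zeta>^2 \<Phi>'' + 3 \<zeta> \<Phi>' = q (q + 2) \<Phi>, with solutions \<zeta>^q and
  \<zeta>^(-q-2); regularity at 0 leaves the first. Only its effect on the unit circle is
  stated.\<close>

lemma sphere_mean_homogeneous:
  fixes s t :: "complex^4" and q :: nat
  defines "\<nu> \<equiv> (t$0)\<^sup>2 + (t$1)\<^sup>2 + (t$2)\<^sup>2 + (t$3)\<^sup>2"
  defines "D \<equiv> \<lambda>\<zeta> x. 1 - 2 * \<zeta> * cdot t x + \<zeta>\<^sup>2 * \<nu>"
  defines "\<Phi> \<equiv> \<lambda>\<zeta>. sphere.avg (\<lambda>x. cdot s x ^ q * inverse (D \<zeta> x))"
  assumes null: "(s$0)\<^sup>2 + (s$1)\<^sup>2 + (s$2)\<^sup>2 + (s$3)\<^sup>2 = 0"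
    and nz: "\<And>\<zeta> x. \<zeta> \<in> cball 0 1 \<Longrightarrow> x \<in> sphere.carr \<Longrightarrow> D \<zeta> x \<noteq> 0"
  shows "cis (- \<tau>) ^ q * \<Phi> (cis \<tau>) = \<Phi> 1"
proof -
  define D' where "D' \<zeta> x = 2 * \<zeta> * \<nu> - 2 * cdot t x" for \<zeta> x
  define A where "A \<zeta> = sphere.avg (\<lambda>x. cdot s x ^ q * - (D' \<zeta> x * inverse (D \<zeta> x) ^ 2))" for \<zeta>
  define A' where "A' \<zeta> = sphere.avg (\<lambda>x. cdot s x ^ q * (2 * (D' \<zeta> x)\<^sup>2 * inverse (D \<zeta> x) ^ 3 - 2 * \<nu> * inverse (D \<zeta> x) ^ 2))" for \<zeta>
  have dD: "((\<lambda>\<zeta>. D \<zeta> x) has_field_derivative D' \<zeta> x) (at \<zeta> within S)" for \<zeta> x S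
    unfolding D_def D'_def by (auto intro!: derivative_eq_intros)
  have dD': "((\<lambda>\<zeta>. D' \<zeta> x) has_field_derivative 2 * \<nu>) (at \<zeta> within S)" for \<zeta> x S
    unfolding D'_def by (auto intro!: derivative_eq_intros)
  have di: "((\<lambda>\<zeta>. inverse (D \<zeta> x)) has_field_derivative - (D' \<zeta> x * inverse (D \<zeta> x) ^ 2)) (at \<zeta> within S)"
    if "\<zeta> \<in> cball 0 1" "x \<in> sphere.carr" for \<zeta> x S
    using nz[OF that] by (auto intro!: derivative_eq_intros dD simp: power2_eq_square)
  have nz2: "D (fst y) (snd y) \<noteq> 0" if "y \<in> cball 0 1 \<times> sphere.carr" for y using nz that by auto
  have d1: "(\<Phi> has_field_derivative A \<zeta>) (at \<zeta> within cball 0 1)" if \<zeta>: "\<zeta> \<in> cball 0 1" for \<zeta>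
    unfolding \<Phi>_def A_def
  proof (rule sphere.avg_field_derivative[OF DERIV_cmult[OF di] _ _ \<zeta> convex_cball])
    show "continuous_on sphere.carr (\<lambda>x. cdot s x ^ q * inverse (D \<zeta> x))" if "\<zeta> \<in> cball 0 1" for \<zeta>
      using nz[OF that] unfolding D_def by (intro continuous_intros) auto
    show "continuous_on (cball 0 1 \<times> sphere.carr) (\<lambda>(\<zeta>, x). cdot s x ^ q * - (D' \<zeta> x * inverse (D \<zeta> x) ^ 2))"
      using nz2 unfolding D_def D'_def split_def by (intro continuous_intros) auto
  qed
  have d2: "(A has_field_derivative A' \<zeta>) (at \<zeta> within cball 0 1)" if \<zeta>: "\<zeta> \<in> cball 0 1" for \<zeta>
    unfolding A_def[abs_def] A'_def
  proof (rule sphere.avg_field_derivative[OF _ _ _ \<zeta> convex_cball])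
    fix \<zeta> x assume *: "\<zeta> \<in> cball (0::complex) 1" "x \<in> sphere.carr"
    show "((\<lambda>\<zeta>. cdot s x ^ q * - (D' \<zeta> x * inverse (D \<zeta> x) ^ 2)) has_field_derivative
        cdot s x ^ q * (2 * (D' \<zeta> x)\<^sup>2 * inverse (D \<zeta> x) ^ 3 - 2 * \<nu> * inverse (D \<zeta> x) ^ 2)) (at \<zeta> within cball 0 1)"
      by (rule DERIV_cmult, rule DERIV_cong[OF DERIV_minus[OF DERIV_mult[OF dD' DERIV_power[OF di[OF *]]]]])
         (simp add: power2_eq_square power3_eq_cube algebra_simps)
  next
    show "continuous_on sphere.carr (\<lambda>x. cdot s x ^ q * - (D' \<zeta> x * inverse (D \<zeta> x) ^ 2))" if "\<zeta> \<in> cball 0 1" for \<zeta>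
      using nz[OF that] unfolding D_def D'_def by (intro continuous_intros) auto
    show "continuous_on (cball 0 1 \<times> sphere.carr) (\<lambda>(\<zeta>, x). cdot s x ^ q * (2 * (D' \<zeta> x)\<^sup>2 * inverse (D \<zeta> x) ^ 3 - 2 * \<nu> * inverse (D \<zeta> x) ^ 2))"
      using nz2 unfolding D_def D'_def split_def by (intro continuous_intros) auto
  qed
  have ode: "\<zeta>\<^sup>2 * A' \<zeta> + 3 * \<zeta> * A \<zeta> = of_nat q * (of_nat q + 2) * \<Phi> \<zeta>" if \<zeta>: "\<zeta> \<in> cball 0 1" for \<zeta>
  proof -
    have c: "continuous_on sphere.carr (\<lambda>x. cdot s x ^ q * inverse (D \<zeta> x))"
      "continuous_on sphere.carr (\<lambda>x. cdot s x ^ q * - (D' \<zeta> x * inverse (D \<zeta> x) ^ 2))"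
      "continuous_on sphere.carr (\<lambda>x. cdot s x ^ q * (2 * (D' \<zeta> x)\<^sup>2 * inverse (D \<zeta> x) ^ 3 - 2 * \<nu> * inverse (D \<zeta> x) ^ 2))"
      using nz[OF \<zeta>] unfolding D_def D'_def by (intro continuous_intros; auto)+
    have "0 = sphere.avg (\<lambda>x. cdot s x ^ q * (of_nat q * (of_nat q + 2) * inverse (D \<zeta> x)
      - 6 * \<zeta> * cdot t x * inverse (D \<zeta> x) ^ 2 + 8 * \<zeta>\<^sup>2 * (\<nu> - (cdot t x)\<^sup>2) * inverse (D \<zeta> x) ^ 3))"
      using sphere_green[OF null, of \<zeta> t q] nz[OF \<zeta>] unfolding D_def \<nu>_def by simp
    also have "\<dots> = sphere.avg (\<lambda>x. of_nat q * (of_nat q + 2) * (cdot s x ^ q * inverse (D \<zeta> x))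
        - (\<zeta>\<^sup>2 * (cdot s x ^ q * (2 * (D' \<zeta> x)\<^sup>2 * inverse (D \<zeta> x) ^ 3 - 2 * \<nu> * inverse (D \<zeta> x) ^ 2))
          + 3 * \<zeta> * (cdot s x ^ q * - (D' \<zeta> x * inverse (D \<zeta> x) ^ 2))))"
    proof (rule sphere.avg_cong)
      fix x assume x: "x \<in> sphere.carr"
      define d where "d = D \<zeta> x"
      define i where "i = inverse d"
      have di: "d * i = 1" using nz[OF \<zeta> x] by (simp add: i_def d_def)
      have "d = 1 - 2 * \<zeta> * cdot t x + \<zeta>\<^sup>2 * \<nu>" by (simp add: d_def D_def)
      then have eq: "of_nat q * (of_nat q + 2) * i - 6 * \<zeta> * cdot t x * i ^ 2 + 8 * \<zeta>\<^sup>2 * (\<nu> - (cdot t x)\<^sup>2) * i ^ 3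
        = of_nat q * (of_nat q + 2) * i - (\<zeta>\<^sup>2 * (2 * (2 * \<zeta> * \<nu> - 2 * cdot t x)\<^sup>2 * i ^ 3 - 2 * \<nu> * i ^ 2)
          + 3 * \<zeta> * - ((2 * \<zeta> * \<nu> - 2 * cdot t x) * i ^ 2))"
        using di by algebra
      show "cdot s x ^ q * (of_nat q * (of_nat q + 2) * inverse (D \<zeta> x)
      - 6 * \<zeta> * cdot t x * inverse (D \<zeta> x) ^ 2 + 8 * \<zeta>\<^sup>2 * (\<nu> - (cdot t x)\<^sup>2) * inverse (D \<zeta> x) ^ 3)
      = of_nat q * (of_nat q + 2) * (cdot s x ^ q * inverse (D \<zeta> x))
        - (\<zeta>\<^sup>2 * (cdot s x ^ q * (2 * (D' \<zeta> x)\<^sup>2 * inverse (D \<zeta> x) ^ 3 - 2 * \<nu> * inverse (D \<zeta> x) ^ 2))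
          + 3 * \<zeta> * (cdot s x ^ q * - (D' \<zeta> x * inverse (D \<zeta> x) ^ 2)))"
        unfolding D'_def d_def[symmetric] i_def[symmetric]
        using arg_cong[OF eq, of "\<lambda>r. cdot s x ^ q * r"] by (simp add: algebra_simps)
    qed
    also have "\<dots> = of_nat q * (of_nat q + 2) * \<Phi> \<zeta> - (\<zeta>\<^sup>2 * A' \<zeta> + 3 * \<zeta> * A \<zeta>)"
      unfolding \<Phi>_def A_def A'_def
      by (subst sphere.avg_diff; (intro continuous_on_add continuous_on_mult_left c)?)
         (subst sphere.avg_add; (intro continuous_on_mult_left c)?; simp only: sphere.avg_cmult)
    finally show ?thesis by simp
  qed
  \<comment> \<open>The singular solution is removed without dividing: this expression is constant
    on the disc and vanishes at 0, hence \<zeta> \<Phi>' = q \<Phi> away from 0.\<close>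
  have "((\<lambda>\<zeta>. \<zeta> ^ (q + 2) * (\<zeta> * A \<zeta> - of_nat q * \<Phi> \<zeta>)) has_field_derivative 0) (at \<zeta> within cball 0 1)"
    if \<zeta>: "\<zeta> \<in> cball 0 1" for \<zeta>
  proof -
    have "((\<lambda>\<zeta>. \<zeta> ^ (q + 2) * (\<zeta> * A \<zeta> - of_nat q * \<Phi> \<zeta>)) has_field_derivative
        of_nat (q + 2) * \<zeta> ^ (q + 1) * (\<zeta> * A \<zeta> - of_nat q * \<Phi> \<zeta>) + \<zeta> ^ (q + 2) * ((A \<zeta> + \<zeta> * A' \<zeta>) - of_nat q * A \<zeta>))
        (at \<zeta> within cball 0 1)"
      by (rule DERIV_cong[OF DERIV_mult[OF DERIV_power[OF DERIV_ident, of "q + 2"]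
              DERIV_diff[OF DERIV_mult[OF DERIV_ident d2[OF \<zeta>]] DERIV_cmult[OF d1[OF \<zeta>]]]]])
         (simp add: algebra_simps)
    moreover have "of_nat (q + 2) * \<zeta> ^ (q + 1) * (\<zeta> * A \<zeta> - of_nat q * \<Phi> \<zeta>) + \<zeta> ^ (q + 2) * ((A \<zeta> + \<zeta> * A' \<zeta>) - of_nat q * A \<zeta>)
      = \<zeta> ^ (q + 1) * ((\<zeta>\<^sup>2 * A' \<zeta> + 3 * \<zeta> * A \<zeta>) - of_nat q * (of_nat q + 2) * \<Phi> \<zeta>)"
      by (simp add: power2_eq_square algebra_simps)
    ultimately show ?thesis using ode[OF \<zeta>] by simp
  qed
  from has_field_derivative_zero_constant[OF convex_cball this]
  obtain c where c: "\<And>\<zeta>. \<zeta> \<in> cball 0 1 \<Longrightarrow> \<zeta> ^ (q + 2) * (\<zeta> * A \<zeta> - of_nat q * \<Phi> \<zeta>) = c"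
    by blast
  have "c = 0" using c[of 0] by simp
  then have first: "\<zeta> * A \<zeta> = of_nat q * \<Phi> \<zeta>" if "\<zeta> \<in> cball 0 1" "\<zeta> \<noteq> 0" for \<zeta>
    using c[OF that(1)] that(2) by simp
  have ic: "cis \<tau> \<in> cball 0 1" for \<tau> by simp
  have dc: "((\<lambda>\<tau>. \<Phi> (cis \<tau>)) has_vector_derivative \<i> * (of_nat q * \<Phi> (cis \<tau>))) (at \<tau>)" for \<tau>
  proof -
    have "((\<Phi> \<circ> cis) has_vector_derivative (\<i> * cis \<tau>) * A (cis \<tau>)) (at \<tau> within UNIV)"
      by (rule field_vector_diff_chain_within)
         (use cis_vector_derivative[of 1 \<tau> UNIV] in simp, rule has_field_derivative_subset[OF d1], auto)
    then show ?thesis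
      using first[OF ic[of \<tau>]] by (simp add: o_def mult.assoc)
  qed
  have dq: "((\<lambda>\<tau>. cis (- real q * \<tau>)) has_vector_derivative \<i> * of_real (- real q) * cis (- real q * \<tau>)) (at \<tau>)" for \<tau>
    by (rule cis_vector_derivative)
  have "((\<lambda>\<tau>. cis (- real q * \<tau>) * \<Phi> (cis \<tau>)) has_vector_derivative 0) (at \<tau> within UNIV)" for \<tau>
    using has_vector_derivative_mult[OF dq dc, of \<tau>] by (simp add: algebra_simps)
  then obtain c where c: "\<And>\<tau>. cis (- real q * \<tau>) * \<Phi> (cis \<tau>) = c"
    using has_vector_derivative_zero_constant[OF convex_UNIV, of "\<lambda>\<tau>. cis (- real q * \<tau>) * \<Phi> (cis \<tau>)"] by auto
  have "cis (- \<tau>) ^ q = cis (- real q * \<tau>)" by (simp add: Complex.DeMoivre)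
  then show ?thesis using c[of 0] c[of \<tau>] by simp
qed

text \<open>By \<open>sphere_mean_homogeneous\<close> all phase slices contribute the same value, so
  the mean over the unit sphere equals the mean over \<open>U2 1\<close>, which
  \<open>E_one_pole\<close> evaluates.\<close>

theorem sphere_plane_wave:
  assumes T: "T \<in> inside 1"
  shows "of_nat (Suc q) * sphere.avg (\<lambda>x. pair (tens u v) (quat (cvec x)) ^ q * inverse (N (quat (cvec x) - T)))
    = pair (tens u v) T ^ q"
proof -
  obtain t where t: "T = quat t" using quat_surj by metis
  define s where "s = (\<chi> k. pair (tens u v) (quat (axis k 1)))"
  define \<nu> where "\<nu> = (t$0)\<^sup>2 + (t$1)\<^sup>2 + (t$2)\<^sup>2 + (t$3)\<^sup>2"
  have s: "cdot s x = pair (tens u v) (quat (cvec x))" for x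
    by (simp add: cdot_def s_def sum_4' quat_def pair_def cvec_def axis_def algebra_simps)
  \<comment> \<open>The quadratic form of s is a multiple of det(u v^T), which is 0.\<close>
  have null: "(s$0)\<^sup>2 + (s$1)\<^sup>2 + (s$2)\<^sup>2 + (s$3)\<^sup>2 = 0"
    by (simp add: s_def quat_def pair_def axis_def power2_eq_square algebra_simps)
  have D: "N (quat (cvec x) - csc \<zeta> T) = 1 - 2 * \<zeta> * cdot t x + \<zeta>\<^sup>2 * \<nu>" if "x \<in> sphere.carr" for x \<zeta>
  proof -
    have "quat (cvec x) - csc \<zeta> T = quat (cvec x - \<zeta> *s t)"
      by (simp add: t quat_def hc_eq_iff algebra_simps)
    then have "N (quat (cvec x) - csc \<zeta> T) = complex_of_real ((x$0)\<^sup>2 + (x$1)\<^sup>2 + (x$2)\<^sup>2 + (x$3)\<^sup>2)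
        - 2 * \<zeta> * cdot t x + \<zeta>\<^sup>2 * \<nu>"
      by (simp add: N_quat cvec_def cdot_def sum_4' \<nu>_def power2_eq_square algebra_simps)
    moreover have "(x$0)\<^sup>2 + (x$1)\<^sup>2 + (x$2)\<^sup>2 + (x$3)\<^sup>2 = 1"
      using that by (simp add: sphere_carr)
    ultimately show ?thesis by (simp only: of_real_1)
  qed
  have XU: "quat (cvec x) \<in> U2 1" if "x \<in> sphere.carr" for x
    using sphere_U2[OF that, of 1 0] by simp
  have nz: "1 - 2 * \<zeta> * cdot t x + \<zeta>\<^sup>2 * \<nu> \<noteq> 0" if "\<zeta> \<in> cball 0 1" "x \<in> sphere.carr" for \<zeta> x
    using insideD[OF T XU[OF that(2)], of \<zeta>] that by (simp add: D)
  note hom = sphere_mean_homogeneous[OF null, where t = t and q = q, folded \<nu>_def, OF nz]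
  define F where "F Z = pair (tens u v) Z ^ q * (N Z * inverse (N (Z - T)))" for Z
  have "E 1 F = integral {0..pi} (\<lambda>\<tau>. sphere.avg (\<lambda>x. F (quat ((complex_of_real 1 * cis (- \<tau>)) *s cvec x)))) / pi"
    by (rule E_iterated) (use insideD1[OF T] in \<open>auto simp: F_def[abs_def] intro!: continuous_intros\<close>)
  also have "(\<lambda>\<tau>. sphere.avg (\<lambda>x. F (quat ((complex_of_real 1 * cis (- \<tau>)) *s cvec x))))
    = (\<lambda>\<tau>. sphere.avg (\<lambda>x. cdot s x ^ q * inverse (1 - 2 * 1 * cdot t x + 1\<^sup>2 * \<nu>)))"
  proof
    fix \<tau>
    define e where "e = cis (- \<tau>)"
    have e: "e \<noteq> 0" "inverse e = cis \<tau>" by (simp_all add: e_def)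
    have "sphere.avg (\<lambda>x. F (quat ((complex_of_real 1 * e) *s cvec x)))
      = sphere.avg (\<lambda>x. e ^ q * (cdot s x ^ q * inverse (1 - 2 * cis \<tau> * cdot t x + (cis \<tau>)\<^sup>2 * \<nu>)))"
    proof (rule sphere.avg_cong)
      fix x assume x: "x \<in> sphere.carr"
      \<comment> \<open>The phase moves from the sphere to the pole: the slice at phase e sees the
        pole T / e.\<close>
      have eq: "csc e (quat (cvec x)) - T = csc e (quat (cvec x) - csc (inverse e) T)"
        using e(1) by (simp add: hc_eq_iff algebra_simps)
      have 1: "N (csc e (quat (cvec x)) - T) = e\<^sup>2 * (1 - 2 * cis \<tau> * cdot t x + (cis \<tau>)\<^sup>2 * \<nu>)"
        unfolding eq N_csc D[OF x] e(2) ..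
      have 2: "N (csc e (quat (cvec x))) = e\<^sup>2"
        unfolding N_csc using D[OF x, of 0] by simp
      show "F (quat ((complex_of_real 1 * e) *s cvec x))
        = e ^ q * (cdot s x ^ q * inverse (1 - 2 * cis \<tau> * cdot t x + (cis \<tau>)\<^sup>2 * \<nu>))"
        unfolding F_def of_real_1 mult_1 quat_smult 1 2 pair_simps s[symmetric]
        using e(1) by (simp add: power_mult_distrib)
    qed
    also have "\<dots> = e ^ q * sphere.avg (\<lambda>x. cdot s x ^ q * inverse (1 - 2 * cis \<tau> * cdot t x + (cis \<tau>)\<^sup>2 * \<nu>))"
      by (rule sphere.avg_cmult)
    also have "\<dots> = sphere.avg (\<lambda>x. cdot s x ^ q * inverse (1 - 2 * 1 * cdot t x + 1\<^sup>2 * \<nu>))"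
      unfolding e_def by (rule hom)
    finally show "sphere.avg (\<lambda>x. F (quat ((complex_of_real 1 * cis (- \<tau>)) *s cvec x)))
      = sphere.avg (\<lambda>x. cdot s x ^ q * inverse (1 - 2 * 1 * cdot t x + 1\<^sup>2 * \<nu>))"
      by (simp only: e_def)
  qed
  also have "sphere.avg (\<lambda>x. cdot s x ^ q * inverse (1 - 2 * 1 * cdot t x + 1\<^sup>2 * \<nu>))
      = sphere.avg (\<lambda>x. pair (tens u v) (quat (cvec x)) ^ q * inverse (N (quat (cvec x) - T)))"
    by (rule sphere.avg_cong) (use D[of _ 1] in \<open>simp add: s\<close>)
  finally have "E 1 F = sphere.avg (\<lambda>x. pair (tens u v) (quat (cvec x)) ^ q * inverse (N (quat (cvec x) - T)))"
    by (simp add: scaleR_conv_of_real)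
  then show ?thesis
    using E_one_pole[OF T, of q u v] by (simp add: F_def[abs_def])
qed

section \<open>Reduction of the ladder operator\<close>

definition colsum :: "hc \<Rightarrow> complex^2 \<Rightarrow> 2 \<Rightarrow> complex" where
  "colsum A x j = cnj (A$1$j) * x$1 + cnj (A$2$j) * x$2"

text \<open>The squared length of \<open>adj A\<close> applied to x; \<open>D_plus\<close> and
  \<open>U2\<close> are compared with \<open>inside\<close> through this function.\<close>

definition adj_norm :: "hc \<Rightarrow> complex^2 \<Rightarrow> real" where
  "adj_norm A x = (norm (colsum A x 1))\<^sup>2 + (norm (colsum A x 2))\<^sup>2"

lemma adj_norm_quadratic:
  "Re (\<Sum>i\<in>UNIV. cnj (v $ i) * ((mat (complex_of_real c) - W ** adj W) *v v) $ i)
    = c * ((norm (v$1))\<^sup>2 + (norm (v$2))\<^sup>2) - adj_norm W v"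
  unfolding sum_2 matrix_vector_mult_def vec_lambda_beta matrix_mult_nth_2 vector_minus_component
    adj_def mat_def adj_norm_def colsum_def cmod_power2
  by (simp add: algebra_simps power2_eq_square)

lemma U2_adj_norm:
  assumes "Z \<in> U2 r"
  shows "adj_norm Z x = r\<^sup>2 * ((norm (x$1))\<^sup>2 + (norm (x$2))\<^sup>2)"
proof -
  obtain Y where Y: "Z = r *\<^sub>R Y" "Y ** adj Y = mat 1" using assms by (auto simp: U2_def)
  have ent: "(Y ** adj Y) $ i $ j = (mat 1 :: hc) $ i $ j" for i j using Y(2) by simp
  have "mat (complex_of_real (r\<^sup>2)) - Z ** adj Z = 0"
    using ent[of 1 1] ent[of 1 2] ent[of 2 1] ent[of 2 2]
    by (simp add: hc_eq_iff matrix_mult_nth_2 adj_def Y(1) mat_def scaleR_conv_of_real[where 'a=complex] power2_eq_square)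
       algebra
  then show ?thesis using adj_norm_quadratic[of x "r\<^sup>2" Z] by simp
qed

text \<open>If Z - \<zeta> W is singular, its adjoint kills some nonzero x, so the adjoints of Z and
  of \<zeta> W agree at x. The first has length R times that of x, the second is shorter.\<close>

lemma inside_of_adj_norm:
  assumes "\<And>x. x \<noteq> 0 \<Longrightarrow> adj_norm W x < R\<^sup>2 * ((norm (x$1))\<^sup>2 + (norm (x$2))\<^sup>2)"
  shows "W \<in> inside R"
  unfolding inside_def
proof (intro CollectI ballI allI impI notI)
  fix Z \<zeta> assume Z: "Z \<in> U2 R" and \<zeta>: "norm (\<zeta>::complex) \<le> 1" and z: "N (Z - csc \<zeta> W) = 0"
  define A where "A = Z - csc \<zeta> W"
  have "\<exists>x. x \<noteq> 0 \<and> colsum A x 1 = 0 \<and> colsum A x 2 = 0"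
  proof -
    have d: "cnj (A$1$1) * cnj (A$2$2) = cnj (A$1$2) * cnj (A$2$1)"
      using arg_cong[OF z, of cnj] by (simp add: A_def det_2)
    \<comment> \<open>A nonzero column of A yields a vector killed by that column of the adjoint,
      and by the other one since the determinant is 0; for A = 0 any vector will do.\<close>
    consider "A$2$1 \<noteq> 0 \<or> A$1$1 \<noteq> 0" | "A$2$2 \<noteq> 0 \<or> A$1$2 \<noteq> 0" | "A$2$1 = 0" "A$1$1 = 0" "A$2$2 = 0" "A$1$2 = 0"
      by blast
    then show ?thesis
    proof cases
      case 1
      then show ?thesis
        using d by (intro exI[of _ "vector [cnj (A$2$1), - cnj (A$1$1)]"]) (auto simp: colsum_def vec_eq_iff forall_2 algebra_simps)
    next
      case 2
      then show ?thesis
        using d by (intro exI[of _ "vector [cnj (A$2$2), - cnj (A$1$2)]"]) (auto simp: colsum_def vec_eq_iff forall_2 algebra_simps)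
    next
      case 3
      then show ?thesis
        by (intro exI[of _ "vector [1, 0]"]) (auto simp: colsum_def vec_eq_iff forall_2)
    qed
  qed
  then obtain x where x: "x \<noteq> 0" "colsum A x 1 = 0" "colsum A x 2 = 0" by blast
  have "colsum A x j = colsum Z x j - cnj \<zeta> * colsum W x j" for j
    by (simp add: A_def colsum_def algebra_simps)
  then have "colsum Z x 1 = cnj \<zeta> * colsum W x 1" "colsum Z x 2 = cnj \<zeta> * colsum W x 2"
    using x by simp_all
  then have "adj_norm Z x = (norm \<zeta>)\<^sup>2 * adj_norm W x"
    by (simp add: adj_norm_def norm_mult power_mult_distrib algebra_simps)
  also have "\<dots> \<le> 1 * adj_norm W x"
    using \<zeta> by (intro mult_right_mono) (auto simp: adj_norm_def power_le_one)
  also have "\<dots> < R\<^sup>2 * ((norm (x$1))\<^sup>2 + (norm (x$2))\<^sup>2)" using assms[OF x(1)] by simp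
  also have "\<dots> = adj_norm Z x" by (simp add: U2_adj_norm[OF Z])
  finally show False by simp
qed

lemma norm_sq_pos: "(x::complex^2) \<noteq> 0 \<Longrightarrow> (norm (x$1))\<^sup>2 + (norm (x$2))\<^sup>2 > 0"
  by (auto simp: vec_eq_iff forall_2 add_nonneg_pos add_pos_nonneg)

lemma D_plus_inside:
  assumes "W \<in> D_plus r" "0 \<le> r" "r \<le> R"
  shows "W \<in> inside R"
proof (rule inside_of_adj_norm)
  fix x :: "complex^2" assume x: "x \<noteq> 0"
  have "0 < r\<^sup>2 * ((norm (x$1))\<^sup>2 + (norm (x$2))\<^sup>2) - adj_norm W x"
    using assms(1)[unfolded D_plus_def mem_Collect_eq pos_def_def adj_norm_quadratic] x by blast
  also have "\<dots> \<le> R\<^sup>2 * ((norm (x$1))\<^sup>2 + (norm (x$2))\<^sup>2) - adj_norm W x"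
    using assms by (intro diff_right_mono mult_right_mono power_mono) auto
  finally show "adj_norm W x < R\<^sup>2 * ((norm (x$1))\<^sup>2 + (norm (x$2))\<^sup>2)" by simp
qed

lemma U2_inside:
  assumes "Z \<in> U2 r" "0 \<le> r" "r < R"
  shows "Z \<in> inside R"
proof (rule inside_of_adj_norm)
  fix x :: "complex^2" assume x: "x \<noteq> 0"
  have "r\<^sup>2 < R\<^sup>2" using assms by (simp add: power_strict_mono)
  then show "adj_norm Z x < R\<^sup>2 * ((norm (x$1))\<^sup>2 + (norm (x$2))\<^sup>2)"
    unfolding U2_adj_norm[OF assms(1)] using norm_sq_pos[OF x] by simp
qed

lemma S3_U2: "0 < R \<Longrightarrow> S3 R \<subseteq> U2 R"
proof
  fix Z assume R: "0 < R" and "Z \<in> S3 R"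
  then obtain a b c where "Z = quat (cvec (S3_chart R a b c))"
    unfolding S3_chart_image[OF R, symmetric] by auto
  also have "\<dots> = quat ((complex_of_real R * cis 0) *s cvec (sph a b c))"
    by (simp add: S3_chart_def quat_def cvec_def hc_eq_iff algebra_simps)
  also have "\<dots> \<in> U2 R" by (rule sphere_U2) (use sph_norm in \<open>simp add: sphere_carr\<close>)
  finally show "Z \<in> U2 R" .
qed

section \<open>The integral over the three-sphere of radius R as a mean\<close>

definition S3_pt :: "real \<Rightarrow> real^4 \<Rightarrow> hc" where
  "S3_pt R x = csc R (quat (cvec x))"

lemma continuous_on_S3_pt [continuous_intros]: "continuous_on S f \<Longrightarrow> continuous_on S (\<lambda>x. S3_pt R (f x))"
  unfolding S3_pt_def by (intro continuous_intros)

lemma S3_pt_sph: "quat (cvec (S3_chart R a b c)) = S3_pt R (sph a b c)"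
  by (simp add: S3_pt_def S3_chart_def quat_def cvec_def hc_eq_iff algebra_simps)

lemma S3_pt_in: "x \<in> sphere.carr \<Longrightarrow> S3_pt R x \<in> U2 R"
  using sphere_U2[of x R 0] by (simp add: S3_pt_def quat_smult)

lemma S3_integral_eq_avg:
  assumes R: "0 \<le> R" and f: "continuous_on (U2 R) f"
  shows "S3_integral R f = 2 * complex_of_real pi ^ 2 * R ^ 3 * sphere.avg (\<lambda>x. f (S3_pt R x))"
proof -
  let ?B = "{0..pi} \<times> {0..pi} \<times> {0..2*pi}"
  let ?h = "\<lambda>(a, b, c). complex_of_real ((sin a)\<^sup>2 * sin b / (2 * pi\<^sup>2)) * f (S3_pt R (sph a b c))"
  have B: "?B = cbox (0, 0, 0) (pi, pi, 2*pi)" by (simp add: cbox_Pair_eq)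
  have "continuous_on sphere.carr (\<lambda>x. f (S3_pt R x))"
    by (rule continuous_on_compose2[OF f]) (auto intro!: continuous_intros S3_pt_in)
  from sphere.continuous_integrand[OF this]
  have c: "continuous_on ?B ?h" unfolding B by (simp add: split_def)
  have "S3_integral R f = set_lebesgue_integral lborel ?B (\<lambda>x. (2 * complex_of_real pi ^ 2 * R ^ 3) * ?h x)"
    unfolding S3_integral_def S3_pt_sph
  proof (rule set_lebesgue_integral_cong)
    show "?B \<in> sets lborel" by (simp add: B)
  qed (auto simp: dS_jac_S3[OF R] power2_eq_square)
  also have "\<dots> = (2 * complex_of_real pi ^ 2 * R ^ 3) * set_lebesgue_integral lborel ?B ?h"
    by (rule set_integral_mult_right)
  also have "set_lebesgue_integral lborel ?B ?h = integral ?B ?h"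
    by (intro set_borel_integral_eq_integral, unfold set_integrable_def, intro borel_integrable_compact c)
       (simp add: B)
  also have "integral ?B ?h = sphere.avg (\<lambda>x. f (S3_pt R x))"
    unfolding B sphere.avg_def by (simp add: split_def)
  finally show ?thesis by simp
qed

lemma S3_integral_cong: "(\<And>Z. Z \<in> S3 R \<Longrightarrow> f Z = g Z) \<Longrightarrow> 0 < R \<Longrightarrow> S3_integral R f = S3_integral R g"
  unfolding S3_integral_def
proof (rule set_lebesgue_integral_cong)
  assume *: "\<And>Z. Z \<in> S3 R \<Longrightarrow> f Z = g Z" and R: "0 < R"
  have "{0..pi} \<times> {0..pi} \<times> {0..2*pi} = cbox (0, 0, 0) (pi, pi, 2*pi)"
    by (simp add: cbox_Pair_eq)
  then show "{0..pi} \<times> {0..pi} \<times> {0..2*pi} \<in> sets lborel" by simp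
  show "\<forall>x. x \<in> {0..pi} \<times> {0..pi} \<times> {0..2*pi} \<longrightarrow>
      (case x of (a, b, c) \<Rightarrow> f (quat (cvec (S3_chart R a b c))) * complex_of_real (dS_jac (S3_chart R) a b c)) =
      (case x of (a, b, c) \<Rightarrow> g (quat (cvec (S3_chart R a b c))) * complex_of_real (dS_jac (S3_chart R) a b c))"
  proof (intro allI impI)
    fix x assume "x \<in> {0..pi} \<times> {0..pi} \<times> {0..2*pi}"
    then have "(\<lambda>(a, b, c). quat (cvec (S3_chart R a b c))) x \<in> S3 R"
      unfolding S3_chart_image[OF R, symmetric] by (rule imageI)
    from *[OF this] show "(case x of (a, b, c) \<Rightarrow> f (quat (cvec (S3_chart R a b c))) * complex_of_real (dS_jac (S3_chart R) a b c)) =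
      (case x of (a, b, c) \<Rightarrow> g (quat (cvec (S3_chart R a b c))) * complex_of_real (dS_jac (S3_chart R) a b c))"
      by (simp add: split_def)
  qed
qed

text \<open>R^2 compensates the degree -2 of 1 / N, and q + 1 is the factor by which
  \<open>deg_tilde\<close> multiplies the plane wave.\<close>

lemma sphere_plane_wave_scaled:
  assumes T: "T \<in> inside R" and R: "0 < R"
  shows "sphere.avg (\<lambda>x. complex_of_real R ^ 2 * (of_nat (Suc q) * pair (tens u v) (S3_pt R x) ^ q * inverse (N (S3_pt R x - T))))
    = pair (tens u v) T ^ q"
proof -
  define T0 where "T0 = csc (1 / R) T"
  have T0: "T0 \<in> inside 1"
    unfolding inside_def
  proof (intro CollectI ballI allI impI)
    fix Z \<zeta> assume *: "Z \<in> U2 1" "norm (\<zeta>::complex) \<le> 1"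
    have "csc R Z \<in> U2 R"
    proof -
      have "csc R Z = R *\<^sub>R Z" by (simp add: hc_eq_iff scaleR_conv_of_real[where 'a=complex])
      then show ?thesis using *(1) by (auto simp: U2_def)
    qed
    from insideD[OF T this *(2)] have "N (csc R Z - csc \<zeta> T) \<noteq> 0" .
    moreover have "csc R Z - csc \<zeta> T = csc R (Z - csc \<zeta> T0)"
      using R by (simp add: T0_def hc_eq_iff algebra_simps)
    ultimately show "N (Z - csc \<zeta> T0) \<noteq> 0" by (simp add: N_csc)
  qed
  have T: "T = csc R T0" using R by (simp add: T0_def hc_eq_iff)
  have e: "complex_of_real R ^ 2 * (of_nat (Suc q) * pair (tens u v) (S3_pt R x) ^ q * inverse (N (S3_pt R x - T)))
      = (complex_of_real R ^ q * of_nat (Suc q)) * (pair (tens u v) (quat (cvec x)) ^ q * inverse (N (quat (cvec x) - T0)))" for x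
  proof -
    have "S3_pt R x - T = csc R (quat (cvec x) - T0)"
      by (simp add: T S3_pt_def hc_eq_iff algebra_simps)
    then show ?thesis
      using R by (simp add: N_csc S3_pt_def power_mult_distrib del: of_nat_Suc)
  qed
  show ?thesis
    unfolding e
    unfolding sphere.avg_cmult mult.assoc sphere_plane_wave[OF T0]
    by (simp add: T power_mult_distrib)
qed

section \<open>Constants, and interchange of the four integrals\<close>

lemma N_minus_commute: "N (A - B) = N (B - A)"
  by (simp add: det_2 algebra_simps)

text \<open>The factors free of Z1 and Z2, with the densities N^2 of dV in T1 and T2
  included.\<close>

definition C_kernel :: "hc \<Rightarrow> hc \<Rightarrow> hc \<Rightarrow> hc \<Rightarrow> complex" where
  "C_kernel W1 W2 T1 T2 = (N T1)\<^sup>2 * (N T2)\<^sup>2 * inverse (N (T1 - T2))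
     * inverse (N (T1 - W1)) * inverse (N (T2 - W1)) * inverse (N (T2 - W2))"

text \<open>The factors with Z1; N Z is what remains of the density N^2 after the division by N Z in
  \<open>L2\<close>.\<close>

definition A_kernel :: "(hc \<Rightarrow> complex) \<Rightarrow> hc \<Rightarrow> hc \<Rightarrow> hc \<Rightarrow> hc \<Rightarrow> complex" where
  "A_kernel g W1 Z T1 T2 = N Z * N (Z - W1) * g Z * inverse (N (Z - T1)) * inverse (N (Z - T2))"

context
  fixes r1 r2 R1 R2 :: real and W1 W2 :: hc
  assumes r: "r1 > r2" "r2 > 0" "R1 > r1" "R2 > r1" and W: "W1 \<in> D_plus r2" "W2 \<in> D_plus r2"
begin

lemma kernels_nonzero:
  "T1 \<in> U2 r1 \<Longrightarrow> T2 \<in> U2 r2 \<Longrightarrow> N (T1 - T2) \<noteq> 0"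
  "T1 \<in> U2 r1 \<Longrightarrow> N (T1 - W1) \<noteq> 0" "T2 \<in> U2 r2 \<Longrightarrow> N (T2 - W1) \<noteq> 0" "T2 \<in> U2 r2 \<Longrightarrow> N (T2 - W2) \<noteq> 0"
  "Z1 \<in> U2 R1 \<Longrightarrow> T1 \<in> U2 r1 \<Longrightarrow> N (Z1 - T1) \<noteq> 0" "Z1 \<in> U2 R1 \<Longrightarrow> T2 \<in> U2 r2 \<Longrightarrow> N (Z1 - T2) \<noteq> 0"
  "Z2 \<in> U2 R2 \<Longrightarrow> T1 \<in> U2 r1 \<Longrightarrow> N (Z2 - T1) \<noteq> 0"
proof -
  have U: "Z \<in> U2 R \<Longrightarrow> T \<in> U2 \<rho> \<Longrightarrow> 0 \<le> \<rho> \<Longrightarrow> \<rho> < R \<Longrightarrow> N (Z - T) \<noteq> 0" for Z T R \<rho>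
    using insideD1[OF U2_inside] by blast
  have D: "Z \<in> U2 R \<Longrightarrow> T \<in> D_plus \<rho> \<Longrightarrow> 0 \<le> \<rho> \<Longrightarrow> \<rho> \<le> R \<Longrightarrow> N (Z - T) \<noteq> 0" for Z T R \<rho>
    using insideD1[OF D_plus_inside] by blast
  show "T1 \<in> U2 r1 \<Longrightarrow> T2 \<in> U2 r2 \<Longrightarrow> N (T1 - T2) \<noteq> 0"
    "T1 \<in> U2 r1 \<Longrightarrow> N (T1 - W1) \<noteq> 0" "T2 \<in> U2 r2 \<Longrightarrow> N (T2 - W1) \<noteq> 0" "T2 \<in> U2 r2 \<Longrightarrow> N (T2 - W2) \<noteq> 0"
    "Z1 \<in> U2 R1 \<Longrightarrow> T1 \<in> U2 r1 \<Longrightarrow> N (Z1 - T1) \<noteq> 0" "Z1 \<in> U2 R1 \<Longrightarrow> T2 \<in> U2 r2 \<Longrightarrow> N (Z1 - T2) \<noteq> 0"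
    "Z2 \<in> U2 R2 \<Longrightarrow> T1 \<in> U2 r1 \<Longrightarrow> N (Z2 - T1) \<noteq> 0"
    using U[of T1 r1 T2 r2] D[of T1 r1 W1 r2] D[of T2 r2 W1 r2] D[of T2 r2 W2 r2] U[of Z1 R1 T1 r1] U[of Z1 R1 T2 r2]
      U[of Z2 R2 T1 r1] r W by simp_all
qed

lemma continuous_on_C_kernel:
  assumes "continuous_on S f" "continuous_on S g" "\<And>x. x \<in> S \<Longrightarrow> f x \<in> U2 r1" "\<And>x. x \<in> S \<Longrightarrow> g x \<in> U2 r2"
  shows "continuous_on S (\<lambda>x. C_kernel W1 W2 (f x) (g x))"
  unfolding C_kernel_def
  by (intro continuous_intros assms(1,2)) (use kernels_nonzero assms(3,4) in auto)

lemma continuous_on_A_kernel: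
  assumes "continuous_on S h" "continuous_on S f" "continuous_on S g" "continuous_on UNIV \<phi>"
    "\<And>x. x \<in> S \<Longrightarrow> f x \<in> U2 r1" "\<And>x. x \<in> S \<Longrightarrow> g x \<in> U2 r2" "\<And>x. x \<in> S \<Longrightarrow> h x \<in> U2 R1"
  shows "continuous_on S (\<lambda>x. A_kernel \<phi> W1 (h x) (f x) (g x))"
proof -
  have "continuous_on S (\<lambda>x. \<phi> (h x))" by (rule continuous_on_compose2[OF assms(4,1)]) simp
  then show ?thesis
    unfolding A_kernel_def
    by (intro continuous_intros assms(1-3)) (use kernels_nonzero assms(5-7) in auto)
qed

text \<open>The two integrals of dV contribute (- 2 pi^3 \<i>)^2 = - 4 pi^6, which the prefactor of
  \<open>l2_tilde\<close> cancels.\<close>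

lemma l2_tilde_eq:
  assumes Z: "Z1 \<in> U2 R1" "Z2 \<in> U2 R2"
  shows "l2_tilde r1 r2 Z1 Z2 W1 W2 = E r1 (\<lambda>T1. E r2 (\<lambda>T2.
    C_kernel W1 W2 T1 T2 * (inverse (N (Z1 - T1)) * inverse (N (Z1 - T2)) * inverse (N (Z2 - T1)))))"
proof -
  define K where "K T1 T2 = inverse (N (T1 - T2)) /
       (N (Z1 - T1) * N (Z2 - T1) * N (W1 - T1) * N (Z1 - T2) * N (W1 - T2) * N (W2 - T2))" for T1 T2
  have cK: "continuous_on (U2 r1 \<times> U2 r2) (\<lambda>(T1, T2). K T1 T2)"
    unfolding K_def split_def N_minus_commute[of W1] N_minus_commute[of W2]
    by (intro continuous_intros) (use kernels_nonzero Z in auto)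
  have inner: "U2_integral r2 (K T1) = - 2 * complex_of_real pi ^ 3 * \<i> * E r2 (\<lambda>T2. K T1 T2 * (N T2)\<^sup>2)"
    if "T1 \<in> U2 r1" for T1
    by (rule U2_integral_eq_E) (rule U.slice_continuous[OF cK that])
  have cE: "continuous_on (U2 r1) (\<lambda>T1. E r2 (\<lambda>T2. K T1 T2 * (N T2)\<^sup>2))"
    by (rule E_continuous) (use cK in \<open>auto simp: split_def intro!: continuous_intros\<close>)
  have "U2_integral r1 (\<lambda>T1. U2_integral r2 (K T1))
      = U2_integral r1 (\<lambda>T1. - 2 * complex_of_real pi ^ 3 * \<i> * E r2 (\<lambda>T2. K T1 T2 * (N T2)\<^sup>2))"
    by (rule U2_integral_cong) (rule inner)
  also have "\<dots> = - 2 * complex_of_real pi ^ 3 * \<i> * E r1 (\<lambda>T1. (- 2 * complex_of_real pi ^ 3 * \<i> * E r2 (\<lambda>T2. K T1 T2 * (N T2)\<^sup>2)) * (N T1)\<^sup>2)"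
    by (rule U2_integral_eq_E) (intro continuous_intros cE)
  also have "E r1 (\<lambda>T1. (- 2 * complex_of_real pi ^ 3 * \<i> * E r2 (\<lambda>T2. K T1 T2 * (N T2)\<^sup>2)) * (N T1)\<^sup>2)
      = - 2 * complex_of_real pi ^ 3 * \<i> * E r1 (\<lambda>T1. E r2 (\<lambda>T2. (N T1)\<^sup>2 * (K T1 T2 * (N T2)\<^sup>2)))"
  proof -
    have "(\<lambda>T1. (- 2 * complex_of_real pi ^ 3 * \<i> * E r2 (\<lambda>T2. K T1 T2 * (N T2)\<^sup>2)) * (N T1)\<^sup>2)
      = (\<lambda>T1. - 2 * complex_of_real pi ^ 3 * \<i> * E r2 (\<lambda>T2. (N T1)\<^sup>2 * (K T1 T2 * (N T2)\<^sup>2)))"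
      unfolding E_cmult by (rule ext) (simp add: ac_simps)
    then show ?thesis by (simp only: E_cmult)
  qed
  also have "E r1 (\<lambda>T1. E r2 (\<lambda>T2. (N T1)\<^sup>2 * (K T1 T2 * (N T2)\<^sup>2))) = E r1 (\<lambda>T1. E r2 (\<lambda>T2.
    C_kernel W1 W2 T1 T2 * (inverse (N (Z1 - T1)) * inverse (N (Z1 - T2)) * inverse (N (Z2 - T1)))))"
    unfolding K_def C_kernel_def N_minus_commute[of W1] N_minus_commute[of W2]
    by (simp add: divide_inverse ac_simps)
  finally have "U2_integral r1 (\<lambda>T1. U2_integral r2 (K T1)) = (- 2 * complex_of_real pi ^ 3 * \<i>) * ((- 2 * complex_of_real pi ^ 3 * \<i>) *
     E r1 (\<lambda>T1. E r2 (\<lambda>T2. C_kernel W1 W2 T1 T2 * (inverse (N (Z1 - T1)) * inverse (N (Z1 - T2)) * inverse (N (Z2 - T1))))))" .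
  moreover have "(- 2 * complex_of_real pi ^ 3 * \<i>) * (- 2 * complex_of_real pi ^ 3 * \<i>) = - (4 * complex_of_real pi ^ 6)"
    by (simp add: algebra_simps flip: power_add)
  ultimately have "U2_integral r1 (\<lambda>T1. U2_integral r2 (K T1)) = - (4 * complex_of_real pi ^ 6) *
     E r1 (\<lambda>T1. E r2 (\<lambda>T2. C_kernel W1 W2 T1 T2 * (inverse (N (Z1 - T1)) * inverse (N (Z1 - T2)) * inverse (N (Z2 - T1)))))"
    by (simp only: mult.assoc[symmetric])
  then show ?thesis
    unfolding l2_tilde_def K_def by simp
qed

end

text \<open>The mean form of \<open>l2_tilde\<close> for Z1 in \<open>U2 R1\<close> and Z2 in
  \<open>U2 R2\<close>; its continuity in both points follows from
  \<open>E_continuous\<close>.\<close>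

definition L_kernel :: "real \<Rightarrow> real \<Rightarrow> hc \<Rightarrow> hc \<Rightarrow> hc \<Rightarrow> hc \<Rightarrow> complex" where
  "L_kernel r1 r2 W1 W2 Z1 Z2 = E r1 (\<lambda>T1. E r2 (\<lambda>T2.
     C_kernel W1 W2 T1 T2 * (inverse (N (Z1 - T1)) * inverse (N (Z1 - T2)) * inverse (N (Z2 - T1)))))"

context
  fixes r1 r2 R1 R2 :: real and W1 W2 :: hc
  assumes r: "r1 > r2" "r2 > 0" "R1 > r1" "R2 > r1" and W: "W1 \<in> D_plus r2" "W2 \<in> D_plus r2"
begin

lemmas kernel_denominators = kernels_nonzero[OF r W]
lemmas continuous_C = continuous_on_C_kernel[OF r W]
lemmas continuous_A = continuous_on_A_kernel[OF r W]

lemma continuous_on_L_kernel: "continuous_on (U2 R1 \<times> U2 R2) (\<lambda>(Z1, Z2). L_kernel r1 r2 W1 W2 Z1 Z2)"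
proof -
  have "continuous_on (((U2 R1 \<times> U2 R2) \<times> U2 r1) \<times> U2 r2) (\<lambda>((z, T1), T2). C_kernel W1 W2 T1 T2 *
      (inverse (N (fst z - T1)) * inverse (N (fst z - T2)) * inverse (N (snd z - T1))))"
    unfolding split_def by (intro continuous_intros continuous_C) (use kernel_denominators in auto)
  then have "continuous_on ((U2 R1 \<times> U2 R2) \<times> U2 r1) (\<lambda>x. E r2 (\<lambda>T2. C_kernel W1 W2 (snd x) T2 *
      (inverse (N (fst (fst x) - snd x)) * inverse (N (fst (fst x) - T2)) * inverse (N (snd (fst x) - snd x)))))"
    by (intro E_continuous) (simp add: split_def)
  then have "continuous_on (U2 R1 \<times> U2 R2) (\<lambda>z. E r1 (\<lambda>T1. E r2 (\<lambda>T2. C_kernel W1 W2 T1 T2 *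
      (inverse (N (fst z - T1)) * inverse (N (fst z - T2)) * inverse (N (snd z - T1))))))"
    by (intro E_continuous) (simp add: split_def)
  then show ?thesis by (simp add: L_kernel_def split_def)
qed

lemma continuous_on_L_kernel_sphere:
  assumes "continuous_on UNIV g"
  shows "continuous_on (U2 R1 \<times> sphere.carr) (\<lambda>(Z1, x). L_kernel r1 r2 W1 W2 Z1 (S3_pt R2 x) * g (S3_pt R2 x))"
proof -
  have "continuous_on (U2 R1 \<times> sphere.carr) (\<lambda>x. (\<lambda>(Z1, Z2). L_kernel r1 r2 W1 W2 Z1 Z2) (fst x, S3_pt R2 (snd x)))"
    by (rule continuous_on_compose2[OF continuous_on_L_kernel])
       (use r S3_pt_in in \<open>auto intro!: continuous_intros\<close>)
  moreover have "continuous_on (U2 R1 \<times> sphere.carr) (\<lambda>x. g (S3_pt R2 (snd x)))"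
    by (rule continuous_on_compose2[OF assms]) (auto intro!: continuous_intros)
  ultimately show ?thesis
    unfolding split_def by (intro continuous_intros) simp_all
qed

text \<open>The constants cancel: \<i> / (4 pi^5) times - 2 pi^3 \<i> from dV times 2 pi^2 from the
  sphere is 1, and R2^3 / R2 leaves R2^2.\<close>

lemma L2_eq_mean:
  assumes f: "continuous_on UNIV (deg_tilde f1)" "continuous_on UNIV (deg_tilde f2)"
  shows "L2 r1 r2 R1 R2 f1 f2 W1 W2 = E R1 (\<lambda>Z1. N Z1 * N (Z1 - W1) * deg_tilde f1 Z1 * (complex_of_real R2 ^ 2 *
    sphere.avg (\<lambda>x. L_kernel r1 r2 W1 W2 Z1 (S3_pt R2 x) * deg_tilde f2 (S3_pt R2 x))))"
proof -
  define g1 g2 where "g1 = deg_tilde f1" and "g2 = deg_tilde f2"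
  define lt where "lt = L_kernel r1 r2 W1 W2"
  have R: "R1 > 0" "R2 > 0" "r1 > 0" using r by auto
  have cg: "continuous_on S (\<lambda>x. g1 (f x))" "continuous_on S (\<lambda>x. g2 (f x))"
    if "continuous_on S f" for f and S :: "'q::topological_space set"
    using continuous_on_compose2[OF assms(1) that] continuous_on_compose2[OF assms(2) that]
    by (auto simp: g1_def g2_def)
  note clt = continuous_on_L_kernel[folded lt_def]
  define F where "F Z1 = sphere.avg (\<lambda>x. lt Z1 (S3_pt R2 x) * g2 (S3_pt R2 x))" for Z1
  have cF: "continuous_on (U2 R1) F"
    unfolding F_def lt_def g2_def by (rule sphere.avg_continuous continuous_on_L_kernel_sphere f(2))+
  have nzR: "Z \<in> U2 R1 \<Longrightarrow> N Z \<noteq> 0" for Z using U2_N_nonzero[of Z R1] R by simp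
  have "U2_integral R1 (\<lambda>Z1. S3_integral R2 (\<lambda>Z2. l2 r1 r2 Z1 Z2 W1 W2 * g1 Z1 * g2 Z2 / N Z1 / complex_of_real R2))
    = U2_integral R1 (\<lambda>Z1. 2 * complex_of_real pi ^ 2 * complex_of_real R2 ^ 2 * (N (Z1 - W1) * g1 Z1 / N Z1 * F Z1))"
  proof (rule U2_integral_cong)
    fix Z1 assume Z1: "Z1 \<in> U2 R1"
    have "S3_integral R2 (\<lambda>Z2. l2 r1 r2 Z1 Z2 W1 W2 * g1 Z1 * g2 Z2 / N Z1 / complex_of_real R2)
      = S3_integral R2 (\<lambda>Z2. N (Z1 - W1) * lt Z1 Z2 * g1 Z1 * g2 Z2 / N Z1 / complex_of_real R2)"
      by (rule S3_integral_cong)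
         (use l2_tilde_eq[OF r W Z1] S3_U2[OF R(2)] R in \<open>auto simp: l2_def lt_def L_kernel_def\<close>)
    also have "\<dots> = 2 * complex_of_real pi ^ 2 * R2 ^ 3 * sphere.avg (\<lambda>x. N (Z1 - W1) * lt Z1 (S3_pt R2 x) * g1 Z1 * g2 (S3_pt R2 x) / N Z1 / complex_of_real R2)"
      using R by (intro S3_integral_eq_avg continuous_intros cg U.slice_continuous[OF clt Z1] continuous_on_id) (auto simp: nzR Z1)
    also have "(\<lambda>x. N (Z1 - W1) * lt Z1 (S3_pt R2 x) * g1 Z1 * g2 (S3_pt R2 x) / N Z1 / complex_of_real R2)
        = (\<lambda>x. N (Z1 - W1) * g1 Z1 / N Z1 / complex_of_real R2 * (lt Z1 (S3_pt R2 x) * g2 (S3_pt R2 x)))"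
      by (simp add: divide_inverse ac_simps)
    also have "sphere.avg \<dots> = N (Z1 - W1) * g1 Z1 / N Z1 / complex_of_real R2 * F Z1"
      unfolding F_def by (rule sphere.avg_cmult)
    finally show "S3_integral R2 (\<lambda>Z2. l2 r1 r2 Z1 Z2 W1 W2 * g1 Z1 * g2 Z2 / N Z1 / complex_of_real R2)
      = 2 * complex_of_real pi ^ 2 * complex_of_real R2 ^ 2 * (N (Z1 - W1) * g1 Z1 / N Z1 * F Z1)"
      using R by (simp add: power2_eq_square power3_eq_cube)
  qed
  also have "\<dots> = - 2 * complex_of_real pi ^ 3 * \<i> * E R1 (\<lambda>Z1. 2 * complex_of_real pi ^ 2 * complex_of_real R2 ^ 2 * (N (Z1 - W1) * g1 Z1 / N Z1 * F Z1) * (N Z1)\<^sup>2)"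
    by (rule U2_integral_eq_E) (auto intro!: continuous_intros cg cF nzR)
  also have "E R1 (\<lambda>Z1. 2 * complex_of_real pi ^ 2 * complex_of_real R2 ^ 2 * (N (Z1 - W1) * g1 Z1 / N Z1 * F Z1) * (N Z1)\<^sup>2)
      = E R1 (\<lambda>Z1. (2 * complex_of_real pi ^ 2) * (N Z1 * N (Z1 - W1) * g1 Z1 * (complex_of_real R2 ^ 2 * F Z1)))"
    by (rule E_cong) (use nzR in \<open>simp add: power2_eq_square field_simps\<close>)
  also have "\<dots> = (2 * complex_of_real pi ^ 2) * E R1 (\<lambda>Z1. N Z1 * N (Z1 - W1) * g1 Z1 * (complex_of_real R2 ^ 2 * F Z1))"
    by (rule E_cmult)
  finally have "L2 r1 r2 R1 R2 f1 f2 W1 W2 = (\<i> / (4 * complex_of_real pi ^ 5) * (- 2 * complex_of_real pi ^ 3 * \<i> * (2 * complex_of_real pi ^ 2)))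
      * E R1 (\<lambda>Z1. N Z1 * N (Z1 - W1) * g1 Z1 * (complex_of_real R2 ^ 2 * F Z1))"
    unfolding L2_def g1_def g2_def by simp
  also have "\<i> / (4 * complex_of_real pi ^ 5) * (- 2 * complex_of_real pi ^ 3 * \<i> * (2 * complex_of_real pi ^ 2)) = 1"
    by (simp add: field_simps flip: power_add)
  finally show ?thesis by (simp add: F_def g1_def g2_def lt_def)
qed

text \<open>The means over Z2 and Z1 enter as given functions h and k. T1 ends up innermost because
  T2 lies inside \<open>U2 r1\<close>: the T1 mean has the admissible poles W1 and T2, and the T2
  mean then has W1 and W2.\<close>

lemma L2_eq_means:
  assumes f: "continuous_on UNIV (deg_tilde f1)" "continuous_on UNIV (deg_tilde f2)"
    and S: "\<And>T. T \<in> U2 r1 \<Longrightarrow> sphere.avg (\<lambda>x. complex_of_real R2 ^ 2 * (deg_tilde f2 (S3_pt R2 x) * inverse (N (S3_pt R2 x - T)))) = h T"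
    and h: "continuous_on UNIV h"
    and A: "\<And>T1 T2. T1 \<in> U2 r1 \<Longrightarrow> T2 \<in> U2 r2 \<Longrightarrow> E R1 (\<lambda>Z. A_kernel (deg_tilde f1) W1 Z T1 T2) = k T1 T2"
  shows "L2 r1 r2 R1 R2 f1 f2 W1 W2 = E r2 (\<lambda>T2. E r1 (\<lambda>T1. C_kernel W1 W2 T1 T2 * (k T1 T2 * h T1)))"
proof -
  define g1 g2 where "g1 = deg_tilde f1" and "g2 = deg_tilde f2"
  define a where "a = A_kernel g1 W1"
  define c where "c = C_kernel W1 W2"
  define b where "b x T = complex_of_real R2 ^ 2 * (g2 (S3_pt R2 x) * inverse (N (S3_pt R2 x - T)))" for x T
  define lt where "lt = L_kernel r1 r2 W1 W2"
  define F where "F Z1 = sphere.avg (\<lambda>x. lt Z1 (S3_pt R2 x) * g2 (S3_pt R2 x))" for Z1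
  have R: "R1 > 0" "R2 > 0" "r1 > 0" using r by auto
  have cg: "continuous_on S (\<lambda>x. g1 (f x))" "continuous_on S (\<lambda>x. g2 (f x))" "continuous_on S (\<lambda>x. h (f x))"
    if "continuous_on S f" for f and S :: "'q::topological_space set"
    using continuous_on_compose2[OF assms(1) that] continuous_on_compose2[OF assms(2) that]
      continuous_on_compose2[OF h that] by (auto simp: g1_def g2_def)
  have "L2 r1 r2 R1 R2 f1 f2 W1 W2 = E R1 (\<lambda>Z1. N Z1 * N (Z1 - W1) * g1 Z1 * (complex_of_real R2 ^ 2 * F Z1))"
    by (simp add: L2_eq_mean f F_def g1_def g2_def lt_def)
  also have "E R1 (\<lambda>Z1. N Z1 * N (Z1 - W1) * g1 Z1 * (complex_of_real R2 ^ 2 * F Z1))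
      = E R1 (\<lambda>Z1. E r1 (\<lambda>T1. h T1 * E r2 (\<lambda>T2. c T1 T2 * a Z1 T1 T2)))"
  proof (rule E_cong)
    fix Z1 assume Z1: "Z1 \<in> U2 R1"
    \<comment> \<open>Everything except the factor with Z2, so that the sphere mean has to be
      exchanged with the mean over T1 only.\<close>
    define d where "d T1 = E r2 (\<lambda>T2. c T1 T2 * a Z1 T1 T2)" for T1
    have "continuous_on (U2 r1 \<times> U2 r2) (\<lambda>(T1, T2). c T1 T2 * a Z1 T1 T2)"
      unfolding split_def c_def a_def
      by (intro continuous_intros continuous_C continuous_A) (use Z1 cg(1)[OF continuous_on_id] in auto)
    then have cd: "continuous_on (U2 r1) d"
      unfolding d_def by (rule E_continuous)
    have cb: "continuous_on (U2 r1 \<times> sphere.carr) (\<lambda>(T1, x). d T1 * b x T1)"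
    proof -
      have "continuous_on (U2 r1 \<times> sphere.carr) (\<lambda>x. d (fst x))"
        by (rule continuous_on_compose2[OF cd]) (auto intro!: continuous_intros)
      then show ?thesis
        unfolding split_def b_def by (intro continuous_intros cg) (use kernel_denominators S3_pt_in in auto)
    qed
    have "N Z1 * N (Z1 - W1) * g1 Z1 * (complex_of_real R2 ^ 2 * F Z1)
      = sphere.avg (\<lambda>x. (N Z1 * N (Z1 - W1) * g1 Z1 * complex_of_real R2 ^ 2) * (lt Z1 (S3_pt R2 x) * g2 (S3_pt R2 x)))"
      unfolding F_def sphere.avg_cmult by (simp add: ac_simps)
    also have "\<dots> = sphere.avg (\<lambda>x. E r1 (\<lambda>T1. d T1 * b x T1))"
    proof (rule arg_cong[where f = sphere.avg], rule ext)
      fix x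
      define m where "m = N Z1 * N (Z1 - W1) * g1 Z1 * complex_of_real R2 ^ 2 * g2 (S3_pt R2 x)"
      have "E r1 (\<lambda>T1. d T1 * b x T1) = E r1 (\<lambda>T1. m * E r2 (\<lambda>T2.
          c T1 T2 * (inverse (N (Z1 - T1)) * inverse (N (Z1 - T2)) * inverse (N (S3_pt R2 x - T1)))))"
      proof (rule arg_cong[where f = "E r1"], rule ext)
        fix T1
        have "d T1 * b x T1 = b x T1 * d T1" by simp
        also have "\<dots> = E r2 (\<lambda>T2. b x T1 * (c T1 T2 * a Z1 T1 T2))"
          unfolding d_def by (rule E_cmult[symmetric])
        also have "\<dots> = E r2 (\<lambda>T2. m * (c T1 T2 * (inverse (N (Z1 - T1)) * inverse (N (Z1 - T2)) * inverse (N (S3_pt R2 x - T1)))))"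
          unfolding a_def A_kernel_def b_def m_def by (simp add: ac_simps)
        also have "\<dots> = m * E r2 (\<lambda>T2. c T1 T2 * (inverse (N (Z1 - T1)) * inverse (N (Z1 - T2)) * inverse (N (S3_pt R2 x - T1))))"
          by (rule E_cmult)
        finally show "d T1 * b x T1 = m * E r2 (\<lambda>T2. c T1 T2 * (inverse (N (Z1 - T1)) * inverse (N (Z1 - T2)) * inverse (N (S3_pt R2 x - T1))))" .
      qed
      also have "\<dots> = m * lt Z1 (S3_pt R2 x)" unfolding lt_def L_kernel_def c_def[symmetric] by (rule E_cmult)
      finally show "(N Z1 * N (Z1 - W1) * g1 Z1 * complex_of_real R2 ^ 2) * (lt Z1 (S3_pt R2 x) * g2 (S3_pt R2 x))
          = E r1 (\<lambda>T1. d T1 * b x T1)"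
        by (simp add: m_def ac_simps)
    qed
    also have "\<dots> = E r1 (\<lambda>T1. sphere.avg (\<lambda>x. d T1 * b x T1))"
      by (rule E_sphere_swap[OF cb, symmetric])
    also have "\<dots> = E r1 (\<lambda>T1. h T1 * d T1)"
      by (rule E_cong) (use S in \<open>simp add: sphere.avg_cmult[of "d _"] flip: b_def g2_def\<close>)
    finally show "N Z1 * N (Z1 - W1) * g1 Z1 * (complex_of_real R2 ^ 2 * F Z1)
      = E r1 (\<lambda>T1. h T1 * E r2 (\<lambda>T2. c T1 T2 * a Z1 T1 T2))" by (simp add: d_def)
  qed
  also have "\<dots> = E r1 (\<lambda>T1. E R1 (\<lambda>Z1. h T1 * E r2 (\<lambda>T2. c T1 T2 * a Z1 T1 T2)))"
  proof (rule E_E_swap)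
    have "continuous_on ((U2 R1 \<times> U2 r1) \<times> U2 r2) (\<lambda>(z, T2). c (snd z) T2 * a (fst z) (snd z) T2)"
      unfolding split_def c_def a_def
      by (intro continuous_intros continuous_C continuous_A) (use cg(1)[OF continuous_on_id] in auto)
    then have "continuous_on (U2 R1 \<times> U2 r1) (\<lambda>z. E r2 (\<lambda>T2. c (snd z) T2 * a (fst z) (snd z) T2))"
      by (rule E_continuous)
    then show "continuous_on (U2 R1 \<times> U2 r1) (\<lambda>(Z1, T1). h T1 * E r2 (\<lambda>T2. c T1 T2 * a Z1 T1 T2))"
      unfolding split_def by (intro continuous_intros cg) auto
  qed
  also have "\<dots> = E r1 (\<lambda>T1. E r2 (\<lambda>T2. c T1 T2 * (k T1 T2 * h T1)))"
  proof (rule E_cong)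
    fix T1 assume T1: "T1 \<in> U2 r1"
    have "E R1 (\<lambda>Z1. h T1 * E r2 (\<lambda>T2. c T1 T2 * a Z1 T1 T2)) = h T1 * E R1 (\<lambda>Z1. E r2 (\<lambda>T2. c T1 T2 * a Z1 T1 T2))"
      by (rule E_cmult)
    also have "E R1 (\<lambda>Z1. E r2 (\<lambda>T2. c T1 T2 * a Z1 T1 T2)) = E r2 (\<lambda>T2. E R1 (\<lambda>Z1. c T1 T2 * a Z1 T1 T2))"
      by (rule E_E_swap) (unfold split_def c_def a_def, intro continuous_intros continuous_C continuous_A,
        use T1 cg(1)[OF continuous_on_id] in auto)
    also have "\<dots> = E r2 (\<lambda>T2. c T1 T2 * k T1 T2)"
      by (rule E_cong) (simp add: E_cmult a_def g1_def A T1)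
    also have "h T1 * \<dots> = E r2 (\<lambda>T2. h T1 * (c T1 T2 * k T1 T2))"
      by (rule E_cmult[symmetric])
    finally show "E R1 (\<lambda>Z1. h T1 * E r2 (\<lambda>T2. c T1 T2 * a Z1 T1 T2)) = E r2 (\<lambda>T2. c T1 T2 * (k T1 T2 * h T1))"
      by (simp add: ac_simps)
  qed
  also have "\<dots> = E r2 (\<lambda>T2. E r1 (\<lambda>T1. c T1 T2 * (k T1 T2 * h T1)))"
  proof -
    have "continuous_on (U2 r1 \<times> U2 r2) (\<lambda>z. E R1 (\<lambda>Z. a Z (fst z) (snd z)))"
    proof (rule E_continuous)
      show "continuous_on ((U2 r1 \<times> U2 r2) \<times> U2 R1) (\<lambda>(z, Z). a Z (fst z) (snd z))"
        unfolding split_def a_def by (intro continuous_intros continuous_A) (use cg(1)[OF continuous_on_id] in auto)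
    qed
    then have "continuous_on (U2 r1 \<times> U2 r2) (\<lambda>z. k (fst z) (snd z))"
      by (rule continuous_on_eq) (auto simp: a_def g1_def A)
    then have "continuous_on (U2 r1 \<times> U2 r2) (\<lambda>(T1, T2). c T1 T2 * (k T1 T2 * h T1))"
      unfolding split_def c_def by (intro continuous_intros continuous_C cg) auto
    then show ?thesis by (rule E_E_swap)
  qed
  finally show ?thesis by (simp add: c_def)
qed

section \<open>Bilinearity of the operator\<close>

lemma L2_add_left:
  assumes "continuous_on UNIV (deg_tilde f)" "continuous_on UNIV (deg_tilde f')" "continuous_on UNIV (deg_tilde g)"
    and d: "\<And>Z. deg_tilde (\<lambda>Z. f Z + f' Z) Z = deg_tilde f Z + deg_tilde f' Z"
  shows "L2 r1 r2 R1 R2 (\<lambda>Z. f Z + f' Z) g W1 W2 = L2 r1 r2 R1 R2 f g W1 W2 + L2 r1 r2 R1 R2 f' g W1 W2"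
proof -
  have "continuous_on UNIV (deg_tilde (\<lambda>Z. f Z + f' Z))"
    unfolding d[abs_def] by (intro continuous_intros assms)
  note m = L2_eq_mean[OF this assms(3)] L2_eq_mean[OF assms(1,3)] L2_eq_mean[OF assms(2,3)]
  have c: "continuous_on (U2 R1) (\<lambda>Z1. N Z1 * N (Z1 - W1) * h Z1 * (complex_of_real R2 ^ 2 *
      sphere.avg (\<lambda>x. L_kernel r1 r2 W1 W2 Z1 (S3_pt R2 x) * deg_tilde g (S3_pt R2 x))))"
    if "continuous_on UNIV h" for h
    by (intro continuous_intros sphere.avg_continuous continuous_on_L_kernel_sphere assms(3) continuous_on_subset[OF that]) simp
  show ?thesis
    unfolding m d E_add[OF c[OF assms(1)] c[OF assms(2)], symmetric] by (simp add: algebra_simps)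
qed

lemma L2_add_right:
  assumes "continuous_on UNIV (deg_tilde f)" "continuous_on UNIV (deg_tilde f')" "continuous_on UNIV (deg_tilde g)"
    and d: "\<And>Z. deg_tilde (\<lambda>Z. f Z + f' Z) Z = deg_tilde f Z + deg_tilde f' Z"
  shows "L2 r1 r2 R1 R2 g (\<lambda>Z. f Z + f' Z) W1 W2 = L2 r1 r2 R1 R2 g f W1 W2 + L2 r1 r2 R1 R2 g f' W1 W2"
proof -
  have "continuous_on UNIV (deg_tilde (\<lambda>Z. f Z + f' Z))"
    unfolding d[abs_def] by (intro continuous_intros assms)
  note m = L2_eq_mean[OF assms(3) this] L2_eq_mean[OF assms(3,1)] L2_eq_mean[OF assms(3,2)]
  define S where "S h Z1 = sphere.avg (\<lambda>x. L_kernel r1 r2 W1 W2 Z1 (S3_pt R2 x) * h (S3_pt R2 x))" for h Z1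
  have cS: "continuous_on (U2 R1) (S h)" if "continuous_on UNIV h" for h
    unfolding S_def by (rule sphere.avg_continuous continuous_on_L_kernel_sphere that)+
  have c: "continuous_on (U2 R1) (\<lambda>Z1. N Z1 * N (Z1 - W1) * deg_tilde g Z1 * (complex_of_real R2 ^ 2 * S h Z1))"
    if "continuous_on UNIV h" for h
    by (intro continuous_intros cS that continuous_on_subset[OF assms(3)]) simp
  have "S (deg_tilde (\<lambda>Z. f Z + f' Z)) Z1 = S (deg_tilde f) Z1 + S (deg_tilde f') Z1" if "Z1 \<in> U2 R1" for Z1
    unfolding S_def d distrib_left
    by (rule sphere.avg_add) (intro sphere.slice_continuous[OF continuous_on_L_kernel_sphere that] assms)+
  then show ?thesis
    unfolding m S_def[symmetric] E_add[OF c[OF assms(1)] c[OF assms(2)], symmetric]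
    by (intro E_cong) (simp add: algebra_simps)
qed

lemma L2_cmult_left:
  assumes "continuous_on UNIV (deg_tilde f)" "continuous_on UNIV (deg_tilde g)"
    and d: "\<And>Z. deg_tilde (\<lambda>Z. k * f Z) Z = k * deg_tilde f Z"
  shows "L2 r1 r2 R1 R2 (\<lambda>Z. k * f Z) g W1 W2 = k * L2 r1 r2 R1 R2 f g W1 W2"
proof -
  have "continuous_on UNIV (deg_tilde (\<lambda>Z. k * f Z))"
    unfolding d[abs_def] by (intro continuous_intros assms)
  note m = L2_eq_mean[OF this assms(2)] L2_eq_mean[OF assms(1,2)]
  show ?thesis unfolding m d E_cmult[symmetric] by (simp add: ac_simps)
qed

lemma L2_cmult_right:
  assumes "continuous_on UNIV (deg_tilde f)" "continuous_on UNIV (deg_tilde g)"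
    and d: "\<And>Z. deg_tilde (\<lambda>Z. k * f Z) Z = k * deg_tilde f Z"
  shows "L2 r1 r2 R1 R2 g (\<lambda>Z. k * f Z) W1 W2 = k * L2 r1 r2 R1 R2 g f W1 W2"
proof -
  have "continuous_on UNIV (deg_tilde (\<lambda>Z. k * f Z))"
    unfolding d[abs_def] by (intro continuous_intros assms)
  note m = L2_eq_mean[OF assms(2) this] L2_eq_mean[OF assms(2,1)]
  have "L_kernel r1 r2 W1 W2 Z1 Z2 * (k * z) = k * (L_kernel r1 r2 W1 W2 Z1 Z2 * z)" for Z1 Z2 z by simp
  then have "sphere.avg (\<lambda>x. L_kernel r1 r2 W1 W2 Z1 (S3_pt R2 x) * (k * deg_tilde f (S3_pt R2 x)))
      = k * sphere.avg (\<lambda>x. L_kernel r1 r2 W1 W2 Z1 (S3_pt R2 x) * deg_tilde f (S3_pt R2 x))" for Z1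
    by (simp only: sphere.avg_cmult)
  then show ?thesis unfolding m d E_cmult[symmetric] by (simp add: ac_simps)
qed

end

section \<open>The symmetry of the coefficients\<close>

text \<open>The harmonic number of p + q + 1 minus that of q.\<close>

definition harm_segment :: "nat \<Rightarrow> nat \<Rightarrow> complex" where
  "harm_segment p q = (\<Sum>k\<le>p. 1 / of_nat (Suc (k + q)))"

text \<open>The denominator is that of \<open>PA_moment\<close>; its reciprocal is the Beta value p!
  q! / (p + q + 1)!.\<close>

definition ladder_coeff :: "nat \<Rightarrow> nat \<Rightarrow> complex" where
  "ladder_coeff p q = harm_segment p q / (of_nat (Suc (p + q)) * of_nat (p + q choose p))"

lemma ladder_coeff_fact: "ladder_coeff p q = harm_segment p q * fact p * fact q / fact (Suc (p + q))"
proof -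
  have "of_nat (p + q choose p) = (fact (p + q) / (fact p * fact q) :: complex)"
    using binomial_fact[of p "p + q", where 'a = complex] by simp
  then show ?thesis unfolding ladder_coeff_def by (simp add: fact_Suc del: of_nat_Suc)
qed

lemma harm_segment_Suc_right:
  "harm_segment p (Suc q) = harm_segment p q - 1 / of_nat (Suc q) + 1 / of_nat (Suc (Suc (p + q)))"
  unfolding harm_segment_def
  by (induction p) (simp_all add: of_nat_1[unfolded One_nat_def] del: of_nat_Suc)

text \<open>With a = p + 1 and b = q + 1 the Beta values contribute the weights a / (a + b) and b /
  (a + b). The increments of the harmonic segment, 1 / (a + b) and 1 / (a + b) - 1 / b, cancel under
  these weights.\<close>

lemma ladder_coeff_rec: "ladder_coeff (Suc p) q + ladder_coeff p (Suc q) = ladder_coeff p q"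
proof -
  define h F :: complex where "h = harm_segment p q" and "F = fact (Suc (p + q))"
  define a b :: complex where "a = of_nat (Suc p)" and "b = of_nat (Suc q)"
  have nz: "b \<noteq> 0" "F \<noteq> 0" by (simp_all add: b_def F_def del: of_nat_Suc fact_Suc)
  have ab: "of_nat (Suc (Suc (p + q))) = a + b" by (simp add: a_def b_def)
  then have nz2: "a + b \<noteq> 0" by (metis of_nat_eq_0_iff nat.distinct(1))
  have 1: "ladder_coeff (Suc p) q = (h + 1 / (a + b)) * (a * fact p) * fact q / ((a + b) * F)"
    unfolding ladder_coeff_fact F_def
    by (simp only: add_Suc fact_Suc[of "Suc (p + q)"] fact_Suc[of p] of_nat_mult of_nat_fact ab a_def[symmetric])
       (simp add: harm_segment_def h_def ab[symmetric] del: of_nat_Suc)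
  have 2: "ladder_coeff p (Suc q) = (h - 1 / b + 1 / (a + b)) * fact p * (b * fact q) / ((a + b) * F)"
    unfolding ladder_coeff_fact F_def
    by (simp only: add_Suc_right fact_Suc[of "Suc (p + q)"] fact_Suc[of q] of_nat_mult of_nat_fact ab
        harm_segment_Suc_right h_def b_def)
  have "(h + 1 / (a + b)) * a + (h - 1 / b + 1 / (a + b)) * b = h * (a + b)"
  proof -
    have "(a + b) * (1 / (a + b)) = 1" "b * (1 / b) = 1" using nz nz2 by simp_all
    then show ?thesis by algebra
  qed
  moreover have "c * (a * fact p) * fact q / D + c' * fact p * (b * fact q) / D = (c * a + c' * b) * (fact p * fact q) / D"
    for c c' D
    unfolding add_divide_distrib[symmetric] by (simp add: algebra_simps)
  ultimately have "ladder_coeff (Suc p) q + ladder_coeff p (Suc q) = h * (a + b) * (fact p * fact q) / ((a + b) * F)"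
    unfolding 1 2 by simp
  also have "\<dots> = h * (fact p * fact q) / F" using nz2 by simp
  finally show ?thesis by (simp add: ladder_coeff_fact h_def F_def ac_simps del: fact_Suc)
qed

section \<open>Binomial transforms\<close>

lemma sum_choose_Suc:
  fixes F :: "nat \<Rightarrow> complex"
  shows "(\<Sum>i\<le>Suc n. of_nat (Suc n choose i) * F i) = (\<Sum>i\<le>n. of_nat (n choose i) * (F i + F (Suc i)))"
proof -
  have "(\<Sum>i\<le>Suc n. of_nat (Suc n choose i) * F i)
      = F 0 + (\<Sum>i\<le>n. of_nat (n choose Suc i) * F (Suc i)) + (\<Sum>i\<le>n. of_nat (n choose i) * F (Suc i))"
    by (subst sum.atMost_Suc_shift) (simp add: sum.distrib algebra_simps)
  also have "F 0 + (\<Sum>i\<le>n. of_nat (n choose Suc i) * F (Suc i)) = (\<Sum>i\<le>Suc n. of_nat (n choose i) * F i)"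
    by (subst sum.atMost_Suc_shift) simp
  also have "\<dots> = (\<Sum>i\<le>n. of_nat (n choose i) * F i)" by (simp add: binomial_eq_0)
  finally show ?thesis by (simp add: sum.distrib algebra_simps)
qed

text \<open>Pascal's rule lowers n by one and forms differences F i m - F (i + 1) m, which the
  recursion identifies with a step in the second index.\<close>

lemma alternating_sum_eq:
  fixes F :: "nat \<Rightarrow> nat \<Rightarrow> complex"
  assumes "\<And>i j. F i (Suc j) = F i j - F (Suc i) j"
  shows "(\<Sum>i\<le>n. of_nat (n choose i) * ((-1) ^ i * F (k + i) m)) = F k (m + n)"
proof (induction n arbitrary: m)
  case (Suc n)
  have "(\<Sum>i\<le>Suc n. of_nat (Suc n choose i) * ((-1) ^ i * F (k + i) m))
      = (\<Sum>i\<le>n. of_nat (n choose i) * ((-1) ^ i * F (k + i) (Suc m)))"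
  proof -
    have "(-1) ^ i * F (k + i) m + (-1) ^ Suc i * F (k + Suc i) m = (-1) ^ i * F (k + i) (Suc m)" for i
      by (simp add: assms right_diff_distrib)
    then show ?thesis by (simp only: sum_choose_Suc)
  qed
  then show ?case by (simp only: Suc add_Suc_right add_Suc)
qed simp

lemma ladder_coeff_alternating:
  "(\<Sum>j\<le>b. of_nat (b choose j) * ((-1) ^ j * ladder_coeff (k + j) m)) = ladder_coeff k (m + b)"
  "(\<Sum>i\<le>a. of_nat (a choose i) * ((-1) ^ i * ladder_coeff n (k + i))) = ladder_coeff (n + a) k"
proof -
  have "ladder_coeff i (Suc j) = ladder_coeff i j - ladder_coeff (Suc i) j"
    "ladder_coeff (Suc j) i = ladder_coeff j i - ladder_coeff j (Suc i)" for i j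
    using ladder_coeff_rec[of i j] ladder_coeff_rec[of j i] by (simp_all add: eq_diff_eq add.commute)
  from alternating_sum_eq[of ladder_coeff, OF this(1)] alternating_sum_eq[of "\<lambda>i j. ladder_coeff j i", OF this(2)]
  show "(\<Sum>j\<le>b. of_nat (b choose j) * ((-1) ^ j * ladder_coeff (k + j) m)) = ladder_coeff k (m + b)"
    "(\<Sum>i\<le>a. of_nat (a choose i) * ((-1) ^ i * ladder_coeff n (k + i))) = ladder_coeff (n + a) k" .
qed

lemma Rsum_extend:
  assumes "i \<le> p"
  shows "Rsum i j X Y M = (\<Sum>k\<le>p. of_nat (i choose k) * of_nat (j choose k) * X ^ (i - k) * Y ^ (j - k) * M ^ k)"
  unfolding Rsum_def by (rule sum.mono_neutral_left) (use assms in \<open>auto simp: binomial_eq_0\<close>)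

text \<open>binom(p, i) binom(i, k) = binom(p, k) binom(p - k, i - k), and the exponents of X add up
  to p - k for every i, so only an alternating binomial sum of F is left.\<close>

lemma choose_choose_sum:
  fixes F :: "nat \<Rightarrow> complex"
  shows "(\<Sum>i\<le>p. of_nat (p choose i) * X ^ (p - i) * (of_nat (i choose k) * X ^ (i - k)) * ((-1) ^ i * F i))
    = of_nat (p choose k) * X ^ (p - k) * ((-1) ^ k * (\<Sum>i\<le>p - k. of_nat (p - k choose i) * ((-1) ^ i * F (k + i))))"
proof (cases "k \<le> p")
  case True
  have gen: "a * b = c * d \<Longrightarrow> P * Q = R \<Longrightarrow> a * P * (b * Q) * t = c * R * (d * t)" for a b c d P Q R t :: complex
    by algebra
  have "(\<Sum>i\<le>p. of_nat (p choose i) * X ^ (p - i) * (of_nat (i choose k) * X ^ (i - k)) * ((-1) ^ i * F i))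
    = (\<Sum>i=k..p. of_nat (p choose i) * X ^ (p - i) * (of_nat (i choose k) * X ^ (i - k)) * ((-1) ^ i * F i))"
    by (rule sum.mono_neutral_right) (auto simp: binomial_eq_0)
  also have "\<dots> = (\<Sum>i=k..p. of_nat (p choose k) * X ^ (p - k) * (of_nat (p - k choose (i - k)) * ((-1) ^ i * F i)))"
  proof (rule sum.cong)
    fix i assume i: "i \<in> {k..p}"
    have "of_nat (p choose i) * of_nat (i choose k) = (of_nat (p choose k) * of_nat (p - k choose (i - k)) :: complex)"
      unfolding of_nat_mult[symmetric] using choose_mult[of k i p] i by simp
    moreover have "X ^ (p - i) * X ^ (i - k) = X ^ (p - k)"
      using i by (simp flip: power_add)
    ultimately show "of_nat (p choose i) * X ^ (p - i) * (of_nat (i choose k) * X ^ (i - k)) * ((-1) ^ i * F i)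
      = of_nat (p choose k) * X ^ (p - k) * (of_nat (p - k choose (i - k)) * ((-1) ^ i * F i))"
      by (rule gen)
  qed simp
  also have "\<dots> = (\<Sum>i\<le>p - k. of_nat (p choose k) * X ^ (p - k) * (of_nat (p - k choose i) * ((-1) ^ (k + i) * F (k + i))))"
    by (rule sum.reindex_bij_witness[of _ "\<lambda>i. k + i" "\<lambda>i. i - k"]) (use True in auto)
  finally show ?thesis by (simp add: sum_distrib_left power_add ac_simps)
qed (simp add: binomial_eq_0 sum.neutral)

text \<open>A change of origin: if A i j is a mean of s^i t^j, this is the mean of (x + s)^p (y +
  t)^q.\<close>

definition binom_transform :: "complex \<Rightarrow> complex \<Rightarrow> (nat \<Rightarrow> nat \<Rightarrow> complex) \<Rightarrow> nat \<Rightarrow> nat \<Rightarrow> complex" where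
  "binom_transform x y A p q = (\<Sum>i\<le>p. \<Sum>j\<le>q. of_nat (p choose i) * x ^ (p - i) * (of_nat (q choose j) * y ^ (q - j)) * A i j)"

text \<open>At each power M^k, \<open>choose_choose_sum\<close> reduces the sums to those of
  \<open>ladder_coeff_alternating\<close>. The sum over j starts at first index k and moves the
  second to i + (q - k); the sum over i then moves the first to p and leaves the second at q. The
  two signs (-1)^k cancel.\<close>

lemma binom_transform_ladder:
  "binom_transform X Y (\<lambda>i j. (-1) ^ (i + j) * ladder_coeff j i * Rsum i j X Y M) p q = ladder_coeff p q * Rsum p q X Y M"
proof -
  define a b where "a i k = of_nat (p choose i) * X ^ (p - i) * (of_nat (i choose k) * X ^ (i - k))"
    and "b j k = of_nat (q choose j) * Y ^ (q - j) * (of_nat (j choose k) * Y ^ (j - k))" for i j k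
  have "binom_transform X Y (\<lambda>i j. (-1) ^ (i + j) * ladder_coeff j i * Rsum i j X Y M) p q
    = (\<Sum>i\<le>p. \<Sum>j\<le>q. \<Sum>k\<le>p. M ^ k * (a i k * ((-1) ^ i * (b j k * ((-1) ^ j * ladder_coeff j i)))))"
    unfolding binom_transform_def a_def b_def
    by (intro sum.cong refl, subst Rsum_extend[of _ p]) (auto simp: sum_distrib_left power_add ac_simps)
  also have "\<dots> = (\<Sum>i\<le>p. \<Sum>k\<le>p. \<Sum>j\<le>q. M ^ k * (a i k * ((-1) ^ i * (b j k * ((-1) ^ j * ladder_coeff j i)))))"
    by (intro sum.cong refl sum.swap)
  also have "\<dots> = (\<Sum>k\<le>p. \<Sum>i\<le>p. \<Sum>j\<le>q. M ^ k * (a i k * ((-1) ^ i * (b j k * ((-1) ^ j * ladder_coeff j i)))))"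
    by (rule sum.swap)
  also have "\<dots> = (\<Sum>k\<le>p. M ^ k * (\<Sum>i\<le>p. a i k * ((-1) ^ i * (\<Sum>j\<le>q. b j k * ((-1) ^ j * ladder_coeff j i)))))"
    by (simp only: sum_distrib_left)
  also have "\<dots> = (\<Sum>k\<le>p. of_nat (p choose k) * of_nat (q choose k) * X ^ (p - k) * Y ^ (q - k) * M ^ k * ladder_coeff p q)"
  proof (rule sum.cong)
    fix k assume k: "k \<in> {..p}"
    define B where "B = of_nat (q choose k) * Y ^ (q - k)"
    have "(\<Sum>j\<le>q. b j k * ((-1) ^ j * ladder_coeff j i)) = (-1) ^ k * B * ladder_coeff k (i + (q - k))" for i
      unfolding b_def choose_choose_sum ladder_coeff_alternating B_def by simp
    then have "(\<Sum>i\<le>p. a i k * ((-1) ^ i * (\<Sum>j\<le>q. b j k * ((-1) ^ j * ladder_coeff j i))))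
        = (-1) ^ k * B * (\<Sum>i\<le>p. a i k * ((-1) ^ i * ladder_coeff k (i + (q - k))))"
      by (simp add: sum_distrib_left ac_simps)
    also have "(\<Sum>i\<le>p. a i k * ((-1) ^ i * ladder_coeff k (i + (q - k))))
        = of_nat (p choose k) * X ^ (p - k) * ((-1) ^ k * ladder_coeff (k + (p - k)) (k + (q - k)))"
      unfolding a_def choose_choose_sum
      using ladder_coeff_alternating(2)[of "p - k" k "k + (q - k)"] by (simp add: ac_simps)
    finally have "(\<Sum>i\<le>p. a i k * ((-1) ^ i * (\<Sum>j\<le>q. b j k * ((-1) ^ j * ladder_coeff j i))))
        = ((-1) ^ k * (-1) ^ k) * (B * (of_nat (p choose k) * X ^ (p - k) * ladder_coeff p (k + (q - k))))"
      using k by (simp add: ac_simps)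
    also have "\<dots> = B * (of_nat (p choose k) * X ^ (p - k) * ladder_coeff p (k + (q - k)))"
      by (simp flip: power_mult_distrib)
    \<comment> \<open>For k > q the index k + (q - k) differs from q, but then the binomial in B is
      0.\<close>
    also have "\<dots> = B * (of_nat (p choose k) * X ^ (p - k) * ladder_coeff p q)"
      by (cases "k \<le> q") (simp_all add: B_def binomial_eq_0)
    finally show "M ^ k * (\<Sum>i\<le>p. a i k * ((-1) ^ i * (\<Sum>j\<le>q. b j k * ((-1) ^ j * ladder_coeff j i))))
      = of_nat (p choose k) * of_nat (q choose k) * X ^ (p - k) * Y ^ (q - k) * M ^ k * ladder_coeff p q"
      by (simp add: B_def ac_simps)
  qed simp
  also have "\<dots> = Rsum p q X Y M * ladder_coeff p q" by (simp only: Rsum_def sum_distrib_right)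
  finally show ?thesis by (simp only: mult.commute)
qed

lemma binomial_transform_Suc:
  fixes a :: "nat \<Rightarrow> complex"
  shows "(\<Sum>i\<le>Suc p. of_nat (Suc p choose i) * z ^ (Suc p - i) * a i)
      = z * (\<Sum>i\<le>p. of_nat (p choose i) * z ^ (p - i) * a i) + (\<Sum>i\<le>p. of_nat (p choose i) * z ^ (p - i) * a (Suc i))"
  using sum_choose_Suc[of p "\<lambda>i. z ^ (Suc p - i) * a i"]
  by (simp add: sum.distrib[symmetric] sum_distrib_left algebra_simps Suc_diff_le)

lemma binomial_transform_add:
  fixes a :: "nat \<Rightarrow> complex"
  shows "(\<Sum>i\<le>p. of_nat (p choose i) * (x + y) ^ (p - i) * a i)
    = (\<Sum>i\<le>p. of_nat (p choose i) * x ^ (p - i) * (\<Sum>k\<le>i. of_nat (i choose k) * y ^ (i - k) * a k))"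
proof (induction p arbitrary: a)
  case (Suc p)
  define b where "b i = (\<Sum>k\<le>i. of_nat (i choose k) * y ^ (i - k) * a k)" for i
  have b: "b (Suc i) = y * b i + (\<Sum>k\<le>i. of_nat (i choose k) * y ^ (i - k) * a (Suc k))" for i
    unfolding b_def by (rule binomial_transform_Suc)
  show ?case
    unfolding b_def[symmetric] binomial_transform_Suc Suc b
    by (simp add: sum.distrib sum_distrib_left algebra_simps)
qed simp

text \<open>Changes of origin compose by adding the shifts.\<close>

lemma binom_transform_add: "binom_transform (x + x') (y + y') A = binom_transform x y (binom_transform x' y' A)"
proof (intro ext)
  fix p q
  have s: "binom_transform x y A p q = (\<Sum>i\<le>p. of_nat (p choose i) * x ^ (p - i) * (\<Sum>j\<le>q. of_nat (q choose j) * y ^ (q - j) * A i j))"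
    for x y A p q
    by (simp add: binom_transform_def sum_distrib_left ac_simps)
  define T where "T y A i q = (\<Sum>j\<le>q. of_nat (q choose j) * y ^ (q - j) * (A i j :: complex))" for y A and i q :: nat
  have "binom_transform (x + x') (y + y') A p q
    = (\<Sum>i\<le>p. of_nat (p choose i) * x ^ (p - i) * (\<Sum>k\<le>i. of_nat (i choose k) * x' ^ (i - k) * T y (T y' A) k q))"
    unfolding s binomial_transform_add T_def ..
  moreover have T: "(\<Sum>k\<le>i. of_nat (i choose k) * x' ^ (i - k) * T y (T y' A) k q) = T y (binom_transform x' y' A) i q" for i
  proof -
    define c d where "c j = of_nat (q choose j) * y ^ (q - j)" and "d k = of_nat (i choose k) * x' ^ (i - k)" for j k
    have "(\<Sum>k\<le>i. d k * (\<Sum>j\<le>q. c j * T y' A k j)) = (\<Sum>j\<le>q. c j * (\<Sum>k\<le>i. d k * T y' A k j))"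
      unfolding sum_distrib_left by (subst sum.swap) (simp add: ac_simps)
    then show ?thesis by (simp only: c_def d_def s T_def)
  qed
  ultimately have "binom_transform (x + x') (y + y') A p q
    = (\<Sum>i\<le>p. of_nat (p choose i) * x ^ (p - i) * T y (binom_transform x' y' A) i q)"
    by (simp only:)
  also have "\<dots> = binom_transform x y (binom_transform x' y' A) p q"
    unfolding s[of x y] T_def ..
  finally show "binom_transform (x + x') (y + y') A p q = binom_transform x y (binom_transform x' y' A) p q" .
qed

text \<open>Each term has degree i + j - 2 k in X and Y, so changing both signs multiplies it by
  (-1)^(i+j).\<close>

lemma Rsum_swap: "Rsum j i (- Y) (- X) M = (-1) ^ (i + j) * Rsum i j X Y M"
proof -
  have m: "(- z) ^ (n - k) = (-1) ^ n * (-1) ^ k * z ^ (n - k)" if "k \<le> n" for z :: complex and n k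
  proof -
    have "(- z) ^ (n - k) = ((-1) ^ k * (-1) ^ k) * ((-1) ^ (n - k) * z ^ (n - k))"
      by (subst power_mult_distrib[symmetric]) (simp flip: power_mult_distrib)
    also have "\<dots> = (-1) ^ (k + (n - k)) * (-1) ^ k * z ^ (n - k)" by (simp add: power_add)
    finally show ?thesis using that by simp
  qed
  have "Rsum j i (- Y) (- X) M = (\<Sum>k\<le>min i j. of_nat (j choose k) * of_nat (i choose k) * (- Y) ^ (j - k) * (- X) ^ (i - k) * M ^ k)"
    unfolding Rsum_def by (rule sum.mono_neutral_right) (auto simp: binomial_eq_0)
  also have "\<dots> = (\<Sum>k\<le>min i j. (-1) ^ (i + j) * (of_nat (i choose k) * of_nat (j choose k) * X ^ (i - k) * Y ^ (j - k) * M ^ k))"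
  proof (rule sum.cong)
    fix k assume k: "k \<in> {..min i j}"
    have "(- 1) ^ k * (- 1) ^ k = (1::complex)" by (simp flip: power_mult_distrib)
    then show "of_nat (j choose k) * of_nat (i choose k) * (- Y) ^ (j - k) * (- X) ^ (i - k) * M ^ k
      = (-1) ^ (i + j) * (of_nat (i choose k) * of_nat (j choose k) * X ^ (i - k) * Y ^ (j - k) * M ^ k)"
      using k m[of k j Y] m[of k i X] unfolding power_add by (simp del: power_mult_distrib)
  qed simp
  also have "\<dots> = (-1) ^ (i + j) * Rsum i j X Y M"
    unfolding sum_distrib_left[symmetric] Rsum_def
    by (intro arg_cong2[where f = "(*)"] refl sum.mono_neutral_left) (auto simp: binomial_eq_0)
  finally show ?thesis .
qed

lemma binom_transform_swap: "binom_transform x y A p q = binom_transform y x (\<lambda>j i. A i j) q p"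
  unfolding binom_transform_def by (subst sum.swap) (simp add: ac_simps)

text \<open>In the application w, w' are the values of the two linear forms at W1, and w + X, w' + Y
  those at W2. The shift to W2 splits into (w, w') after (X, Y), and the inner transform is
  \<open>binom_transform_ladder\<close>.\<close>

lemma ladder_symmetry:
  "binom_transform w w' (\<lambda>i j. ladder_coeff i j * Rsum i j X Y M) p q
    = binom_transform (w' + Y) (w + X) (\<lambda>i j. ladder_coeff i j * Rsum i j (- Y) (- X) M) q p"
proof -
  have "binom_transform (w' + Y) (w + X) (\<lambda>j i. ladder_coeff j i * Rsum j i (- Y) (- X) M) q p
    = binom_transform (w + X) (w' + Y) (\<lambda>i j. (-1) ^ (i + j) * ladder_coeff j i * Rsum i j X Y M) p q"
    by (subst binom_transform_swap) (simp add: Rsum_swap ac_simps)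
  also have "\<dots> = binom_transform w w' (\<lambda>i j. ladder_coeff i j * Rsum i j X Y M) p q"
    unfolding binom_transform_add by (rule arg_cong[where f = "\<lambda>A. binom_transform w w' A p q"]) (intro ext binom_transform_ladder)
  finally show ?thesis by simp
qed

section \<open>The ladder operator on plane waves\<close>

lemma pd_hol:
  assumes "hol UNIV f G" shows "pd i j f Z = G Z $ i $ j"
proof -
  have e: "(\<chi> k l. if k = i \<and> l = j then t else Z $ k $ l) = Z + csc (t - Z $ i $ j) (unit_mat i j)" for t
    by (auto simp: vec_eq_iff unit_mat_def)
  have "((\<lambda>s. f (Z + csc s (unit_mat i j))) has_field_derivative pair (G Z) (unit_mat i j)) (at (Z $ i $ j - Z $ i $ j))"
    using has_derivative_line[of f "G Z" Z 0 "unit_mat i j"] holD(1)[OF assms, of Z] by simp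
  then have "((\<lambda>t. f (Z + csc (t - Z $ i $ j) (unit_mat i j))) has_field_derivative pair (G Z) (unit_mat i j) * (1 - 0)) (at (Z $ i $ j))"
    by (rule DERIV_chain2) (intro DERIV_diff DERIV_ident DERIV_const)
  then have "pd i j f Z = pair (G Z) (unit_mat i j)"
    unfolding pd_def e by (simp add: DERIV_imp_deriv)
  then show ?thesis
    using pair_unit_mat[of i j "G Z"] by (simp add: pair_def mult.commute)
qed

lemma deg_tilde_hol: "hol UNIV f G \<Longrightarrow> deg_tilde f Z = f Z + pair (G Z) Z"
  by (simp add: deg_tilde_def pd_hol sum_2 pair_def ac_simps)

lemma continuous_on_deg_tilde: "f \<in> PF \<Longrightarrow> continuous_on UNIV (deg_tilde f)"
proof -
  assume "f \<in> PF"
  then obtain G where G: "hol UNIV f G" using PF_hol by blast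
  show ?thesis
    unfolding deg_tilde_hol[OF G, abs_def] by (intro continuous_intros holD(2,3)[OF G])
qed

lemma deg_tilde_add:
  assumes "f \<in> PF" "g \<in> PF" shows "deg_tilde (\<lambda>Z. f Z + g Z) Z = deg_tilde f Z + deg_tilde g Z"
proof -
  obtain F G where h: "hol UNIV f F" "hol UNIV g G" using assms PF_hol by metis
  show ?thesis by (simp add: deg_tilde_hol[OF h(1)] deg_tilde_hol[OF h(2)] deg_tilde_hol[OF hol_add[OF h]])
qed

lemma deg_tilde_cmult:
  assumes "f \<in> PF" shows "deg_tilde (\<lambda>Z. c * f Z) Z = c * deg_tilde f Z"
proof -
  obtain F where h: "hol UNIV f F" using assms PF_hol by metis
  show ?thesis by (simp add: deg_tilde_hol[OF h] deg_tilde_hol[OF hol_mult[OF hol_const h]] algebra_simps)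
qed

lemma deg_tilde_plane_wave: "deg_tilde (\<lambda>Z. pair A Z ^ p) Z = of_nat (Suc p) * pair A Z ^ p"
proof -
  have "deg_tilde (\<lambda>Z. pair A Z ^ p) Z = pair A Z ^ p + pair (csc (of_nat p * pair A Z ^ (p - 1)) A) Z"
    by (rule deg_tilde_hol) (intro hol_power hol_pair0)
  then show ?thesis by (cases p) (simp_all add: algebra_simps)
qed

section \<open>Expansion about the first pole, and collapse at rank one\<close>

lemma power_shift: "(w + y) ^ q = (\<Sum>j\<le>q. of_nat (q choose j) * w ^ (q - j) * (y::complex) ^ j)"
  unfolding add.commute[of w] binomial_ring by (simp add: ac_simps)

text \<open>The left side is the divided difference of t^p (t - w) between t = w + x and t = w + y;
  expanding this function in powers of t - w gives the right side.\<close>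

lemma divdiff_shift:
  "divdiff (Suc p) (w + x) (w + y) - w * divdiff p (w + x) (w + y)
    = (\<Sum>i\<le>p. of_nat (p choose i) * w ^ (p - i) * divdiff (Suc i) x y)"
proof -
  have S: "(\<Sum>i\<le>p. of_nat (p choose i) * w ^ (p - i) * divdiff (Suc i) x y)
      = x * (\<Sum>i\<le>p. of_nat (p choose i) * w ^ (p - i) * divdiff i x y) + (w + y) ^ p" for p
    by (simp add: divdiff_Suc power_shift sum.distrib sum_distrib_left algebra_simps)
  have D: "divdiff p (w + x) (w + y) = (\<Sum>i\<le>p. of_nat (p choose i) * w ^ (p - i) * divdiff i x y)" for p
  proof (induction p)
    case (Suc p)
    show ?case
      unfolding binomial_transform_Suc S Suc[symmetric] by (simp add: divdiff_Suc algebra_simps)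
  qed simp
  show ?thesis unfolding S D[of p, symmetric] by (simp add: divdiff_Suc algebra_simps)
qed

text \<open>Here every term is the same monomial, and Vandermonde's identity sums the
  coefficients.\<close>

lemma Rsum_rank_one: "Rsum k j x y (x * y) = of_nat (k + j choose k) * x ^ k * y ^ j"
proof -
  have "of_nat (k choose l) * of_nat (j choose l) * x ^ (k - l) * y ^ (j - l) * (x * y) ^ l
      = of_nat ((k choose (k - l)) * (j choose l)) * (x ^ k * y ^ j)" if "l \<le> k" for l
  proof (cases "l \<le> j")
    case True
    have "x ^ (k - l) * x ^ l = x ^ k" "y ^ (j - l) * y ^ l = y ^ j"
      using that True by (simp_all flip: power_add)
    then show ?thesis using binomial_symmetric[OF that]
      by (simp add: power_mult_distrib) (metis mult.assoc mult.left_commute)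
  qed (simp add: binomial_eq_0)
  then have "Rsum k j x y (x * y) = (\<Sum>l\<le>k. of_nat ((k choose (k - l)) * (j choose l)) * (x ^ k * y ^ j))"
    unfolding Rsum_def by (intro sum.cong) auto
  also have "\<dots> = of_nat (\<Sum>l\<le>k. (j choose l) * (k choose (k - l))) * (x ^ k * y ^ j)"
    unfolding of_nat_sum sum_distrib_right by (simp add: ac_simps)
  also have "(\<Sum>l\<le>k. (j choose l) * (k choose (k - l))) = k + j choose k"
    using vandermonde[of j k k] by (simp add: add.commute)
  finally show ?thesis by (simp add: mult.assoc)
qed

lemma pair_P_set:
  assumes "P \<in> P_set"
  shows "pair (tens u v') P * pair (tens u' v) P = pair (tens u v) P * pair (tens u' v') P"
proof -
  note * = P_set_rank_one(2)[OF assms]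
  show ?thesis unfolding pair_def tens_nth using * by algebra
qed

text \<open>The T1 mean for exponents i, j with W1 as origin and Y = T2 - W1: the divided difference
  is expanded into powers, and each of them is averaged by \<open>PA_moment\<close>.\<close>

definition ladder_term :: "complex^2 \<Rightarrow> complex^2 \<Rightarrow> complex^2 \<Rightarrow> complex^2 \<Rightarrow> nat \<Rightarrow> nat \<Rightarrow> hc \<Rightarrow> complex" where
  "ladder_term u v u' v' i j Y = (\<Sum>k<Suc i. pair (tens u v) Y ^ (i - k) *
     (Rsum k j (pair (tens u v) Y) (pair (tens u' v') Y) (pair (tens u v') Y * pair (tens u' v) Y)
       / (of_nat (Suc (k + j)) * of_nat (k + j choose k))))"

text \<open>At D P the 2 by 2 minors vanish, so the last argument of \<open>Rsum\<close> is the
  product of the two before it. Each k then contributes the same monomial times 1 / (k + j + 1),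
  which is where the harmonic segment comes from.\<close>

lemma ladder_term_rank_one:
  assumes "P \<in> P_set"
  shows "ladder_term u v u' v' i j (D ** P)
    = harm_segment i j * (pair (tens (lmul u D) v) P ^ i * pair (tens (lmul u' D) v') P ^ j)"
proof -
  define x y where "x = pair (tens (lmul u D) v) P" and "y = pair (tens (lmul u' D) v') P"
  have "ladder_term u v u' v' i j (D ** P) = (\<Sum>k<Suc i. x ^ (i - k) * (Rsum k j x y (x * y)
       / (of_nat (Suc (k + j)) * of_nat (k + j choose k))))"
    unfolding ladder_term_def pair_tens_mult pair_P_set[OF assms] x_def y_def ..
  also have "\<dots> = (\<Sum>k<Suc i. 1 / of_nat (Suc (k + j)) * (x ^ i * y ^ j))"
  proof (rule sum.cong)
    fix k assume k: "k \<in> {..<Suc i}"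
    have "x ^ (i - k) * x ^ k = x ^ i" using k by (simp flip: power_add)
    then have "x ^ (i - k) * Rsum k j x y (x * y) = of_nat (k + j choose k) * (x ^ i * y ^ j)"
      unfolding Rsum_rank_one by (metis mult.assoc mult.left_commute)
    then have "x ^ (i - k) * (Rsum k j x y (x * y) / (of_nat (Suc (k + j)) * of_nat (k + j choose k)))
      = of_nat (k + j choose k) * (x ^ i * y ^ j) / (of_nat (Suc (k + j)) * of_nat (k + j choose k))"
      by (metis times_divide_eq_right)
    then show "x ^ (i - k) * (Rsum k j x y (x * y) / (of_nat (Suc (k + j)) * of_nat (k + j choose k)))
      = 1 / of_nat (Suc (k + j)) * (x ^ i * y ^ j)"
      by (simp add: binomial_eq_0_iff del: of_nat_Suc)
  qed simp
  finally show ?thesis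
    unfolding x_def y_def harm_segment_def sum_distrib_right lessThan_Suc_atMost .
qed

lemma PF_shift_pair: "(\<lambda>Z. pair A (Z - W)) \<in> PF"
  by (rule PF_pair) (simp add: PF_diff PF_nth PF_const)

lemma PF_ladder_term: "(\<lambda>Z. ladder_term u v u' v' i j (Z - W)) \<in> PF"
  unfolding ladder_term_def Rsum_def divide_inverse
  by (intro PF_sum PF_mult PF_power PF_const PF_shift_pair)

lemma continuous_on_divdiff [continuous_intros]:
  "continuous_on S f \<Longrightarrow> continuous_on S g \<Longrightarrow> continuous_on S (\<lambda>x. divdiff n (f x) (g x))"
  unfolding divdiff_def by (intro continuous_intros)

lemma PA_binom_transform:
  assumes "\<And>i j. continuous_on P_set (\<lambda>P. A P i j)"
  shows "PA (\<lambda>P. binom_transform x y (A P) p q) = binom_transform x y (\<lambda>i j. PA (\<lambda>P. A P i j)) p q"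
  unfolding binom_transform_def
  by (subst Pr.avg_sum | intro continuous_intros assms finite_atMost sum.cong refl Pr.avg_cmult)+

context
  fixes r1 r2 R1 R2 :: real and W1 W2 :: hc and u v u' v' :: "complex^2"
  assumes r: "r1 > r2" "r2 > 0" "R1 > r1" "R2 > r1" and W: "W1 \<in> D_plus r2" "W2 \<in> D_plus r2"
begin

text \<open>The poles are W1 and T2, so T1 becomes W1 + (T2 - W1) P. By
  \<open>divdiff_shift\<close>, the subtracted term with \<open>pair (tens u v) W1\<close> is what
  makes the result a pure change of origin to W1.\<close>

lemma inner_ladder_mean:
  assumes T2: "T2 \<in> U2 r2"
  shows "E r1 (two_poles (\<lambda>T1. (divdiff (Suc p) (pair (tens u v) T1) (pair (tens u v) T2)
      - pair (tens u v) W1 * divdiff p (pair (tens u v) T1) (pair (tens u v) T2)) * pair (tens u' v') T1 ^ q) W1 T2)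
    = binom_transform (pair (tens u v) W1) (pair (tens u' v') W1) (\<lambda>i j. ladder_term u v u' v' i j (T2 - W1)) p q"
proof -
  define Y where "Y = T2 - W1"
  define \<sigma> \<sigma>' where "\<sigma> = pair (tens u v)" and "\<sigma>' = pair (tens u' v')"
  have PFg: "(\<lambda>T1. (divdiff (Suc p) (\<sigma> T1) (\<sigma> T2) - \<sigma> W1 * divdiff p (\<sigma> T1) (\<sigma> T2)) * \<sigma>' T1 ^ q) \<in> PF"
    unfolding divdiff_def \<sigma>_def \<sigma>'_def by (intro PF_mult PF_diff PF_sum PF_power PF_const PF_plane_wave)
  have "E r1 (two_poles (\<lambda>T1. (divdiff (Suc p) (\<sigma> T1) (\<sigma> T2) - \<sigma> W1 * divdiff p (\<sigma> T1) (\<sigma> T2)) * \<sigma>' T1 ^ q) W1 T2)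
    = PA (\<lambda>P. (divdiff (Suc p) (\<sigma> (W1 + Y ** P)) (\<sigma> T2) - \<sigma> W1 * divdiff p (\<sigma> (W1 + Y ** P)) (\<sigma> T2)) * \<sigma>' (W1 + Y ** P) ^ q)"
    unfolding Y_def
    by (rule E_two_poles[OF PFg]) (use r W D_plus_inside[of W1 r2 r1] U2_inside[OF T2] in auto)
  also have "\<dots> = PA (\<lambda>P. binom_transform (\<sigma> W1) (\<sigma>' W1) (\<lambda>i j. divdiff (Suc i) (\<sigma> (Y ** P)) (\<sigma> Y) * \<sigma>' (Y ** P) ^ j) p q)"
  proof (rule arg_cong[where f = PA], rule ext)
    fix P
    have T2: "\<sigma> T2 = \<sigma> W1 + \<sigma> Y" by (simp add: Y_def \<sigma>_def)
    have "\<sigma> (W1 + Y ** P) = \<sigma> W1 + \<sigma> (Y ** P)" "\<sigma>' (W1 + Y ** P) = \<sigma>' W1 + \<sigma>' (Y ** P)"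
      by (simp_all add: \<sigma>_def \<sigma>'_def)
    then show "(divdiff (Suc p) (\<sigma> (W1 + Y ** P)) (\<sigma> T2) - \<sigma> W1 * divdiff p (\<sigma> (W1 + Y ** P)) (\<sigma> T2)) * \<sigma>' (W1 + Y ** P) ^ q
      = binom_transform (\<sigma> W1) (\<sigma>' W1) (\<lambda>i j. divdiff (Suc i) (\<sigma> (Y ** P)) (\<sigma> Y) * \<sigma>' (Y ** P) ^ j) p q"
      by (simp only: T2 divdiff_shift power_shift[of "\<sigma>' W1"] binom_transform_def sum_product) (simp add: ac_simps)
  qed
  also have "\<dots> = binom_transform (\<sigma> W1) (\<sigma>' W1) (\<lambda>i j. PA (\<lambda>P. divdiff (Suc i) (\<sigma> (Y ** P)) (\<sigma> Y) * \<sigma>' (Y ** P) ^ j)) p q"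
    by (rule PA_binom_transform) (unfold \<sigma>_def \<sigma>'_def, intro continuous_intros)
  also have "(\<lambda>i j. PA (\<lambda>P. divdiff (Suc i) (\<sigma> (Y ** P)) (\<sigma> Y) * \<sigma>' (Y ** P) ^ j)) = (\<lambda>i j. ladder_term u v u' v' i j Y)"
  proof (intro ext)
    fix i j
    have "PA (\<lambda>P. divdiff (Suc i) (\<sigma> (Y ** P)) (\<sigma> Y) * \<sigma>' (Y ** P) ^ j)
      = PA (\<lambda>P. \<Sum>k<Suc i. \<sigma> Y ^ (i - k) * (pair (tens (lmul u Y) v) P ^ k * pair (tens (lmul u' Y) v') P ^ j))"
      unfolding divdiff_def sum_distrib_right \<sigma>_def \<sigma>'_def pair_tens_mult by (simp only: diff_Suc_Suc ac_simps)
    also have "\<dots> = (\<Sum>k<Suc i. \<sigma> Y ^ (i - k) * PA (\<lambda>P. pair (tens (lmul u Y) v) P ^ k * pair (tens (lmul u' Y) v') P ^ j))"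
      by (subst Pr.avg_sum) (auto intro!: continuous_intros simp only: Pr.avg_cmult)
    also have "\<dots> = ladder_term u v u' v' i j Y"
      unfolding ladder_term_def PA_moment dot_lmul \<sigma>_def ..
    finally show "PA (\<lambda>P. divdiff (Suc i) (\<sigma> (Y ** P)) (\<sigma> Y) * \<sigma>' (Y ** P) ^ j) = ladder_term u v u' v' i j Y" .
  qed
  finally show ?thesis by (simp only: \<sigma>_def \<sigma>'_def Y_def)
qed

text \<open>In the T2 mean the poles are W1 and W2, so T2 - W1 becomes (W2 - W1) P, of rank one. The
  T1 result collapses to a monomial times \<open>harm_segment\<close>, and \<open>PA_moment\<close>
  supplies \<open>Rsum\<close> and the denominator of \<open>ladder_coeff\<close>.\<close>

theorem L2_plane_waves:
  "L2 r1 r2 R1 R2 (\<lambda>Z. pair (tens u v) Z ^ p) (\<lambda>Z. pair (tens u' v') Z ^ q) W1 W2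
    = binom_transform (pair (tens u v) W1) (pair (tens u' v') W1) (\<lambda>i j. ladder_coeff i j *
        Rsum i j (pair (tens u v) (W2 - W1)) (pair (tens u' v') (W2 - W1))
          (pair (tens u v') (W2 - W1) * pair (tens u' v) (W2 - W1))) p q"
proof -
  define \<sigma> \<sigma>' where "\<sigma> = pair (tens u v)" and "\<sigma>' = pair (tens u' v')"
  define k where "k T1 T2 = divdiff (Suc p) (\<sigma> T1) (\<sigma> T2) - \<sigma> W1 * divdiff p (\<sigma> T1) (\<sigma> T2)" for T1 T2
  define B where "B Y = binom_transform (\<sigma> W1) (\<sigma>' W1) (\<lambda>i j. ladder_term u v u' v' i j Y) p q" for Y
  have "L2 r1 r2 R1 R2 (\<lambda>Z. \<sigma> Z ^ p) (\<lambda>Z. \<sigma>' Z ^ q) W1 W2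
    = E r2 (\<lambda>T2. E r1 (\<lambda>T1. C_kernel W1 W2 T1 T2 * (k T1 T2 * \<sigma>' T1 ^ q)))"
  proof (rule L2_eq_means[OF r W])
    show "continuous_on UNIV (deg_tilde (\<lambda>Z. \<sigma> Z ^ p))" "continuous_on UNIV (deg_tilde (\<lambda>Z. \<sigma>' Z ^ q))"
      unfolding \<sigma>_def \<sigma>'_def by (intro continuous_on_deg_tilde PF_power PF_plane_wave)+
    show "continuous_on UNIV (\<lambda>Z. \<sigma>' Z ^ q)"
      unfolding \<sigma>'_def by (intro continuous_intros)
    show "sphere.avg (\<lambda>x. complex_of_real R2 ^ 2 * (deg_tilde (\<lambda>Z. \<sigma>' Z ^ q) (S3_pt R2 x) * inverse (N (S3_pt R2 x - T)))) = \<sigma>' T ^ q"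
      if "T \<in> U2 r1" for T
      unfolding \<sigma>'_def deg_tilde_plane_wave
      by (rule sphere_plane_wave_scaled) (use r U2_inside[OF that] in auto)
    fix T1 T2 assume T: "T1 \<in> U2 r1" "T2 \<in> U2 r2"
    have "E R1 (\<lambda>Z. A_kernel (deg_tilde (\<lambda>Z. \<sigma> Z ^ p)) W1 Z T1 T2)
      = E R1 (\<lambda>Z. of_nat (Suc p) * (\<sigma> Z ^ p * (N Z * (N (Z - W1) * (inverse (N (Z - T1)) * inverse (N (Z - T2)))))))"
      unfolding A_kernel_def \<sigma>_def deg_tilde_plane_wave by (simp only: ac_simps)
    also have "\<dots> = k T1 T2"
      unfolding E_cmult k_def \<sigma>_def
      by (rule E_plane_wave) (use r U2_inside[OF T(1)] U2_inside[OF T(2)] in auto)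
    finally show "E R1 (\<lambda>Z. A_kernel (deg_tilde (\<lambda>Z. \<sigma> Z ^ p)) W1 Z T1 T2) = k T1 T2" .
  qed
  also have "\<dots> = E r2 (two_poles (\<lambda>T2. B (T2 - W1)) W1 W2)"
  proof (rule E_cong)
    fix T2 assume T2: "T2 \<in> U2 r2"
    define d where "d = (N T2)\<^sup>2 * (inverse (N (T2 - W1)) * inverse (N (T2 - W2)))"
    have "E r1 (\<lambda>T1. C_kernel W1 W2 T1 T2 * (k T1 T2 * \<sigma>' T1 ^ q))
      = E r1 (\<lambda>T1. d * two_poles (\<lambda>T1. k T1 T2 * \<sigma>' T1 ^ q) W1 T2 T1)"
      unfolding C_kernel_def two_poles_def d_def by (simp only: ac_simps)
    also have "\<dots> = d * B (T2 - W1)"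
      unfolding E_cmult B_def using inner_ladder_mean[OF T2, of p q] by (simp only: k_def \<sigma>_def \<sigma>'_def)
    finally show "E r1 (\<lambda>T1. C_kernel W1 W2 T1 T2 * (k T1 T2 * \<sigma>' T1 ^ q)) = two_poles (\<lambda>T2. B (T2 - W1)) W1 W2 T2"
      by (simp add: two_poles_def d_def)
  qed
  also have "\<dots> = PA (\<lambda>P. B (W1 + (W2 - W1) ** P - W1))"
  proof (rule E_two_poles)
    show "(\<lambda>T2. B (T2 - W1)) \<in> PF"
      unfolding B_def binom_transform_def by (intro PF_sum PF_mult PF_const PF_ladder_term)
  qed (use r W D_plus_inside[of _ r2 r2] in auto)
  also have "\<dots> = PA (\<lambda>P. binom_transform (\<sigma> W1) (\<sigma>' W1) (\<lambda>i j. harm_segment i j *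
      (pair (tens (lmul u (W2 - W1)) v) P ^ i * pair (tens (lmul u' (W2 - W1)) v') P ^ j)) p q)"
    by (rule Pr.avg_cong) (simp add: B_def ladder_term_rank_one)
  also have "\<dots> = binom_transform (\<sigma> W1) (\<sigma>' W1) (\<lambda>i j. PA (\<lambda>P. harm_segment i j *
      (pair (tens (lmul u (W2 - W1)) v) P ^ i * pair (tens (lmul u' (W2 - W1)) v') P ^ j))) p q"
    by (rule PA_binom_transform) (intro continuous_intros)
  finally show ?thesis
    unfolding Pr.avg_cmult PA_moment dot_lmul ladder_coeff_def \<sigma>_def \<sigma>'_def by simp
qed

end

theorem L2_plane_wave_symmetry:
  assumes "r1 > r2" "r2 > 0" "R1 > r1" "R2 > r1" "W1 \<in> D_plus r2" "W2 \<in> D_plus r2"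
  shows "L2 r1 r2 R1 R2 (\<lambda>Z. pair (tens u v) Z ^ p) (\<lambda>Z. pair (tens u' v') Z ^ q) W1 W2
    = L2 r1 r2 R1 R2 (\<lambda>Z. pair (tens u' v') Z ^ q) (\<lambda>Z. pair (tens u v) Z ^ p) W2 W1"
proof -
  have m: "pair A (W1 - W2) = - pair A (W2 - W1)" "pair A W2 = pair A W1 + pair A (W2 - W1)" for A
    by simp_all
  show ?thesis
    unfolding L2_plane_waves[OF assms(1-4,5,6)] L2_plane_waves[OF assms(1-4,6,5)]
      m(2)[of "tens u v"] m(2)[of "tens u' v'"] m(1)
    by (subst ladder_symmetry)
       (simp only: minus_mult_minus mult.commute[of "pair (tens u v') (W2 - W1)" "pair (tens u' v) (W2 - W1)"])
qed

section \<open>Plane waves span the harmonic polynomials\<close>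

definition quart :: "nat \<Rightarrow> (nat \<Rightarrow> nat \<Rightarrow> nat \<Rightarrow> nat \<Rightarrow> complex) \<Rightarrow> hc \<Rightarrow> complex" where
  "quart n C Z = (\<Sum>p\<le>n. \<Sum>q\<le>n. \<Sum>r\<le>n. \<Sum>s\<le>n. C p q r s * (Z$1$1)^p * (Z$1$2)^q * (Z$2$1)^r * (Z$2$2)^s)"

text \<open>Reindexing after differentiation: the factor from the exponent kills the term at 0, and
  the coefficient beyond n is 0, so the range of the sum is unchanged.\<close>

lemma sum_shift_index:
  fixes F :: "nat \<Rightarrow> complex"
  assumes "F 0 = 0" "F (Suc n) = 0" shows "(\<Sum>i\<le>n. F i) = (\<Sum>i\<le>n. F (Suc i))"
proof -
  have "(\<Sum>i\<le>n. F i) = (\<Sum>i\<le>Suc n. F i)" using assms by simp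
  also have "\<dots> = (\<Sum>i\<le>n. F (Suc i))" by (subst sum.atMost_Suc_shift) (simp add: assms)
  finally show ?thesis .
qed

lemma pd_quart:
  "(\<And>q r s. C (Suc n) q r s = 0) \<Longrightarrow> pd 1 1 (quart n C) = quart n (\<lambda>p q r s. of_nat (Suc p) * C (Suc p) q r s)"
  "(\<And>p r s. C p (Suc n) r s = 0) \<Longrightarrow> pd 1 2 (quart n C) = quart n (\<lambda>p q r s. of_nat (Suc q) * C p (Suc q) r s)"
  "(\<And>p q s. C p q (Suc n) s = 0) \<Longrightarrow> pd 2 1 (quart n C) = quart n (\<lambda>p q r s. of_nat (Suc r) * C p q (Suc r) s)"
  "(\<And>p q r. C p q r (Suc n) = 0) \<Longrightarrow> pd 2 2 (quart n C) = quart n (\<lambda>p q r s. of_nat (Suc s) * C p q r (Suc s))"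
proof -
  note I = DERIV_imp_deriv[OF DERIV_sum[OF DERIV_sum[OF DERIV_sum[OF DERIV_sum]]]]
  have D: "((\<lambda>t. c * t ^ k) has_field_derivative c * (of_nat k * x ^ (k - 1))) (at x)" for c x :: complex and k
    by (auto intro!: derivative_eq_intros)
  {
    assume C: "\<And>q r s. C (Suc n) q r s = 0"
    show "pd 1 1 (quart n C) = quart n (\<lambda>p q r s. of_nat (Suc p) * C (Suc p) q r s)"
    proof (rule ext)
      fix Z
      have "pd 1 1 (quart n C) Z = deriv (\<lambda>t. \<Sum>p\<le>n. \<Sum>q\<le>n. \<Sum>r\<le>n. \<Sum>s\<le>n. (C p q r s * (Z$1$2)^q * (Z$2$1)^r * (Z$2$2)^s) * t^p) (Z$1$1)"
        unfolding pd_def quart_def by (simp add: ac_simps)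
      also have "\<dots> = (\<Sum>p\<le>n. \<Sum>q\<le>n. \<Sum>r\<le>n. \<Sum>s\<le>n. (C p q r s * (Z$1$2)^q * (Z$2$1)^r * (Z$2$2)^s) * (of_nat p * (Z$1$1)^(p - 1)))"
        by (rule I) (rule D)
      also have "\<dots> = quart n (\<lambda>p q r s. of_nat (Suc p) * C (Suc p) q r s) Z"
        unfolding quart_def by (subst sum_shift_index) (simp_all add: C ac_simps)
      finally show "pd 1 1 (quart n C) Z = quart n (\<lambda>p q r s. of_nat (Suc p) * C (Suc p) q r s) Z" .
    qed
  next
    assume C: "\<And>p r s. C p (Suc n) r s = 0"
    show "pd 1 2 (quart n C) = quart n (\<lambda>p q r s. of_nat (Suc q) * C p (Suc q) r s)"
    proof (rule ext)
      fix Z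
      have "pd 1 2 (quart n C) Z = deriv (\<lambda>t. \<Sum>p\<le>n. \<Sum>q\<le>n. \<Sum>r\<le>n. \<Sum>s\<le>n. (C p q r s * (Z$1$1)^p * (Z$2$1)^r * (Z$2$2)^s) * t^q) (Z$1$2)"
        unfolding pd_def quart_def by (simp add: ac_simps)
      also have "\<dots> = (\<Sum>p\<le>n. \<Sum>q\<le>n. \<Sum>r\<le>n. \<Sum>s\<le>n. (C p q r s * (Z$1$1)^p * (Z$2$1)^r * (Z$2$2)^s) * (of_nat q * (Z$1$2)^(q - 1)))"
        by (rule I) (rule D)
      also have "\<dots> = quart n (\<lambda>p q r s. of_nat (Suc q) * C p (Suc q) r s) Z"
        unfolding quart_def by (rule sum.cong[OF refl], subst sum_shift_index) (simp_all add: C ac_simps)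
      finally show "pd 1 2 (quart n C) Z = quart n (\<lambda>p q r s. of_nat (Suc q) * C p (Suc q) r s) Z" .
    qed
  next
    assume C: "\<And>p q s. C p q (Suc n) s = 0"
    show "pd 2 1 (quart n C) = quart n (\<lambda>p q r s. of_nat (Suc r) * C p q (Suc r) s)"
    proof (rule ext)
      fix Z
      have "pd 2 1 (quart n C) Z = deriv (\<lambda>t. \<Sum>p\<le>n. \<Sum>q\<le>n. \<Sum>r\<le>n. \<Sum>s\<le>n. (C p q r s * (Z$1$1)^p * (Z$1$2)^q * (Z$2$2)^s) * t^r) (Z$2$1)"
        unfolding pd_def quart_def by (simp add: ac_simps)
      also have "\<dots> = (\<Sum>p\<le>n. \<Sum>q\<le>n. \<Sum>r\<le>n. \<Sum>s\<le>n. (C p q r s * (Z$1$1)^p * (Z$1$2)^q * (Z$2$2)^s) * (of_nat r * (Z$2$1)^(r - 1)))"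
        by (rule I) (rule D)
      also have "\<dots> = quart n (\<lambda>p q r s. of_nat (Suc r) * C p q (Suc r) s) Z"
        unfolding quart_def by (rule sum.cong[OF refl], rule sum.cong[OF refl], subst sum_shift_index) (simp_all add: C ac_simps)
      finally show "pd 2 1 (quart n C) Z = quart n (\<lambda>p q r s. of_nat (Suc r) * C p q (Suc r) s) Z" .
    qed
  next
    assume C: "\<And>p q r. C p q r (Suc n) = 0"
    show "pd 2 2 (quart n C) = quart n (\<lambda>p q r s. of_nat (Suc s) * C p q r (Suc s))"
    proof (rule ext)
      fix Z
      have "pd 2 2 (quart n C) Z = deriv (\<lambda>t. \<Sum>p\<le>n. \<Sum>q\<le>n. \<Sum>r\<le>n. \<Sum>s\<le>n. (C p q r s * (Z$1$1)^p * (Z$1$2)^q * (Z$2$1)^r) * t^s) (Z$2$2)"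
        unfolding pd_def quart_def by (simp add: ac_simps)
      also have "\<dots> = (\<Sum>p\<le>n. \<Sum>q\<le>n. \<Sum>r\<le>n. \<Sum>s\<le>n. (C p q r s * (Z$1$1)^p * (Z$1$2)^q * (Z$2$1)^r) * (of_nat s * (Z$2$2)^(s - 1)))"
        by (rule I) (rule D)
      also have "\<dots> = quart n (\<lambda>p q r s. of_nat (Suc s) * C p q r (Suc s)) Z"
        unfolding quart_def by (rule sum.cong[OF refl], rule sum.cong[OF refl], rule sum.cong[OF refl], subst sum_shift_index) (simp_all add: C ac_simps)
      finally show "pd 2 2 (quart n C) Z = quart n (\<lambda>p q r s. of_nat (Suc s) * C p q r (Suc s)) Z" .
    qed
  }
qed

lemma quart_eq_0:
  assumes Z: "\<And>Z. quart n C Z = 0" and i: "p \<le> n" "q \<le> n" "r \<le> n" "s \<le> n"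
  shows "C p q r s = 0"
proof -
  have "(\<Sum>p\<le>n. (\<Sum>q\<le>n. \<Sum>r\<le>n. \<Sum>s\<le>n. C p q r s * b^q * c^r * d^s) * a^p) = 0" for a b c d
  proof -
    have "quart n C (vector [vector [a, b], vector [c, d]]) = (\<Sum>p\<le>n. (\<Sum>q\<le>n. \<Sum>r\<le>n. \<Sum>s\<le>n. C p q r s * b^q * c^r * d^s) * a^p)"
      by (simp add: quart_def sum_distrib_left ac_simps)
    then show ?thesis by (simp add: Z)
  qed
  then have "(\<Sum>q\<le>n. \<Sum>r\<le>n. \<Sum>s\<le>n. C p q r s * b^q * c^r * d^s) = 0" for b c d
    using i(1) Transcendental.polyfun_eq_0[of "\<lambda>p. \<Sum>q\<le>n. \<Sum>r\<le>n. \<Sum>s\<le>n. C p q r s * b^q * c^r * d^s" n] by blast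
  then have "(\<Sum>q\<le>n. (\<Sum>r\<le>n. \<Sum>s\<le>n. C p q r s * c^r * d^s) * b^q) = 0" for b c d
    by (simp add: sum_distrib_left ac_simps)
  then have "(\<Sum>r\<le>n. \<Sum>s\<le>n. C p q r s * c^r * d^s) = 0" for c d
    using i(2) Transcendental.polyfun_eq_0[of "\<lambda>q. \<Sum>r\<le>n. \<Sum>s\<le>n. C p q r s * c^r * d^s" n] by blast
  then have "(\<Sum>r\<le>n. (\<Sum>s\<le>n. C p q r s * d^s) * c^r) = 0" for c d
    by (simp add: sum_distrib_left ac_simps)
  then have "(\<Sum>s\<le>n. C p q r s * d^s) = 0" for d
    using i(3) Transcendental.polyfun_eq_0[of "\<lambda>r. \<Sum>s\<le>n. C p q r s * d^s" n] by blast
  then show ?thesis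
    using i(4) Transcendental.polyfun_eq_0[of "\<lambda>s. C p q r s" n] by blast
qed

lemma H_plus_coefficients:
  assumes "f \<in> H_plus"
  obtains n C where "f = quart n C" "\<And>p q r s. p > n \<or> q > n \<or> r > n \<or> s > n \<Longrightarrow> C p q r s = 0"
    "\<And>p q r s. of_nat (Suc p) * of_nat (Suc s) * C (Suc p) q r (Suc s) = of_nat (Suc q) * of_nat (Suc r) * C p (Suc q) (Suc r) s"
proof -
  obtain n C0 where f: "\<And>Z. f Z = quart n C0 Z"
    using assms unfolding H_plus_def poly_fun_def quart_def by blast
  \<comment> \<open>Extending the coefficients by 0 makes the recursion hold at all indices, also
    across the edge of the range.\<close>
  define C where "C p q r s = (if p \<le> n \<and> q \<le> n \<and> r \<le> n \<and> s \<le> n then C0 p q r s else 0)" for p q r s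
  have fC: "f = quart n C"
    by (rule ext) (auto simp: f quart_def C_def intro!: sum.cong)
  have C: "p > n \<or> q > n \<or> r > n \<or> s > n \<Longrightarrow> C p q r s = 0" for p q r s
    by (auto simp: C_def)
  define D where "D p q r s = of_nat (Suc p) * of_nat (Suc s) * C (Suc p) q r (Suc s)
      - of_nat (Suc q) * of_nat (Suc r) * C p (Suc q) (Suc r) s" for p q r s
  have "quart n D Z = 0" for Z
  proof -
    have "box_op f Z = 4 * (quart n (\<lambda>p q r s. of_nat (Suc p) * (of_nat (Suc s) * C (Suc p) q r (Suc s))) Z
      - quart n (\<lambda>p q r s. of_nat (Suc q) * (of_nat (Suc r) * C p (Suc q) (Suc r) s)) Z)"
      unfolding box_op_def fC by (simp only: pd_quart C less_Suc_eq simp_thms mult_zero_right)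
    also have "\<dots> = 4 * quart n D Z"
      by (simp add: quart_def D_def sum_subtractf left_diff_distrib mult.assoc del: of_nat_Suc)
    finally show ?thesis using assms by (simp add: H_plus_def)
  qed
  then have "D p q r s = 0" for p q r s
    using quart_eq_0[of n D p q r s] by (cases "p \<le> n \<and> q \<le> n \<and> r \<le> n \<and> s \<le> n") (auto simp: D_def C)
  then show ?thesis
    using that[OF fC C] by (simp add: D_def del: of_nat_Suc)
qed

text \<open>Multiplied by factorials, the coefficients agree at (p + 1, q, r, s + 1) and (p, q + 1,
  r + 1, s). These moves keep both row degrees a = p + q and k = r + s, and they connect all indices
  with the same p + r.\<close>

lemma H_plus_weights:
  fixes C :: "nat \<Rightarrow> nat \<Rightarrow> nat \<Rightarrow> nat \<Rightarrow> complex"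
  assumes C: "\<And>p q r s. of_nat (Suc p) * of_nat (Suc s) * C (Suc p) q r (Suc s) = of_nat (Suc q) * of_nat (Suc r) * C p (Suc q) (Suc r) s"
  obtains \<kappa> where "\<And>p r. p \<le> a \<Longrightarrow> r \<le> k \<Longrightarrow>
    C p (a - p) r (k - r) = \<kappa> (p + r) * (of_nat (a choose p) * of_nat (k choose r))"
proof -
  define K where "K p q r s = C p q r s * (fact p * fact q * fact r * fact s)" for p q r s
  have K: "K (Suc p) q r (Suc s) = K p (Suc q) (Suc r) s" for p q r s
  proof -
    have "K (Suc p) q r (Suc s) = (of_nat (Suc p) * of_nat (Suc s) * C (Suc p) q r (Suc s)) * (fact p * fact q * fact r * fact s)"
      by (simp add: K_def ac_simps del: of_nat_Suc)
    also have "\<dots> = K p (Suc q) (Suc r) s"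
      unfolding C by (simp add: K_def ac_simps del: of_nat_Suc)
    finally show ?thesis .
  qed
  \<comment> \<open>One representative of each class p + r = i: r = 0 if i \<le> a, and p = a
    otherwise.\<close>
  define \<kappa> where "\<kappa> i = (if i \<le> a then K i (a - i) 0 k else K a 0 (i - a) (k - (i - a)))" for i
  have \<kappa>: "p \<le> a \<Longrightarrow> r \<le> k \<Longrightarrow> K p (a - p) r (k - r) = \<kappa> (p + r)" for p r
  proof (induction r arbitrary: p)
    case (Suc r)
    show ?case
    proof (cases "p < a")
      case True
      have "K (Suc p) (a - Suc p) r (Suc (k - Suc r)) = K p (Suc (a - Suc p)) (Suc r) (k - Suc r)" by (rule K)
      moreover have "Suc (k - Suc r) = k - r" "Suc (a - Suc p) = a - p" using True Suc.prems by auto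
      ultimately show ?thesis using Suc.IH[of "Suc p"] True Suc.prems by simp
    next
      case False
      then show ?thesis using Suc.prems by (simp add: \<kappa>_def)
    qed
  qed (simp add: \<kappa>_def)
  have "C p (a - p) r (k - r) = \<kappa> (p + r) / (fact a * fact k) * (of_nat (a choose p) * of_nat (k choose r))"
    if "p \<le> a" "r \<le> k" for p r
    unfolding \<kappa>[OF that, symmetric] K_def binomial_fact[OF that(1)] binomial_fact[OF that(2)] by simp
  then show ?thesis by (rule that)
qed

section \<open>Functionals on harmonic polynomials are determined by plane waves\<close>

lemma sum_by_degree:
  fixes F :: "nat \<Rightarrow> nat \<Rightarrow> complex"
  shows "(\<Sum>p\<le>a. \<Sum>r\<le>k. \<kappa> (p + r) * F p r) = (\<Sum>i\<le>a + k. \<kappa> i * (\<Sum>p\<le>a. \<Sum>r\<le>k. if p + r = i then F p r else 0))"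
proof -
  have "(\<Sum>p\<le>a. \<Sum>r\<le>k. \<kappa> (p + r) * F p r) = (\<Sum>p\<le>a. \<Sum>r\<le>k. \<Sum>i\<le>a + k. \<kappa> i * (if p + r = i then F p r else 0))"
  proof (intro sum.cong refl)
    fix p r assume "p \<in> {..a}" "r \<in> {..k}"
    then have "p + r \<in> {..a + k}" by auto
    then show "\<kappa> (p + r) * F p r = (\<Sum>i\<le>a + k. \<kappa> i * (if p + r = i then F p r else 0))"
      by (simp add: if_distrib[of "(*) _"] sum.delta' cong: if_cong)
  qed
  also have "\<dots> = (\<Sum>p\<le>a. \<Sum>i\<le>a + k. \<Sum>r\<le>k. \<kappa> i * (if p + r = i then F p r else 0))"
    by (intro sum.cong refl sum.swap)
  also have "\<dots> = (\<Sum>i\<le>a + k. \<Sum>p\<le>a. \<Sum>r\<le>k. \<kappa> i * (if p + r = i then F p r else 0))"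
    by (rule sum.swap)
  finally show ?thesis by (simp only: sum_distrib_left)
qed

text \<open>A polynomial in \<eta> that vanishes identically has zero coefficients, so the powers of
  \<eta> may be replaced by arbitrary weights.\<close>

lemma weighted_sum_eq_0:
  fixes F :: "nat \<Rightarrow> nat \<Rightarrow> complex"
  assumes "\<And>\<eta>. (\<Sum>p\<le>a. \<Sum>r\<le>k. \<eta> ^ (p + r) * F p r) = 0"
  shows "(\<Sum>p\<le>a. \<Sum>r\<le>k. \<kappa> (p + r) * F p r) = 0"
proof -
  define c where "c i = (\<Sum>p\<le>a. \<Sum>r\<le>k. if p + r = i then F p r else 0)" for i
  have "(\<Sum>i\<le>a + k. c i * \<eta> ^ i) = 0" for \<eta>
    using assms[of \<eta>] unfolding sum_by_degree c_def by (simp only: mult.commute)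
  then have "\<forall>i\<le>a + k. c i = 0" using Transcendental.polyfun_eq_0[of c "a + k"] by blast
  then show ?thesis unfolding sum_by_degree c_def[symmetric] by simp
qed

lemma sum_square_triangle:
  fixes g :: "nat \<Rightarrow> nat \<Rightarrow> complex"
  assumes "\<And>p q. p > n \<or> q > n \<Longrightarrow> g p q = 0"
  shows "(\<Sum>p\<le>n. \<Sum>q\<le>n. g p q) = (\<Sum>a\<le>2 * n. \<Sum>p\<le>a. g p (a - p))"
proof -
  have "(\<Sum>p\<le>n. \<Sum>q\<le>n. g p q) = (\<Sum>(p, q)\<in>{..n} \<times> {..n}. g p q)"
    by (rule sum.cartesian_product)
  also have "\<dots> = (\<Sum>(p, q)\<in>{(p, q). p + q \<le> 2 * n}. g p q)"
  proof (rule sum.mono_neutral_left)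
    have "{(p, q). p + q \<le> 2 * n} \<subseteq> {..2 * n} \<times> {..2 * n}" by auto
    then show "finite {(p, q). p + q \<le> 2 * n}" by (rule finite_subset) simp
  qed (auto simp: assms not_le[symmetric], (metis assms not_le)+)
  also have "\<dots> = (\<Sum>a\<le>2 * n. \<Sum>p\<le>a. g p (a - p))" by (rule sum.triangle_reindex_eq)
  finally show ?thesis .
qed

definition mono4 :: "nat \<Rightarrow> nat \<Rightarrow> nat \<Rightarrow> nat \<Rightarrow> hc \<Rightarrow> complex" where
  "mono4 p q r s Z = (Z$1$1)^p * (Z$1$2)^q * (Z$2$1)^r * (Z$2$2)^s"

lemma PF_mono4: "mono4 p q r s \<in> PF"
  using PF.mono[of 1 p q r s] by (simp add: mono4_def[abs_def])

text \<open>The exponent of \<xi> is the degree in the second row, that of \<eta> the degree in the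
  first column; these are the gradings that occur in \<open>H_plus_weights\<close>.\<close>

lemma plane_wave_expansion:
  "pair (tens (vector [1, \<xi>]) (vector [\<eta>, 1])) Z ^ m
    = (\<Sum>k\<le>m. (\<Sum>p\<le>m - k. \<Sum>r\<le>k. of_nat (m choose k) * \<xi> ^ k * \<eta> ^ (p + r) * (of_nat (m - k choose p) * of_nat (k choose r))
        * mono4 p (m - k - p) r (k - r) Z))"
proof -
  have "pair (tens (vector [1, \<xi>]) (vector [\<eta>, 1])) Z = \<xi> * (\<eta> * Z$2$1 + Z$2$2) + (\<eta> * Z$1$1 + Z$1$2)"
    by (simp add: pair_def algebra_simps)
  then have "pair (tens (vector [1, \<xi>]) (vector [\<eta>, 1])) Z ^ m
    = (\<Sum>k\<le>m. of_nat (m choose k) * (\<xi> * (\<eta> * Z$2$1 + Z$2$2)) ^ k * (\<eta> * Z$1$1 + Z$1$2) ^ (m - k))"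
    by (simp only: binomial_ring)
  also have "\<dots> = (\<Sum>k\<le>m. of_nat (m choose k) * \<xi> ^ k * ((\<eta> * Z$1$1 + Z$1$2) ^ (m - k) * (\<eta> * Z$2$1 + Z$2$2) ^ k))"
    by (simp only: power_mult_distrib ac_simps)
  also have "\<dots> = (\<Sum>k\<le>m. (\<Sum>p\<le>m - k. \<Sum>r\<le>k. of_nat (m choose k) * \<xi> ^ k * \<eta> ^ (p + r) * (of_nat (m - k choose p) * of_nat (k choose r))
        * mono4 p (m - k - p) r (k - r) Z))"
    unfolding binomial_ring sum_product unfolding sum_distrib_left mono4_def
    by (intro sum.cong refl) (simp_all add: power_mult_distrib power_add ac_simps)
  finally show ?thesis .
qed

text \<open>The spanning property in dual form, without constructing a decomposition. Vanishing on
  all waves yields relations between the values on monomials, and by \<open>H_plus_weights\<close>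
  the value on a harmonic polynomial is a combination of exactly these.\<close>

theorem linear_functional_eq_0:
  assumes f: "f \<in> H_plus"
    and add: "\<And>f g. f \<in> PF \<Longrightarrow> g \<in> PF \<Longrightarrow> \<Phi> (\<lambda>Z. f Z + g Z) = \<Phi> f + \<Phi> g"
    and cmult: "\<And>c f. f \<in> PF \<Longrightarrow> \<Phi> (\<lambda>Z. c * f Z) = c * (\<Phi> f :: complex)"
    and wave: "\<And>u v m. \<Phi> (\<lambda>Z. pair (tens u v) Z ^ m) = 0"
  shows "\<Phi> f = 0"
proof -
  have sum: "\<Phi> (\<lambda>Z. \<Sum>i\<in>I. g i Z) = (\<Sum>i\<in>I. \<Phi> (g i))" if "\<And>i. g i \<in> PF" for I :: "nat set" and g
  proof (induction I rule: infinite_finite_induct)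
    case (insert i I)
    have "\<Phi> (\<lambda>Z. g i Z + (\<Sum>i\<in>I. g i Z)) = \<Phi> (g i) + \<Phi> (\<lambda>Z. \<Sum>i\<in>I. g i Z)"
      by (intro add PF_sum that)
    then show ?case using insert by simp
  qed (use cmult[OF PF_const, of 0 0] in simp_all)
  define \<mu> where "\<mu> p q r s = \<Phi> (mono4 p q r s)" for p q r s
  \<comment> \<open>Only \<xi> is eliminated here, which isolates the row degrees (a, k); \<eta>
    stays free for \<open>weighted_sum_eq_0\<close>.\<close>
  have wave0: "(\<Sum>p\<le>a. \<Sum>r\<le>k. \<eta> ^ (p + r) * (of_nat (a choose p) * of_nat (k choose r) * \<mu> p (a - p) r (k - r))) = 0" for a k \<eta>
  proof -
    define m where "m = a + k"
    define c where "c k = of_nat (m choose k) * (\<Sum>p\<le>m - k. \<Sum>r\<le>k. \<eta> ^ (p + r) * (of_nat (m - k choose p) * of_nat (k choose r) * \<mu> p (m - k - p) r (k - r)))" for k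
    have "(\<Sum>k\<le>m. c k * \<xi> ^ k) = 0" for \<xi>
    proof -
      have "0 = \<Phi> (\<lambda>Z. \<Sum>k\<le>m. (\<Sum>p\<le>m - k. \<Sum>r\<le>k. of_nat (m choose k) * \<xi> ^ k * \<eta> ^ (p + r) * (of_nat (m - k choose p) * of_nat (k choose r))
        * mono4 p (m - k - p) r (k - r) Z))"
        using wave[of "vector [1, \<xi>]" "vector [\<eta>, 1]" m] unfolding plane_wave_expansion by simp
      also have "\<dots> = (\<Sum>k\<le>m. (\<Sum>p\<le>m - k. \<Sum>r\<le>k. of_nat (m choose k) * \<xi> ^ k * \<eta> ^ (p + r) * (of_nat (m - k choose p) * of_nat (k choose r))
        * \<mu> p (m - k - p) r (k - r)))"
        unfolding \<mu>_def by (subst sum | intro PF_sum PF_mult PF_const PF_mono4 sum.cong refl cmult)+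
      also have "\<dots> = (\<Sum>k\<le>m. c k * \<xi> ^ k)"
        unfolding c_def by (simp add: sum_distrib_left sum_distrib_right ac_simps)
      finally show ?thesis by simp
    qed
    then have "c k = 0" using Transcendental.polyfun_eq_0[of c m] by (simp add: m_def)
    then show ?thesis by (simp add: c_def m_def)
  qed
  obtain n C where fC: "f = quart n C" and C: "\<And>p q r s. p > n \<or> q > n \<or> r > n \<or> s > n \<Longrightarrow> C p q r s = 0"
    and box: "\<And>p q r s. of_nat (Suc p) * of_nat (Suc s) * C (Suc p) q r (Suc s) = of_nat (Suc q) * of_nat (Suc r) * C p (Suc q) (Suc r) s"
    by (rule H_plus_coefficients[OF f], rule that)
  have "\<Phi> f = \<Phi> (\<lambda>Z. \<Sum>p\<le>n. \<Sum>q\<le>n. \<Sum>r\<le>n. \<Sum>s\<le>n. C p q r s * mono4 p q r s Z)"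
    by (simp add: fC quart_def[abs_def] mono4_def mult.assoc)
  also have "\<dots> = (\<Sum>p\<le>n. \<Sum>q\<le>n. \<Sum>r\<le>n. \<Sum>s\<le>n. C p q r s * \<mu> p q r s)"
    unfolding \<mu>_def by (subst sum | intro PF_sum PF_mult PF_const PF_mono4 sum.cong refl cmult)+
  \<comment> \<open>Regrouping by the row degrees r + s and then p + q, each at most 2 n on the
    support of C.\<close>
  also have "\<dots> = (\<Sum>p\<le>n. \<Sum>q\<le>n. \<Sum>k\<le>2 * n. \<Sum>r\<le>k. C p q r (k - r) * \<mu> p q r (k - r))"
    by (intro sum.cong refl sum_square_triangle) (simp add: C)
  also have "\<dots> = (\<Sum>a\<le>2 * n. \<Sum>p\<le>a. \<Sum>k\<le>2 * n. \<Sum>r\<le>k. C p (a - p) r (k - r) * \<mu> p (a - p) r (k - r))"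
    by (rule sum_square_triangle) (auto simp: C intro!: sum.neutral)
  also have "\<dots> = (\<Sum>a\<le>2 * n. \<Sum>k\<le>2 * n. \<Sum>p\<le>a. \<Sum>r\<le>k. C p (a - p) r (k - r) * \<mu> p (a - p) r (k - r))"
    by (intro sum.cong refl sum.swap)
  also have "\<dots> = 0"
  proof (rule sum.neutral, rule ballI, rule sum.neutral, rule ballI)
    fix a k
    obtain \<kappa> where \<kappa>: "\<And>p r. p \<le> a \<Longrightarrow> r \<le> k \<Longrightarrow> C p (a - p) r (k - r) = \<kappa> (p + r) * (of_nat (a choose p) * of_nat (k choose r))"
      by (rule H_plus_weights[OF box], rule that)
    have "(\<Sum>p\<le>a. \<Sum>r\<le>k. C p (a - p) r (k - r) * \<mu> p (a - p) r (k - r))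
      = (\<Sum>p\<le>a. \<Sum>r\<le>k. \<kappa> (p + r) * (of_nat (a choose p) * of_nat (k choose r) * \<mu> p (a - p) r (k - r)))"
      by (intro sum.cong refl) (simp add: \<kappa> mult.assoc)
    also have "\<dots> = 0" by (rule weighted_sum_eq_0[OF wave0])
    finally show "(\<Sum>p\<le>a. \<Sum>r\<le>k. C p (a - p) r (k - r) * \<mu> p (a - p) r (k - r)) = 0" .
  qed
  finally show ?thesis .
qed

lemma H_plus_PF: "f \<in> H_plus \<Longrightarrow> f \<in> PF"
  by (simp add: H_plus_def poly_fun_PF)

text \<open>The difference of the two sides is bilinear in the pair of polynomials, so
  \<open>linear_functional_eq_0\<close> applies to one argument at a time.\<close>

theorem L2_symmetric:
  assumes r: "r1 > r2" "r2 > 0" "R1 > r1" "R2 > r1" and W: "W1 \<in> D_plus r2" "W2 \<in> D_plus r2"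
    and \<phi>: "\<phi>1 \<in> H_plus" "\<phi>2 \<in> H_plus"
  shows "L2 r1 r2 R1 R2 \<phi>1 \<phi>2 W1 W2 = L2 r1 r2 R1 R2 \<phi>2 \<phi>1 W2 W1"
proof -
  define D where "D f g = L2 r1 r2 R1 R2 f g W1 W2 - L2 r1 r2 R1 R2 g f W2 W1" for f g
  note dt = continuous_on_deg_tilde deg_tilde_add deg_tilde_cmult
  have add: "D (\<lambda>Z. f Z + f' Z) g = D f g + D f' g" "D g (\<lambda>Z. f Z + f' Z) = D g f + D g f'"
    if "f \<in> PF" "f' \<in> PF" "g \<in> PF" for f f' g
    using that by (simp_all add: D_def L2_add_left[OF r W] L2_add_right[OF r W] L2_add_left[OF r W(2,1)]
        L2_add_right[OF r W(2,1)] dt)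
  have cmult: "D (\<lambda>Z. c * f Z) g = c * D f g" "D g (\<lambda>Z. c * f Z) = c * D g f"
    if "f \<in> PF" "g \<in> PF" for c f g
    using that by (simp_all add: D_def L2_cmult_left[OF r W] L2_cmult_right[OF r W] L2_cmult_left[OF r W(2,1)]
        L2_cmult_right[OF r W(2,1)] dt right_diff_distrib)
  have waves: "D (\<lambda>Z. pair (tens u v) Z ^ p) (\<lambda>Z. pair (tens u' v') Z ^ q) = 0" for u v p u' v' q
    unfolding D_def L2_plane_wave_symmetry[OF r W] by simp
  have wave: "D \<phi>1 (\<lambda>Z. pair (tens u v) Z ^ q) = 0" for u v q
    by (rule linear_functional_eq_0[OF \<phi>(1), of "\<lambda>f. D f (\<lambda>Z. pair (tens u v) Z ^ q)"])
       (intro add cmult waves PF_power PF_plane_wave; assumption)+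
  have "D \<phi>1 \<phi>2 = 0"
    by (rule linear_functional_eq_0[OF \<phi>(2), of "D \<phi>1"]) (intro add cmult wave H_plus_PF[OF \<phi>(1)]; assumption)+
  then show ?thesis by (simp add: D_def)
qed

section \<open>From \<open>D_plus\<close> to all arguments\<close>

lemma small_multiples_D_plus:
  assumes "r > 0"
  obtains \<delta> :: real where "\<delta> > 0" "\<And>t. 0 < t \<Longrightarrow> t < \<delta> \<Longrightarrow> csc (complex_of_real t) W \<in> D_plus r"
proof -
  define B where "B = norm (W$1$1) + norm (W$1$2) + norm (W$2$1) + norm (W$2$2)"
  have B0: "B \<ge> 0" by (simp add: B_def)
  have col: "norm (colsum W x j) \<le> B * (norm (x$1) + norm (x$2))" for x j
  proof -
    have "norm (colsum W x j) \<le> norm (W$1$j) * norm (x$1) + norm (W$2$j) * norm (x$2)"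
      unfolding colsum_def by (rule order_trans[OF norm_triangle_ineq]) (simp add: norm_mult)
    also have "\<dots> \<le> B * norm (x$1) + B * norm (x$2)"
      using exhaust_2[of j] by (intro add_mono mult_right_mono) (auto simp: B_def)
    finally show ?thesis by (simp add: distrib_left)
  qed
  have bound: "adj_norm W x \<le> 4 * B\<^sup>2 * ((norm (x$1))\<^sup>2 + (norm (x$2))\<^sup>2)" for x
  proof -
    have "(norm (colsum W x j))\<^sup>2 \<le> 2 * B\<^sup>2 * ((norm (x$1))\<^sup>2 + (norm (x$2))\<^sup>2)" for j
    proof -
      have "(norm (colsum W x j))\<^sup>2 \<le> (B * (norm (x$1) + norm (x$2)))\<^sup>2"
        by (rule power_mono[OF col]) simp
      also have "\<dots> \<le> B\<^sup>2 * (2 * ((norm (x$1))\<^sup>2 + (norm (x$2))\<^sup>2))"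
        unfolding power_mult_distrib using sum_squares_bound[of "norm (x$1)" "norm (x$2)"]
        by (intro mult_left_mono) (auto simp: power2_sum)
      finally show ?thesis by (simp add: algebra_simps)
    qed
    from this[of 1] this[of 2] show ?thesis unfolding adj_norm_def by simp
  qed
  \<comment> \<open>By \<open>bound\<close>, \<open>adj W\<close> stretches lengths by at most 2 B;
    B + 1 in place of B keeps the denominator positive for W = 0.\<close>
  define \<delta> where "\<delta> = r / (2 * (B + 1))"
  have "csc (complex_of_real t) W \<in> D_plus r" if t: "0 < t" "t < \<delta>" for t
  proof -
    have tB: "(t * (2 * (B + 1)))\<^sup>2 < r\<^sup>2"
      using t B0 assms by (intro power_strict_mono) (auto simp: \<delta>_def field_simps)
    have "0 < r\<^sup>2 * ((norm (x$1))\<^sup>2 + (norm (x$2))\<^sup>2) - adj_norm (csc (complex_of_real t) W) x" if x: "x \<noteq> 0" for x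
    proof -
      have "colsum (csc (complex_of_real t) W) x j = complex_of_real t * colsum W x j" for j
        by (simp add: colsum_def algebra_simps)
      then have "adj_norm (csc (complex_of_real t) W) x = t\<^sup>2 * adj_norm W x"
        by (simp add: adj_norm_def norm_mult power_mult_distrib algebra_simps)
      also have "\<dots> \<le> t\<^sup>2 * (4 * B\<^sup>2 * ((norm (x$1))\<^sup>2 + (norm (x$2))\<^sup>2))"
        by (intro mult_left_mono bound) simp
      also have "\<dots> = (t * (2 * B))\<^sup>2 * ((norm (x$1))\<^sup>2 + (norm (x$2))\<^sup>2)"
        by (simp add: power_mult_distrib)
      also have "\<dots> < r\<^sup>2 * ((norm (x$1))\<^sup>2 + (norm (x$2))\<^sup>2)"
      proof (rule mult_strict_right_mono[OF le_less_trans[OF _ tB] norm_sq_pos[OF x]])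
        show "(t * (2 * B))\<^sup>2 \<le> (t * (2 * (B + 1)))\<^sup>2"
          using t B0 by (intro power_mono mult_left_mono) auto
      qed
      finally show ?thesis by simp
    qed
    moreover have "adj (mat (complex_of_real (r\<^sup>2)) - csc t W ** adj (csc t W)) = mat (complex_of_real (r\<^sup>2)) - csc t W ** adj (csc t W)"
      by (simp add: hc_eq_iff adj_def matrix_mult_nth_2 mat_def)
    ultimately show ?thesis
      unfolding D_plus_def mem_Collect_eq pos_def_def adj_norm_quadratic by blast
  qed
  moreover have "\<delta> > 0" using assms B0 by (simp add: \<delta>_def)
  ultimately show ?thesis using that by blast
qed

text \<open>Restricting to a complex ray reduces the comparison of polynomials to one variable,
  where infinitely many common values suffice.\<close>

lemma PF_along_ray:
  assumes "f \<in> PF" obtains p where "\<And>s. f (csc s W) = poly p s"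
proof -
  have "\<exists>p. \<forall>s. f (csc s W) = poly p s"
    using assms
  proof induction
    case (mono c p q r s)
    show ?case
      by (intro exI[of _ "[:c:] * [:0, W$1$1:] ^ p * [:0, W$1$2:] ^ q * [:0, W$2$1:] ^ r * [:0, W$2$2:] ^ s"]) simp
  next
    case (add f g)
    then show ?case by (metis poly_add)
  qed
  then show ?thesis using that by blast
qed

lemma H_plus_tensor_along_ray:
  assumes "P \<in> H_plus_tensor" obtains p where "\<And>s. P (csc s W1) (csc s W2) = poly p s"
proof -
  obtain n f g where fg: "\<And>k. k < n \<Longrightarrow> f k \<in> H_plus \<and> g k \<in> H_plus" and P: "P = (\<lambda>W1 W2. \<Sum>k<(n::nat). f k W1 * g k W2)"
    using assms unfolding H_plus_tensor_def by blast
  have "\<forall>k. \<exists>p. k < n \<longrightarrow> (\<forall>s. f k (csc s W1) * g k (csc s W2) = poly p s)"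
    using PF_along_ray[OF H_plus_PF] fg by (metis poly_mult)
  then obtain p where "\<And>k s. k < n \<Longrightarrow> f k (csc s W1) * g k (csc s W2) = poly (p k) s"
    by metis
  then have "P (csc s W1) (csc s W2) = poly (\<Sum>k<n. p k) s" for s
    by (simp add: P poly_sum)
  then show ?thesis by (rule that)
qed

text \<open>For the representing polynomials: small positive multiples t W1, t W2 lie in
  \<open>D_plus r2\<close>, so the two sides agree along the ray for infinitely many t and hence
  also at t = 1.\<close>

theorem lemma29:
  fixes r1 r2 R1 R2 :: real and \<phi>1 \<phi>2 :: "hc \<Rightarrow> complex"
  assumes "r1 > r2" and "r2 > 0" and "R1 > r1" and "R2 > r1"
    and "\<phi>1 \<in> H_plus" and "\<phi>2 \<in> H_plus"
  shows "(\<forall>W1\<in>D_plus r2. \<forall>W2\<in>D_plus r2.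
            L2 r1 r2 R1 R2 \<phi>1 \<phi>2 W1 W2 = L2 r1 r2 R1 R2 \<phi>2 \<phi>1 W2 W1) \<and>
         (\<forall>P Q. L2_represents r1 r2 R1 R2 \<phi>1 \<phi>2 P \<longrightarrow> L2_represents r1 r2 R1 R2 \<phi>2 \<phi>1 Q \<longrightarrow>
            (\<forall>W1 W2. P W1 W2 = Q W2 W1))"
proof (intro conjI ballI allI impI)
  show sym: "L2 r1 r2 R1 R2 \<phi>1 \<phi>2 W1 W2 = L2 r1 r2 R1 R2 \<phi>2 \<phi>1 W2 W1"
    if "W1 \<in> D_plus r2" "W2 \<in> D_plus r2" for W1 W2
    using assms that by (intro L2_symmetric)
  fix P Q W1 W2
  assume P: "L2_represents r1 r2 R1 R2 \<phi>1 \<phi>2 P" and Q: "L2_represents r1 r2 R1 R2 \<phi>2 \<phi>1 Q"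
  obtain p where p: "\<And>s. P (csc s W1) (csc s W2) = poly p s"
    using P H_plus_tensor_along_ray unfolding L2_represents_def by metis
  obtain q where q: "\<And>s. Q (csc s W2) (csc s W1) = poly q s"
    using Q H_plus_tensor_along_ray unfolding L2_represents_def by metis
  obtain \<delta>1 where \<delta>1: "\<delta>1 > 0" "\<And>t. 0 < t \<Longrightarrow> t < \<delta>1 \<Longrightarrow> csc (complex_of_real t) W1 \<in> D_plus r2"
    using small_multiples_D_plus[OF assms(2)] by metis
  obtain \<delta>2 where \<delta>2: "\<delta>2 > 0" "\<And>t. 0 < t \<Longrightarrow> t < \<delta>2 \<Longrightarrow> csc (complex_of_real t) W2 \<in> D_plus r2"
    using small_multiples_D_plus[OF assms(2)] by metis
  have "poly (p - q) (complex_of_real t) = 0" if "t \<in> {0<..<min \<delta>1 \<delta>2}" for t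
  proof -
    have "csc (complex_of_real t) W1 \<in> D_plus r2" "csc (complex_of_real t) W2 \<in> D_plus r2"
      using that \<delta>1 \<delta>2 by auto
    then show ?thesis
      using P Q sym unfolding L2_represents_def by (simp add: p[symmetric] q[symmetric])
  qed
  then have "complex_of_real ` {0<..<min \<delta>1 \<delta>2} \<subseteq> {s. poly (p - q) s = 0}" by blast
  moreover have "infinite (complex_of_real ` {0<..<min \<delta>1 \<delta>2})"
    using \<delta>1 \<delta>2 by (simp add: finite_image_iff inj_on_def infinite_Ioo)
  ultimately have "p - q = 0" using poly_roots_finite finite_subset by blast
  then show "P W1 W2 = Q W2 W1" using p[of 1] q[of 1] by simp
qed

end
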